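(* Let $n\in\mathbb{N}$, $\beta\in(0,\infty)$, and let $\varrho$ be a measurable function on $E=[0,\infty)^n$ such that: (1) $\varrho$ is $m_{n,\beta}$-a.e. positive and $\varrho\in L^1(E;m_{n,\beta})$; (2) for every $\varnothing\neq B\subset I$ one has $\varrho=0$ $\lambda_B^{n,\beta}$-a.e. on $\overline{E_+(B)}\setminus R_\varrho\big(\overline{E_+(B)}\big)$. Then $$\mathcal{E}(f,g)=\sum_{\varnothing\neq B\subset I}\int_{E_+(B)}\big(\nabla^Bf,\nabla^Bg\big)\,d\mu_B,\qquad f,g\in\mathcal{D}=C_c^2(E),$$ is a densely defined, positive definite (i.e. $\mathcal{E}(f,f)\ge 0$), symmetric bilinear form which is closable on $L^2(E;\mu)$. Its closure $(\mathcal{E},D(\mathcal{E}))$ is a recurrent, hence in particular conservative, strongly local, regular, symmetric Dirichlet form on $L^2(E;\mu)$.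
   Context: Notation: $I=\{1,\dots,n\}$ and $E=[0,\infty)^n$. For $B\subset I$, $E_+(B)=\{x\in E: x_i>0 \text{ for } i\in B,\ x_i=0\text{ for } i\in I\setminus B\}$, and $\overline{E_+(B)}$ is its Euclidean closure. $\lambda_B^{(n)}$ is the product measure on $E$ given by Lebesgue measure on $[0,\infty)$ in each coordinate $i\in B$ and the Dirac measure at $0$ in each coordinate $j\in I\setminus B$. Put $\lambda_B^{n,\beta}=\beta^{n-\#B}\lambda_B^{(n)}$, $m_{n,\beta}=\sum_{B\subset I}\lambda_B^{n,\beta}$, $\mu=\varrho\,m_{n,\beta}$, $\mu_B=\varrho\,\lambda_B^{n,\beta}$. $R_\varrho(\overline{E_+(B)})$ is the set of all $x\in\overline{E_+(B)}$ such that $\int_{\overline{B_\varepsilon(x)}}\varrho^{-1}\,d\lambda_B^{n,\beta}<\infty$ for some $\varepsilon>0$, where $B_\varepsilon(x)=\{y\in\overline{E_+(B)}: |x-y|<\varepsilon\}$. $C_c^k(E)$ is the set of functions $f:E\to\mathbb{R}$ with compact support in $E$ that are $k$-times continuously differentiable on $(0,\infty)^n$ and whose partial derivatives of order $\le k$ extend continuously to $E$ (the extensions being denoted by the same symbols). $\nabla^Bf=\sum_{i\in B}\partial_if\,e_i$ with $e_1,\dots,e_n$ the canonical basis of $\mathbb{R}^n$; $(\cdot,\cdot)$ is the Euclidean inner product. *)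

theory Defs
  imports "HOL-Analysis.Analysis" "HOL-Probability.Giry_Monad"
begin

section \<open>The state space and the reference measures\<close>

text \<open>The index set \<open>I\<close> is the universe of a finite type \<open>'n\<close>, so that \<open>n = CARD('n)\<close>.
  Functions on the orthant are represented by functions on all of \<open>real^'n\<close>; all notions below
  only depend on the values on the orthant, the space of every measure involved.\<close>

definition orthant :: "(real^'n) set" where
  "orthant = {x. \<forall>i. 0 \<le> x $ i}"

definition open_orthant :: "(real^'n) set" where
  "open_orthant = {x. \<forall>i. 0 < x $ i}"

definition face :: "'n set \<Rightarrow> (real^'n) set" where
  "face B = {x. (\<forall>i\<in>B. 0 < x $ i) \<and> (\<forall>i. i \<notin> B \<longrightarrow> x $ i = 0)}"

definition face_lebesgue :: "'n::finite set \<Rightarrow> (real^'n) measure" where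
  "face_lebesgue B =
     distr (PiM UNIV (\<lambda>i. if i \<in> B then restrict_space lborel {0..}
                          else return (restrict_space borel {0..}) 0))
       (restrict_space borel orthant) (\<lambda>f. \<chi> i. f i)"

definition face_measure :: "real \<Rightarrow> 'n::finite set \<Rightarrow> (real^'n) measure" where
  "face_measure \<beta> B = scale_measure (ennreal (\<beta> ^ (CARD('n) - card B))) (face_lebesgue B)"

definition ref_measure :: "real \<Rightarrow> (real^'n::finite) measure" where
  "ref_measure \<beta> = measure_of orthant (sets (restrict_space borel orthant))
     (\<lambda>A. \<Sum>B\<in>UNIV. emeasure (face_measure \<beta> B) A)"

definition weighted_measure :: "real \<Rightarrow> (real^'n::finite \<Rightarrow> real) \<Rightarrow> (real^'n) measure" where
  "weighted_measure \<beta> \<rho> = density (ref_measure \<beta>) (\<lambda>x. ennreal (\<rho> x))"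

definition weighted_face_measure ::
    "real \<Rightarrow> (real^'n::finite \<Rightarrow> real) \<Rightarrow> 'n set \<Rightarrow> (real^'n) measure" where
  "weighted_face_measure \<beta> \<rho> B = density (face_measure \<beta> B) (\<lambda>x. ennreal (\<rho> x))"

text \<open>In \<open>inverse (ennreal (\<rho> y))\<close> the value at \<open>\<rho> y = 0\<close> is infinite.\<close>

definition regular_points ::
    "real \<Rightarrow> (real^'n::finite \<Rightarrow> real) \<Rightarrow> 'n set \<Rightarrow> (real^'n) set" where
  "regular_points \<beta> \<rho> B = {x \<in> closure (face B). \<exists>\<epsilon>>0.
     (\<integral>\<^sup>+ y \<in> closure {y \<in> closure (face B). dist x y < \<epsilon>}.
        inverse (ennreal (\<rho> y)) \<partial>face_measure \<beta> B) < \<infinity>}"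


section \<open>Differentiable functions with compact support\<close>

definition compactly_supported_on :: "'a::topological_space set \<Rightarrow> ('a \<Rightarrow> real) \<Rightarrow> bool" where
  "compactly_supported_on X f \<longleftrightarrow> compact (X \<inter> closure {x \<in> X. f x \<noteq> 0})"

definition Cc :: "'a::topological_space set \<Rightarrow> ('a \<Rightarrow> real) set" where
  "Cc X = {f. continuous_on X f \<and> compactly_supported_on X f}"

definition partial_deriv :: "'n::finite \<Rightarrow> (real^'n \<Rightarrow> real) \<Rightarrow> real^'n \<Rightarrow> real" where
  "partial_deriv i f x = deriv (\<lambda>t. f (x + t *\<^sub>R axis i 1)) 0"

fun iter_partial :: "'n::finite list \<Rightarrow> (real^'n \<Rightarrow> real) \<Rightarrow> real^'n \<Rightarrow> real" where
  "iter_partial [] f = f"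
| "iter_partial (i # js) f = partial_deriv i (iter_partial js f)"

definition k_times_cont_diff_on ::
    "nat \<Rightarrow> (real^'n::finite) set \<Rightarrow> (real^'n \<Rightarrow> real) \<Rightarrow> bool" where
  "k_times_cont_diff_on k U f \<longleftrightarrow>
     (\<forall>js. length js < k \<longrightarrow> (\<forall>x\<in>U. \<forall>i.
        (\<lambda>t. iter_partial js f (x + t *\<^sub>R axis i 1)) differentiable (at 0))) \<and>
     (\<forall>js. length js \<le> k \<longrightarrow> continuous_on U (iter_partial js f))"

text \<open>The order \<open>0\<close> derivative of \<open>f\<close> is \<open>f\<close> itself, whose continuous extension from the open
  orthant is required to be the given \<open>f\<close>; this is the condition \<open>continuous_on orthant f\<close>.\<close>

definition Cck :: "nat \<Rightarrow> (real^'n::finite \<Rightarrow> real) set" where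
  "Cck k = {f. continuous_on orthant f \<and> compactly_supported_on orthant f \<and>
     k_times_cont_diff_on k open_orthant f \<and>
     (\<forall>js. length js \<le> k \<longrightarrow> (\<exists>g. continuous_on orthant g \<and>
        (\<forall>x\<in>open_orthant. g x = iter_partial js f x)))}"

text \<open>The continuous extension to the orthant of a function on the open orthant.\<close>

definition orthant_extension :: "(real^'n::finite \<Rightarrow> real) \<Rightarrow> real^'n \<Rightarrow> real" where
  "orthant_extension g x = Lim (at x within open_orthant) g"

definition face_gradient ::
    "'n::finite set \<Rightarrow> (real^'n \<Rightarrow> real) \<Rightarrow> real^'n \<Rightarrow> real^'n" where
  "face_gradient B f x = (\<Sum>i\<in>B. orthant_extension (partial_deriv i f) x *\<^sub>R axis i 1)"

definition gradient_form ::
    "real \<Rightarrow> (real^'n::finite \<Rightarrow> real) \<Rightarrow> (real^'n \<Rightarrow> real) \<Rightarrow> (real^'n \<Rightarrow> real) \<Rightarrow> real" where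
  "gradient_form \<beta> \<rho> f g =
     (\<Sum>B\<in>{B. B \<noteq> {}}. set_lebesgue_integral (weighted_face_measure \<beta> \<rho> B) (face B)
        (\<lambda>x. face_gradient B f x \<bullet> face_gradient B g x))"


section \<open>Bilinear forms on L2\<close>

text \<open>Elements of \<open>L\<^sup>2(M)\<close> are represented by functions, equality of elements being equality
  \<open>M\<close>-almost everywhere.  A form is a pair of a set \<open>D\<close> of such functions (the domain)
  and a map \<open>F\<close>, of which only the values on \<open>D\<close> matter.\<close>

definition L2 :: "'a measure \<Rightarrow> ('a \<Rightarrow> real) set" where
  "L2 M = {f \<in> borel_measurable M. integrable M (\<lambda>x. (f x)\<^sup>2)}"

definition L2_inner :: "'a measure \<Rightarrow> ('a \<Rightarrow> real) \<Rightarrow> ('a \<Rightarrow> real) \<Rightarrow> real" where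
  "L2_inner M f g = (\<integral>x. f x * g x \<partial>M)"

definition L2_norm :: "'a measure \<Rightarrow> ('a \<Rightarrow> real) \<Rightarrow> real" where
  "L2_norm M f = sqrt (L2_inner M f f)"

text \<open>The last condition states that \<open>F\<close> is well defined on almost everywhere classes.\<close>

definition symmetric_form_on ::
    "'a measure \<Rightarrow> ('a \<Rightarrow> real) set \<Rightarrow> (('a \<Rightarrow> real) \<Rightarrow> ('a \<Rightarrow> real) \<Rightarrow> real) \<Rightarrow> bool" where
  "symmetric_form_on M D F \<longleftrightarrow>
     D \<subseteq> L2 M \<and> (\<lambda>_. 0) \<in> D \<and>
     (\<forall>f\<in>D. \<forall>g\<in>D. (\<lambda>x. f x + g x) \<in> D) \<and>
     (\<forall>f\<in>D. \<forall>c. (\<lambda>x. c * f x) \<in> D) \<and>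
     (\<forall>f\<in>D. \<forall>g\<in>D. \<forall>h\<in>D. F (\<lambda>x. f x + g x) h = F f h + F g h) \<and>
     (\<forall>f\<in>D. \<forall>h\<in>D. \<forall>c. F (\<lambda>x. c * f x) h = c * F f h) \<and>
     (\<forall>f\<in>D. \<forall>g\<in>D. F f g = F g f) \<and>
     (\<forall>f\<in>D. \<forall>g\<in>D. (AE x in M. f x = 0) \<longrightarrow> F f g = 0)"

definition positive_definite_on ::
    "('a \<Rightarrow> real) set \<Rightarrow> (('a \<Rightarrow> real) \<Rightarrow> ('a \<Rightarrow> real) \<Rightarrow> real) \<Rightarrow> bool" where
  "positive_definite_on D F \<longleftrightarrow> (\<forall>f\<in>D. 0 \<le> F f f)"

definition L2_dense :: "'a measure \<Rightarrow> ('a \<Rightarrow> real) set \<Rightarrow> bool" where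
  "L2_dense M D \<longleftrightarrow> D \<subseteq> L2 M \<and>
     (\<forall>u\<in>L2 M. \<forall>\<epsilon>>0. \<exists>f\<in>D. L2_norm M (\<lambda>x. u x - f x) < \<epsilon>)"

definition form_Cauchy ::
    "(('a \<Rightarrow> real) \<Rightarrow> ('a \<Rightarrow> real) \<Rightarrow> real) \<Rightarrow> (nat \<Rightarrow> 'a \<Rightarrow> real) \<Rightarrow> bool" where
  "form_Cauchy F s \<longleftrightarrow> (\<forall>\<epsilon>>0. \<exists>N. \<forall>j\<ge>N. \<forall>k\<ge>N.
     F (\<lambda>x. s j x - s k x) (\<lambda>x. s j x - s k x) < \<epsilon>)"

definition closable_on ::
    "'a measure \<Rightarrow> ('a \<Rightarrow> real) set \<Rightarrow> (('a \<Rightarrow> real) \<Rightarrow> ('a \<Rightarrow> real) \<Rightarrow> real) \<Rightarrow> bool" where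
  "closable_on M D F \<longleftrightarrow> (\<forall>s. (\<forall>k. s k \<in> D) \<and> form_Cauchy F s \<and>
     (\<lambda>k. L2_norm M (s k)) \<longlonglongrightarrow> 0 \<longrightarrow> (\<lambda>k. F (s k) (s k)) \<longlonglongrightarrow> 0)"

definition approximates ::
    "'a measure \<Rightarrow> ('a \<Rightarrow> real) set \<Rightarrow> (('a \<Rightarrow> real) \<Rightarrow> ('a \<Rightarrow> real) \<Rightarrow> real) \<Rightarrow>
     (nat \<Rightarrow> 'a \<Rightarrow> real) \<Rightarrow> ('a \<Rightarrow> real) \<Rightarrow> bool" where
  "approximates M D F s u \<longleftrightarrow> (\<forall>k. s k \<in> D) \<and> form_Cauchy F s \<and>
     (\<lambda>k. L2_norm M (\<lambda>x. s k x - u x)) \<longlonglongrightarrow> 0"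

text \<open>The closure of a closable form, i.e. its smallest closed extension.\<close>

definition closure_domain ::
    "'a measure \<Rightarrow> ('a \<Rightarrow> real) set \<Rightarrow> (('a \<Rightarrow> real) \<Rightarrow> ('a \<Rightarrow> real) \<Rightarrow> real) \<Rightarrow>
     ('a \<Rightarrow> real) set" where
  "closure_domain M D F = {u \<in> L2 M. \<exists>s. approximates M D F s u}"

definition closure_form ::
    "'a measure \<Rightarrow> ('a \<Rightarrow> real) set \<Rightarrow> (('a \<Rightarrow> real) \<Rightarrow> ('a \<Rightarrow> real) \<Rightarrow> real) \<Rightarrow>
     ('a \<Rightarrow> real) \<Rightarrow> ('a \<Rightarrow> real) \<Rightarrow> real" where
  "closure_form M D F u v = (THE c. \<forall>s t. approximates M D F s u \<and> approximates M D F t v \<longrightarrow>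
     (\<lambda>k. F (s k) (t k)) \<longlonglongrightarrow> c)"


section \<open>Dirichlet forms\<close>

definition form_one ::
    "'a measure \<Rightarrow> (('a \<Rightarrow> real) \<Rightarrow> ('a \<Rightarrow> real) \<Rightarrow> real) \<Rightarrow> ('a \<Rightarrow> real) \<Rightarrow> ('a \<Rightarrow> real) \<Rightarrow> real" where
  "form_one M F f g = F f g + L2_inner M f g"

definition closed_form ::
    "'a measure \<Rightarrow> ('a \<Rightarrow> real) set \<Rightarrow> (('a \<Rightarrow> real) \<Rightarrow> ('a \<Rightarrow> real) \<Rightarrow> real) \<Rightarrow> bool" where
  "closed_form M D F \<longleftrightarrow> (\<forall>s. (\<forall>k. s k \<in> D) \<and> form_Cauchy (form_one M F) s \<longrightarrow>
     (\<exists>u\<in>D. (\<lambda>k. form_one M F (\<lambda>x. s k x - u x) (\<lambda>x. s k x - u x)) \<longlonglongrightarrow> 0))"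

text \<open>The third condition says that \<open>D\<close> consists of whole almost everywhere classes.\<close>

definition symmetric_Dirichlet_form ::
    "'a measure \<Rightarrow> ('a \<Rightarrow> real) set \<Rightarrow> (('a \<Rightarrow> real) \<Rightarrow> ('a \<Rightarrow> real) \<Rightarrow> real) \<Rightarrow> bool" where
  "symmetric_Dirichlet_form M D F \<longleftrightarrow>
     symmetric_form_on M D F \<and> positive_definite_on D F \<and>
     (\<forall>u\<in>D. \<forall>v\<in>L2 M. (AE x in M. u x = v x) \<longrightarrow> v \<in> D) \<and>
     L2_dense M D \<and> closed_form M D F \<and>
     (\<forall>u\<in>D. (\<lambda>x. min (max (u x) 0) 1) \<in> D \<and>
        F (\<lambda>x. min (max (u x) 0) 1) (\<lambda>x. min (max (u x) 0) 1) \<le> F u u)"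

text \<open>The first two conditions are the usual standing assumptions of the theory of regular
  Dirichlet forms: the reference measure is Radon and has full support.\<close>

definition regular_form ::
    "'a::topological_space measure \<Rightarrow> ('a \<Rightarrow> real) set \<Rightarrow>
     (('a \<Rightarrow> real) \<Rightarrow> ('a \<Rightarrow> real) \<Rightarrow> real) \<Rightarrow> bool" where
  "regular_form M D F \<longleftrightarrow>
     (\<forall>K. compact K \<and> K \<subseteq> space M \<longrightarrow> emeasure M K < \<infinity>) \<and>
     (\<forall>U. open U \<and> U \<inter> space M \<noteq> {} \<longrightarrow> emeasure M (U \<inter> space M) > 0) \<and>
     (\<forall>u\<in>D. \<forall>\<epsilon>>0. \<exists>f\<in>D \<inter> Cc (space M).
        form_one M F (\<lambda>x. u x - f x) (\<lambda>x. u x - f x) < \<epsilon>) \<and>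
     (\<forall>g\<in>Cc (space M). \<forall>\<epsilon>>0. \<exists>f\<in>D \<inter> Cc (space M). \<forall>x\<in>space M. \<bar>g x - f x\<bar> < \<epsilon>)"

text \<open>The support of the measure with density \<open>\<bar>u\<bar>\<close> with respect to \<open>M\<close>.\<close>

definition ess_support :: "'a::topological_space measure \<Rightarrow> ('a \<Rightarrow> real) \<Rightarrow> 'a set" where
  "ess_support M u = {x \<in> space M. \<forall>U. open U \<and> x \<in> U \<longrightarrow> \<not> (AE y in M. y \<in> U \<longrightarrow> u y = 0)}"

definition strongly_local_form ::
    "'a::topological_space measure \<Rightarrow> ('a \<Rightarrow> real) set \<Rightarrow>
     (('a \<Rightarrow> real) \<Rightarrow> ('a \<Rightarrow> real) \<Rightarrow> real) \<Rightarrow> bool" where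
  "strongly_local_form M D F \<longleftrightarrow>
     (\<forall>u\<in>D. \<forall>v\<in>D. compact (ess_support M u) \<and> compact (ess_support M v) \<and>
        (\<exists>U c. open U \<and> ess_support M u \<subseteq> U \<and> (AE x in M. x \<in> U \<longrightarrow> v x = c)) \<longrightarrow> F u v = 0)"


section \<open>The semigroup, conservativeness and recurrence\<close>

text \<open>\<open>T\<close> is the strongly continuous contraction semigroup on \<open>L\<^sup>2(M)\<close> associated with the closed
  form \<open>(F, D)\<close>: its generator \<open>A\<close> is the operator of the form, i.e. \<open>u\<close> belongs to the domain of
  \<open>A\<close> with \<open>A u = w\<close> iff \<open>u \<in> D\<close> and \<open>F u v = - (w, v)\<close> for all \<open>v \<in> D\<close>.  It is unique up to
  almost everywhere equality.\<close>

definition form_semigroup ::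
    "'a measure \<Rightarrow> ('a \<Rightarrow> real) set \<Rightarrow> (('a \<Rightarrow> real) \<Rightarrow> ('a \<Rightarrow> real) \<Rightarrow> real) \<Rightarrow>
     (real \<Rightarrow> ('a \<Rightarrow> real) \<Rightarrow> 'a \<Rightarrow> real) \<Rightarrow> bool" where
  "form_semigroup M D F T \<longleftrightarrow>
     (\<forall>t\<ge>0. \<forall>f\<in>L2 M. T t f \<in> L2 M \<and> L2_norm M (T t f) \<le> L2_norm M f) \<and>
     (\<forall>t\<ge>0. \<forall>f\<in>L2 M. \<forall>g\<in>L2 M. \<forall>a b. AE x in M.
        T t (\<lambda>y. a * f y + b * g y) x = a * T t f x + b * T t g x) \<and>
     (\<forall>f\<in>L2 M. AE x in M. T 0 f x = f x) \<and>
     (\<forall>s\<ge>0. \<forall>t\<ge>0. \<forall>f\<in>L2 M. AE x in M. T (s + t) f x = T s (T t f) x) \<and>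
     (\<forall>f\<in>L2 M. ((\<lambda>t. L2_norm M (\<lambda>x. T t f x - f x)) \<longlongrightarrow> 0) (at_right 0)) \<and>
     (\<forall>u\<in>L2 M. \<forall>w\<in>L2 M.
        ((\<lambda>t. L2_norm M (\<lambda>x. (T t u x - u x) / t - w x)) \<longlongrightarrow> 0) (at_right 0) \<longleftrightarrow>
        u \<in> D \<and> (\<forall>v\<in>D. F u v = - L2_inner M w v))"

text \<open>Conservativeness \<open>T\<^sub>t 1 = 1\<close>, for a finite measure \<open>M\<close>, where \<open>1\<close> is in \<open>L\<^sup>2(M)\<close>.\<close>

definition conservative_form ::
    "'a measure \<Rightarrow> ('a \<Rightarrow> real) set \<Rightarrow> (('a \<Rightarrow> real) \<Rightarrow> ('a \<Rightarrow> real) \<Rightarrow> real) \<Rightarrow> bool" where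
  "conservative_form M D F \<longleftrightarrow> finite_measure M \<and>
     (\<exists>T. form_semigroup M D F T \<and> (\<forall>t>0. AE x in M. T t (\<lambda>_. 1) x = 1))"

text \<open>The extension of the semigroup from \<open>L\<^sup>1 \<inter> L\<^sup>2\<close> to \<open>L\<^sup>1\<close> by continuity.\<close>

definition semigroup_L1 ::
    "'a measure \<Rightarrow> (real \<Rightarrow> ('a \<Rightarrow> real) \<Rightarrow> 'a \<Rightarrow> real) \<Rightarrow> real \<Rightarrow> ('a \<Rightarrow> real) \<Rightarrow> 'a \<Rightarrow> real" where
  "semigroup_L1 M T t f = (SOME g. integrable M g \<and>
     (\<forall>s. (\<forall>k. s k \<in> L2 M \<and> integrable M (s k)) \<and> (\<lambda>k. \<integral>x. \<bar>s k x - f x\<bar> \<partial>M) \<longlonglongrightarrow> 0 \<longrightarrow>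
        (\<forall>k. integrable M (T t (s k))) \<and> (\<lambda>k. \<integral>x. \<bar>T t (s k) x - g x\<bar> \<partial>M) \<longlonglongrightarrow> 0))"

text \<open>The \<open>L\<^sup>1\<close>-valued integral of \<open>T\<^sub>s f\<close> over \<open>0 \<le> s \<le> r\<close>, which is determined by its integrals
  over measurable sets.\<close>

definition semigroup_integral ::
    "'a measure \<Rightarrow> (real \<Rightarrow> ('a \<Rightarrow> real) \<Rightarrow> 'a \<Rightarrow> real) \<Rightarrow> real \<Rightarrow> ('a \<Rightarrow> real) \<Rightarrow> 'a \<Rightarrow> real" where
  "semigroup_integral M T r f = (SOME h. integrable M h \<and>
     (\<forall>A\<in>sets M. set_lebesgue_integral M A h =
        set_lebesgue_integral lborel {0..r}
          (\<lambda>s. set_lebesgue_integral M A (semigroup_L1 M T s f))))"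

text \<open>The potential operator \<open>G f = lim\<^sub>N \<integral>\<^sub>0\<^sup>N T\<^sub>s f ds\<close>; for \<open>f \<ge> 0\<close> the limit is increasing.\<close>

definition potential ::
    "'a measure \<Rightarrow> (real \<Rightarrow> ('a \<Rightarrow> real) \<Rightarrow> 'a \<Rightarrow> real) \<Rightarrow> ('a \<Rightarrow> real) \<Rightarrow> 'a \<Rightarrow> ennreal" where
  "potential M T f x = (SUP N::nat. ennreal (semigroup_integral M T (real N) f x))"

definition recurrent_form ::
    "'a measure \<Rightarrow> ('a \<Rightarrow> real) set \<Rightarrow> (('a \<Rightarrow> real) \<Rightarrow> ('a \<Rightarrow> real) \<Rightarrow> real) \<Rightarrow> bool" where
  "recurrent_form M D F \<longleftrightarrow> (\<exists>T. form_semigroup M D F T \<and>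
     (\<forall>f. integrable M f \<and> (AE x in M. 0 \<le> f x) \<longrightarrow>
        (AE x in M. potential M T f x = 0 \<or> potential M T f x = \<infinity>)))"

end

(* The faces partition the orthant and i is in B iff x_i > 0 on the face of B, so
   F(f, g) is the integral over mu of the sum over i of 1_{x_i > 0} d_i f d_i g, i.e. the inner
   product of two gradients in L2(mu)^n.

   Closability: around a regular point of the closed face of B the function 1/rho is locally
   integrable. If f_k -> 0 in L2(mu) and 1_{x_i > 0} d_i f_k -> w_i, then testing with h / rho on
   the face, where h is a bump function vanishing on {x_i = 0}, and integrating by parts in the
   i-th coordinate gives that the integral of w_i h over the face is 0. Hence w_i = 0 almost
   everywhere on regular points, and the remaining points are a null set for mu.

   The closure is then the inner product of second components of a closed subspace Gamma of
   L2 x L2^n. Smooth contractions do not increase gradients; the passage to the unit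
   contraction uses, instead of weak compactness, points of least norm of convex hulls.
   Locality holds since Gamma is stable under multiplication by bump functions.

   The semigroup is constructed by Yosida approximation, and its positivity comes from the
   variational characterization of the resolvent. Cutoff functions with small gradient show that
   1 is in the domain with gradient 0, so T_t 1 = 1. The truncated potentials min(G f, c) of f >= 0
   are superharmonic and, as T_t preserves integrals, harmonic; therefore G f is 0 or infinite. *)

theory Submission
  imports Defs
begin

section \<open>Hilbert spaces\<close>

text \<open>Two obstacles shape the proof. First, \<open>\<mu>\<close> charges the faces of the
  boundary, while derivatives are given only in the interior and then extended by continuity.
  Integrating by parts inside a face needs that the extension is still a derivative there, in the
  directions along the face; this is \<open>C1_deriv\<close>. Secondly, \<open>\<rho>\<close> has no
  smoothness, so it must never be differentiated. Dividing a test function h by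
  \<open>\<rho>\<close> cancels the weight, and h / \<open>\<rho>\<close> is square integrable for
  \<open>\<mu>\<close> exactly when h^2 / \<open>\<rho>\<close> is integrable on the face; this is
  the use of local integrability of 1 / \<open>\<rho>\<close>. That h vanishes at x_i = 0 kills the
  boundary term and costs nothing, since the i-th derivative counts only where x_i > 0. Finiteness
  of \<open>\<mu>\<close> is used throughout: uniform estimates become estimates in L2, the function
  1 belongs to L2, and symmetry with T_t 1 = 1 yields preservation of integrals. The potential G f
  may be infinite, hence its truncation: min(G f, c) is bounded and stays in L2.\<close>

lemma parallelogram_midpoint:
  fixes a x y :: "'a::real_inner"
  shows "(norm (x - y))\<^sup>2 = 2 * (norm (a - x))\<^sup>2 + 2 * (norm (a - y))\<^sup>2
    - 4 * (norm (a - (1/2) *\<^sub>R (x + y)))\<^sup>2"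
  unfolding power2_norm_eq_inner
  by (simp add: inner_diff_left inner_diff_right inner_add_left inner_add_right inner_commute
      algebra_simps)

text \<open>The parallelogram identity bounds the distance of \<open>x j\<close> and
  \<open>x k\<close> by the excess of their squared distances to \<open>a\<close> over that of their
  midpoint. The level \<open>d\<close> may move with the index, so that a fixed convex set and a
  shrinking sequence of sets are both covered.\<close>

lemma Cauchy_minimizing:
  fixes a :: "'a::real_inner" and x :: "nat \<Rightarrow> 'a"
  assumes mid: "\<And>j k N. N \<le> j \<Longrightarrow> N \<le> k \<Longrightarrow> d N \<le> (norm (a - (1/2) *\<^sub>R (x j + x k)))\<^sup>2"
    and up: "\<And>k. (norm (a - x k))\<^sup>2 \<le> d k + e k" and d: "d \<longlonglongrightarrow> l" and e: "e \<longlonglongrightarrow> 0"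
  shows "Cauchy x"
proof (rule metric_CauchyI)
  fix r :: real assume r: "r > 0"
  \<comment> \<open>The errors enter the final estimate with weights 2 + 2 + 2 + 2 + 4 = 12, which
    is below 16.\<close>
  have "\<forall>\<^sub>F n in sequentially. \<bar>d n - l\<bar> < r\<^sup>2/16"
    using tendstoD[OF d, of "r\<^sup>2/16"] r by (simp add: dist_real_def)
  moreover have "\<forall>\<^sub>F n in sequentially. \<bar>e n\<bar> < r\<^sup>2/16"
    using tendstoD[OF e, of "r\<^sup>2/16"] r by (simp add: dist_real_def)
  ultimately have "\<forall>\<^sub>F n in sequentially. \<bar>d n - l\<bar> < r\<^sup>2/16 \<and> \<bar>e n\<bar> < r\<^sup>2/16"
    by eventually_elim auto
  then obtain N where N: "\<And>n. n \<ge> N \<Longrightarrow> \<bar>d n - l\<bar> < r\<^sup>2/16" "\<And>n. n \<ge> N \<Longrightarrow> \<bar>e n\<bar> < r\<^sup>2/16"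
    by (auto simp: eventually_sequentially)
  have "dist (x j) (x k) < r" if "j \<ge> N" "k \<ge> N" for j k
  proof -
    have "(norm (x j - x k))\<^sup>2 \<le> 2 * (d j + e j) + 2 * (d k + e k) - 4 * d N"
    proof -
      have "s \<le> 2 * u + 2 * v - 4 * n"
        if "s = 2 * u' + 2 * v' - 4 * m" "n \<le> m" "u' \<le> u" "v' \<le> v" for s u v m n u' v' :: real
        using that by linarith
      from this[OF parallelogram_midpoint mid[OF that] up up] show ?thesis .
    qed
    also have "\<dots> < r\<^sup>2"
    proof -
      have "2 * (u + p) + 2 * (v + q) - 4 * n < s"
        if "\<bar>u - l\<bar> < s/16" "\<bar>v - l\<bar> < s/16" "\<bar>n - l\<bar> < s/16" "\<bar>p\<bar> < s/16" "\<bar>q\<bar> < s/16"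
        for u v n p q s :: real
      proof -
        have "u < l + s/16" "v < l + s/16" "l - s/16 < n" "p < s/16" "q < s/16" "0 < s"
          using that by linarith+
        then show ?thesis by simp
      qed
      from this[OF N(1)[OF that(1)] N(1)[OF that(2)] N(1)[OF order_refl] N(2)[OF that(1)] N(2)[OF that(2)]]
      show ?thesis .
    qed
    finally show ?thesis
      using r by (simp add: dist_norm power2_less_imp_less)
  qed
  then show "\<exists>M. \<forall>m\<ge>M. \<forall>n\<ge>M. dist (x m) (x n) < r" by blast
qed

text \<open>Midpoints stay in the convex set, so a minimizing sequence is Cauchy; completeness takes
  the place of compactness.\<close>

lemma ex_closest_point:
  fixes S :: "'a::{real_inner,banach} set"
  assumes "closed S" "convex S" "S \<noteq> {}"
  shows "\<exists>p\<in>S. \<forall>y\<in>S. norm (a - p) \<le> norm (a - y)"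
proof -
  define d where "d = (INF y\<in>S. (norm (a - y))\<^sup>2)"
  have bdd: "bdd_below ((\<lambda>y. (norm (a - y))\<^sup>2) ` S)"
    by (rule bdd_belowI2[where m=0]) auto
  have d_le: "d \<le> (norm (a - y))\<^sup>2" if "y \<in> S" for y
    unfolding d_def by (rule cINF_lower[OF bdd that])
  have "\<exists>y\<in>S. (norm (a - y))\<^sup>2 < d + inverse (Suc k)" for k
    using cINF_less_iff[OF assms(3) bdd, of "d + inverse (Suc k)"] unfolding d_def[symmetric] by simp
  then obtain x where x: "\<And>k. x k \<in> S" "\<And>k. (norm (a - x k))\<^sup>2 < d + inverse (real (Suc k))"
    by metis
  have "Cauchy x"
  proof (rule Cauchy_minimizing)
    show "d \<le> (norm (a - (1/2) *\<^sub>R (x j + x k)))\<^sup>2" for j k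
    proof (rule d_le)
      show "(1/2) *\<^sub>R (x j + x k) \<in> S"
        using convexD[OF assms(2) x(1)[of j] x(1)[of k], of "1/2" "1/2"] by (simp add: scaleR_add_right)
    qed
    show "(norm (a - x k))\<^sup>2 \<le> d + inverse (real (Suc k))" for k using x(2)[of k] by simp
    show "(\<lambda>k. inverse (real (Suc k))) \<longlonglongrightarrow> 0" by (rule LIMSEQ_inverse_real_of_nat)
  qed auto
  then obtain p where p: "x \<longlonglongrightarrow> p" using Cauchy_convergent convergent_def by blast
  have "p \<in> S" using closed_sequentially[OF assms(1) _ p] x(1) by blast
  moreover have "(norm (a - p))\<^sup>2 \<le> d"
  proof (rule tendsto_le[OF sequentially_bot])
    show "(\<lambda>k. (norm (a - x k))\<^sup>2) \<longlonglongrightarrow> (norm (a - p))\<^sup>2" by (intro tendsto_intros p)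
    show "(\<lambda>k. d + inverse (real (Suc k))) \<longlonglongrightarrow> d"
      using tendsto_add[OF tendsto_const LIMSEQ_inverse_real_of_nat, of d] by simp
    show "\<forall>\<^sub>F k in sequentially. (norm (a - x k))\<^sup>2 \<le> d + inverse (real (Suc k))"
      using x(2) by (auto intro!: always_eventually less_imp_le)
  qed
  ultimately show ?thesis
    using d_le by (meson norm_ge_zero order_trans power2_le_imp_le)
qed

lemma ex_orthogonal_projection:
  fixes S :: "'a::{real_inner,banach} set"
  assumes "closed S" "subspace S"
  shows "\<exists>p\<in>S. \<forall>y\<in>S. inner (a - p) y = 0"
proof -
  obtain p where p: "p \<in> S" "\<And>y. y \<in> S \<Longrightarrow> norm (a - p) \<le> norm (a - y)"
    using ex_closest_point[OF assms(1) subspace_imp_convex[OF assms(2)]] subspace_0[OF assms(2)] by blast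
  have "inner (a - p) y = 0" if y: "y \<in> S" for y
  proof (cases "y = 0")
    case False
    \<comment> \<open>The minimizer of the quadratic polynomial t -> |a - p - t y|^2.\<close>
    define t where "t = inner (a - p) y / inner y y"
    have "p + t *\<^sub>R y \<in> S" using p(1) y assms(2) by (simp add: subspace_add subspace_scale)
    from p(2)[OF this] have "inner (a - p) (a - p) \<le> inner (a - p - t *\<^sub>R y) (a - p - t *\<^sub>R y)"
      by (metis diff_diff_eq norm_le)
    also have "\<dots> = inner (a - p) (a - p) - 2 * t * inner (a - p) y + t * t * inner y y"
      by (simp add: inner_diff_left inner_diff_right inner_commute algebra_simps)
    also have "t * t * inner y y = t * inner (a - p) y" using False by (simp add: t_def)
    finally have "t * inner (a - p) y \<le> 0" by simp
    then have "(inner (a - p) y)\<^sup>2 / inner y y \<le> 0" by (simp add: t_def power2_eq_square)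
    moreover have "inner y y > 0" using False by simp
    ultimately show ?thesis by (simp add: divide_le_0_iff)
  qed simp
  with p(1) show ?thesis by blast
qed

lemma subspace_closure:
  fixes S :: "'a::real_normed_vector set"
  assumes "subspace S"
  shows "subspace (closure S)"
proof (rule subspaceI)
  show "0 \<in> closure S" using subspace_0[OF assms] closure_subset by blast
next
  fix x y assume "x \<in> closure S" "y \<in> closure S"
  then obtain f g where "\<And>n. f n \<in> S" "f \<longlonglongrightarrow> x" "\<And>n. g n \<in> S" "g \<longlonglongrightarrow> y"
    unfolding closure_sequential by blast
  then have "(\<forall>n. f n + g n \<in> S) \<and> (\<lambda>n. f n + g n) \<longlonglongrightarrow> x + y"
    using assms by (auto intro: subspace_add tendsto_add)
  then show "x + y \<in> closure S" unfolding closure_sequential by (intro exI)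
next
  fix c x assume "x \<in> closure S"
  then obtain f where "\<And>n. f n \<in> S" "f \<longlonglongrightarrow> x"
    unfolding closure_sequential by blast
  then have "(\<forall>n. c *\<^sub>R f n \<in> S) \<and> (\<lambda>n. c *\<^sub>R f n) \<longlonglongrightarrow> c *\<^sub>R x"
    using assms by (auto intro: subspace_scale tendsto_intros)
  then show "c *\<^sub>R x \<in> closure S" unfolding closure_sequential by (intro exI)
qed

text \<open>The difference between a point and its projection onto \<open>closure S\<close> is
  orthogonal to \<open>S\<close>.\<close>

lemma dense_subspaceI:
  fixes S :: "'a::{real_inner,banach} set"
  assumes "subspace S" and "\<And>x. (\<And>y. y \<in> S \<Longrightarrow> inner x y = 0) \<Longrightarrow> x = 0"
  shows "closure S = UNIV"
proof -
  have "a \<in> closure S" for a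
  proof -
    obtain p where p: "p \<in> closure S" "\<And>y. y \<in> closure S \<Longrightarrow> inner (a - p) y = 0"
      using ex_orthogonal_projection[of "closure S" a] assms(1) by (auto simp: subspace_closure)
    have "a - p = 0"
      using p(2) closure_subset[of S] by (intro assms(2)) auto
    then show ?thesis using p(1) by simp
  qed
  then show ?thesis by auto
qed

text \<open>A substitute for weak compactness: the points of least norm in the closed convex hulls of the
  tails form a Cauchy sequence.\<close>

lemma bounded_tails_limit:
  fixes x :: "nat \<Rightarrow> 'a::{real_inner,banach}"
  assumes C: "\<And>k. closed (C k)" "\<And>k. convex (C k)" "decseq C"
    and x: "\<And>k. x k \<in> C k" "\<And>k. norm (x k) \<le> B"
  shows "\<exists>z. (\<forall>k. z \<in> C k) \<and> norm z \<le> B"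
proof -
  have "\<forall>k. \<exists>p\<in>C k. \<forall>y\<in>C k. norm p \<le> norm y"
    using ex_closest_point[OF C(1) C(2), of _ 0] x(1) by fastforce
  then obtain p where p: "\<And>k. p k \<in> C k" "\<And>k y. y \<in> C k \<Longrightarrow> norm (p k) \<le> norm y" by metis
  have pB: "norm (p k) \<le> B" for k using p(2)[OF x(1)] x(2) order_trans by blast
  have sub: "C j \<subseteq> C k" if "k \<le> j" for j k using C(3) that by (simp add: decseqD)
  \<comment> \<open>The sets shrink, so the least norms increase; being bounded by \<open>B\<close>
    they converge, and these are the convergent levels that \<open>Cauchy_minimizing\<close> asks
    for.\<close>
  have "incseq (\<lambda>k. norm (p k))"
    unfolding incseq_def using p(2) p(1) sub by blast
  then have inc: "incseq (\<lambda>k. (norm (p k))\<^sup>2)" unfolding incseq_def by (auto intro!: power_mono)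
  have "Bseq (\<lambda>k. (norm (p k))\<^sup>2)"
    by (rule BseqI'[where K="B\<^sup>2"]) (simp add: pB power_mono)
  then obtain l where l: "(\<lambda>k. (norm (p k))\<^sup>2) \<longlonglongrightarrow> l"
    using inc Bseq_monoseq_convergent convergent_def incseq_imp_monoseq by metis
  have "Cauchy p"
  proof (rule Cauchy_minimizing[where a=0 and d="\<lambda>k. (norm (p k))\<^sup>2" and e="\<lambda>_. 0"])
    fix j k N :: nat assume N: "N \<le> j" "N \<le> k"
    have "(1/2) *\<^sub>R (p j + p k) \<in> C N"
      using convexD[OF C(2), of "p j" N "p k" "1/2" "1/2"] p(1) sub[OF N(1)] sub[OF N(2)]
      by (auto simp: scaleR_add_right)
    then show "(norm (p N))\<^sup>2 \<le> (norm (0 - (1/2) *\<^sub>R (p j + p k)))\<^sup>2"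
      using p(2) by (simp only: diff_0 norm_minus_cancel) (meson norm_ge_zero power_mono)
  qed (use l in auto)
  then obtain z where z: "p \<longlonglongrightarrow> z" using Cauchy_convergent convergent_def by blast
  have "z \<in> C k" for k
  proof (rule closed_sequentially[OF C(1)])
    show "(\<lambda>j. p (j + k)) \<longlonglongrightarrow> z" using z by (rule LIMSEQ_ignore_initial_segment)
    show "p (j + k) \<in> C k" for j using p(1)[of "j+k"] sub[of k "j+k"] by auto
  qed
  moreover have "norm z \<le> B"
    using LIMSEQ_le_const2[OF tendsto_norm[OF z]] pB by blast
  ultimately show ?thesis by blast
qed

text \<open>Weak lower semicontinuity of the norm: the first components converge, the second ones
  are merely bounded. The points of \<open>\<Gamma>\<close> with first component within 1 / (k + 1)
  of \<open>u\<close> and second component of norm at most \<open>B\<close> form a decreasing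
  sequence of closed convex sets, and a point common to all of them has first component
  \<open>u\<close>.\<close>

lemma closed_convex_lsc:
  fixes \<Gamma> :: "('h::{real_inner,banach} \<times> 'k::{real_inner,banach}) set"
  assumes "closed \<Gamma>" "convex \<Gamma>" and xw: "\<And>k. (x k, w k) \<in> \<Gamma>" and x: "x \<longlonglongrightarrow> u"
    and w: "\<And>k. norm (w k) \<le> B"
  shows "\<exists>w. (u, w) \<in> \<Gamma> \<and> norm w \<le> B"
proof -
  have "Bseq x" using x convergent_imp_Bseq convergentI by blast
  then obtain A where A: "\<And>k. norm (x k) \<le> A" unfolding Bseq_def by blast
  obtain K where K: "\<And>j k. K k \<le> j \<Longrightarrow> norm (x j - u) \<le> inverse (Suc k)"
  proof -
    have "\<exists>N. \<forall>j\<ge>N. norm (x j - u) \<le> inverse (Suc k)" for k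
      using LIMSEQ_D[OF x, of "inverse (Suc k)"] by (meson inverse_positive_iff_positive less_imp_le of_nat_0_less_iff zero_less_Suc)
    then obtain K where "\<And>k. \<forall>j\<ge>K k. norm (x j - u) \<le> inverse (Suc k)" by metis
    then show ?thesis using that by blast
  qed
  define C where "C k = \<Gamma> \<inter> (cball u (inverse (Suc k)) \<times> cball 0 B)" for k
  define J where "J k = Max (K ` {..k})" for k
  have KJ: "K k \<le> J k" for k unfolding J_def by (intro Max_ge) auto
  have "\<exists>z. (\<forall>k. z \<in> C k) \<and> norm z \<le> A + B"
  proof (rule bounded_tails_limit)
    show "closed (C k)" "convex (C k)" for k
      unfolding C_def using assms by (auto intro!: closed_Int closed_Times convex_Int convex_Times)
    show "decseq C" unfolding C_def decseq_def
      by (intro allI impI Int_mono Sigma_mono order_refl subset_cball le_imp_inverse_le) auto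
    show "(x (J k), w (J k)) \<in> C k" for k
      unfolding C_def using xw K[OF KJ[of k]] w by (auto simp: dist_norm norm_minus_commute)
    show "norm (x (J k), w (J k)) \<le> A + B" for k
      using norm_Pair_le[of "x (J k)" "w (J k)"] A[of "J k"] w[of "J k"] by linarith
  qed
  then obtain v w where z: "\<And>k. (v, w) \<in> C k" by auto
  have "(\<lambda>k. inverse (real (Suc k))) \<longlonglongrightarrow> 0" by (rule LIMSEQ_inverse_real_of_nat)
  then have "dist u v \<le> 0"
    using z by (intro LIMSEQ_le_const[where X="\<lambda>k. inverse (real (Suc k))"]) (auto simp: C_def)
  then show ?thesis using z[of 0] by (auto simp: C_def)
qed

section \<open>The algebra of bounded operators\<close>

text \<open>A copy of the space of bounded linear maps with composition as product, so that \<open>exp\<close> and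
  absolutely convergent series are available; \<open>perfect_space\<close> excludes the zero space, where
  \<open>norm 1 = 0\<close>.\<close>

typedef (overloaded) ('a::real_normed_vector) endo = "UNIV :: ('a \<Rightarrow>\<^sub>L 'a) set"
  morphisms endo_blinfun Endo by auto

setup_lifting type_definition_endo

instantiation endo :: ("{real_normed_vector,perfect_space}") real_normed_algebra_1
begin

lift_definition zero_endo :: "'a endo" is 0 .
lift_definition one_endo :: "'a endo" is id_blinfun .
lift_definition plus_endo :: "'a endo \<Rightarrow> 'a endo \<Rightarrow> 'a endo" is "(+)" .
lift_definition minus_endo :: "'a endo \<Rightarrow> 'a endo \<Rightarrow> 'a endo" is "(-)" .
lift_definition uminus_endo :: "'a endo \<Rightarrow> 'a endo" is "uminus" .
lift_definition times_endo :: "'a endo \<Rightarrow> 'a endo \<Rightarrow> 'a endo" is "(o\<^sub>L)" .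
lift_definition scaleR_endo :: "real \<Rightarrow> 'a endo \<Rightarrow> 'a endo" is "(*\<^sub>R)" .
lift_definition norm_endo :: "'a endo \<Rightarrow> real" is norm .
definition sgn_endo :: "'a endo \<Rightarrow> 'a endo" where "sgn_endo x = inverse (norm x) *\<^sub>R x"
definition dist_endo :: "'a endo \<Rightarrow> 'a endo \<Rightarrow> real" where "dist_endo x y = norm (x - y)"
definition uniformity_endo :: "('a endo \<times> 'a endo) filter"
  where "uniformity_endo = (INF e\<in>{0 <..}. principal {(x, y). dist x y < e})"
definition open_endo :: "'a endo set \<Rightarrow> bool"
  where "open_endo U \<longleftrightarrow> (\<forall>x\<in>U. \<forall>\<^sub>F (x', y) in uniformity. x' = x \<longrightarrow> y \<in> U)"

instance
proof
  fix x y z :: "'a endo" and a b :: real and U :: "'a endo set"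
  show "x + y + z = x + (y + z)" by transfer simp
  show "x + y = y + x" by transfer simp
  show "0 + x = x" by transfer simp
  show "- x + x = 0" by transfer simp
  show "x - y = x + - y" by transfer simp
  show "a *\<^sub>R (x + y) = a *\<^sub>R x + a *\<^sub>R y" by transfer (rule scaleR_add_right)
  show "(a + b) *\<^sub>R x = a *\<^sub>R x + b *\<^sub>R x" by transfer (rule scaleR_add_left)
  show "a *\<^sub>R b *\<^sub>R x = (a * b) *\<^sub>R x" by transfer simp
  show "1 *\<^sub>R x = x" by transfer simp
  show "x * y * z = x * (y * z)" by transfer (rule blinfun_eqI, simp)
  show "(x + y) * z = x * z + y * z" by transfer (rule blinfun_eqI, simp add: blinfun.add_left)
  show "x * (y + z) = x * y + x * z" by transfer (rule blinfun_eqI, simp add: blinfun.bilinear_simps)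
  show "a *\<^sub>R x * y = a *\<^sub>R (x * y)" by transfer (rule blinfun_eqI, simp add: blinfun.bilinear_simps)
  show "x * a *\<^sub>R y = a *\<^sub>R (x * y)" by transfer (rule blinfun_eqI, simp add: blinfun.bilinear_simps)
  show "1 * x = x" by transfer (rule blinfun_eqI, simp)
  show "x * 1 = x" by transfer (rule blinfun_eqI, simp)
  show "(0::'a endo) \<noteq> 1"
  proof transfer
    have "norm (id_blinfun :: 'a \<Rightarrow>\<^sub>L 'a) = 1" by simp
    then show "(0 :: 'a \<Rightarrow>\<^sub>L 'a) \<noteq> id_blinfun" by (metis norm_zero zero_neq_one)
  qed
  show "dist x y = norm (x - y)" by (fact dist_endo_def)
  show "sgn x = inverse (norm x) *\<^sub>R x" by (fact sgn_endo_def)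
  show "(uniformity :: ('a endo \<times> 'a endo) filter) = (INF e\<in>{0 <..}. principal {(x, y). dist x y < e})"
    by (fact uniformity_endo_def)
  show "open U \<longleftrightarrow> (\<forall>x\<in>U. \<forall>\<^sub>F (x', y) in uniformity. x' = x \<longrightarrow> y \<in> U)" by (fact open_endo_def)
  show "norm x = 0 \<longleftrightarrow> x = 0" by transfer simp
  show "norm (x + y) \<le> norm x + norm y" by transfer (rule norm_triangle_ineq)
  show "norm (a *\<^sub>R x) = \<bar>a\<bar> * norm x" by transfer simp
  show "norm (x * y) \<le> norm x * norm y" by transfer (rule norm_blinfun_compose)
  show "norm (1::'a endo) = 1" by transfer simp
qed

end

instance endo :: ("{banach,perfect_space}") banach
proof
  fix X :: "nat \<Rightarrow> 'a endo" assume X: "Cauchy X"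
  have dist: "dist (endo_blinfun a) (endo_blinfun b) = dist a b" for a b :: "'a endo"
    unfolding dist_norm by transfer simp
  have "Cauchy (\<lambda>n. endo_blinfun (X n))" using X unfolding Cauchy_def dist .
  then obtain L where L: "(\<lambda>n. endo_blinfun (X n)) \<longlonglongrightarrow> L"
    using Cauchy_convergent convergent_def by blast
  then have "(\<lambda>n. endo_blinfun (X n)) \<longlonglongrightarrow> endo_blinfun (Endo L)" by (simp add: Endo_inverse)
  then have "X \<longlonglongrightarrow> Endo L" unfolding tendsto_iff dist .
  then show "convergent X" by (auto simp: convergent_def)
qed

lift_definition endo_app :: "('a::real_normed_vector) endo \<Rightarrow> 'a \<Rightarrow> 'a" is blinfun_apply .

lemma bounded_bilinear_endo_app:
  "bounded_bilinear (endo_app :: ('a::{real_normed_vector,perfect_space}) endo \<Rightarrow> 'a \<Rightarrow> 'a)"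
proof
  fix a a' :: "'a endo" and b b' :: 'a and r :: real
  show "endo_app (a + a') b = endo_app a b + endo_app a' b" by transfer (rule blinfun.add_left)
  show "endo_app a (b + b') = endo_app a b + endo_app a b'" by transfer (rule blinfun.add_right)
  show "endo_app (r *\<^sub>R a) b = r *\<^sub>R endo_app a b" by transfer (rule blinfun.scaleR_left)
  show "endo_app a (r *\<^sub>R b) = r *\<^sub>R endo_app a b" by transfer (rule blinfun.scaleR_right)
  have "norm (endo_app a b) \<le> norm a * norm b * 1" for a :: "'a endo" and b
    by transfer (simp add: norm_blinfun)
  then show "\<exists>K. \<forall>(a::'a endo) b. norm (endo_app a b) \<le> norm a * norm b * K" by blast
qed

interpretation endo: bounded_bilinear
  "endo_app :: ('a::{real_normed_vector,perfect_space}) endo \<Rightarrow> 'a \<Rightarrow> 'a"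
  by (rule bounded_bilinear_endo_app)

lemma endo_app_mult [simp]:
  "endo_app ((a::('a::{real_normed_vector,perfect_space}) endo) * b) x = endo_app a (endo_app b x)"
  by transfer simp

lemma endo_app_one [simp]: "endo_app (1::('a::{real_normed_vector,perfect_space}) endo) x = x"
  by transfer simp

lemma norm_endo_app_le: "norm (endo_app (a::('a::{real_normed_vector,perfect_space}) endo) x) \<le> norm a * norm x"
  by transfer (rule norm_blinfun)

text \<open>Brings the resolvents, which are obtained as plain functions, into the Banach algebra
  with norm at most 1, so that their exponentials can be formed.\<close>

lemma ex_endo:
  fixes f :: "'a::{real_normed_vector,perfect_space} \<Rightarrow> 'a"
  assumes "linear f" "\<And>x. norm (f x) \<le> norm x"
  shows "\<exists>a. norm a \<le> 1 \<and> endo_app a = f"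
proof -
  have bl: "bounded_linear f"
    using assms by (intro bounded_linear_intro[where K=1]) (auto simp: linear_add linear_scale)
  let ?a = "Endo (Blinfun f)"
  have "endo_app ?a = f" by (simp add: endo_app.rep_eq Endo_inverse bounded_linear_Blinfun_apply[OF bl])
  moreover have "norm ?a \<le> 1"
    by (simp add: norm_endo.rep_eq Endo_inverse)
      (rule norm_blinfun_bound, auto simp: bounded_linear_Blinfun_apply[OF bl] assms)
  ultimately show ?thesis by blast
qed

section \<open>The semigroup of a closed symmetric form\<close>

lemma norm_add3_le: "norm (a + b + c) \<le> norm a + norm b + norm (c::'a::real_normed_vector)"
  using norm_triangle_ineq[of "a + b" c] norm_triangle_ineq[of a b] by linarith

lemma norm_add_diff_le: "norm (a + b - c) \<le> norm a + norm b + norm (c::'a::real_normed_vector)"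
  using norm_triangle_ineq4[of "a + b" c] norm_triangle_ineq[of a b] by linarith

lemma norm_add3_diff_le: "norm (a + b + c - d) \<le> norm a + norm b + norm c + norm (d::'a::real_normed_vector)"
  using norm_triangle_ineq4[of "a + b + c" d] norm_add3_le[of a b c] by linarith

text \<open>A closed densely defined operator is given by its graph \<open>\<Gamma>\<close>; \<open>gen u g\<close> says that \<open>u\<close> is in the
  domain of the operator \<open>A\<close> of the form \<open>(u, v) \<mapsto> inner w z\<close>, where \<open>(u, w)\<close> and \<open>(v, z)\<close> are
  in \<open>\<Gamma>\<close>, and that \<open>A u = g\<close>.\<close>

locale closed_graph =
  fixes \<Gamma> :: "('h::{real_inner,banach,perfect_space} \<times> 'k::{real_inner,banach}) set"
  assumes closed_\<Gamma>: "closed \<Gamma>" and subspace_\<Gamma>: "subspace \<Gamma>"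
    and single_\<Gamma>: "\<And>w. (0, w) \<in> \<Gamma> \<Longrightarrow> w = 0" and dense_\<Gamma>: "closure (fst ` \<Gamma>) = UNIV"
begin

definition gen :: "'h \<Rightarrow> 'h \<Rightarrow> bool" where
  "gen u g \<longleftrightarrow> (\<exists>w. (u, w) \<in> \<Gamma> \<and> (\<forall>v z. (v, z) \<in> \<Gamma> \<longrightarrow> inner w z = - inner g v))"

section \<open>Linearity, symmetry and dissipativity of the operator\<close>

lemma gen_linear:
  assumes "gen u g" "gen v h"
  shows "gen (a *\<^sub>R u + b *\<^sub>R v) (a *\<^sub>R g + b *\<^sub>R h)"
proof -
  obtain w where w: "(u, w) \<in> \<Gamma>" "\<And>v z. (v, z) \<in> \<Gamma> \<Longrightarrow> inner w z = - inner g v"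
    using assms(1) unfolding gen_def by blast
  obtain w' where w': "(v, w') \<in> \<Gamma>" "\<And>v z. (v, z) \<in> \<Gamma> \<Longrightarrow> inner w' z = - inner h v"
    using assms(2) unfolding gen_def by blast
  have "(a *\<^sub>R u + b *\<^sub>R v, a *\<^sub>R w + b *\<^sub>R w') \<in> \<Gamma>"
    using subspace_add[OF subspace_\<Gamma> subspace_scale[OF subspace_\<Gamma> w(1), of a]
        subspace_scale[OF subspace_\<Gamma> w'(1), of b]] by simp
  then show ?thesis unfolding gen_def
    using w(2) w'(2)
    by (intro exI[of _ "a *\<^sub>R w + b *\<^sub>R w'"])
      (auto simp: inner_add_left algebra_simps)
qed

lemmas gen_add = gen_linear[where a=1 and b=1, simplified]
lemmas gen_diff = gen_linear[where a=1 and b="-1", simplified]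
lemma gen_scale: "gen u g \<Longrightarrow> gen (a *\<^sub>R u) (a *\<^sub>R g)"
  using gen_linear[of u g u g a 0] by simp

lemma gen_sym:
  assumes "gen u g" "gen v h"
  shows "inner g v = inner u h"
proof -
  obtain w where w: "(u, w) \<in> \<Gamma>" "\<And>v z. (v, z) \<in> \<Gamma> \<Longrightarrow> inner w z = - inner g v"
    using assms(1) unfolding gen_def by blast
  obtain w' where w': "(v, w') \<in> \<Gamma>" "\<And>v z. (v, z) \<in> \<Gamma> \<Longrightarrow> inner w' z = - inner h v"
    using assms(2) unfolding gen_def by blast
  show ?thesis using w(2)[OF w'(1)] w'(2)[OF w(1)] by (simp add: inner_commute)
qed

lemma gen_dissipative: "gen u g \<Longrightarrow> inner g u \<le> 0"
  unfolding gen_def by (metis inner_ge_zero neg_0_le_iff_le)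

section \<open>The resolvent\<close>

lemma ex_resolvent:
  assumes "l > 0" shows "\<exists>u. gen u (l *\<^sub>R (u - f))"
proof -
  \<comment> \<open>\<open>S\<close> consists of the points \<open>(sqrt l *\<^sub>R u, w)\<close>
    with \<open>(u, w)\<close> in \<open>\<Gamma>\<close>. This scaling turns the minimization of l
    |u - f|^2 + |w|^2 over \<open>\<Gamma>\<close> into an orthogonal projection in the product
    space, and the orthogonality relation is the weak form of A u = l (u - f).\<close>
  define S where "S = (\<lambda>p. (inverse (sqrt l) *\<^sub>R fst p, snd p)) -` \<Gamma>"
  have lin: "linear (\<lambda>p::'h\<times>'k. (inverse (sqrt l) *\<^sub>R fst p, snd p))"
    by (rule linearI) (auto simp: algebra_simps)
  have "closed S" unfolding S_def
    by (rule closed_vimage[OF closed_\<Gamma>]) (intro continuous_intros)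
  moreover have "subspace S" unfolding S_def
    by (rule linear_subspace_vimage[OF lin subspace_\<Gamma>])
  ultimately obtain p where p: "p \<in> S" "\<And>y. y \<in> S \<Longrightarrow> inner ((sqrt l *\<^sub>R f, 0) - p) y = 0"
    using ex_orthogonal_projection[of S] by metis
  obtain a w where aw: "p = (a, w)" by fastforce
  define u where "u = inverse (sqrt l) *\<^sub>R a"
  have s: "sqrt l * sqrt l = l" "sqrt l \<noteq> 0" using assms by auto
  have a: "a = sqrt l *\<^sub>R u" using s by (simp add: u_def)
  have "inner w z = - inner (l *\<^sub>R (u - f)) v" if vz: "(v, z) \<in> \<Gamma>" for v z
  proof -
    have "(sqrt l *\<^sub>R v, z) \<in> S" using vz s by (simp add: S_def)
    from p(2)[OF this] have "sqrt l * (sqrt l * inner f v) - sqrt l * (sqrt l * inner u v) - inner w z = 0"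
      by (simp add: aw a inner_diff_left algebra_simps)
    then have "l * inner f v - l * inner u v - inner w z = 0" unfolding mult.assoc[symmetric] s .
    then show ?thesis by (simp add: inner_diff_left algebra_simps)
  qed
  moreover have "(u, w) \<in> \<Gamma>" using p(1) by (simp add: S_def aw u_def)
  ultimately show ?thesis unfolding gen_def by blast
qed

text \<open>This is l (l - A)^(-1); the factor l makes it a contraction that tends to the identity
  as l tends to infinity.\<close>

definition J :: "real \<Rightarrow> 'h \<Rightarrow> 'h" where
  "J l f = (SOME u. gen u (l *\<^sub>R (u - f)))"

lemma gen_J: "l > 0 \<Longrightarrow> gen (J l f) (l *\<^sub>R (J l f - f))"
  unfolding J_def using someI_ex[OF ex_resolvent] .

text \<open>The difference d of two solutions satisfies A d = l d, and dissipativity leaves only d =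
  0.\<close>

lemma J_eqI:
  assumes "l > 0" "gen u (l *\<^sub>R (u - f))" shows "J l f = u"
proof -
  have "inner (l *\<^sub>R (J l f - f) - l *\<^sub>R (u - f)) (J l f - u) \<le> 0"
    by (intro gen_dissipative gen_diff gen_J assms)
  then have "l * inner (J l f - u) (J l f - u) \<le> 0" by (simp add: algebra_simps)
  then have "inner (J l f - u) (J l f - u) \<le> 0" using assms(1) by (simp add: mult_le_0_iff)
  then have "J l f - u = 0" using inner_eq_zero_iff inner_ge_zero antisym by blast
  then show ?thesis by simp
qed

lemma linear_J: "l > 0 \<Longrightarrow> linear (J l)"
proof (rule linearI)
  fix x y :: 'h and c :: real assume l: "l > 0"
  show "J l (x + y) = J l x + J l y"
    using gen_add[OF gen_J[OF l, of x] gen_J[OF l, of y]]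
    by (intro J_eqI l) (simp add: algebra_simps)
  show "J l (c *\<^sub>R x) = c *\<^sub>R J l x"
    using gen_scale[OF gen_J[OF l, of x], of c]
    by (intro J_eqI l) (simp add: algebra_simps)
qed

lemma norm_J_le:
  assumes "l > 0" shows "norm (J l f) \<le> norm f"
proof -
  have "inner (l *\<^sub>R (J l f - f)) (J l f) \<le> 0" by (intro gen_dissipative gen_J assms)
  then have "inner (J l f) (J l f) \<le> inner f (J l f)"
    using assms by (simp add: inner_diff_left mult_le_0_iff)
  also have "\<dots> \<le> norm f * norm (J l f)" by (rule norm_cauchy_schwarz)
  finally have "norm (J l f) * norm (J l f) \<le> norm f * norm (J l f)"
    by (simp add: power2_norm_eq_inner[symmetric] power2_eq_square)
  then show ?thesis using mult_right_le_imp_le[of "norm (J l f)" "norm (J l f)"]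
    by (cases "J l f = 0") auto
qed

lemma J_sym: "l > 0 \<Longrightarrow> inner (J l f) g = inner f (J l g)"
  using gen_sym[OF gen_J gen_J, of l l f g] by (simp add: inner_diff_left inner_diff_right)

text \<open>The resolvent commutes with A: the left side is A (J l f), the right side is J l (A
  f).\<close>

lemma J_gen:
  assumes "l > 0" "gen f g" shows "l *\<^sub>R (J l f - f) = J l g"
  using gen_scale[OF gen_diff[OF gen_J[OF assms(1), of f] assms(2)], of l] assms(1)
  by (intro J_eqI[symmetric])

lemma J_commute:
  assumes "l > 0" "m > 0" shows "J l (J m f) = J m (J l f)"
proof (cases "l = m")
  case False
  text \<open>The resolvent identity: both sides equal \<open>(m J l f - l J m f) / (m - l)\<close>.\<close>
  have *: "J m (J l f) = inverse (m - l) *\<^sub>R (m *\<^sub>R J l f - l *\<^sub>R J m f)"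
    if lm: "l > 0" "m > 0" "l \<noteq> m" for l m
  proof (rule J_eqI[OF lm(2)])
    let ?u = "J l f" and ?y = "J m f"
    define x where "x = inverse (m - l) *\<^sub>R (m *\<^sub>R ?u - l *\<^sub>R ?y)"
    have "gen x (inverse (m - l) *\<^sub>R (m *\<^sub>R l *\<^sub>R (?u - f) - l *\<^sub>R m *\<^sub>R (?y - f)))"
      unfolding x_def by (intro gen_scale gen_diff gen_J lm)
    also have "inverse (m - l) *\<^sub>R (m *\<^sub>R l *\<^sub>R (?u - f) - l *\<^sub>R m *\<^sub>R (?y - f)) = m *\<^sub>R (x - ?u)"
    proof -
      have "m *\<^sub>R l *\<^sub>R (?u - f) - l *\<^sub>R m *\<^sub>R (?y - f) = m *\<^sub>R (l *\<^sub>R ?u - l *\<^sub>R ?y)"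
        by (simp add: algebra_simps)
      also have "\<dots> = m *\<^sub>R ((m - l) *\<^sub>R (x - ?u))"
      proof -
        have "(m - l) *\<^sub>R x = m *\<^sub>R ?u - l *\<^sub>R ?y" using lm by (simp add: x_def)
        then have "(m - l) *\<^sub>R (x - ?u) = l *\<^sub>R ?u - l *\<^sub>R ?y"
          by (simp add: scaleR_diff_right scaleR_diff_left)
        then show ?thesis by simp
      qed
      finally show ?thesis using lm by simp
    qed
    finally show "gen x (m *\<^sub>R (x - ?u))" .
  qed
  have "inverse (l - m) *\<^sub>R (l *\<^sub>R J m f - m *\<^sub>R J l f) = inverse (m - l) *\<^sub>R (m *\<^sub>R J l f - l *\<^sub>R J m f)"
  proof -
    have "inverse (l - m) = - inverse (m - l)" by (metis inverse_minus_eq minus_diff_eq)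
    then show ?thesis by (simp add: scaleR_diff_right)
  qed
  then show ?thesis using *[of l m] *[of m l] assms False by simp
qed simp

lemma J_tendsto: "(\<lambda>n. J (real (Suc n)) f) \<longlonglongrightarrow> f"
proof -
  have dom: "(\<lambda>n. J (real (Suc n)) f) \<longlonglongrightarrow> f" if fw: "(f, wf) \<in> \<Gamma>" for f wf
  proof -
    \<comment> \<open>Testing the resolvent equation with \<open>(?u - f, w - wf)\<close> gives l |u
      - f|^2 + |w|^2 = (w, wf), and the right side is at most |w|^2 + |wf|^2.\<close>
    have bound: "(norm (J l f - f))\<^sup>2 \<le> (norm wf)\<^sup>2 / l" if l: "l > 0" for l
    proof -
      let ?u = "J l f"
      obtain w where w: "(?u, w) \<in> \<Gamma>" "\<And>v z. (v, z) \<in> \<Gamma> \<Longrightarrow> inner w z = - inner (l *\<^sub>R (?u - f)) v"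
        using gen_J[OF l, of f] unfolding gen_def by blast
      have "(?u - f, w - wf) \<in> \<Gamma>" using subspace_diff[OF subspace_\<Gamma> w(1) fw] by simp
      from w(2)[OF this] have "inner w w - inner w wf = - (l * inner (?u - f) (?u - f))"
        by (simp only: inner_diff_right[of w] inner_scaleR_left)
      then have "l * (norm (?u - f))\<^sup>2 = inner w wf - inner w w"
        unfolding power2_norm_eq_inner by linarith
      also have "\<dots> \<le> norm w * norm wf - (norm w)\<^sup>2"
        using norm_cauchy_schwarz[of w wf] by (simp add: power2_norm_eq_inner)
      also have "\<dots> \<le> (norm wf)\<^sup>2"
        using sum_squares_bound[of "norm w" "norm wf"] zero_le_power2[of "norm w"] zero_le_power2[of "norm wf"]
        by linarith
      finally show ?thesis using l by (simp add: field_simps)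
    qed
    have "(\<lambda>n. (norm (J (real (Suc n)) f - f))\<^sup>2) \<longlonglongrightarrow> 0"
    proof (rule tendsto_sandwich[OF _ _ tendsto_const])
      show "(\<lambda>n. (norm wf)\<^sup>2 / real (Suc n)) \<longlonglongrightarrow> 0"
        using LIMSEQ_inverse_real_of_nat
        by (simp add: divide_inverse tendsto_mult_right_zero)
      show "\<forall>\<^sub>F n in sequentially. (norm (J (real (Suc n)) f - f))\<^sup>2 \<le> (norm wf)\<^sup>2 / real (Suc n)"
        using bound by (intro always_eventually) simp
    qed simp
    then have "(\<lambda>n. norm (J (real (Suc n)) f - f)) \<longlonglongrightarrow> 0"
      using tendsto_real_sqrt by fastforce
    then show ?thesis by (simp add: LIM_zero_iff tendsto_norm_zero_iff)
  qed
  \<comment> \<open>All \<open>J\<close> are contractions, so convergence extends from the dense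
    first projection of \<open>\<Gamma>\<close> to every \<open>f\<close>.\<close>
  show ?thesis
  proof (rule LIMSEQ_I)
    fix r :: real assume r: "r > 0"
    have "f \<in> closure (fst ` \<Gamma>)" using dense_\<Gamma> by simp
    then obtain g where g: "g \<in> fst ` \<Gamma>" "dist g f < r/3"
      using r unfolding closure_approachable by (metis divide_pos_pos zero_less_numeral)
    then obtain N where N: "\<And>n. n \<ge> N \<Longrightarrow> norm (J (real (Suc n)) g - g) < r/3"
      using LIMSEQ_D[OF dom, of g _ "r/3"] r by force
    have "norm (J (real (Suc n)) f - f) < r" if "n \<ge> N" for n
    proof -
      have l: "real (Suc n) > 0" by simp
      have "J (real (Suc n)) f - f = J (real (Suc n)) (f - g) + (J (real (Suc n)) g - g) + (g - f)"
        using linear_diff[OF linear_J[OF l], of f g] by simp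
      also have "norm \<dots> \<le> norm (J (real (Suc n)) (f - g)) + norm (J (real (Suc n)) g - g) + norm (g - f)"
        by (rule norm_add3_le)
      also have "\<dots> < r"
        using norm_J_le[OF l, of "f - g"] N[OF that] g(2) by (simp add: dist_norm norm_minus_commute)
      finally show ?thesis .
    qed
    then show "\<exists>N. \<forall>n\<ge>N. norm (J (real (Suc n)) f - f) < r" by blast
  qed
qed

text \<open>The domain of A contains every \<open>J l f\<close>, and these converge to
  \<open>f\<close>.\<close>

lemma gen_dense: "\<exists>g h. gen g h \<and> norm (f - g) < e" if "e > 0"
  using LIMSEQ_D[OF J_tendsto that, of f] gen_J[of "real (Suc _)" f]
  by (metis norm_minus_commute of_nat_0_less_iff order_refl zero_less_Suc)

text \<open>Yosida: \<open>T t\<close> is the limit of \<open>exp (t l (J l - 1))\<close> for \<open>l\<close> tending to infinity.\<close>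

definition jn :: "nat \<Rightarrow> 'h endo" where
  "jn n = (SOME a. norm a \<le> 1 \<and> endo_app a = J (real (Suc n)))"

lemma jn: "norm (jn n) \<le> 1" "endo_app (jn n) = J (real (Suc n))"
  using someI_ex[OF ex_endo[OF linear_J norm_J_le], of "real (Suc n)"] unfolding jn_def by auto

lemma endo_eqI: "(\<And>x. endo_app a x = endo_app b x) \<Longrightarrow> a = (b :: 'h endo)"
  by transfer (rule blinfun_eqI)

lemma jn_commute: "jn m * jn n = jn n * jn m"
  by (rule endo_eqI) (simp add: jn J_commute)

definition yo :: "nat \<Rightarrow> 'h endo" where "yo n = real (Suc n) *\<^sub>R (jn n - 1)"

lemma yo_commute: "yo m * yo n = yo n * yo m"
  by (simp add: yo_def algebra_simps jn_commute)

lemma yo_app: "endo_app (yo n) f = real (Suc n) *\<^sub>R (J (real (Suc n)) f - f)"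
  by (simp add: yo_def endo.scaleR_left endo.diff_left jn)

text \<open>On the domain of A the Yosida approximation of A f is the resolvent applied to A f,
  hence it converges to A f and is bounded by |A f|.\<close>

lemma yo_gen: "gen f g \<Longrightarrow> endo_app (yo n) f = J (real (Suc n)) g"
  by (simp only: yo_app) (rule J_gen, auto)

definition E :: "nat \<Rightarrow> real \<Rightarrow> 'h endo" where "E n t = exp (t *\<^sub>R yo n)"

text \<open>Splitting off the scalar part leaves the exponential of a nonnegative multiple of a
  contraction. Both the bound \<open>norm_E_le\<close> and the invariance of cones in
  \<open>T_in_cone\<close> are read off this form.\<close>

lemma E_eq: "E n t = exp (- (t * real (Suc n))) *\<^sub>R exp ((t * real (Suc n)) *\<^sub>R jn n)"
proof -
  have "t *\<^sub>R yo n = (t * real (Suc n)) *\<^sub>R jn n + of_real (- (t * real (Suc n)))"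
    by (simp add: yo_def of_real_def scaleR_diff_right)
  then have "E n t = exp ((t * real (Suc n)) *\<^sub>R jn n) * exp (of_real (- (t * real (Suc n))))"
    unfolding E_def by (simp only:) (rule exp_add_commuting, simp add: of_real_def)
  then show ?thesis by (simp only: exp_of_real) (simp add: of_real_def)
qed

lemma norm_E_le: "0 \<le> t \<Longrightarrow> norm (E n t) \<le> 1"
proof -
  assume t: "0 \<le> t"
  define s where "s = t * real (Suc n)"
  have s: "0 \<le> s" using t by (simp add: s_def)
  have "norm (exp (s *\<^sub>R jn n)) \<le> exp (norm (s *\<^sub>R jn n))" by (rule norm_exp)
  also have "\<dots> \<le> exp s" using jn(1)[of n] s by (simp add: mult_left_le)
  finally have "exp (- s) * norm (exp (s *\<^sub>R jn n)) \<le> exp (- s) * exp s" by simp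
  then show ?thesis unfolding E_eq s_def[symmetric] by (simp add: exp_minus_inverse mult.commute)
qed

lemma norm_E_app_le: "0 \<le> t \<Longrightarrow> norm (endo_app (E n t) f) \<le> norm f"
  using norm_endo_app_le[of "E n t" f] mult_right_mono[OF norm_E_le[of t n] norm_ge_zero[of f]] by simp

lemma E_add: "E n (s + t) = E n s * E n t"
  unfolding E_def scaleR_add_left by (rule exp_add_commuting) simp

text \<open>The curve s -> E m (t - s) E n s f joins the two vectors. Since the approximations
  commute, its derivative is a contraction applied to the difference of \<open>yo n\<close> and
  \<open>yo m\<close> at f, and the mean value inequality gives the bound.\<close>

lemma E_diff_le:
  assumes t: "0 \<le> t"
  shows "norm (endo_app (E n t) f - endo_app (E m t) f) \<le> t * norm (endo_app (yo n) f - endo_app (yo m) f)"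
proof (cases "t = 0")
  case False
  define C where "C = yo n - yo m"
  define h where "h s = exp (t *\<^sub>R yo m) * exp (s *\<^sub>R C)" for s
  have h_eq: "h s = E m (t - s) * E n s" for s
  proof -
    have "h s = exp (t *\<^sub>R yo m + s *\<^sub>R C)"
      unfolding h_def by (rule exp_add_commuting[symmetric]) (simp add: C_def algebra_simps yo_commute)
    also have "t *\<^sub>R yo m + s *\<^sub>R C = (t - s) *\<^sub>R yo m + s *\<^sub>R yo n"
      by (simp add: C_def algebra_simps)
    also have "exp \<dots> = E m (t - s) * E n s"
      unfolding E_def by (rule exp_add_commuting) (simp add: yo_commute)
    finally show ?thesis .
  qed
  have der: "((\<lambda>s. endo_app (h s) f) has_vector_derivative endo_app (h s * C) f) (at s)" for s
  proof -
    have "((\<lambda>s. h s) has_vector_derivative h s * C) (at s)"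
      unfolding h_def mult.assoc
      by (rule has_vector_derivative_mult_right) (rule exp_scaleR_has_vector_derivative_right)
    then show ?thesis by (rule bounded_linear.has_vector_derivative[OF endo.bounded_linear_left])
  qed
  have "continuous_on {0..t} (\<lambda>s. endo_app (h s) f)"
    using der by (meson continuous_at_imp_continuous_on has_vector_derivative_continuous)
  from mvt_general[OF _ this der[unfolded has_vector_derivative_def]] t False
  obtain s where s: "0 < s" "s < t"
    "norm (endo_app (h t) f - endo_app (h 0) f) \<le> norm (t *\<^sub>R endo_app (h s * C) f)" by auto
  have "norm (endo_app (h s * C) f) \<le> norm (endo_app C f)"
    unfolding h_eq endo_app_mult using s norm_E_app_le[of "t - s"] norm_E_app_le[of s]
    by (meson diff_ge_0_iff_ge less_imp_le order_trans)
  then have "norm (t *\<^sub>R endo_app (h s * C) f) \<le> t * norm (endo_app C f)"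
    using t by (simp add: mult_left_mono)
  moreover have "h t = E n t" "h 0 = E m t" by (auto simp: h_eq E_def)
  ultimately show ?thesis using s(3) by (simp add: C_def endo.diff_left)
qed (simp add: E_def)

text \<open>The mean value inequality for s -> E n s f - s g. The choice g = 0 yields the first
  bound; g = A f will yield the derivative of the semigroup at 0.\<close>

lemma E_zero_diff_le:
  assumes t: "0 \<le> t"
  shows "norm (endo_app (E n t) f - f) \<le> t * norm (endo_app (yo n) f)"
    and "\<exists>s. 0 \<le> s \<and> s \<le> t \<and> norm (endo_app (E n t) f - f - t *\<^sub>R g) \<le> t * norm (endo_app (E n s) (endo_app (yo n) f) - g)"
proof -
  have der: "((\<lambda>s. endo_app (E n s) f) has_vector_derivative endo_app (E n s * yo n) f) (at s)" for s
    unfolding E_def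
    by (rule bounded_linear.has_vector_derivative[OF endo.bounded_linear_left exp_scaleR_has_vector_derivative_right])
  show *: "\<exists>s. 0 \<le> s \<and> s \<le> t \<and> norm (endo_app (E n t) f - f - t *\<^sub>R g) \<le> t * norm (endo_app (E n s) (endo_app (yo n) f) - g)" for g
  proof (cases "t = 0")
    case False
    have der': "((\<lambda>s. endo_app (E n s) f - s *\<^sub>R g) has_vector_derivative endo_app (E n s * yo n) f - g) (at s)" for s
      by (auto intro!: derivative_eq_intros der)
    have "continuous_on {0..t} (\<lambda>s. endo_app (E n s) f - s *\<^sub>R g)"
      using der' by (meson continuous_at_imp_continuous_on has_vector_derivative_continuous)
    from mvt_general[OF _ this der'[unfolded has_vector_derivative_def]] t False
    obtain s where s: "0 < s" "s < t" "norm (endo_app (E n t) f - t *\<^sub>R g - (endo_app (E n 0) f - 0 *\<^sub>R g))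
       \<le> norm ((t - 0) *\<^sub>R (endo_app (E n s * yo n) f - g))" by auto
    have "norm ((t - 0) *\<^sub>R (endo_app (E n s * yo n) f - g)) = t * norm (endo_app (E n s) (endo_app (yo n) f) - g)"
      using t by simp
    moreover have "endo_app (E n t) f - t *\<^sub>R g - (endo_app (E n 0) f - 0 *\<^sub>R g) = endo_app (E n t) f - f - t *\<^sub>R g"
      by (simp add: E_def)
    ultimately have "norm (endo_app (E n t) f - f - t *\<^sub>R g) \<le> t * norm (endo_app (E n s) (endo_app (yo n) f) - g)"
      using s(3) by (simp only:)
    then show ?thesis using s by (intro exI[of _ s]) simp
  qed (simp add: E_def, blast)
  obtain s where s: "0 \<le> s" "norm (endo_app (E n t) f - f) \<le> t * norm (endo_app (E n s) (endo_app (yo n) f))"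
    using *[of 0] by auto
  then show "norm (endo_app (E n t) f - f) \<le> t * norm (endo_app (yo n) f)"
    using norm_E_app_le[OF s(1)] t by (meson mult_left_mono order_trans)
qed

text \<open>On the domain of A the vectors \<open>endo_app (yo n) g\<close> converge, so
  \<open>E_diff_le\<close> applies; density and contractivity do the rest.\<close>

lemma E_Cauchy:
  assumes t: "0 \<le> t" shows "Cauchy (\<lambda>n. endo_app (E n t) f)"
proof (rule metric_CauchyI)
  fix r :: real assume r: "r > 0"
  obtain g h where g: "gen g h" "norm (f - g) < r/3" using gen_dense[of "r/3" f] r by auto
  have "(\<lambda>n. endo_app (yo n) g) \<longlonglongrightarrow> h" unfolding yo_gen[OF g(1)] by (rule J_tendsto)
  then have "Cauchy (\<lambda>n. endo_app (yo n) g)" by (rule LIMSEQ_imp_Cauchy)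
  \<comment> \<open>Dividing by t + 1 instead of t covers t = 0.\<close>
  moreover have "r / 3 / (t + 1) > 0" using r t by simp
  ultimately obtain N where N: "\<And>m n. m \<ge> N \<Longrightarrow> n \<ge> N \<Longrightarrow>
      dist (endo_app (yo m) g) (endo_app (yo n) g) < r/3/(t+1)"
    unfolding Cauchy_def by meson
  have "dist (endo_app (E m t) f) (endo_app (E n t) f) < r" if "m \<ge> N" "n \<ge> N" for m n
  proof -
    have "norm (endo_app (E m t) g - endo_app (E n t) g) \<le> t * norm (endo_app (yo m) g - endo_app (yo n) g)"
      by (rule E_diff_le[OF t])
    also have "\<dots> \<le> (t + 1) * (r/3/(t+1))"
      using N[OF that] t by (intro mult_mono) (auto simp: dist_norm)
    also have "\<dots> = r/3"
    proof -
      have "t + 1 \<noteq> 0" using t by linarith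
      moreover have "a * (b / a) = b" if "a \<noteq> 0" for a b :: real using that by simp
      ultimately show ?thesis by blast
    qed
    finally have 1: "norm (endo_app (E m t) g - endo_app (E n t) g) \<le> r/3" .
    have 2: "norm (endo_app (E m t) (f - g)) < r/3" "norm (endo_app (E n t) (f - g)) < r/3"
      using norm_E_app_le[OF t, of _ "f - g"] g(2) by (meson le_less_trans)+
    have "endo_app (E m t) f - endo_app (E n t) f = endo_app (E m t) (f - g)
        + (endo_app (E m t) g - endo_app (E n t) g) - endo_app (E n t) (f - g)"
      by (simp add: endo.diff_right)
    also have "norm \<dots> \<le> norm (endo_app (E m t) (f - g)) + norm (endo_app (E m t) g - endo_app (E n t) g)
        + norm (endo_app (E n t) (f - g))"
      by (rule norm_add_diff_le)
    finally show ?thesis using 1 2 by (simp add: dist_norm)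
  qed
  then show "\<exists>M. \<forall>m\<ge>M. \<forall>n\<ge>M. dist (endo_app (E m t) f) (endo_app (E n t) f) < r" by blast
qed

section \<open>The semigroup as the limit of the exponentials\<close>

definition T :: "real \<Rightarrow> 'h \<Rightarrow> 'h" where "T t f = lim (\<lambda>n. endo_app (E n t) f)"

lemma E_tendsto: "0 \<le> t \<Longrightarrow> (\<lambda>n. endo_app (E n t) f) \<longlonglongrightarrow> T t f"
  unfolding T_def using E_Cauchy[of t f] by (simp add: Cauchy_convergent_iff convergent_LIMSEQ_iff)

lemma T_norm_le: "0 \<le> t \<Longrightarrow> norm (T t f) \<le> norm f"
  using LIMSEQ_le_const2[OF tendsto_norm[OF E_tendsto]] norm_E_app_le by blast

lemma T_linear: "0 \<le> t \<Longrightarrow> linear (T t)"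
proof (rule linearI)
  fix x y :: 'h and c :: real assume t: "0 \<le> t"
  show "T t (x + y) = T t x + T t y"
    using E_tendsto[OF t, of "x + y"] tendsto_add[OF E_tendsto[OF t, of x] E_tendsto[OF t, of y]]
    unfolding endo.add_right by (rule LIMSEQ_unique)
  show "T t (c *\<^sub>R x) = c *\<^sub>R T t x"
    using E_tendsto[OF t, of "c *\<^sub>R x"] tendsto_scaleR[OF tendsto_const E_tendsto[OF t, of x], of c]
    unfolding endo.scaleR_right by (rule LIMSEQ_unique)
qed

lemma T_zero: "T 0 f = f"
  using E_tendsto[of 0 f] by (simp add: E_def LIMSEQ_const_iff)

lemma T_add:
  assumes "0 \<le> s" "0 \<le> t" shows "T (s + t) f = T s (T t f)"
proof (rule LIMSEQ_unique)
  show "(\<lambda>n. endo_app (E n (s + t)) f) \<longlonglongrightarrow> T (s + t) f" using assms by (intro E_tendsto) simp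
  have "(\<lambda>n. endo_app (E n s) (endo_app (E n t) f - T t f)) \<longlonglongrightarrow> 0"
  proof (rule Lim_null_comparison)
    show "\<forall>\<^sub>F n in sequentially. norm (endo_app (E n s) (endo_app (E n t) f - T t f)) \<le> norm (endo_app (E n t) f - T t f)"
      using norm_E_app_le[OF assms(1)] by simp
    show "(\<lambda>n. norm (endo_app (E n t) f - T t f)) \<longlonglongrightarrow> 0"
      using E_tendsto[OF assms(2)] by (simp add: LIM_zero_iff tendsto_norm_zero)
  qed
  from tendsto_add[OF this E_tendsto[OF assms(1), of "T t f"]]
  show "(\<lambda>n. endo_app (E n (s + t)) f) \<longlonglongrightarrow> T s (T t f)"
    by (simp add: E_add endo.diff_right)
qed

lemma T_gen_le: 
  assumes t: "0 \<le> t" and "gen f g" shows "norm (T t f - f) \<le> t * norm g"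
proof (rule LIMSEQ_le_const2)
  show "(\<lambda>n. norm (endo_app (E n t) f - f)) \<longlonglongrightarrow> norm (T t f - f)"
    by (intro tendsto_intros E_tendsto t)
  have "norm (endo_app (E n t) f - f) \<le> t * norm g" for n
  proof -
    have "norm (endo_app (yo n) f) \<le> norm g" unfolding yo_gen[OF assms(2)] by (rule norm_J_le) simp
    then show ?thesis using E_zero_diff_le(1)[OF t, of n f] t by (meson mult_left_mono order_trans)
  qed
  then show "\<exists>N. \<forall>n\<ge>N. norm (endo_app (E n t) f - f) \<le> t * norm g" by blast
qed

lemma T_tendsto_0: "((\<lambda>t. T t f) \<longlongrightarrow> f) (at_right 0)"
proof (rule tendstoI)
  fix r :: real assume r: "r > 0"
  obtain g h where g: "gen g h" "norm (f - g) < r/3" using gen_dense[of "r/3" f] r by auto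
  have "((\<lambda>t. t * norm h) \<longlongrightarrow> 0 * norm h) (at_right 0)" by (intro tendsto_intros)
  then have "\<forall>\<^sub>F t in at_right 0. t * norm h < r/3" using r by (intro order_tendstoD(2)) auto
  moreover have "\<forall>\<^sub>F t in at_right (0::real). t > 0" by (rule eventually_at_right_less)
  ultimately show "\<forall>\<^sub>F t in at_right 0. dist (T t f) f < r"
  proof eventually_elim
    fix t :: real assume t: "t * norm h < r/3" "t > 0"
    have "T t f - f = T t (f - g) + (T t g - g) - (f - g)"
      using linear_diff[OF T_linear[of t]] t by simp
    also have "norm \<dots> \<le> norm (T t (f - g)) + norm (T t g - g) + norm (f - g)"
      by (rule norm_add_diff_le)
    also have "\<dots> < r" using T_norm_le[of t "f - g"] T_gen_le[OF _ g(1), of t] t g(2) by simp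
    finally show "dist (T t f) f < r" by (simp add: dist_norm)
  qed
qed

text \<open>The vector h = A f may lie outside the domain of A, where no rate is available for E n s
  h - h. It is replaced by some g in the domain with A g = k, at the cost 2 |h - g| + t |k|; first g
  is chosen close to h, then t tends to 0.\<close>

lemma T_derivative:
  assumes f: "gen f h"
  shows "((\<lambda>t. (T t f - f) /\<^sub>R t) \<longlongrightarrow> h) (at_right 0)"
proof (rule tendstoI)
  fix r :: real assume r: "r > 0"
  obtain g k where g: "gen g k" "norm (h - g) < r/4" using gen_dense[of "r/4" h] r by auto
  have main: "norm (T t f - f - t *\<^sub>R h) \<le> t * (2 * norm (h - g) + t * norm k)" if t: "0 \<le> t" for t
  proof (rule LIMSEQ_le)
    show "(\<lambda>n. norm (endo_app (E n t) f - f - t *\<^sub>R h)) \<longlonglongrightarrow> norm (T t f - f - t *\<^sub>R h)"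
      by (intro tendsto_intros E_tendsto t)
    have "(\<lambda>n. t * (norm (J (real (Suc n)) h - h) + 2 * norm (h - g) + t * norm k))
        \<longlonglongrightarrow> t * (norm (h - h) + 2 * norm (h - g) + t * norm k)"
      by (intro tendsto_intros J_tendsto)
    then show "(\<lambda>n. t * (norm (J (real (Suc n)) h - h) + 2 * norm (h - g) + t * norm k))
        \<longlonglongrightarrow> t * (2 * norm (h - g) + t * norm k)" by simp
    have "norm (endo_app (E n t) f - f - t *\<^sub>R h) \<le> t * (norm (J (real (Suc n)) h - h) + 2 * norm (h - g) + t * norm k)" for n
    proof -
      obtain s where s: "0 \<le> s" "s \<le> t" "norm (endo_app (E n t) f - f - t *\<^sub>R h) \<le> t * norm (endo_app (E n s) (J (real (Suc n)) h) - h)"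
        using E_zero_diff_le(2)[OF t, of n f h] unfolding yo_gen[OF f] by blast
      have kb: "norm (endo_app (yo n) g) \<le> norm k" unfolding yo_gen[OF g(1)] by (rule norm_J_le) simp
      have "norm (endo_app (E n s) g - g) \<le> s * norm (endo_app (yo n) g)"
        by (rule E_zero_diff_le(1)[OF s(1)])
      also have "\<dots> \<le> t * norm k" using s kb by (intro mult_mono) auto
      finally have 1: "norm (endo_app (E n s) g - g) \<le> t * norm k" .
      have "endo_app (E n s) (J (real (Suc n)) h) - h = endo_app (E n s) (J (real (Suc n)) h - h)
          + endo_app (E n s) (h - g) + (endo_app (E n s) g - g) - (h - g)"
        by (simp add: endo.diff_right)
      also have "norm \<dots> \<le> norm (endo_app (E n s) (J (real (Suc n)) h - h))
          + norm (endo_app (E n s) (h - g)) + norm (endo_app (E n s) g - g) + norm (h - g)"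
        by (rule norm_add3_diff_le)
      also have "\<dots> \<le> norm (J (real (Suc n)) h - h) + 2 * norm (h - g) + t * norm k"
        using norm_E_app_le[OF s(1), of n "J (real (Suc n)) h - h"] norm_E_app_le[OF s(1), of n "h - g"] 1 by linarith
      finally show ?thesis using s(3) t by (meson mult_left_mono order_trans)
    qed
    then show "\<exists>N. \<forall>n\<ge>N. norm (endo_app (E n t) f - f - t *\<^sub>R h) \<le> t * (norm (J (real (Suc n)) h - h) + 2 * norm (h - g) + t * norm k)"
      by blast
  qed
  have "((\<lambda>t. t * norm k) \<longlongrightarrow> 0 * norm k) (at_right 0)" by (intro tendsto_intros)
  then have "\<forall>\<^sub>F t in at_right 0. t * norm k < r/2" using r by (intro order_tendstoD(2)) auto
  moreover have "\<forall>\<^sub>F t in at_right (0::real). t > 0" by (rule eventually_at_right_less)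
  ultimately show "\<forall>\<^sub>F t in at_right 0. dist ((T t f - f) /\<^sub>R t) h < r"
  proof eventually_elim
    fix t :: real assume t: "t * norm k < r/2" "t > 0"
    have "(T t f - f) /\<^sub>R t - h = (T t f - f - t *\<^sub>R h) /\<^sub>R t"
      using t by (simp add: scaleR_diff_right)
    then have "norm ((T t f - f) /\<^sub>R t - h) = norm (T t f - f - t *\<^sub>R h) / t"
      using t by (simp only: norm_scaleR abs_inverse abs_of_pos divide_inverse mult.commute)
    also have "\<dots> \<le> 2 * norm (h - g) + t * norm k" using main[of t] t by (simp add: field_simps)
    also have "\<dots> < r" using t g(2) by simp
    finally show "dist ((T t f - f) /\<^sub>R t) h < r" by (simp add: dist_norm)
  qed
qed

text \<open>For the converse of \<open>T_derivative\<close>: the generator of the semigroup extends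
  A, and 1 - A is onto. With x - A x = u - w, the generator maps y = x - u to y itself, while (T_t y
  - y, y) is nonpositive by contractivity; so y = 0 and u lies in the domain of A.\<close>

lemma T_generator: "((\<lambda>t. (T t u - u) /\<^sub>R t) \<longlongrightarrow> w) (at_right 0) \<longleftrightarrow> gen u w"
proof
  assume u: "((\<lambda>t. (T t u - u) /\<^sub>R t) \<longlongrightarrow> w) (at_right 0)"
  define x where "x = J 1 (u - w)"
  have x: "gen x (x - (u - w))" using gen_J[of 1 "u - w"] by (simp add: x_def)
  define y where "y = x - u"
  have "((\<lambda>t. (T t x - x) /\<^sub>R t - (T t u - u) /\<^sub>R t) \<longlongrightarrow> x - (u - w) - w) (at_right 0)"
    by (intro tendsto_intros T_derivative x u)
  then have "((\<lambda>t. (T t x - x) /\<^sub>R t - (T t u - u) /\<^sub>R t) \<longlongrightarrow> y) (at_right 0)" by (simp add: y_def)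
  then have "((\<lambda>t. inner ((T t x - x) /\<^sub>R t - (T t u - u) /\<^sub>R t) y) \<longlongrightarrow> inner y y) (at_right 0)"
    by (intro tendsto_inner tendsto_const)
  moreover have "\<forall>\<^sub>F t in at_right 0. inner ((T t x - x) /\<^sub>R t - (T t u - u) /\<^sub>R t) y \<le> 0"
    using eventually_at_right_less[of "0::real"]
  proof eventually_elim
    fix t :: real assume t: "0 < t"
    have "T t y = T t x - T t u" using linear_diff[OF T_linear[of t], of x u] t by (simp add: y_def)
    then have "(T t x - x) - (T t u - u) = T t y - y" by (simp add: y_def)
    then have "(T t x - x) /\<^sub>R t - (T t u - u) /\<^sub>R t = (T t y - y) /\<^sub>R t"
      by (simp only: scaleR_diff_right[symmetric])
    moreover have "inner (T t y) y \<le> inner y y"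
      using norm_cauchy_schwarz[of "T t y" y] T_norm_le[of t y] t
      by (metis less_imp_le mult_right_mono norm_ge_zero order_trans power2_eq_square power2_norm_eq_inner)
    ultimately show "inner ((T t x - x) /\<^sub>R t - (T t u - u) /\<^sub>R t) y \<le> 0"
      using t by (simp add: inner_diff_left mult_le_0_iff)
  qed
  ultimately have "inner y y \<le> 0" by (rule tendsto_upperbound) simp
  then have "y = 0" using inner_eq_zero_iff inner_ge_zero antisym by blast
  then show "gen u w" using x by (simp add: y_def)
qed (rule T_derivative)

section \<open>Invariant cones and symmetry\<close>

lemma exp_app_in_cone:
  fixes a :: "'h endo"
  assumes "closed C" "0 \<in> C" "\<And>x y. x \<in> C \<Longrightarrow> y \<in> C \<Longrightarrow> x + y \<in> C"
    "\<And>c x. 0 \<le> c \<Longrightarrow> x \<in> C \<Longrightarrow> c *\<^sub>R x \<in> C"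
    and inv: "\<And>x. x \<in> C \<Longrightarrow> endo_app a x \<in> C" and f: "f \<in> C"
  shows "endo_app (exp a) f \<in> C"
proof -
  have "(\<lambda>n. a ^ n /\<^sub>R fact n) sums exp a"
    unfolding exp_def by (rule summable_sums[OF summable_exp_generic])
  then have "(\<lambda>n. endo_app (a ^ n /\<^sub>R fact n) f) sums endo_app (exp a) f"
    by (rule bounded_linear.sums[OF endo.bounded_linear_left])
  then have lim: "(\<lambda>n. \<Sum>i<n. endo_app (a ^ i /\<^sub>R fact i) f) \<longlonglongrightarrow> endo_app (exp a) f"
    by (simp add: sums_def)
  have pow: "endo_app (a ^ n) f \<in> C" for n
    by (induction n) (auto intro: f inv)
  have "(\<Sum>i<n. endo_app (a ^ i /\<^sub>R fact i) f) \<in> C" for n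
    by (induction n) (auto simp: endo.scaleR_left intro!: assms pow)
  then show ?thesis using closed_sequentially[OF assms(1) _ lim] by blast
qed

text \<open>By \<open>E_eq\<close> the approximations are positive multiples of exponentials of
  positive multiples of resolvents, and the coefficients of the exponential series are positive. The
  cone of nonnegative functions will be the case of interest.\<close>

lemma T_in_cone:
  assumes C: "closed C" "0 \<in> C" "\<And>x y. x \<in> C \<Longrightarrow> y \<in> C \<Longrightarrow> x + y \<in> C"
    "\<And>c x. 0 \<le> c \<Longrightarrow> x \<in> C \<Longrightarrow> c *\<^sub>R x \<in> C"
    and inv: "\<And>l x. l > 0 \<Longrightarrow> x \<in> C \<Longrightarrow> J l x \<in> C" and "f \<in> C" and t: "0 \<le> t"
  shows "T t f \<in> C"
proof (rule closed_sequentially[OF C(1) _ E_tendsto[OF t]])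
  fix n
  have "endo_app (exp ((t * real (Suc n)) *\<^sub>R jn n)) f \<in> C"
    using assms by (intro exp_app_in_cone) (auto simp: endo.scaleR_left jn simp del: of_nat_Suc)
  then show "endo_app (E n t) f \<in> C"
    unfolding E_eq by (simp add: endo.scaleR_left C(4) del: of_nat_Suc)
qed

text \<open>Symmetry passes from the resolvents to the powers of \<open>yo n\<close>, termwise
  through the exponential series, and to the limit.\<close>

lemma T_sym:
  assumes t: "0 \<le> t" shows "inner (T t f) g = inner f (T t g)"
proof -
  have pow: "inner (endo_app (yo n ^ i) f) g = inner f (endo_app (yo n ^ i) g)" for n i f g
  proof (induction i arbitrary: f g)
    case (Suc i)
    have 1: "inner (endo_app (yo n) f) g = inner f (endo_app (yo n) g)" for f g
      by (simp add: yo_app J_sym inner_diff_left inner_diff_right del: of_nat_Suc)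
    have "endo_app (yo n ^ Suc i) g = endo_app (yo n ^ i) (endo_app (yo n) g)"
      by (simp only: power_Suc2 endo_app_mult)
    then show ?case by (simp only: power_Suc endo_app_mult 1 Suc)
  qed simp
  have E: "(\<lambda>i. endo_app ((t *\<^sub>R yo n) ^ i /\<^sub>R fact i) h) sums endo_app (E n t) h" for n h
    using bounded_linear.sums[OF endo.bounded_linear_left summable_sums[OF summable_exp_generic]]
    unfolding E_def exp_def by blast
  have "inner (endo_app (E n t) f) g = inner f (endo_app (E n t) g)" for n
  proof (rule sums_unique2)
    show "(\<lambda>i. inner (endo_app ((t *\<^sub>R yo n) ^ i /\<^sub>R fact i) f) g) sums inner (endo_app (E n t) f) g"
      by (rule bounded_linear.sums[OF bounded_linear_inner_left E])
    have "(\<lambda>i. inner f (endo_app ((t *\<^sub>R yo n) ^ i /\<^sub>R fact i) g)) sums inner f (endo_app (E n t) g)"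
      by (rule bounded_linear.sums[OF bounded_linear_inner_right E])
    then show "(\<lambda>i. inner (endo_app ((t *\<^sub>R yo n) ^ i /\<^sub>R fact i) f) g) sums inner f (endo_app (E n t) g)"
      by (simp add: endo.scaleR_left pow)
  qed
  then show ?thesis
    using tendsto_inner[OF E_tendsto[OF t, of f] tendsto_const, of g]
      tendsto_inner[OF tendsto_const E_tendsto[OF t, of g], of f] LIMSEQ_unique by simp
qed

end

section \<open>Forms given by a closable gradient\<close>

lemma L2D: "f \<in> L2 M \<Longrightarrow> f \<in> borel_measurable M" "f \<in> L2 M \<Longrightarrow> integrable M (\<lambda>x. (f x)\<^sup>2)"
  by (auto simp: L2_def)

lemma integrable_L2_mult:
  assumes "f \<in> L2 M" "g \<in> L2 M"
  shows "integrable M (\<lambda>x. f x * g x)"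
proof (rule Bochner_Integration.integrable_bound)
  show "integrable M (\<lambda>x. (f x)\<^sup>2 + (g x)\<^sup>2)" using assms by (auto intro: L2D)
  show "(\<lambda>x. f x * g x) \<in> borel_measurable M" using assms[THEN L2D(1)] by measurable
  have "\<bar>a * b\<bar> \<le> a\<^sup>2 + b\<^sup>2" for a b :: real
    using sum_squares_bound[of "\<bar>a\<bar>" "\<bar>b\<bar>"] zero_le_power2[of a] zero_le_power2[of b]
    unfolding abs_mult power2_abs by linarith
  then show "AE x in M. norm (f x * g x) \<le> norm ((f x)\<^sup>2 + (g x)\<^sup>2)" by simp
qed

lemma L2_0: "(\<lambda>_. 0) \<in> L2 M" by (simp add: L2_def)

lemma L2_add: "f \<in> L2 M \<Longrightarrow> g \<in> L2 M \<Longrightarrow> (\<lambda>x. f x + g x) \<in> L2 M"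
  using integrable_L2_mult[of f M g] by (auto simp: L2_def power2_sum mult.assoc)

lemma L2_scale: "f \<in> L2 M \<Longrightarrow> (\<lambda>x. c * f x) \<in> L2 M"
  by (auto simp: L2_def power_mult_distrib)

lemma L2_diff: "f \<in> L2 M \<Longrightarrow> g \<in> L2 M \<Longrightarrow> (\<lambda>x. f x - g x) \<in> L2 M"
  using L2_add[OF _ L2_scale[of g M "-1"]] by auto

lemma L2_bound:
  assumes "g \<in> L2 M" "f \<in> borel_measurable M" "AE x in M. \<bar>f x\<bar> \<le> \<bar>g x\<bar>"
  shows "f \<in> L2 M"
proof -
  have "integrable M (\<lambda>x. (f x)\<^sup>2)"
    by (rule Bochner_Integration.integrable_bound[OF L2D(2)[OF assms(1)]])
      (use assms in \<open>auto simp: abs_le_square_iff\<close>)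
  then show ?thesis using assms by (simp add: L2_def)
qed

lemma L2_cong_AE: "f \<in> L2 M \<Longrightarrow> g \<in> borel_measurable M \<Longrightarrow> (AE x in M. f x = g x) \<Longrightarrow> g \<in> L2 M"
  by (rule L2_bound[of f]) auto

lemma (in finite_measure) integrable_L2: "f \<in> L2 M \<Longrightarrow> integrable M f"
  using integrable_L2_mult[of f M "\<lambda>_. 1"] by (auto simp: L2_def)

lemma (in finite_measure) L2_bounded:
  assumes "f \<in> borel_measurable M" "\<And>x. x \<in> space M \<Longrightarrow> \<bar>f x\<bar> \<le> B" shows "f \<in> L2 M"
  by (rule L2_bound[where g="\<lambda>_. B"]) (use assms in \<open>auto simp: L2_def intro!: AE_I2 order_trans[OF _ abs_ge_self]\<close>)

text \<open>The interface between functions and a Hilbert space type: \<open>\<Phi>\<close> sends a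
  function to its class, and \<open>\<Psi>\<close> chooses a representative. Results about the
  closed graph are transported back to functions through this pair.\<close>

locale L2_space =
  fixes M :: "'a measure" and \<Phi> :: "('a \<Rightarrow> real) \<Rightarrow> 'h::{real_inner,banach,perfect_space}" and \<Psi> :: "'h \<Rightarrow> 'a \<Rightarrow> real"
  assumes \<Phi>_add: "f \<in> L2 M \<Longrightarrow> g \<in> L2 M \<Longrightarrow> \<Phi> (\<lambda>x. f x + g x) = \<Phi> f + \<Phi> g"
    and \<Phi>_scale: "f \<in> L2 M \<Longrightarrow> \<Phi> (\<lambda>x. c * f x) = c *\<^sub>R \<Phi> f"
    and \<Phi>_inner: "f \<in> L2 M \<Longrightarrow> g \<in> L2 M \<Longrightarrow> inner (\<Phi> f) (\<Phi> g) = L2_inner M f g"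
    and \<Psi>_L2: "\<Psi> h \<in> L2 M"
    and \<Phi>_\<Psi>: "\<Phi> (\<Psi> h) = h"
begin

lemma \<Phi>_diff: "f \<in> L2 M \<Longrightarrow> g \<in> L2 M \<Longrightarrow> \<Phi> (\<lambda>x. f x - g x) = \<Phi> f - \<Phi> g"
  using \<Phi>_add[OF _ L2_scale[of g M "-1"], of f] \<Phi>_scale[of g "-1"] by simp

lemma \<Phi>_0: "\<Phi> (\<lambda>_. 0) = 0"
  using \<Phi>_scale[OF L2_0, of 0] by simp

lemma norm_\<Phi>: "f \<in> L2 M \<Longrightarrow> norm (\<Phi> f) = L2_norm M f"
  by (simp add: L2_norm_def \<Phi>_inner[symmetric] norm_eq_sqrt_inner)

lemma \<Phi>_eq_0_iff: assumes "f \<in> L2 M" shows "\<Phi> f = 0 \<longleftrightarrow> (AE x in M. f x = 0)"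
proof -
  have "\<Phi> f = 0 \<longleftrightarrow> (\<integral>x. (f x)\<^sup>2 \<partial>M) = 0"
    using \<Phi>_inner[OF assms assms] inner_eq_zero_iff[of "\<Phi> f"] by (simp add: L2_inner_def power2_eq_square)
  also have "\<dots> \<longleftrightarrow> (AE x in M. (f x)\<^sup>2 = 0)"
    by (rule integral_nonneg_eq_0_iff_AE) (auto intro: L2D assms)
  finally show ?thesis by simp
qed

lemma \<Phi>_eq_iff: "f \<in> L2 M \<Longrightarrow> g \<in> L2 M \<Longrightarrow> \<Phi> f = \<Phi> g \<longleftrightarrow> (AE x in M. f x = g x)"
  using \<Phi>_eq_0_iff[of "\<lambda>x. f x - g x"] by (simp add: \<Phi>_diff L2_diff)

lemma \<Psi>_\<Phi>: "f \<in> L2 M \<Longrightarrow> AE x in M. \<Psi> (\<Phi> f) x = f x"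
  using \<Phi>_eq_iff[OF \<Psi>_L2, of f "\<Phi> f"] by (simp add: \<Phi>_\<Psi>)

end

text \<open>A form that factors through an operator \<open>G\<close> into a second Hilbert space.
  Closability is stated for \<open>G\<close>: the closure of its graph is again a graph.\<close>

locale grad_form = L2_space M \<Phi> \<Psi>
  for M :: "'a measure" and \<Phi> :: "('a \<Rightarrow> real) \<Rightarrow> 'h::{real_inner,banach,perfect_space}" and \<Psi> :: "'h \<Rightarrow> 'a \<Rightarrow> real" +
  fixes D :: "('a \<Rightarrow> real) set" and F :: "('a \<Rightarrow> real) \<Rightarrow> ('a \<Rightarrow> real) \<Rightarrow> real"
    and G :: "('a \<Rightarrow> real) \<Rightarrow> 'k::{real_inner,banach}"
  assumes D_L2: "D \<subseteq> L2 M" and D_0: "(\<lambda>_. 0) \<in> D"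
    and D_add: "f \<in> D \<Longrightarrow> g \<in> D \<Longrightarrow> (\<lambda>x. f x + g x) \<in> D" and D_scale: "f \<in> D \<Longrightarrow> (\<lambda>x. c * f x) \<in> D"
    and G_add: "f \<in> D \<Longrightarrow> g \<in> D \<Longrightarrow> G (\<lambda>x. f x + g x) = G f + G g"
    and G_scale: "f \<in> D \<Longrightarrow> G (\<lambda>x. c * f x) = c *\<^sub>R G f"
    and F_eq: "f \<in> D \<Longrightarrow> g \<in> D \<Longrightarrow> F f g = inner (G f) (G g)"
    and closable: "(0, w) \<in> closure ((\<lambda>f. (\<Phi> f, G f)) ` D) \<Longrightarrow> w = 0"
    and dense: "closure (\<Phi> ` D) = UNIV"
begin

definition \<Gamma> :: "('h \<times> 'k) set" where "\<Gamma> = closure ((\<lambda>f. (\<Phi> f, G f)) ` D)"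

lemma D_L2': "f \<in> D \<Longrightarrow> f \<in> L2 M" using D_L2 by blast

lemma D_diff: "f \<in> D \<Longrightarrow> g \<in> D \<Longrightarrow> (\<lambda>x. f x - g x) \<in> D"
  using D_add[OF _ D_scale[of g "-1"], of f] by simp

lemma G_diff: "f \<in> D \<Longrightarrow> g \<in> D \<Longrightarrow> G (\<lambda>x. f x - g x) = G f - G g"
  using G_add[OF _ D_scale[of g "-1"], of f] G_scale[of g "-1"] by simp

lemma in_\<Gamma>: "f \<in> D \<Longrightarrow> (\<Phi> f, G f) \<in> \<Gamma>"
  unfolding \<Gamma>_def using closure_subset by fastforce

sublocale closed_graph \<Gamma>
proof
  show "closed \<Gamma>" by (simp add: \<Gamma>_def)
  have "subspace ((\<lambda>f. (\<Phi> f, G f)) ` D)"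
  proof (rule subspaceI)
    show "0 \<in> (\<lambda>f. (\<Phi> f, G f)) ` D"
    proof (rule image_eqI[OF _ D_0])
      show "0 = (\<Phi> (\<lambda>_. 0), G (\<lambda>_. 0))"
        using \<Phi>_0 G_scale[OF D_0, of 0] by (intro prod_eqI) auto
    qed
  next
    fix x y assume "x \<in> (\<lambda>f. (\<Phi> f, G f)) ` D" "y \<in> (\<lambda>f. (\<Phi> f, G f)) ` D"
    then obtain f g where "f \<in> D" "g \<in> D" "x = (\<Phi> f, G f)" "y = (\<Phi> g, G g)" by auto
    then show "x + y \<in> (\<lambda>f. (\<Phi> f, G f)) ` D"
      by (intro image_eqI[of _ _ "\<lambda>x. f x + g x"]) (auto simp: \<Phi>_add G_add D_add D_L2')
  next
    fix c x assume "x \<in> (\<lambda>f. (\<Phi> f, G f)) ` D"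
    then obtain f where "f \<in> D" "x = (\<Phi> f, G f)" by auto
    then show "c *\<^sub>R x \<in> (\<lambda>f. (\<Phi> f, G f)) ` D"
      by (intro image_eqI[of _ _ "\<lambda>x. c * f x"]) (auto simp: \<Phi>_scale G_scale D_scale D_L2')
  qed
  then show "subspace \<Gamma>" unfolding \<Gamma>_def by (rule subspace_closure)
  show "w = 0" if "(0, w) \<in> \<Gamma>" for w using closable that by (simp add: \<Gamma>_def)
  have "\<Phi> ` D \<subseteq> fst ` \<Gamma>" using in_\<Gamma> by force
  then show "closure (fst ` \<Gamma>) = UNIV" using dense closure_mono by blast
qed

lemma \<Gamma>_unique: assumes "(u, w) \<in> \<Gamma>" "(u, w') \<in> \<Gamma>" shows "w = w'"
  using single_\<Gamma>[of "w - w'"] subspace_diff[OF subspace_\<Gamma> assms] by simp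

lemma \<Gamma>_sequence:
  assumes "(u, w) \<in> \<Gamma>"
  obtains s where "\<And>k. s k \<in> D" "(\<lambda>k. \<Phi> (s k)) \<longlonglongrightarrow> u" "(\<lambda>k. G (s k)) \<longlonglongrightarrow> w"
proof -
  obtain x where x: "\<And>k. x k \<in> (\<lambda>f. (\<Phi> f, G f)) ` D" "x \<longlonglongrightarrow> (u, w)"
    using assms unfolding \<Gamma>_def closure_sequential by blast
  then have "\<forall>k. \<exists>f\<in>D. x k = (\<Phi> f, G f)" by blast
  then obtain s where s: "\<And>k. s k \<in> D" "\<And>k. x k = (\<Phi> (s k), G (s k))" by metis
  from tendsto_fst[OF x(2)] tendsto_snd[OF x(2)] show ?thesis using that[OF s(1)] by (simp add: s(2))
qed

lemma in_\<Gamma>_limit: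
  assumes "\<And>k. s k \<in> D" "(\<lambda>k. \<Phi> (s k)) \<longlonglongrightarrow> u" "(\<lambda>k. G (s k)) \<longlonglongrightarrow> w"
  shows "(u, w) \<in> \<Gamma>"
  using closed_sequentially[OF closed_\<Gamma> in_\<Gamma>[OF assms(1)] tendsto_Pair[OF assms(2,3)]] .

lemma F_diff: "f \<in> D \<Longrightarrow> g \<in> D \<Longrightarrow> F (\<lambda>x. f x - g x) (\<lambda>x. f x - g x) = (norm (G f - G g))\<^sup>2"
  by (simp add: F_eq D_diff G_diff power2_norm_eq_inner)

section \<open>Approximating sequences and the closure of the form\<close>

lemma form_Cauchy_iff:
  assumes "\<And>k. s k \<in> D" shows "form_Cauchy F s \<longleftrightarrow> Cauchy (\<lambda>k. G (s k))"
proof -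
  have F: "F (\<lambda>x. s j x - s k x) (\<lambda>x. s j x - s k x) = (dist (G (s j)) (G (s k)))\<^sup>2" for j k
    using assms by (simp add: F_diff dist_norm)
  show ?thesis
  proof
    assume *: "form_Cauchy F s"
    show "Cauchy (\<lambda>k. G (s k))"
    proof (rule metric_CauchyI)
      fix e :: real assume e: "e > 0"
      then obtain N where "\<forall>j\<ge>N. \<forall>k\<ge>N. (dist (G (s j)) (G (s k)))\<^sup>2 < e\<^sup>2"
        using * unfolding form_Cauchy_def F by (meson zero_less_power)
      then show "\<exists>N. \<forall>j\<ge>N. \<forall>k\<ge>N. dist (G (s j)) (G (s k)) < e"
        using e by (meson less_imp_le power2_less_imp_less)
    qed
  next
    assume *: "Cauchy (\<lambda>k. G (s k))"
    show "form_Cauchy F s" unfolding form_Cauchy_def F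
    proof (intro allI impI)
      fix e :: real assume e: "e > 0"
      then obtain N where N: "\<forall>j\<ge>N. \<forall>k\<ge>N. dist (G (s j)) (G (s k)) < sqrt e"
        using * unfolding Cauchy_def by (meson real_sqrt_gt_zero)
      have "(dist (G (s j)) (G (s k)))\<^sup>2 < e" if "j \<ge> N" "k \<ge> N" for j k
        using power_strict_mono[of "dist (G (s j)) (G (s k))" "sqrt e" 2] N that e by simp
      then show "\<exists>N. \<forall>j\<ge>N. \<forall>k\<ge>N. (dist (G (s j)) (G (s k)))\<^sup>2 < e" by blast
    qed
  qed
qed

lemma L2_norm_tendsto_iff:
  assumes "\<And>k. s k \<in> L2 M" "u \<in> L2 M"
  shows "(\<lambda>k. L2_norm M (\<lambda>x. s k x - u x)) \<longlonglongrightarrow> 0 \<longleftrightarrow> (\<lambda>k. \<Phi> (s k)) \<longlonglongrightarrow> \<Phi> u"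
  using assms by (simp add: norm_\<Phi>[symmetric] L2_diff \<Phi>_diff tendsto_norm_zero_iff LIM_zero_iff)

lemma approximates_iff:
  assumes "u \<in> L2 M"
  shows "approximates M D F s u \<longleftrightarrow> (\<forall>k. s k \<in> D) \<and> (\<lambda>k. \<Phi> (s k)) \<longlonglongrightarrow> \<Phi> u \<and> convergent (\<lambda>k. G (s k))"
proof (cases "\<forall>k. s k \<in> D")
  case True
  then show ?thesis unfolding approximates_def
    using form_Cauchy_iff[of s] L2_norm_tendsto_iff[of s u] D_L2' assms by (auto simp: Cauchy_convergent_iff)
qed (auto simp: approximates_def)

lemma approximates_limit:
  assumes "u \<in> L2 M" "(\<Phi> u, w) \<in> \<Gamma>" "approximates M D F s u"
  shows "(\<lambda>k. G (s k)) \<longlonglongrightarrow> w"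
  using assms approximates_iff[of u s] in_\<Gamma>_limit[of s "\<Phi> u"] \<Gamma>_unique convergent_def by metis

text \<open>Approximating sequences of the form are the sequences whose pairs
  \<open>(\<Phi> (s k), G (s k))\<close> converge in the product space, so the closure can be read
  off \<open>\<Gamma>\<close>.\<close>

lemma closure_domain_iff: "u \<in> closure_domain M D F \<longleftrightarrow> u \<in> L2 M \<and> (\<exists>w. (\<Phi> u, w) \<in> \<Gamma>)"
proof
  assume "u \<in> closure_domain M D F"
  then obtain s where u: "u \<in> L2 M" and s: "approximates M D F s u" by (auto simp: closure_domain_def)
  then obtain w where "(\<lambda>k. G (s k)) \<longlonglongrightarrow> w" using approximates_iff[OF u] convergent_def by blast
  then show "u \<in> L2 M \<and> (\<exists>w. (\<Phi> u, w) \<in> \<Gamma>)" using in_\<Gamma>_limit[of s] s u approximates_iff[OF u] by blast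
next
  assume u: "u \<in> L2 M \<and> (\<exists>w. (\<Phi> u, w) \<in> \<Gamma>)"
  then obtain w s where "\<And>k. s k \<in> D" "(\<lambda>k. \<Phi> (s k)) \<longlonglongrightarrow> \<Phi> u" "(\<lambda>k. G (s k)) \<longlonglongrightarrow> w" using \<Gamma>_sequence by metis
  then have "approximates M D F s u" using u by (auto simp: approximates_iff convergent_def)
  then show "u \<in> closure_domain M D F" using u by (auto simp: closure_domain_def)
qed

lemma closure_domainE:
  assumes "u \<in> closure_domain M D F"
  obtains w where "u \<in> L2 M" "(\<Phi> u, w) \<in> \<Gamma>"
  using assms by (auto simp: closure_domain_iff)

lemma closure_domainI: "u \<in> L2 M \<Longrightarrow> (\<Phi> u, w) \<in> \<Gamma> \<Longrightarrow> u \<in> closure_domain M D F"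
  by (auto simp: closure_domain_iff)

lemma closure_form_eq:
  assumes u: "u \<in> L2 M" "(\<Phi> u, w) \<in> \<Gamma>" and v: "v \<in> L2 M" "(\<Phi> v, z) \<in> \<Gamma>"
  shows "closure_form M D F u v = inner w z"
  unfolding closure_form_def
proof (rule the_equality)
  have *: "(\<lambda>k. F (s k) (t k)) \<longlonglongrightarrow> inner w z"
    if st: "approximates M D F s u" "approximates M D F t v" for s t
  proof -
    have "F (s k) (t k) = inner (G (s k)) (G (t k))" for k
      using st by (simp add: F_eq approximates_def)
    then show ?thesis
      using tendsto_inner[OF approximates_limit[OF u st(1)] approximates_limit[OF v st(2)]] by simp
  qed
  then show "\<forall>s t. approximates M D F s u \<and> approximates M D F t v \<longrightarrow> (\<lambda>k. F (s k) (t k)) \<longlonglongrightarrow> inner w z"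
    by blast
  \<comment> \<open>Approximating sequences exist; otherwise the condition under \<open>THE\<close>
    would hold vacuously for every number.\<close>
  obtain s t where "approximates M D F s u" "approximates M D F t v"
    using closure_domainI[OF u] closure_domainI[OF v] by (auto simp: closure_domain_def)
  then show "c = inner w z"
    if "\<forall>s t. approximates M D F s u \<and> approximates M D F t v \<longrightarrow> (\<lambda>k. F (s k) (t k)) \<longlonglongrightarrow> c" for c
    using * that LIMSEQ_unique by blast
qed

lemma symmetric_form_F: "symmetric_form_on M D F"
  unfolding symmetric_form_on_def
proof (intro conjI ballI allI impI D_L2 D_0 D_add D_scale)
  fix f g assume f: "f \<in> D" and g: "g \<in> D" and "AE x in M. f x = 0"
  then have "\<Phi> f = 0" by (simp add: \<Phi>_eq_0_iff D_L2')
  then have "G f = 0" using in_\<Gamma>[OF f] single_\<Gamma> by simp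
  then show "F f g = 0" by (simp add: F_eq f g)
qed (simp_all add: F_eq D_add D_scale G_add G_scale inner_add_left inner_add_right inner_commute)

lemma positive_definite_F: "positive_definite_on D F"
  by (simp add: positive_definite_on_def F_eq)

lemma L2_dense_F: "L2_dense M D"
  unfolding L2_dense_def
proof (intro conjI D_L2 ballI allI impI)
  fix u and e :: real assume u: "u \<in> L2 M" and e: "e > 0"
  have "\<Phi> u \<in> closure (\<Phi> ` D)" using dense by simp
  then obtain f where "f \<in> D" "norm (\<Phi> f - \<Phi> u) < e"
    using e unfolding closure_approachable dist_norm by blast
  then show "\<exists>f\<in>D. L2_norm M (\<lambda>x. u x - f x) < e"
    using u by (intro bexI[of _ f]) (simp_all add: norm_\<Phi>[symmetric] \<Phi>_diff L2_diff D_L2' norm_minus_commute)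
qed

lemma closable_F: "closable_on M D F"
  unfolding closable_on_def
proof (intro allI impI)
  fix s assume s: "(\<forall>k. s k \<in> D) \<and> form_Cauchy F s \<and> (\<lambda>k. L2_norm M (s k)) \<longlonglongrightarrow> 0"
  then have "approximates M D F s (\<lambda>_. 0)" by (simp add: approximates_def)
  then have "(\<lambda>k. G (s k)) \<longlonglongrightarrow> 0"
    using approximates_limit[OF L2_0, of 0 s] subspace_0[OF subspace_\<Gamma>] by (simp add: \<Phi>_0 zero_prod_def)
  from tendsto_inner[OF this this] show "(\<lambda>k. F (s k) (s k)) \<longlonglongrightarrow> 0" using s by (simp add: F_eq)
qed

lemma symmetric_form_closure: "symmetric_form_on M (closure_domain M D F) (closure_form M D F)"
  (is "symmetric_form_on M ?D ?F")
proof -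
  have 0: "(\<lambda>_. 0) \<in> ?D"
    using closure_domainI[OF D_L2'[OF D_0] in_\<Gamma>[OF D_0]] .
  have add: "(\<lambda>x. f x + g x) \<in> L2 M \<and> (\<Phi> (\<lambda>x. f x + g x), w + z) \<in> \<Gamma>"
    if "f \<in> L2 M" "(\<Phi> f, w) \<in> \<Gamma>" "g \<in> L2 M" "(\<Phi> g, z) \<in> \<Gamma>" for f g w z
    using subspace_add[OF subspace_\<Gamma> that(2,4)] that by (simp add: \<Phi>_add L2_add)
  have scale: "(\<lambda>x. c * f x) \<in> L2 M \<and> (\<Phi> (\<lambda>x. c * f x), c *\<^sub>R w) \<in> \<Gamma>"
    if "f \<in> L2 M" "(\<Phi> f, w) \<in> \<Gamma>" for f w c
    using subspace_scale[OF subspace_\<Gamma> that(2), of c] that by (simp add: \<Phi>_scale L2_scale)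
  show ?thesis unfolding symmetric_form_on_def
  proof (intro conjI ballI allI impI 0)
    show "?D \<subseteq> L2 M" by (auto simp: closure_domain_def)
  next
    fix f g assume "f \<in> ?D" "g \<in> ?D"
    then obtain w z where fg: "f \<in> L2 M" "(\<Phi> f, w) \<in> \<Gamma>" "g \<in> L2 M" "(\<Phi> g, z) \<in> \<Gamma>" by (metis closure_domainE)
    show "(\<lambda>x. f x + g x) \<in> ?D" using add[OF fg] closure_domainI by blast
    show "?F f g = ?F g f" using fg by (simp add: closure_form_eq inner_commute)
    show "?F f g = 0" if "AE x in M. f x = 0"
      using fg closure_form_eq[OF fg] that single_\<Gamma>[of w] by (auto simp: \<Phi>_eq_0_iff[symmetric])
    show "?F (\<lambda>x. f x + g x) h = ?F f h + ?F g h" if hD: "h \<in> ?D" for h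
    proof -
      obtain y where h: "h \<in> L2 M" "(\<Phi> h, y) \<in> \<Gamma>" using hD by (metis closure_domainE)
      show ?thesis
        using closure_form_eq[OF conjunct1[OF add[OF fg]] conjunct2[OF add[OF fg]] h]
          closure_form_eq[OF fg(1,2) h] closure_form_eq[OF fg(3,4) h] by (simp add: inner_add_left)
    qed
  next
    fix f c assume "f \<in> ?D"
    then obtain w where f: "f \<in> L2 M" "(\<Phi> f, w) \<in> \<Gamma>" by (metis closure_domainE)
    show "(\<lambda>x. c * f x) \<in> ?D" using scale[OF f] closure_domainI by blast
    fix h assume "h \<in> ?D"
    then obtain y where h: "h \<in> L2 M" "(\<Phi> h, y) \<in> \<Gamma>" by (metis closure_domainE)
    show "?F (\<lambda>x. c * f x) h = c * ?F f h"
      using closure_form_eq[OF conjunct1[OF scale[OF f]] conjunct2[OF scale[OF f]] h]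
        closure_form_eq[OF f h] by simp
  qed
qed

text \<open>The norm of the form is the graph norm. Closedness and the density of the core thereby
  become statements about points of \<open>\<Gamma>\<close>.\<close>

lemma form_one_closure:
  assumes "u \<in> L2 M" "(\<Phi> u, w) \<in> \<Gamma>" "v \<in> L2 M" "(\<Phi> v, z) \<in> \<Gamma>"
  shows "form_one M (closure_form M D F) (\<lambda>x. u x - v x) (\<lambda>x. u x - v x) = (norm ((\<Phi> u, w) - (\<Phi> v, z)))\<^sup>2"
proof -
  have "(\<lambda>x. u x - v x) \<in> L2 M" "(\<Phi> (\<lambda>x. u x - v x), w - z) \<in> \<Gamma>"
    using assms subspace_diff[OF subspace_\<Gamma> assms(2,4)] by (auto simp: L2_diff \<Phi>_diff)
  then show ?thesis using assms
    by (simp add: form_one_def closure_form_eq \<Phi>_inner[symmetric] \<Phi>_diff power2_norm_eq_inner)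
qed

lemma closed_form_closure: "closed_form M (closure_domain M D F) (closure_form M D F)"
  unfolding closed_form_def
proof (intro allI impI)
  fix s assume s: "(\<forall>k. s k \<in> closure_domain M D F) \<and> form_Cauchy (form_one M (closure_form M D F)) s"
  then have "\<forall>k. \<exists>w. s k \<in> L2 M \<and> (\<Phi> (s k), w) \<in> \<Gamma>" by (simp add: closure_domain_iff)
  then obtain w where w: "\<And>k. s k \<in> L2 M" "\<And>k. (\<Phi> (s k), w k) \<in> \<Gamma>" by metis
  define p where "p k = (\<Phi> (s k), w k)" for k
  have eq: "form_one M (closure_form M D F) (\<lambda>x. s j x - s k x) (\<lambda>x. s j x - s k x) = (dist (p j) (p k))\<^sup>2" for j k
    using form_one_closure[OF w(1) w(2) w(1) w(2)] by (simp add: p_def dist_norm)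
  have "Cauchy p"
  proof (rule metric_CauchyI)
    fix e :: real assume e: "e > 0"
    then obtain N where "\<forall>j\<ge>N. \<forall>k\<ge>N. (dist (p j) (p k))\<^sup>2 < e\<^sup>2"
      using s unfolding form_Cauchy_def eq by (meson zero_less_power)
    then show "\<exists>N. \<forall>j\<ge>N. \<forall>k\<ge>N. dist (p j) (p k) < e"
      using e by (meson less_imp_le power2_less_imp_less)
  qed
  then obtain q where q: "p \<longlonglongrightarrow> q" using Cauchy_convergent convergent_def by blast
  have "q \<in> \<Gamma>" using closed_sequentially[OF closed_\<Gamma> _ q] w by (simp add: p_def)
  define u where "u = \<Psi> (fst q)"
  have u: "u \<in> L2 M" "(\<Phi> u, snd q) \<in> \<Gamma>" using \<open>q \<in> \<Gamma>\<close> by (auto simp: u_def \<Psi>_L2 \<Phi>_\<Psi>)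
  have "(\<Phi> u, snd q) = q" by (simp add: u_def \<Phi>_\<Psi>)
  then have "form_one M (closure_form M D F) (\<lambda>x. s k x - u x) (\<lambda>x. s k x - u x) = (norm (p k - q))\<^sup>2" for k
    using form_one_closure[OF w(1) w(2) u, of k] by (simp add: p_def)
  moreover have "(\<lambda>k. (norm (p k - q))\<^sup>2) \<longlonglongrightarrow> 0"
    using tendsto_power[OF tendsto_norm_zero[OF LIM_zero[OF q]], of 2] by simp
  ultimately show "\<exists>u\<in>closure_domain M D F. (\<lambda>k. form_one M (closure_form M D F) (\<lambda>x. s k x - u x) (\<lambda>x. s k x - u x)) \<longlonglongrightarrow> 0"
    using closure_domainI[OF u] by (intro bexI[of _ u]) (simp_all only:)
qed

lemma D_subset_closure: "D \<subseteq> closure_domain M D F"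
  using closure_domainI[OF D_L2' in_\<Gamma>] by blast

lemma L2_dense_closure: "L2_dense M (closure_domain M D F)"
  using L2_dense_F D_subset_closure symmetric_form_closure
  unfolding L2_dense_def symmetric_form_on_def by blast

text \<open>Everything except the unit contraction holds for any closable gradient. That property
  rests on a chain rule, which only the concrete gradient provides.\<close>

lemma symmetric_Dirichlet_formI:
  assumes "\<And>u w. u \<in> L2 M \<Longrightarrow> (\<Phi> u, w) \<in> \<Gamma> \<Longrightarrow>
    \<exists>z. (\<Phi> (\<lambda>x. min (max (u x) 0) 1), z) \<in> \<Gamma> \<and> norm z \<le> norm w"
  shows "symmetric_Dirichlet_form M (closure_domain M D F) (closure_form M D F)"
  unfolding symmetric_Dirichlet_form_def
proof (intro conjI ballI impI symmetric_form_closure L2_dense_closure closed_form_closure)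
  show "positive_definite_on (closure_domain M D F) (closure_form M D F)"
    unfolding positive_definite_on_def by (metis closure_domainE closure_form_eq inner_ge_zero)
next
  fix u v assume "u \<in> closure_domain M D F" "v \<in> L2 M" "AE x in M. u x = v x"
  then show "v \<in> closure_domain M D F" using \<Phi>_eq_iff[of u v] by (auto simp: closure_domain_iff)
next
  fix u :: "'a \<Rightarrow> real" let ?c = "\<lambda>x. min (max (u x) 0) 1"
  assume "u \<in> closure_domain M D F"
  then obtain w where u: "u \<in> L2 M" "(\<Phi> u, w) \<in> \<Gamma>" by (metis closure_domainE)
  obtain z where z: "(\<Phi> ?c, z) \<in> \<Gamma>" "norm z \<le> norm w" using assms[OF u] by blast
  have c: "?c \<in> L2 M" using L2D(1)[OF u(1)] by (intro L2_bound[OF u(1)]) auto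
  show "?c \<in> closure_domain M D F" using closure_domainI[OF c z(1)] .
  show "closure_form M D F ?c ?c \<le> closure_form M D F u u"
    using z(2) unfolding closure_form_eq[OF c z(1) c z(1)] closure_form_eq[OF u u] by (simp add: norm_le)
qed

section \<open>The semigroup on functions\<close>

definition SG :: "real \<Rightarrow> ('a \<Rightarrow> real) \<Rightarrow> 'a \<Rightarrow> real" where "SG t f = \<Psi> (T t (\<Phi> f))"

lemma \<Phi>_SG: "\<Phi> (SG t f) = T t (\<Phi> f)" and SG_L2: "SG t f \<in> L2 M"
  by (auto simp: SG_def \<Phi>_\<Psi> \<Psi>_L2)

lemma form_semigroup_closure: "form_semigroup M (closure_domain M D F) (closure_form M D F) SG"
  unfolding form_semigroup_def
proof (intro conjI allI ballI impI SG_L2)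
  fix t :: real and f assume "0 \<le> t" "f \<in> L2 M"
  then show "L2_norm M (SG t f) \<le> L2_norm M f"
    by (simp add: norm_\<Phi>[symmetric] SG_L2 \<Phi>_SG T_norm_le)
next
  fix t :: real and f g a b assume t: "0 \<le> t" and f: "f \<in> L2 M" "g \<in> L2 M"
  have "\<Phi> (SG t (\<lambda>y. a * f y + b * g y)) = \<Phi> (\<lambda>x. a * SG t f x + b * SG t g x)"
    using f by (simp add: \<Phi>_SG \<Phi>_add \<Phi>_scale L2_scale SG_L2 linear_add[OF T_linear[OF t]] linear_scale[OF T_linear[OF t]])
  then show "AE x in M. SG t (\<lambda>y. a * f y + b * g y) x = a * SG t f x + b * SG t g x"
    by (simp add: \<Phi>_eq_iff L2_add L2_scale SG_L2)
next
  fix f assume "f \<in> L2 M"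
  then show "AE x in M. SG 0 f x = f x" by (simp add: \<Phi>_eq_iff[symmetric] SG_L2 \<Phi>_SG T_zero)
next
  fix s t :: real and f assume "0 \<le> s" "0 \<le> t" "f \<in> L2 M"
  then show "AE x in M. SG (s + t) f x = SG s (SG t f) x"
    by (simp add: \<Phi>_eq_iff[symmetric] SG_L2 \<Phi>_SG T_add)
next
  fix f assume "f \<in> L2 M"
  then show "((\<lambda>t. L2_norm M (\<lambda>x. SG t f x - f x)) \<longlongrightarrow> 0) (at_right 0)"
    using tendsto_norm_zero[OF LIM_zero[OF T_tendsto_0[of "\<Phi> f"]]]
    by (simp add: norm_\<Phi>[symmetric] L2_diff SG_L2 \<Phi>_diff \<Phi>_SG)
next
  fix u w assume u: "u \<in> L2 M" and w: "w \<in> L2 M"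
  have q: "(\<lambda>x. (SG t u x - u x) / t) \<in> L2 M" for t
    using L2_scale[OF L2_diff[OF SG_L2 u], of "inverse t"] by (simp add: divide_inverse mult.commute)
  have \<Phi>q: "\<Phi> (\<lambda>x. (SG t u x - u x) / t) = (T t (\<Phi> u) - \<Phi> u) /\<^sub>R t" for t
    using \<Phi>_scale[OF L2_diff[OF SG_L2 u], of "inverse t" t] u
    by (simp add: divide_inverse mult.commute \<Phi>_diff SG_L2 \<Phi>_SG)
  have "L2_norm M (\<lambda>x. (SG t u x - u x) / t - w x) = norm ((T t (\<Phi> u) - \<Phi> u) /\<^sub>R t - \<Phi> w)" for t
    unfolding norm_\<Phi>[OF L2_diff[OF q w], symmetric] \<Phi>_diff[OF q w] \<Phi>q ..
  then have "((\<lambda>t. L2_norm M (\<lambda>x. (SG t u x - u x) / t - w x)) \<longlongrightarrow> 0) (at_right 0)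
      \<longleftrightarrow> ((\<lambda>t. (T t (\<Phi> u) - \<Phi> u) /\<^sub>R t) \<longlongrightarrow> \<Phi> w) (at_right 0)"
    by (simp add: tendsto_norm_zero_iff LIM_zero_iff)
  also have "\<dots> \<longleftrightarrow> gen (\<Phi> u) (\<Phi> w)" by (rule T_generator)
  also have "\<dots> \<longleftrightarrow> u \<in> closure_domain M D F \<and> (\<forall>v\<in>closure_domain M D F. closure_form M D F u v = - L2_inner M w v)"
  proof
    assume "gen (\<Phi> u) (\<Phi> w)"
    then obtain y where y: "(\<Phi> u, y) \<in> \<Gamma>" "\<And>v z. (v, z) \<in> \<Gamma> \<Longrightarrow> inner y z = - inner (\<Phi> w) v"
      unfolding gen_def by blast
    then show "u \<in> closure_domain M D F \<and> (\<forall>v\<in>closure_domain M D F. closure_form M D F u v = - L2_inner M w v)"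
      using u w closure_domainI[OF u y(1)]
      by (metis closure_domainE closure_form_eq \<Phi>_inner)
  next
    assume *: "u \<in> closure_domain M D F \<and> (\<forall>v\<in>closure_domain M D F. closure_form M D F u v = - L2_inner M w v)"
    then obtain y where y: "(\<Phi> u, y) \<in> \<Gamma>" by (metis closure_domainE)
    have "inner y z = - inner (\<Phi> w) v" if "(v, z) \<in> \<Gamma>" for v z
    proof -
      have v: "\<Psi> v \<in> L2 M" "(\<Phi> (\<Psi> v), z) \<in> \<Gamma>" using that by (auto simp: \<Psi>_L2 \<Phi>_\<Psi>)
      have "inner y z = closure_form M D F u (\<Psi> v)" by (simp add: closure_form_eq[OF u y v])
      also have "\<dots> = - L2_inner M w (\<Psi> v)" using * closure_domainI[OF v] by blast
      also have "\<dots> = - inner (\<Phi> w) v" by (simp add: \<Phi>_inner[symmetric] w \<Psi>_L2 \<Phi>_\<Psi>)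
      finally show ?thesis .
    qed
    then show "gen (\<Phi> u) (\<Phi> w)" using y unfolding gen_def by blast
  qed
  finally show "((\<lambda>t. L2_norm M (\<lambda>x. (SG t u x - u x) / t - w x)) \<longlongrightarrow> 0) (at_right 0) \<longleftrightarrow>
    u \<in> closure_domain M D F \<and> (\<forall>v\<in>closure_domain M D F. closure_form M D F u v = - L2_inner M w v)" .
qed

end

section \<open>Recurrence of conservative symmetric semigroups\<close>

text \<open>The supremum is taken in \<open>ennreal\<close>, where it always exists, and the bound
  on the integrals makes it finite almost everywhere. It will identify both the extension of the
  semigroup to L1 and its integral over time.\<close>

lemma integrable_monotone_limit:
  fixes u :: "nat \<Rightarrow> 'a \<Rightarrow> real"
  assumes int: "\<And>k. integrable M (u k)" and nonneg: "\<And>k. AE x in M. 0 \<le> u k x"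
    and mono: "\<And>k. AE x in M. u k x \<le> u (Suc k) x" and bound: "\<And>k. (\<integral>x. u k x \<partial>M) \<le> B"
  obtains h where "integrable M h" "AE x in M. incseq (\<lambda>k. u k x) \<and> (\<lambda>k. u k x) \<longlonglongrightarrow> h x"
    "(\<lambda>k. \<integral>x. \<bar>u k x - h x\<bar> \<partial>M) \<longlonglongrightarrow> 0"
proof -
  define U where "U x = (SUP k. ennreal (u k x))" for x
  have meas [measurable]: "\<And>k. u k \<in> borel_measurable M" using int by simp
  have "AE x in M. ennreal (u k x) \<le> ennreal (u (Suc k) x)" for k
    using mono[of k] by eventually_elim (rule ennreal_leI)
  then have "(\<integral>\<^sup>+x. U x \<partial>M) = (SUP k. \<integral>\<^sup>+x. ennreal (u k x) \<partial>M)"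
    unfolding U_def by (intro nn_integral_monotone_convergence_SUP_AE) simp_all
  also have "\<dots> \<le> ennreal B"
  proof (rule SUP_least)
    fix k
    have "(\<integral>\<^sup>+x. ennreal (u k x) \<partial>M) = ennreal (\<integral>x. u k x \<partial>M)"
      by (rule nn_integral_eq_integral[OF int nonneg])
    then show "(\<integral>\<^sup>+x. ennreal (u k x) \<partial>M) \<le> ennreal B" using bound[of k] by (simp add: ennreal_leI)
  qed
  finally have fin: "(\<integral>\<^sup>+x. U x \<partial>M) \<noteq> \<infinity>" by (auto simp: top_unique)
  have U_meas [measurable]: "U \<in> borel_measurable M" unfolding U_def by measurable
  have AE_fin: "AE x in M. U x \<noteq> \<infinity>" by (rule nn_integral_noteq_infinite[OF U_meas fin])
  define h where "h x = enn2real (U x)" for x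
  have "AE x in M. \<forall>k. 0 \<le> u k x \<and> u k x \<le> u (Suc k) x" using nonneg mono by (simp add: AE_all_countable)
  then have AE: "AE x in M. incseq (\<lambda>k. u k x) \<and> (\<lambda>k. u k x) \<longlonglongrightarrow> h x \<and> (\<forall>k. 0 \<le> u k x \<and> u k x \<le> h x)"
    using AE_fin
  proof eventually_elim
    case (elim x)
    have inc: "incseq (\<lambda>k. u k x)" using elim(1) by (intro incseq_SucI) auto
    then have "incseq (\<lambda>k. ennreal (u k x))" by (auto simp: incseq_def intro: ennreal_leI)
    then have "(\<lambda>k. ennreal (u k x)) \<longlonglongrightarrow> U x" unfolding U_def by (rule LIMSEQ_SUP)
    moreover have "U x = ennreal (h x)" using elim(2) by (simp add: h_def less_top[symmetric])
    ultimately have "(\<lambda>k. ennreal (u k x)) \<longlonglongrightarrow> ennreal (h x)" by (simp only:)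
    then have lim: "(\<lambda>k. u k x) \<longlonglongrightarrow> h x"
      using elim(1) by (subst (asm) tendsto_ennreal_iff) (auto simp: h_def)
    show ?case using inc elim(1) lim incseq_le[OF inc lim] by blast
  qed
  have h_int: "integrable M h"
  proof (rule integrableI_nonneg)
    show "h \<in> borel_measurable M" unfolding h_def by measurable
    show "AE x in M. 0 \<le> h x" by (simp add: h_def)
    have "(\<integral>\<^sup>+x. ennreal (h x) \<partial>M) \<le> (\<integral>\<^sup>+x. U x \<partial>M)"
      by (intro nn_integral_mono) (simp add: h_def ennreal_enn2real_if)
    then show "(\<integral>\<^sup>+x. ennreal (h x) \<partial>M) < \<infinity>" using fin by (auto simp: less_top[symmetric] top_unique)
  qed
  have "(\<lambda>k. \<integral>x. \<bar>u k x - h x\<bar> \<partial>M) \<longlonglongrightarrow> (\<integral>x. 0 \<partial>M)"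
  proof (rule integral_dominated_convergence[where w=h])
    show "AE x in M. (\<lambda>k. \<bar>u k x - h x\<bar>) \<longlonglongrightarrow> 0"
      using AE by eventually_elim (metis tendsto_rabs_zero LIM_zero)
    show "AE x in M. norm \<bar>u k x - h x\<bar> \<le> h x" for k
      using AE
    proof eventually_elim
      case (elim x)
      then have "0 \<le> u k x" "u k x \<le> h x" by auto
      then show ?case by (simp add: abs_if)
    qed
    show "(\<lambda>x. \<bar>u k x - h x\<bar>) \<in> borel_measurable M" for k using h_int by simp
  qed (use h_int in auto)
  then show ?thesis using that[OF h_int] AE by auto
qed

lemma set_integral_indicator: "set_lebesgue_integral M A f = (\<integral>x. indicator A x * f x \<partial>M)" for f :: "_ \<Rightarrow> real"
  by (simp add: set_lebesgue_integral_def)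

lemma set_integral_diff_le:
  fixes f g :: "'a \<Rightarrow> real"
  assumes "integrable M f" "integrable M g" "A \<in> sets M"
  shows "\<bar>set_lebesgue_integral M A f - set_lebesgue_integral M A g\<bar> \<le> (\<integral>x. \<bar>f x - g x\<bar> \<partial>M)"
proof -
  have "set_lebesgue_integral M A f - set_lebesgue_integral M A g = (\<integral>x. indicator A x * (f x - g x) \<partial>M)"
    using integrable_mult_indicator[OF assms(3) assms(1)] integrable_mult_indicator[OF assms(3) assms(2)]
    by (simp add: set_integral_indicator right_diff_distrib)
  also have "\<bar>\<dots>\<bar> \<le> (\<integral>x. \<bar>indicator A x * (f x - g x)\<bar> \<partial>M)" by (rule integral_abs_bound)
  also have "\<dots> \<le> (\<integral>x. \<bar>f x - g x\<bar> \<partial>M)"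
  proof (rule integral_mono)
    show "integrable M (\<lambda>x. \<bar>indicator A x * (f x - g x)\<bar>)"
      using integrable_mult_indicator[OF assms(3) Bochner_Integration.integrable_diff[OF assms(1,2)]]
      by (intro integrable_abs) simp
    show "\<bar>indicator A x * (f x - g x)\<bar> \<le> \<bar>f x - g x\<bar>" for x by (simp add: indicator_def)
  qed (use assms in auto)
  finally show ?thesis .
qed

lemma set_integral_L1_limit:
  fixes f :: "nat \<Rightarrow> 'a \<Rightarrow> real"
  assumes "\<And>k. integrable M (f k)" "integrable M g" "A \<in> sets M"
    and lim: "(\<lambda>k. \<integral>x. \<bar>f k x - g x\<bar> \<partial>M) \<longlonglongrightarrow> 0"
  shows "(\<lambda>k. set_lebesgue_integral M A (f k)) \<longlonglongrightarrow> set_lebesgue_integral M A g"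
  by (rule LIM_zero_cancel, rule Lim_null_comparison[OF _ lim])
    (use set_integral_diff_le[OF assms(1,2,3)] in auto)

section \<open>Square integrable functions for a finite measure\<close>

locale finite_L2_space = L2_space M \<Phi> \<Psi> + finite_measure M
  for M :: "'a measure" and \<Phi> :: "('a \<Rightarrow> real) \<Rightarrow> 'h::{real_inner,banach,perfect_space}" and \<Psi> :: "'h \<Rightarrow> 'a \<Rightarrow> real"
begin

lemma L2_const: "(\<lambda>_. c) \<in> L2 M" by (rule L2_bounded[of _ "\<bar>c\<bar>"]) auto

lemma L2_indicator: "A \<in> sets M \<Longrightarrow> indicator A \<in> L2 M"
  by (rule L2_bounded[of _ 1]) (auto simp: indicator_def)

lemma set_integral_eq: "f \<in> L2 M \<Longrightarrow> A \<in> sets M \<Longrightarrow> set_lebesgue_integral M A f = inner (\<Phi> f) (\<Phi> (indicator A))"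
  by (simp add: \<Phi>_inner L2_indicator L2_inner_def set_integral_indicator mult.commute)

lemma integral_eq: "f \<in> L2 M \<Longrightarrow> integral\<^sup>L M f = inner (\<Phi> f) (\<Phi> (\<lambda>_. 1))"
  by (simp add: \<Phi>_inner L2_const L2_inner_def)

text \<open>Expresses an inequality between functions by linear inequalities in the Hilbert space, a
  form that can be integrated over time and that describes a closed cone.\<close>

lemma AE_le_iff:
  assumes "f \<in> L2 M" "g \<in> L2 M"
  shows "(AE x in M. f x \<le> g x) \<longleftrightarrow> (\<forall>A\<in>sets M. inner (\<Phi> f) (\<Phi> (indicator A)) \<le> inner (\<Phi> g) (\<Phi> (indicator A)))"
proof
  assume "\<forall>A\<in>sets M. inner (\<Phi> f) (\<Phi> (indicator A)) \<le> inner (\<Phi> g) (\<Phi> (indicator A))"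
  then have "AE x in M. 0 \<le> g x - f x"
    using assms by (intro density_nonneg integrable_L2 L2_diff)
      (simp_all add: set_integral_eq[OF L2_diff[OF assms(2,1)]] \<Phi>_diff inner_diff_left)
  then show "AE x in M. f x \<le> g x" by simp
next
  assume *: "AE x in M. f x \<le> g x"
  show "\<forall>A\<in>sets M. inner (\<Phi> f) (\<Phi> (indicator A)) \<le> inner (\<Phi> g) (\<Phi> (indicator A))"
  proof
    fix A assume A: "A \<in> sets M"
    have "(\<integral>x. indicator A x * f x \<partial>M) \<le> (\<integral>x. indicator A x * g x \<partial>M)"
      using assms * A by (intro integral_mono_AE integrable_L2_mult L2_indicator)
        (auto elim!: eventually_mono simp: indicator_def)
    then show "inner (\<Phi> f) (\<Phi> (indicator A)) \<le> inner (\<Phi> g) (\<Phi> (indicator A))"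
      using assms A by (simp add: set_integral_eq[symmetric] set_integral_indicator)
  qed
qed

lemma norm_\<Phi>_diff:
  assumes "a \<in> L2 M" "b \<in> L2 M"
  shows "(norm (\<Phi> a - \<Phi> b))\<^sup>2 = (\<integral>x. (a x - b x)\<^sup>2 \<partial>M)"
  using \<Phi>_inner[OF L2_diff[OF assms] L2_diff[OF assms]]
  unfolding power2_norm_eq_inner \<Phi>_diff[OF assms] L2_inner_def by (simp only: power2_eq_square)

lemma \<Phi>_tendsto_subseq:
  assumes a: "\<And>N. a N \<in> L2 M" "b \<in> L2 M" "(\<lambda>N. \<Phi> (a N)) \<longlonglongrightarrow> \<Phi> b"
  shows "\<exists>r::nat\<Rightarrow>nat. strict_mono r \<and> (AE x in M. (\<lambda>N. a (r N) x) \<longlonglongrightarrow> b x)"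
proof -
  have "(\<lambda>N. (\<integral>x. norm ((a N x - b x)\<^sup>2) \<partial>M)) \<longlonglongrightarrow> 0"
  proof -
    have "(\<integral>x. norm ((a N x - b x)\<^sup>2) \<partial>M) = (norm (\<Phi> (a N) - \<Phi> b))\<^sup>2" for N
      by (simp add: norm_\<Phi>_diff[OF a(1,2)])
    moreover have "(\<lambda>N. (norm (\<Phi> (a N) - \<Phi> b))\<^sup>2) \<longlonglongrightarrow> 0"
      using tendsto_power[OF tendsto_norm_zero[OF LIM_zero[OF a(3)]], of 2] by simp
    ultimately show ?thesis by simp
  qed
  then obtain r :: "nat \<Rightarrow> nat" where r: "strict_mono r" "AE x in M. (\<lambda>N. (a (r N) x - b x)\<^sup>2) \<longlonglongrightarrow> 0"
    using tendsto_L1_AE_subseq[of M "\<lambda>N x. (a N x - b x)\<^sup>2"] L2D(2)[OF L2_diff, OF a(1) a(2)] by blast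
  have "AE x in M. (\<lambda>N. a (r N) x) \<longlonglongrightarrow> b x" using r(2)
  proof eventually_elim
    case (elim x)
    then have "(\<lambda>N. a (r N) x - b x) \<longlonglongrightarrow> 0" using tendsto_real_sqrt[OF elim] by (simp add: tendsto_rabs_zero_iff)
    then show ?case by (rule LIM_zero_cancel)
  qed
  then show ?thesis using r(1) by blast
qed

lemma \<Phi>_tendsto:
  assumes a: "\<And>N. a N \<in> borel_measurable M" "b \<in> borel_measurable M" "AE x in M. (\<lambda>N. a N x) \<longlonglongrightarrow> b x"
    and c: "c \<in> L2 M" "\<And>N. AE x in M. \<bar>a N x\<bar> \<le> c x"
  shows "(\<lambda>N. \<Phi> (a N)) \<longlonglongrightarrow> \<Phi> b" "b \<in> L2 M"
proof -
  have ac: "AE x in M. \<forall>N. \<bar>a N x\<bar> \<le> c x" using c(2) by (simp add: AE_all_countable)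
  then have bc: "AE x in M. \<bar>b x\<bar> \<le> c x" using a(3)
  proof eventually_elim
    case (elim x)
    from tendsto_rabs[OF elim(2)] show ?case by (rule LIMSEQ_le_const2) (use elim(1) in auto)
  qed
  have aL2: "a N \<in> L2 M" for N
    using c(2)[of N] by (intro L2_bound[OF c(1) a(1)]) (auto elim: eventually_mono)
  show b: "b \<in> L2 M" using bc by (intro L2_bound[OF c(1) a(2)]) (auto elim: eventually_mono)
  have "(\<lambda>N. \<integral>x. (a N x - b x)\<^sup>2 \<partial>M) \<longlonglongrightarrow> (\<integral>x. 0 \<partial>M)"
  proof (rule integral_dominated_convergence[where w="\<lambda>x. (2 * c x)\<^sup>2"])
    show "(\<lambda>x. (a N x - b x)\<^sup>2) \<in> borel_measurable M" for N using a by measurable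
    show "integrable M (\<lambda>x. (2 * c x)\<^sup>2)" by (intro L2D(2) L2_scale c)
    show "AE x in M. (\<lambda>N. (a N x - b x)\<^sup>2) \<longlonglongrightarrow> 0"
      using a(3)
    proof eventually_elim
      case (elim x)
      show ?case using tendsto_power[OF LIM_zero[OF elim], of 2] by simp
    qed
    show "AE x in M. norm ((a N x - b x)\<^sup>2) \<le> (2 * c x)\<^sup>2" for N
      using ac bc
    proof eventually_elim
      case (elim x)
      have "\<bar>a N x - b x\<bar> \<le> 2 * c x" using elim(1)[rule_format, of N] elim(2) by linarith
      then have "\<bar>a N x - b x\<bar>\<^sup>2 \<le> (2 * c x)\<^sup>2" by (intro power_mono) auto
      then show ?case by simp
    qed
  qed simp
  then have "(\<lambda>N. (norm (\<Phi> (a N) - \<Phi> b))\<^sup>2) \<longlonglongrightarrow> 0"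
    by (simp add: norm_\<Phi>_diff[OF aL2 b])
  then have "(\<lambda>N. norm (\<Phi> (a N) - \<Phi> b)) \<longlonglongrightarrow> 0" using tendsto_real_sqrt by fastforce
  then show "(\<lambda>N. \<Phi> (a N)) \<longlonglongrightarrow> \<Phi> b" by (simp add: tendsto_norm_zero_iff LIM_zero_iff)
qed

end

text \<open>What recurrence is derived from. Symmetry together with \<open>T_one\<close> gives
  preservation of integrals, since the integral of f is the inner product of f with 1.\<close>

locale markov_semigroup = finite_L2_space M \<Phi> \<Psi>
  for M :: "'a measure" and \<Phi> :: "('a \<Rightarrow> real) \<Rightarrow> 'h::{real_inner,banach,perfect_space}" and \<Psi> :: "'h \<Rightarrow> 'a \<Rightarrow> real" +
  fixes T :: "real \<Rightarrow> 'h \<Rightarrow> 'h"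
  assumes T_linear: "0 \<le> t \<Longrightarrow> linear (T t)" and T_norm_le: "0 \<le> t \<Longrightarrow> norm (T t h) \<le> norm h"
    and T_add: "0 \<le> s \<Longrightarrow> 0 \<le> t \<Longrightarrow> T (s + t) h = T s (T t h)"
    and T_zero: "T 0 h = h"
    and T_tendsto_0: "((\<lambda>t. T t h) \<longlongrightarrow> h) (at_right 0)"
    and T_sym: "0 \<le> t \<Longrightarrow> inner (T t h) k = inner h (T t k)"
    and T_pos: "0 \<le> t \<Longrightarrow> f \<in> L2 M \<Longrightarrow> (AE x in M. 0 \<le> f x) \<Longrightarrow> AE x in M. 0 \<le> \<Psi> (T t (\<Phi> f)) x"
    and T_one: "0 \<le> t \<Longrightarrow> T t (\<Phi> (\<lambda>_. 1)) = \<Phi> (\<lambda>_. 1)"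
begin

abbreviation S :: "real \<Rightarrow> ('a \<Rightarrow> real) \<Rightarrow> 'a \<Rightarrow> real" where "S t f \<equiv> \<Psi> (T t (\<Phi> f))"

lemma S_mono:
  assumes t: "0 \<le> t" and f: "f \<in> L2 M" "g \<in> L2 M" "AE x in M. f x \<le> g x"
  shows "AE x in M. S t f x \<le> S t g x"
proof -
  have "AE x in M. 0 \<le> S t (\<lambda>x. g x - f x) x"
    using f by (intro T_pos t L2_diff) auto
  moreover have "\<Phi> (S t (\<lambda>x. g x - f x)) = \<Phi> (\<lambda>x. S t g x - S t f x)"
    using f by (simp add: \<Phi>_\<Psi> \<Phi>_diff \<Psi>_L2 linear_diff[OF T_linear[OF t]])
  ultimately show ?thesis by (auto simp: \<Phi>_eq_iff \<Psi>_L2 L2_diff)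
qed

lemma S_integral: "0 \<le> t \<Longrightarrow> f \<in> L2 M \<Longrightarrow> (\<integral>x. S t f x \<partial>M) = (\<integral>x. f x \<partial>M)"
  by (simp add: integral_eq \<Psi>_L2 \<Phi>_\<Psi> T_sym T_one)

text \<open>Positivity bounds the modulus of T_t d by T_t |d|, and the latter has the integral of
  |d|. This makes the extension to L1 by continuity meaningful.\<close>

lemma S_L1_contraction:
  assumes t: "0 \<le> t" and f: "f \<in> L2 M" and g: "g \<in> L2 M"
  shows "(\<integral>x. \<bar>S t f x - S t g x\<bar> \<partial>M) \<le> (\<integral>x. \<bar>f x - g x\<bar> \<partial>M)"
proof -
  define d where "d x = f x - g x" for x
  have d: "d \<in> L2 M" using L2_diff[OF f g] by (simp add: d_def[abs_def])
  have ad: "(\<lambda>x. \<bar>d x\<bar>) \<in> L2 M" using d L2D(1)[OF d] by (intro L2_bound[OF d]) auto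
  have nd: "(\<lambda>x. - d x) \<in> L2 M" using L2_scale[OF d, of "-1"] by simp
  have eq1: "AE x in M. S t d x = S t f x - S t g x"
    using f g unfolding d_def[abs_def]
    by (subst \<Phi>_eq_iff[symmetric]) (simp_all add: \<Psi>_L2 L2_diff \<Phi>_\<Psi> \<Phi>_diff linear_diff[OF T_linear[OF t]])
  have eq2: "AE x in M. S t (\<lambda>x. - d x) x = - S t d x"
    using d \<Phi>_scale[OF d, of "-1"] \<Phi>_scale[OF \<Psi>_L2, of "-1"] L2_scale[OF \<Psi>_L2, of "-1"]
    by (subst \<Phi>_eq_iff[symmetric]) (simp_all add: \<Psi>_L2 \<Phi>_\<Psi> linear_neg[OF T_linear[OF t]])
  have "AE x in M. \<bar>S t f x - S t g x\<bar> \<le> S t (\<lambda>x. \<bar>d x\<bar>) x"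
    using S_mono[OF t d ad] S_mono[OF t nd ad] eq1 eq2 by (auto simp: abs_le_iff)
  then have "(\<integral>x. \<bar>S t f x - S t g x\<bar> \<partial>M) \<le> (\<integral>x. S t (\<lambda>x. \<bar>d x\<bar>) x \<partial>M)"
    by (intro integral_mono_AE integrable_abs integrable_L2 L2_diff \<Psi>_L2)
  also have "\<dots> = (\<integral>x. \<bar>f x - g x\<bar> \<partial>M)" using S_integral[OF t ad] by (simp add: d_def)
  finally show ?thesis .
qed

text \<open>Contractivity reduces the increment between two times to the increment over their
  difference at time 0; so the right limit at 0 gives continuity from both sides.\<close>

lemma T_continuous: "continuous_on {0..} (\<lambda>t. T t h)"
proof (rule continuous_onI)
  fix s e :: real assume s: "s \<in> {0..}" and e: "e > 0"
  have "\<forall>\<^sub>F t in at_right 0. dist (T t h) h < e" by (rule tendstoD[OF T_tendsto_0 e])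
  then obtain d where d: "d > 0" "\<And>t. 0 < t \<Longrightarrow> t < d \<Longrightarrow> dist (T t h) h < e"
    by (auto simp: eventually_at_right_field)
  have *: "dist (T (a + b) h) (T a h) \<le> dist (T b h) h" if "0 \<le> a" "0 \<le> b" for a b
  proof -
    have "T (a + b) h - T a h = T a (T b h - h)"
      using that by (simp add: T_add linear_diff[OF T_linear])
    then show ?thesis using T_norm_le[OF that(1), of "T b h - h"] by (simp add: dist_norm)
  qed
  have "dist (T t h) (T s h) \<le> e" if t: "t \<in> {0..}" "dist t s < d" for t
  proof (cases s t rule: linorder_cases)
    case less
    then show ?thesis using *[of s "t - s"] d(2)[of "t - s"] s t by (simp add: dist_real_def)
  next
    case greater
    then show ?thesis using *[of t "s - t"] d(2)[of "s - t"] s t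
      by (simp add: dist_real_def dist_commute)
  qed (use e in simp)
  then show "\<exists>d>0. \<forall>t\<in>{0..}. dist t s < d \<longrightarrow> dist (T t h) (T s h) \<le> e" using d(1) by blast
qed

lemma T_continuous': "0 \<le> a \<Longrightarrow> continuous_on {a..b} (\<lambda>t. T t h)"
  by (rule continuous_on_subset[OF T_continuous]) auto

lemma T_integrable: "0 \<le> a \<Longrightarrow> (\<lambda>t. T t h) integrable_on {a..b}"
  by (rule integrable_continuous_real[OF T_continuous'])

section \<open>Time integrals of the semigroup\<close>

definition V :: "real \<Rightarrow> 'h \<Rightarrow> 'h" where "V r h = integral {0..r} (\<lambda>t. T t h)"

lemma inner_V: "inner (V r h) k = integral {0..r} (\<lambda>t. inner (T t h) k)"
  using integral_linear[OF T_integrable[of 0 h r] bounded_linear_inner_left[of k]]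
  by (simp add: V_def o_def)

lemma inner_T_continuous: "0 \<le> a \<Longrightarrow> continuous_on {a..b} (\<lambda>t. inner (T t h) k)"
  by (intro continuous_intros T_continuous')

lemma inner_T_integrable: "0 \<le> a \<Longrightarrow> (\<lambda>t. inner (T t h) k) integrable_on {a..b}"
  by (intro integrable_continuous_real inner_T_continuous)

text \<open>Under the integral, \<open>T t\<close> shifts the time interval to
  \<open>{t..t + r}\<close>.\<close>

lemma T_V:
  assumes t: "0 \<le> t" and r: "0 \<le> r" shows "T t (V r h) = V (t + r) h - V t h"
proof -
  have bl: "bounded_linear (T t)"
    using T_norm_le[OF t] linear_add[OF T_linear[OF t]] linear_scale[OF T_linear[OF t]]
    by (intro bounded_linear_intro[where K=1]) auto
  have "T t (V r h) = integral {0..r} (\<lambda>s. T t (T s h))"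
    using integral_linear[OF T_integrable[of 0 h r] bl] by (simp add: V_def o_def)
  also have "\<dots> = integral {0..r} ((\<lambda>s. T s h) \<circ> ((+) t))"
    by (rule integral_cong) (use t in \<open>simp add: T_add\<close>)
  also have "\<dots> = integral {t..t + r} (\<lambda>s. T s h)"
    by (simp add: integral_shift_Icc_real add.commute)
  also have "\<dots> = V (t + r) h - V t h"
    using Henstock_Kurzweil_Integration.integral_combine[of 0 t "t + r" "\<lambda>s. T s h"] t r T_integrable[of 0 h "t + r"]
    by (simp add: V_def algebra_simps)
  finally show ?thesis .
qed

abbreviation W :: "real \<Rightarrow> ('a \<Rightarrow> real) \<Rightarrow> 'a \<Rightarrow> real" where "W r f \<equiv> \<Psi> (V r (\<Phi> f))"

lemma T_inner_nonneg:
  assumes "0 \<le> t" "f \<in> L2 M" "AE x in M. 0 \<le> f x" "A \<in> sets M"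
  shows "0 \<le> inner (T t (\<Phi> f)) (\<Phi> (indicator A))"
  using AE_le_iff[OF L2_0 \<Psi>_L2, of "T t (\<Phi> f)"] T_pos[OF assms(1-3)] assms(4) by (auto simp: \<Phi>_0 \<Phi>_\<Psi>)

text \<open>The representatives chosen by \<open>\<Psi>\<close> carry no joint measurability in time
  and space. The comparison is therefore made for the pairings with indicators, which are continuous
  in time.\<close>

lemma W_mono:
  assumes f: "f \<in> L2 M" "AE x in M. 0 \<le> f x" and g: "g \<in> L2 M" "AE x in M. f x \<le> g x" and r: "0 \<le> r" "r \<le> s"
  shows "AE x in M. W r f x \<le> W s g x"
  unfolding AE_le_iff[OF \<Psi>_L2 \<Psi>_L2] \<Phi>_\<Psi>
proof
  fix A assume A: "A \<in> sets M"
  have g0: "AE x in M. 0 \<le> g x" using f(2) g(2) by eventually_elim simp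
  have "inner (V r (\<Phi> f)) (\<Phi> (indicator A)) \<le> inner (V r (\<Phi> g)) (\<Phi> (indicator A))"
    unfolding inner_V
  proof (rule integral_le[OF inner_T_integrable inner_T_integrable])
    fix t assume "t \<in> {0..r}"
    then show "inner (T t (\<Phi> f)) (\<Phi> (indicator A)) \<le> inner (T t (\<Phi> g)) (\<Phi> (indicator A))"
      using S_mono[of t f g] f g A by (auto simp: AE_le_iff \<Psi>_L2 \<Phi>_\<Psi>)
  qed auto
  also have "\<dots> \<le> inner (V s (\<Phi> g)) (\<Phi> (indicator A))"
    unfolding inner_V using r g g0 A
    by (intro integral_subset_le inner_T_integrable) (auto intro: T_inner_nonneg)
  finally show "inner (V r (\<Phi> f)) (\<Phi> (indicator A)) \<le> inner (V s (\<Phi> g)) (\<Phi> (indicator A))" .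
qed

lemma W_nonneg:
  assumes f: "f \<in> L2 M" "AE x in M. 0 \<le> f x" and r: "0 \<le> r"
  shows "AE x in M. 0 \<le> W r f x"
proof -
  have "AE x in M. W 0 f x = 0" using \<Phi>_eq_0_iff[OF \<Psi>_L2, of "V 0 (\<Phi> f)"] by (simp add: \<Phi>_\<Psi> V_def)
  then show ?thesis using W_mono[OF f f(1) _ order_refl r] by auto
qed

lemma W_integral: "0 \<le> r \<Longrightarrow> f \<in> L2 M \<Longrightarrow> (\<integral>x. W r f x \<partial>M) = r * (\<integral>x. f x \<partial>M)"
  using integral_cong[of "{0..r}" "\<lambda>t. inner (T t (\<Phi> f)) (\<Phi> (\<lambda>_. 1))" "\<lambda>_. inner (\<Phi> f) (\<Phi> (\<lambda>_. 1))"]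
  by (simp add: integral_eq \<Psi>_L2 \<Phi>_\<Psi> inner_V T_sym T_one)

text \<open>The truncated potentials \<open>min (G f) c\<close> are superharmonic, hence harmonic since the semigroup
  preserves integrals. As \<open>T\<^sub>n G f = G f - \<integral>\<^sub>0\<^sup>n T\<^sub>s f ds\<close>, this forces
  \<open>G f + \<integral>\<^sub>0\<^sup>n T\<^sub>s f ds \<le> G f\<close>.\<close>

lemma potential_0_or_infinite:
  assumes f: "f \<in> L2 M" "AE x in M. 0 \<le> f x"
  shows "AE x in M. (SUP N::nat. ennreal (W (real N) f x)) = 0 \<or> (SUP N::nat. ennreal (W (real N) f x)) = \<infinity>"
proof -
  define u where "u N = W (real N) f" for N :: nat
  define g where "g x = (SUP N. ennreal (u N x))" for x
  have u_L2: "u N \<in> L2 M" for N by (simp add: u_def \<Psi>_L2)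
  have u_AE: "AE x in M. \<forall>N. 0 \<le> u N x \<and> u N x \<le> u (Suc N) x"
    unfolding AE_all_countable u_def using W_nonneg[OF f] W_mono[OF f f(1)] by auto
  have [measurable]: "u N \<in> borel_measurable M" for N using u_L2 L2D(1) by blast
  have [measurable]: "g \<in> borel_measurable M" unfolding g_def by measurable
  \<comment> \<open>The potential \<open>g\<close> may be infinite on a large set; its truncation is
    bounded and thus square integrable.\<close>
  define m where "m c x = enn2real (min (g x) (ennreal (real c)))" for c :: nat and x
  have m_meas [measurable]: "m c \<in> borel_measurable M" for c unfolding m_def by measurable
  have m_lim: "AE x in M. (\<lambda>N. min (u N x) (real c)) \<longlonglongrightarrow> m c x \<and> (\<forall>N. min (u N x) (real c) \<le> m c x)" for c
    using u_AE
  proof eventually_elim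
    case (elim x)
    have inc: "incseq (\<lambda>N. u N x)" using elim by (intro incseq_SucI) auto
    then have "incseq (\<lambda>N. ennreal (u N x))" by (auto simp: incseq_def intro: ennreal_leI)
    then have "(\<lambda>N. ennreal (u N x)) \<longlonglongrightarrow> g x" unfolding g_def by (rule LIMSEQ_SUP)
    then have "(\<lambda>N. min (ennreal (u N x)) (ennreal (real c))) \<longlonglongrightarrow> min (g x) (ennreal (real c))"
      by (intro tendsto_min tendsto_const)
    moreover have "min (ennreal (u N x)) (ennreal (real c)) = ennreal (min (u N x) (real c))" for N
      using elim by (simp add: min_ennreal)
    moreover have "min (g x) (ennreal (real c)) = ennreal (m c x)"
    proof -
      have "min (g x) (ennreal (real c)) \<le> ennreal (real c)" by simp
      then have "min (g x) (ennreal (real c)) < top" using ennreal_less_top le_less_trans by blast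
      then show ?thesis by (simp add: m_def)
    qed
    ultimately have "(\<lambda>N. ennreal (min (u N x) (real c))) \<longlonglongrightarrow> ennreal (m c x)" by simp
    then have lim: "(\<lambda>N. min (u N x) (real c)) \<longlonglongrightarrow> m c x"
      using elim by (subst (asm) tendsto_ennreal_iff) (auto simp: m_def)
    have "incseq (\<lambda>N. min (u N x) (real c))" using inc by (fastforce simp: incseq_def)
    then show ?case using lim incseq_le by blast
  qed
  have trunc_L2: "(\<lambda>x. min (u N x) (real c)) \<in> L2 M" for N c
  proof (rule L2_bound[OF u_L2[of N]])
    show "AE x in M. \<bar>min (u N x) (real c)\<bar> \<le> \<bar>u N x\<bar>" using u_AE by eventually_elim (auto simp: min_def)
  qed simp
  have abs_trunc: "AE x in M. \<bar>min (u N x) (real c)\<bar> \<le> real c" for N c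
    using u_AE by eventually_elim (auto simp: min_def)
  have m_L2: "m c \<in> L2 M" and trunc_lim: "(\<lambda>N. \<Phi> (\<lambda>x. min (u N x) (real c))) \<longlonglongrightarrow> \<Phi> (m c)" for c
    using \<Phi>_tendsto[of "\<lambda>N x. min (u N x) (real c)" "m c" "\<lambda>_. real c"] m_lim[of c] L2_const abs_trunc
    by auto
  have S_trunc: "(\<lambda>N. \<Phi> (S (real n) (\<lambda>x. min (u N x) (real c)))) \<longlonglongrightarrow> \<Phi> (S (real n) (m c))" for n c
  proof -
    have "bounded_linear (T (real n))"
      using T_norm_le[of "real n"] linear_add[OF T_linear[of "real n"]] linear_scale[OF T_linear[of "real n"]]
      by (intro bounded_linear_intro[where K=1]) auto
    then show ?thesis unfolding \<Phi>_\<Psi> using trunc_lim by (rule bounded_linear.tendsto)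
  qed
  \<comment> \<open>T_n maps the integral over [0, N] to the integral over [n, n + N].\<close>
  have S_u: "AE x in M. S (real n) (u N) x = u (n + N) x - u n x" for n N
    by (subst \<Phi>_eq_iff[symmetric]) (simp_all add: u_def \<Psi>_L2 L2_diff \<Phi>_\<Psi> \<Phi>_diff T_V)
  have S_trunc_le: "AE x in M. S (real n) (\<lambda>x. min (u N x) (real c)) x + u n x \<le> u (n + N) x" for n N c
  proof -
    have "AE x in M. S (real n) (\<lambda>x. min (u N x) (real c)) x \<le> S (real n) (u N) x"
      by (intro S_mono trunc_L2 u_L2) auto
    then show ?thesis using S_u[of n N] by eventually_elim simp
  qed
  have S_trunc_le_c: "AE x in M. S (real n) (\<lambda>x. min (u N x) (real c)) x \<le> real c" for n N c
  proof -
    have "AE x in M. S (real n) (\<lambda>x. min (u N x) (real c)) x \<le> S (real n) (\<lambda>_. real c) x"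
      by (intro S_mono trunc_L2 L2_const) auto
    moreover have "AE x in M. S (real n) (\<lambda>_. real c) x = real c"
      using \<Phi>_scale[OF L2_const[of 1], of "real c"] T_one[of "real n"] linear_scale[OF T_linear[of "real n"]]
      by (subst \<Phi>_eq_iff[symmetric]) (simp_all add: \<Psi>_L2 L2_const \<Phi>_\<Psi>)
    ultimately show ?thesis by eventually_elim simp
  qed
  \<comment> \<open>T_n of the truncated \<open>u N\<close> lies below \<open>u (n + N)\<close> and
    below c, hence below \<open>m c\<close>; letting N grow gives T_n (m c) below
    \<open>m c\<close>. Both have the same integral, so the nonnegative difference is 0.\<close>
  have harmonic: "AE x in M. S (real n) (m c) x = m c x" for n c
  proof -
    have "AE x in M. S (real n) (m c) x \<le> m c x"
    proof -
      obtain r :: "nat \<Rightarrow> nat" where r: "AE x in M. (\<lambda>N. S (real n) (\<lambda>x. min (u (r N) x) (real c)) x) \<longlonglongrightarrow> S (real n) (m c) x"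
        using \<Phi>_tendsto_subseq[OF \<Psi>_L2 \<Psi>_L2 S_trunc[of n c]] by blast
      have "AE x in M. \<forall>N. S (real n) (\<lambda>x. min (u N x) (real c)) x + u n x \<le> u (n + N) x"
        "AE x in M. \<forall>N. S (real n) (\<lambda>x. min (u N x) (real c)) x \<le> real c"
        using S_trunc_le[of n _ c] S_trunc_le_c[of n _ c] by (auto simp: AE_all_countable)
      then show ?thesis using r m_lim[of c] u_AE
      proof eventually_elim
        case (elim x)
        have "S (real n) (\<lambda>x. min (u (r N) x) (real c)) x \<le> m c x" for N
        proof -
          have "S (real n) (\<lambda>x. min (u (r N) x) (real c)) x \<le> min (u (n + r N) x) (real c)"
            using elim(1)[rule_format, of "r N"] elim(2)[rule_format, of "r N"] elim(5)[rule_format, of n] by simp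
          also have "\<dots> \<le> m c x" using elim(4) by blast
          finally show ?thesis .
        qed
        then show ?case using LIMSEQ_le_const2[OF elim(3)] by blast
      qed
    qed
    moreover have "(\<integral>x. m c x - S (real n) (m c) x \<partial>M) = 0"
      using S_integral[of "real n" "m c"] m_L2 by (simp add: integrable_L2 \<Psi>_L2)
    ultimately have "AE x in M. m c x - S (real n) (m c) x = 0"
      using integral_nonneg_eq_0_iff_AE[of M "\<lambda>x. m c x - S (real n) (m c) x"] m_L2
      by (simp add: integrable_L2 \<Psi>_L2)
    then show ?thesis by eventually_elim simp
  qed
  \<comment> \<open>Now the summand \<open>u n\<close> of \<open>S_trunc_le\<close> is kept: letting
    N grow bounds T_n (m c) + u n by g, and T_n (m c) is \<open>m c\<close> by harmonicity.\<close>
  have main: "AE x in M. ennreal (m c x + u n x) \<le> g x" for c n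
  proof -
    obtain r :: "nat \<Rightarrow> nat" where r: "AE x in M. (\<lambda>N. S (real n) (\<lambda>x. min (u (r N) x) (real c)) x) \<longlonglongrightarrow> S (real n) (m c) x"
      using \<Phi>_tendsto_subseq[OF \<Psi>_L2 \<Psi>_L2 S_trunc[of n c]] by blast
    have "AE x in M. \<forall>N. S (real n) (\<lambda>x. min (u N x) (real c)) x + u n x \<le> u (n + N) x"
      using S_trunc_le[of n _ c] by (auto simp: AE_all_countable)
    then show ?thesis using r harmonic[of n c]
    proof eventually_elim
      case (elim x)
      have "(\<lambda>N. ennreal (S (real n) (\<lambda>x. min (u (r N) x) (real c)) x + u n x)) \<longlonglongrightarrow> ennreal (m c x + u n x)"
        using elim by (intro tendsto_intros) simp
      then show ?case
      proof (rule LIMSEQ_le_const2)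
        show "\<exists>N. \<forall>k\<ge>N. ennreal (S (real n) (\<lambda>x. min (u (r k) x) (real c)) x + u n x) \<le> g x"
          using elim(1) unfolding g_def by (meson SUP_upper2 UNIV_I ennreal_leI)
      qed
    qed
  qed
  have "AE x in M. \<forall>c n. ennreal (m c x + u n x) \<le> g x" using main by (simp add: AE_all_countable)
  then have "AE x in M. g x = 0 \<or> g x = \<infinity>"
    using u_AE
  proof eventually_elim
    case (elim x)
    show ?case
    proof (cases "g x = \<infinity>")
      case False
      then obtain G where G: "G \<ge> 0" "g x = ennreal G" by (cases "g x") auto
      \<comment> \<open>Above the finite value of g the truncation is inactive, so
        \<open>main\<close> reads g + u n <= g at this point.\<close>
      obtain c :: nat where c: "G \<le> real c" using real_arch_simple by blast
      have "m c x = G" using c G by (simp add: m_def min_def ennreal_leI)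
      then have "u n x = 0" for n
      proof -
        have "ennreal (G + u n x) \<le> ennreal G" using elim(1) \<open>m c x = G\<close> G by metis
        then have "G + u n x \<le> G" using G(1) elim(2) by (simp add: ennreal_le_iff)
        then show ?thesis using elim(2)[rule_format, of n] by simp
      qed
      then show ?thesis by (simp add: g_def)
    qed simp
  qed
  then show ?thesis by (simp add: g_def u_def)
qed

text \<open>The truncations min(f, k) are in L2, where \<open>potential_0_or_infinite\<close>
  applies, and a supremum of values 0 and infinity is again 0 or infinite. Most of the work
  identifies the functions chosen by \<open>SOME\<close> in the potential with monotone
  limits.\<close>

lemma recurrent:
  assumes f: "integrable M f" "AE x in M. 0 \<le> f x"
  shows "AE x in M. potential M S f x = 0 \<or> potential M S f x = \<infinity>"
proof -
  define fk where "fk k x = min (max (f x) 0) (real k)" for k x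
  have [measurable]: "f \<in> borel_measurable M" using f by simp
  have fk_L2: "fk k \<in> L2 M" for k
    by (rule L2_bounded[of _ "real k"]) (auto simp: fk_def[abs_def])
  have fk_int: "integrable M (fk k)" for k using fk_L2 by (rule integrable_L2)
  have fk_0: "0 \<le> fk k x" and fk_mono: "fk k x \<le> fk (Suc k) x" for k x by (auto simp: fk_def)
  have fk_f: "(\<integral>x. fk k x \<partial>M) \<le> (\<integral>x. f x \<partial>M)" for k
    by (rule integral_mono_AE[OF fk_int f(1)]) (use f(2) in \<open>eventually_elim, simp add: fk_def\<close>)
  have fk_lim: "(\<lambda>k. \<integral>x. \<bar>fk k x - f x\<bar> \<partial>M) \<longlonglongrightarrow> 0"
  proof -
    have "(\<lambda>k. \<integral>x. \<bar>fk k x - f x\<bar> \<partial>M) \<longlonglongrightarrow> (\<integral>x. 0 \<partial>M)"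
    proof (rule integral_dominated_convergence[where w=f])
      show "AE x in M. (\<lambda>k. \<bar>fk k x - f x\<bar>) \<longlonglongrightarrow> 0" using f(2)
      proof eventually_elim
        case (elim x)
        obtain c :: nat where c: "f x \<le> real c" using real_arch_simple by blast
        have "\<forall>\<^sub>F k in sequentially. \<bar>fk k x - f x\<bar> = 0"
          using eventually_ge_at_top[of c] by eventually_elim (use c elim in \<open>auto simp: fk_def\<close>)
        then show ?case by (rule tendsto_eventually)
      qed
      show "AE x in M. norm \<bar>fk k x - f x\<bar> \<le> f x" for k
        using f(2) by eventually_elim (auto simp: fk_def)
      show "(\<lambda>x. \<bar>fk k x - f x\<bar>) \<in> borel_measurable M" for k unfolding fk_def[abs_def] by measurable
    qed (use f in auto)
    then show ?thesis by simp
  qed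
  have L1: "integrable M (semigroup_L1 M S t f) \<and> (\<lambda>k. \<integral>x. \<bar>S t (fk k) x - semigroup_L1 M S t f x\<bar> \<partial>M) \<longlonglongrightarrow> 0"
    if t: "0 \<le> t" for t
  proof -
    obtain h where h: "integrable M h" "(\<lambda>k. \<integral>x. \<bar>S t (fk k) x - h x\<bar> \<partial>M) \<longlonglongrightarrow> 0"
    proof (rule integrable_monotone_limit[of M "\<lambda>k. S t (fk k)" "\<integral>x. f x \<partial>M"])
      show "integrable M (S t (fk k))" for k by (intro integrable_L2 \<Psi>_L2)
      show "AE x in M. 0 \<le> S t (fk k) x" for k using fk_0 by (intro T_pos t fk_L2) auto
      show "AE x in M. S t (fk k) x \<le> S t (fk (Suc k)) x" for k using fk_mono by (intro S_mono t fk_L2) auto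
      show "(\<integral>x. S t (fk k) x \<partial>M) \<le> (\<integral>x. f x \<partial>M)" for k using fk_f by (simp add: S_integral t fk_L2)
    qed blast
    define Q where "Q g \<longleftrightarrow> integrable M g \<and>
     (\<forall>s. (\<forall>k. s k \<in> L2 M \<and> integrable M (s k)) \<and> (\<lambda>k. \<integral>x. \<bar>s k x - f x\<bar> \<partial>M) \<longlonglongrightarrow> 0 \<longrightarrow>
        (\<forall>k. integrable M (S t (s k))) \<and> (\<lambda>k. \<integral>x. \<bar>S t (s k) x - g x\<bar> \<partial>M) \<longlonglongrightarrow> 0)" for g
    \<comment> \<open>An arbitrary approximating sequence is compared with the truncations
      \<open>fk\<close> through the contraction in L1. The function chosen later by
      \<open>SOME\<close> may differ from \<open>h\<close>; only property \<open>Q\<close> of it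
      will be used.\<close>
    have "Q h" unfolding Q_def
    proof (intro conjI h(1) allI impI)
      fix s assume s: "(\<forall>k. s k \<in> L2 M \<and> integrable M (s k)) \<and> (\<lambda>k. \<integral>x. \<bar>s k x - f x\<bar> \<partial>M) \<longlonglongrightarrow> 0"
      show "integrable M (S t (s k))" for k by (intro integrable_L2 \<Psi>_L2)
      have lim: "(\<lambda>k. ((\<integral>x. \<bar>s k x - f x\<bar> \<partial>M) + (\<integral>x. \<bar>fk k x - f x\<bar> \<partial>M)) + (\<integral>x. \<bar>S t (fk k) x - h x\<bar> \<partial>M)) \<longlonglongrightarrow> 0"
        using tendsto_add[OF tendsto_add[OF conjunct2[OF s] fk_lim] h(2)] by simp
      show "(\<lambda>k. \<integral>x. \<bar>S t (s k) x - h x\<bar> \<partial>M) \<longlonglongrightarrow> 0"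
      proof (rule tendsto_sandwich[OF _ _ tendsto_const lim]; intro always_eventually allI)
        fix k
        have i: "integrable M (S t (s k))" "integrable M (S t (fk k))" by (intro integrable_L2 \<Psi>_L2)+
        have "(\<integral>x. \<bar>S t (s k) x - h x\<bar> \<partial>M) \<le> (\<integral>x. \<bar>S t (s k) x - S t (fk k) x\<bar> + \<bar>S t (fk k) x - h x\<bar> \<partial>M)"
          using i h(1) by (intro integral_mono) auto
        also have "\<dots> = (\<integral>x. \<bar>S t (s k) x - S t (fk k) x\<bar> \<partial>M) + (\<integral>x. \<bar>S t (fk k) x - h x\<bar> \<partial>M)"
          using i h(1) by simp
        also have "(\<integral>x. \<bar>S t (s k) x - S t (fk k) x\<bar> \<partial>M) \<le> (\<integral>x. \<bar>s k x - fk k x\<bar> \<partial>M)"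
          using s by (intro S_L1_contraction t fk_L2) auto
        also have "(\<integral>x. \<bar>s k x - fk k x\<bar> \<partial>M) \<le> (\<integral>x. \<bar>s k x - f x\<bar> + \<bar>fk k x - f x\<bar> \<partial>M)"
          using s f(1) fk_int[of k] by (intro integral_mono) auto
        also have "\<dots> = (\<integral>x. \<bar>s k x - f x\<bar> \<partial>M) + (\<integral>x. \<bar>fk k x - f x\<bar> \<partial>M)"
          using s f(1) fk_int[of k] by simp
        finally show "(\<integral>x. \<bar>S t (s k) x - h x\<bar> \<partial>M) \<le> ((\<integral>x. \<bar>s k x - f x\<bar> \<partial>M) + (\<integral>x. \<bar>fk k x - f x\<bar> \<partial>M)) + (\<integral>x. \<bar>S t (fk k) x - h x\<bar> \<partial>M)"
          by simp
      qed simp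
    qed
    then have "Q (SOME g. Q g)" by (rule someI[of Q])
    moreover have "semigroup_L1 M S t f = (SOME g. Q g)" unfolding semigroup_L1_def Q_def ..
    ultimately have "Q (semigroup_L1 M S t f)" by (simp only:)
    then show ?thesis using fk_L2 fk_int fk_lim by (simp add: Q_def)
  qed
  have W_lim: "AE x in M. incseq (\<lambda>k. W r (fk k) x) \<and> (\<lambda>k. W r (fk k) x) \<longlonglongrightarrow> semigroup_integral M S r f x"
    if r: "0 \<le> r" for r
  proof -
    obtain h where h: "integrable M h" "AE x in M. incseq (\<lambda>k. W r (fk k) x) \<and> (\<lambda>k. W r (fk k) x) \<longlonglongrightarrow> h x"
      "(\<lambda>k. \<integral>x. \<bar>W r (fk k) x - h x\<bar> \<partial>M) \<longlonglongrightarrow> 0"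
    proof (rule integrable_monotone_limit[of M "\<lambda>k. W r (fk k)" "r * (\<integral>x. f x \<partial>M)"])
      show "integrable M (W r (fk k))" for k by (intro integrable_L2 \<Psi>_L2)
      show "AE x in M. 0 \<le> W r (fk k) x" for k using fk_0 by (intro W_nonneg r fk_L2) auto
      show "AE x in M. W r (fk k) x \<le> W r (fk (Suc k)) x" for k
        using fk_mono fk_0 r by (intro W_mono fk_L2) auto
      show "(\<integral>x. W r (fk k) x \<partial>M) \<le> r * (\<integral>x. f x \<partial>M)" for k
        using fk_f r by (simp add: W_integral fk_L2 mult_left_mono)
    qed blast
    have int_h: "set_lebesgue_integral M A h =
        set_lebesgue_integral lborel {0..r} (\<lambda>s. set_lebesgue_integral M A (semigroup_L1 M S s f))"
      if A: "A \<in> sets M" for A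
    proof -
      define P where "P s = set_lebesgue_integral M A (semigroup_L1 M S s f)" for s
      define Q where "Q k s = inner (T s (\<Phi> (fk k))) (\<Phi> (indicator A))" for k s
      have Q: "Q k s = set_lebesgue_integral M A (S s (fk k))" for k s
        by (simp add: Q_def set_integral_eq A \<Psi>_L2 \<Phi>_\<Psi>)
      \<comment> \<open>The bound does not depend on s. So the continuous functions
        \<open>Q k\<close> converge uniformly to \<open>P\<close> on the time interval,
        \<open>P\<close> is continuous, and its integral is the limit of theirs.\<close>
      have bound: "\<bar>Q k s - P s\<bar> \<le> (\<integral>x. \<bar>fk k x - f x\<bar> \<partial>M)" if s: "0 \<le> s" for k s
      proof (rule LIMSEQ_le)
        have "(\<lambda>j. Q j s) \<longlonglongrightarrow> P s" unfolding Q P_def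
          using L1[OF s] integrable_L2[OF \<Psi>_L2] by (intro set_integral_L1_limit A) auto
        then show "(\<lambda>j. \<bar>Q k s - Q j s\<bar>) \<longlonglongrightarrow> \<bar>Q k s - P s\<bar>" by (intro tendsto_intros)
        show "(\<lambda>j. (\<integral>x. \<bar>fk k x - f x\<bar> \<partial>M) + (\<integral>x. \<bar>fk j x - f x\<bar> \<partial>M)) \<longlonglongrightarrow> (\<integral>x. \<bar>fk k x - f x\<bar> \<partial>M)"
          using tendsto_add[OF tendsto_const fk_lim] by simp
        have "\<bar>Q k s - Q j s\<bar> \<le> (\<integral>x. \<bar>fk k x - f x\<bar> \<partial>M) + (\<integral>x. \<bar>fk j x - f x\<bar> \<partial>M)" for j
        proof -
          have "\<bar>Q k s - Q j s\<bar> \<le> (\<integral>x. \<bar>S s (fk k) x - S s (fk j) x\<bar> \<partial>M)"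
            unfolding Q by (intro set_integral_diff_le A integrable_L2 \<Psi>_L2)
          also have "\<dots> \<le> (\<integral>x. \<bar>fk k x - fk j x\<bar> \<partial>M)" by (intro S_L1_contraction s fk_L2)
          also have "\<dots> \<le> (\<integral>x. \<bar>fk k x - f x\<bar> + \<bar>fk j x - f x\<bar> \<partial>M)"
            using f(1) fk_int by (intro integral_mono) auto
          also have "\<dots> = (\<integral>x. \<bar>fk k x - f x\<bar> \<partial>M) + (\<integral>x. \<bar>fk j x - f x\<bar> \<partial>M)"
            using f(1) fk_int by simp
          finally show ?thesis .
        qed
        then show "\<exists>N. \<forall>j\<ge>N. \<bar>Q k s - Q j s\<bar> \<le> (\<integral>x. \<bar>fk k x - f x\<bar> \<partial>M) + (\<integral>x. \<bar>fk j x - f x\<bar> \<partial>M)" by blast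
      qed
      have Q_cont: "continuous_on {0..r} (Q k)" for k unfolding Q_def by (rule inner_T_continuous) simp
      have ul: "uniform_limit {0..r} Q P sequentially"
      proof (rule uniform_limitI)
        fix e :: real assume "e > 0"
        then have "\<forall>\<^sub>F k in sequentially. (\<integral>x. \<bar>fk k x - f x\<bar> \<partial>M) < e" by (rule order_tendstoD(2)[OF fk_lim])
        then show "\<forall>\<^sub>F k in sequentially. \<forall>s\<in>{0..r}. dist (Q k s) (P s) < e"
        proof eventually_elim
          case (elim k)
          show ?case
          proof
            fix s assume "s \<in> {0..r}"
            then show "dist (Q k s) (P s) < e" using bound[of s k] elim by (simp add: dist_real_def)
          qed
        qed
      qed
      then have P_cont: "continuous_on {0..r} P"
        using Q_cont ul by (intro uniform_limit_theorem[where f=Q and F=sequentially]) auto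
      have int_lim: "(\<lambda>k. integral {0..r} (Q k)) \<longlonglongrightarrow> integral {0..r} P"
      proof (rule uniform_limit_integral[OF ul Q_cont sequentially_bot])
        fix I K assume *: "\<And>k. (Q k has_integral I k) {0..r}" "(P has_integral K) {0..r}" "I \<longlonglongrightarrow> K"
        show ?thesis unfolding integral_unique[OF *(1)] integral_unique[OF *(2)] by (rule *(3))
      qed
      have "integral {0..r} (Q k) = set_lebesgue_integral M A (W r (fk k))" for k
        by (simp add: Q_def[abs_def] inner_V[symmetric] set_integral_eq A \<Psi>_L2 \<Phi>_\<Psi>)
      moreover have "(\<lambda>k. set_lebesgue_integral M A (W r (fk k))) \<longlonglongrightarrow> set_lebesgue_integral M A h"
        by (intro set_integral_L1_limit A h integrable_L2 \<Psi>_L2)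
      ultimately have "set_lebesgue_integral M A h = integral {0..r} P" using int_lim LIMSEQ_unique by simp
      also have "\<dots> = set_lebesgue_integral lborel {0..r} P"
        by (rule set_borel_integral_eq_integral(2)[OF borel_integrable_atLeastAtMost'[OF P_cont], symmetric])
      finally show ?thesis unfolding P_def .
    qed
    define Q where "Q h \<longleftrightarrow> integrable M h \<and> (\<forall>A\<in>sets M. set_lebesgue_integral M A h =
        set_lebesgue_integral lborel {0..r} (\<lambda>s. set_lebesgue_integral M A (semigroup_L1 M S s f)))" for h
    have "Q h" unfolding Q_def using h(1) int_h by blast
    then have "Q (SOME h. Q h)" by (rule someI[of Q])
    moreover have "semigroup_integral M S r f = (SOME h. Q h)" unfolding semigroup_integral_def Q_def ..
    ultimately have "Q (semigroup_integral M S r f)" by (simp only:)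
    \<comment> \<open>Two integrable functions with equal integrals over all measurable sets agree
      almost everywhere, so the chosen function inherits the monotone convergence.\<close>
    then have "AE x in M. h x = semigroup_integral M S r f x"
      using h(1) int_h unfolding Q_def by (intro density_unique_banach) auto
    then show ?thesis using h(2) by eventually_elim simp
  qed
  have fin: "AE x in M. \<forall>k. (SUP N::nat. ennreal (W (real N) (fk k) x)) = 0 \<or> (SUP N::nat. ennreal (W (real N) (fk k) x)) = \<infinity>"
    unfolding AE_all_countable using fk_0 by (intro allI potential_0_or_infinite fk_L2) auto
  have "AE x in M. \<forall>N::nat. incseq (\<lambda>k. W (real N) (fk k) x) \<and> (\<lambda>k. W (real N) (fk k) x) \<longlonglongrightarrow> semigroup_integral M S (real N) f x"
    using W_lim by (simp add: AE_all_countable)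
  then show ?thesis using fin
  proof eventually_elim
    case (elim x)
    have "ennreal (semigroup_integral M S (real N) f x) = (SUP k. ennreal (W (real N) (fk k) x))" for N :: nat
    proof (rule LIMSEQ_unique)
      show "(\<lambda>k. ennreal (W (real N) (fk k) x)) \<longlonglongrightarrow> ennreal (semigroup_integral M S (real N) f x)"
        using elim(1) by (intro tendsto_intros) auto
      show "(\<lambda>k. ennreal (W (real N) (fk k) x)) \<longlonglongrightarrow> (SUP k. ennreal (W (real N) (fk k) x))"
        using elim(1) by (intro LIMSEQ_SUP) (auto simp: incseq_def intro: ennreal_leI)
    qed
    then have "potential M S f x = (SUP N::nat. SUP k. ennreal (W (real N) (fk k) x))"
      by (simp add: potential_def)
    \<comment> \<open>The inner supremum is now the potential of a single truncation, to which
      \<open>fin\<close> applies.\<close>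
    also have "\<dots> = (SUP k. SUP N::nat. ennreal (W (real N) (fk k) x))" by (rule SUP_commute)
    finally have eq: "potential M S f x = (SUP k. SUP N::nat. ennreal (W (real N) (fk k) x))" .
    show ?case
    proof (cases "\<exists>k. (SUP N::nat. ennreal (W (real N) (fk k) x)) = \<infinity>")
      case True
      then obtain k where k: "(SUP N::nat. ennreal (W (real N) (fk k) x)) = \<infinity>" by blast
      have "(SUP N::nat. ennreal (W (real N) (fk k) x)) \<le> potential M S f x"
        unfolding eq by (rule SUP_upper) simp
      then show ?thesis unfolding k by (simp add: top_unique)
    next
      case False
      then have "\<forall>k. (SUP N::nat. ennreal (W (real N) (fk k) x)) = 0" using elim(2) by blast
      then have "potential M S f x = 0" unfolding eq by (simp only: SUP_const UNIV_not_empty simp_thms not_False_eq_True)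
      then show ?thesis by blast
    qed
  qed
qed

end

section \<open>Differentiable functions on the orthant\<close>

lemma open_open_orthant: "open (open_orthant :: (real^'n::finite) set)"
proof -
  have *: "open_orthant = (\<Inter>i\<in>UNIV. {x::real^'n. 0 < x $ i})" by (auto simp: open_orthant_def)
  have "open {x::real^'n. 0 < x $ i}" for i by (intro open_Collect_less continuous_intros)
  then show ?thesis unfolding * by (intro open_INT ballI) auto
qed

lemma closed_orthant: "closed (orthant :: (real^'n::finite) set)"
proof -
  have *: "orthant = (\<Inter>i\<in>UNIV. {x::real^'n. 0 \<le> x $ i})" by (auto simp: orthant_def)
  have "closed {x::real^'n. 0 \<le> x $ i}" for i by (intro closed_Collect_le continuous_intros)
  then show ?thesis unfolding * by (intro closed_INT ballI) auto
qed

lemma open_orthant_subset: "open_orthant \<subseteq> orthant"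
  by (auto simp: open_orthant_def orthant_def less_imp_le)

text \<open>Here \<open>1\<close> is the vector of ones: a shift along the diagonal moves every
  boundary point into the interior.\<close>

lemma orthant_approx:
  fixes x :: "real^'n::finite"
  assumes "x \<in> orthant"
  shows "(\<lambda>k. x + inverse (real (Suc k)) *\<^sub>R 1) \<longlonglongrightarrow> x" "x + inverse (real (Suc k)) *\<^sub>R 1 \<in> open_orthant"
proof -
  have "(\<lambda>k. x + inverse (real (Suc k)) *\<^sub>R 1) \<longlonglongrightarrow> x + 0 *\<^sub>R 1"
    by (intro tendsto_intros LIMSEQ_inverse_real_of_nat)
  then show "(\<lambda>k. x + inverse (real (Suc k)) *\<^sub>R 1) \<longlonglongrightarrow> x" by simp
  show "x + inverse (real (Suc k)) *\<^sub>R 1 \<in> open_orthant"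
    using assms by (auto simp: open_orthant_def orthant_def intro!: add_nonneg_pos)
qed

lemma at_within_open_orthant:
  fixes x :: "real^'n::finite"
  assumes "x \<in> orthant"
  shows "at x within open_orthant \<noteq> bot"
proof -
  have "x + inverse (real (Suc k)) *\<^sub>R 1 \<noteq> x" for k :: nat by (simp add: vec_eq_iff)
  then show ?thesis
    unfolding trivial_limit_within islimpt_sequential
    using orthant_approx[OF assms] by (metis Diff_iff singletonD)
qed

lemma eventually_line:
  fixes x :: "real^'n::finite"
  assumes "open U" "x \<in> U"
  shows "\<forall>\<^sub>F t in nhds (0::real). x + t *\<^sub>R axis i 1 \<in> U"
proof -
  have "((\<lambda>t. x + t *\<^sub>R axis i 1) \<longlongrightarrow> x + 0 *\<^sub>R axis i 1) (nhds (0::real))"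
    by (intro tendsto_intros) (rule filterlim_ident)
  then show ?thesis by (rule topological_tendstoD[OF _ assms(1)]) (simp add: assms(2))
qed

lemma deriv_transform_nhds:
  assumes "(f has_real_derivative d) (at x)" "\<forall>\<^sub>F t in nhds x. f t = g t"
  shows "(g has_real_derivative d) (at x)"
  using DERIV_cong_ev[OF refl assms(2) refl] assms(1) by (rule iffD1)

text \<open>The gradient \<open>G\<close> is carried along as a witness, so that the calculus rules
  need not unfold \<open>deriv\<close> and \<open>Lim\<close>. As in \<open>Cck\<close>,
  differentiability is required in the interior only.\<close>

definition C1 :: "(real^'n::finite \<Rightarrow> real) \<Rightarrow> ('n \<Rightarrow> real^'n \<Rightarrow> real) \<Rightarrow> bool" where
  "C1 f G \<longleftrightarrow> continuous_on orthant f \<and> (\<forall>i. continuous_on orthant (G i)) \<and>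
     (\<forall>x\<in>open_orthant. \<forall>i. ((\<lambda>t. f (x + t *\<^sub>R axis i 1)) has_real_derivative G i x) (at 0))"

lemma C1D:
  assumes "C1 f G"
  shows "continuous_on orthant f" "continuous_on orthant (G i)"
    "x \<in> open_orthant \<Longrightarrow> ((\<lambda>t. f (x + t *\<^sub>R axis i 1)) has_real_derivative G i x) (at 0)"
  using assms by (auto simp: C1_def)

lemma partial_deriv_eq: "C1 f G \<Longrightarrow> x \<in> open_orthant \<Longrightarrow> partial_deriv i f x = G i x"
  unfolding partial_deriv_def by (rule DERIV_imp_deriv) (rule C1D)

lemma extension_eq:
  assumes G: "continuous_on orthant G" and eq: "\<And>x. x \<in> open_orthant \<Longrightarrow> h x = G x" and x: "x \<in> orthant"
  shows "orthant_extension h x = G x"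
  unfolding orthant_extension_def
proof (rule tendsto_Lim[OF at_within_open_orthant[OF x]])
  have "(G \<longlongrightarrow> G x) (at x within open_orthant)"
    using G x tendsto_within_subset[OF _ open_orthant_subset] by (auto simp: continuous_on_def)
  then show "(h \<longlongrightarrow> G x) (at x within open_orthant)"
    by (rule Lim_transform_eventually) (auto simp: eventually_at_filter eq)
qed

abbreviation pd :: "'n::finite \<Rightarrow> (real^'n \<Rightarrow> real) \<Rightarrow> real^'n \<Rightarrow> real" where
  "pd i f \<equiv> orthant_extension (partial_deriv i f)"

lemma pd_eq: "C1 f G \<Longrightarrow> x \<in> orthant \<Longrightarrow> pd i f x = G i x"
  by (rule extension_eq) (auto simp: C1D partial_deriv_eq)

lemma C1_cong: "C1 f G \<Longrightarrow> (\<And>i x. x \<in> orthant \<Longrightarrow> G i x = G' i x) \<Longrightarrow> C1 f G'"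
proof -
  assume f: "C1 f G" and eq: "\<And>i x. x \<in> orthant \<Longrightarrow> G i x = G' i x"
  have "continuous_on orthant (G' i)" for i
    using C1D(2)[OF f, of i] eq by (simp cong: continuous_on_cong)
  moreover have "G i x = G' i x" if "x \<in> open_orthant" for i x
    using eq open_orthant_subset that by blast
  ultimately show ?thesis using f unfolding C1_def by simp
qed

text \<open>For a point of the boundary this follows from the mean value theorem on parallel lines in the
  interior, since \<open>G\<close> is continuous.\<close>

lemma C1_deriv:
  fixes x :: "real^'n::finite"
  assumes f: "C1 f G" and x: "x \<in> orthant" "0 < x $ i"
  shows "((\<lambda>t. f (x + t *\<^sub>R axis i 1)) has_real_derivative G i x) (at 0)"
proof -
  let ?e = "axis i 1 :: real^'n"
  have norm_e: "norm ?e = 1" by simp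
  have line: "((\<lambda>s. f (y + s *\<^sub>R ?e)) has_real_derivative G i (y + t *\<^sub>R ?e)) (at t)"
    if "y + t *\<^sub>R ?e \<in> open_orthant" for y t
  proof -
    have "((\<lambda>s. f ((y + t *\<^sub>R ?e) + s *\<^sub>R ?e)) has_real_derivative G i (y + t *\<^sub>R ?e)) (at 0)"
      by (rule C1D(3)[OF f that])
    then show ?thesis
      using DERIV_shift[of "\<lambda>s. f (y + s *\<^sub>R ?e)" "G i (y + t *\<^sub>R ?e)" 0 t]
      by (simp add: scaleR_add_left add_ac)
  qed
  show ?thesis
    unfolding has_field_derivative_def has_derivative_at_alt
  proof (intro conjI allI impI)
    fix e :: real assume e: "0 < e"
    have "\<exists>d>0. \<forall>z\<in>orthant. dist z x < d \<longrightarrow> dist (G i z) (G i x) < e"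
      using C1D(2)[OF f, of i] x(1) e unfolding continuous_on_iff by blast
    then obtain d where d: "d > 0" "\<And>z. z \<in> orthant \<Longrightarrow> dist z x < d \<Longrightarrow> \<bar>G i z - G i x\<bar> < e"
      by (auto simp: dist_real_def)
    \<comment> \<open>One half of \<open>d\<close> is left for the shift of the approximating lines
      into the interior; the bound \<open>x $ i\<close> keeps the segment in the orthant.\<close>
    define \<delta> where "\<delta> = min (d/2) (x $ i)"
    have "\<bar>f (x + t *\<^sub>R ?e) - f x - G i x * t\<bar> \<le> e * \<bar>t\<bar>" if t: "\<bar>t\<bar> < \<delta>" for t
    proof -
      define y where "y k = x + inverse (real (Suc k)) *\<^sub>R 1" for k
      have xt: "x + t *\<^sub>R ?e \<in> orthant"
        using x t by (auto simp: orthant_def axis_def \<delta>_def)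
      have y: "y \<longlonglongrightarrow> x" "\<And>k. y k \<in> open_orthant" using orthant_approx[OF x(1)] by (auto simp: y_def[abs_def])
      have pos: "y k + s *\<^sub>R ?e \<in> open_orthant" if "\<bar>s\<bar> \<le> \<bar>t\<bar>" for k s
      proof -
        have "x $ i + s > 0" using that t by (auto simp: \<delta>_def)
        then have "x + s *\<^sub>R ?e \<in> orthant" using x(1) by (auto simp: orthant_def axis_def)
        from orthant_approx(2)[OF this, of k] show ?thesis by (simp add: y_def algebra_simps)
      qed
      have "\<forall>\<^sub>F k in sequentially. dist (y k) x < d/2" using tendstoD[OF y(1), of "d/2"] d(1) by simp
      then have ev: "\<forall>\<^sub>F k in sequentially. \<bar>f (y k + t *\<^sub>R ?e) - f (y k) - G i x * t\<bar> \<le> e * \<bar>t\<bar>"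
      proof eventually_elim
        fix k assume k: "dist (y k) x < d/2"
        have "norm ((f (y k + t *\<^sub>R ?e) - t * G i x) - (f (y k + 0 *\<^sub>R ?e) - 0 * G i x)) \<le> e * norm (t - 0)"
        proof (rule field_differentiable_bound[where S="{-\<bar>t\<bar>..\<bar>t\<bar>}" and f'="\<lambda>s. G i (y k + s *\<^sub>R ?e) - G i x"])
          fix s assume s: "s \<in> {-\<bar>t\<bar>..\<bar>t\<bar>}"
          then have s': "y k + s *\<^sub>R ?e \<in> open_orthant" by (intro pos) auto
          show "((\<lambda>s. f (y k + s *\<^sub>R ?e) - s * G i x) has_field_derivative G i (y k + s *\<^sub>R ?e) - G i x) (at s within {-\<bar>t\<bar>..\<bar>t\<bar>})"
            by (rule DERIV_subset[OF DERIV_diff[OF line[OF s']]]) (auto intro!: derivative_eq_intros)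
          have "dist (y k + s *\<^sub>R ?e) x \<le> dist (y k) x + \<bar>s\<bar>"
            using norm_triangle_ineq[of "y k - x" "s *\<^sub>R ?e"] by (simp add: dist_norm algebra_simps)
          also have "\<dots> < d" using k s t by (auto simp: \<delta>_def)
          finally show "norm (G i (y k + s *\<^sub>R ?e) - G i x) \<le> e"
            using d(2)[of "y k + s *\<^sub>R ?e"] s' open_orthant_subset by fastforce
        qed auto
        then show "\<bar>f (y k + t *\<^sub>R ?e) - f (y k) - G i x * t\<bar> \<le> e * \<bar>t\<bar>" by (simp add: algebra_simps)
      qed
      have "(\<lambda>k. \<bar>f (y k + t *\<^sub>R ?e) - f (y k) - G i x * t\<bar>) \<longlonglongrightarrow> \<bar>f (x + t *\<^sub>R ?e) - f x - G i x * t\<bar>"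
      proof (intro tendsto_intros)
        have c: "(\<lambda>k. f (z k)) \<longlonglongrightarrow> f w" if "z \<longlonglongrightarrow> w" "w \<in> orthant" "\<And>k. z k \<in> open_orthant" for z w
          using continuous_on_tendsto_compose[OF C1D(1)[OF f] that(1,2)] that(3) open_orthant_subset
          by (auto intro: always_eventually)
        show "(\<lambda>k. f (y k)) \<longlonglongrightarrow> f x" by (rule c[OF y(1) x(1) y(2)])
        show "(\<lambda>k. f (y k + t *\<^sub>R ?e)) \<longlonglongrightarrow> f (x + t *\<^sub>R ?e)"
          by (rule c) (auto intro!: tendsto_intros y xt pos)
      qed
      then show ?thesis by (rule tendsto_upperbound[OF _ ev sequentially_bot])
    qed
    moreover have "\<delta> > 0" using d x by (simp add: \<delta>_def)
    ultimately show "\<exists>d>0. \<forall>y. norm (y - 0) < d \<longrightarrow>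
        norm (f (x + y *\<^sub>R ?e) - f (x + 0 *\<^sub>R ?e) - G i x * (y - 0)) \<le> e * norm (y - 0)"
      by (intro exI[of _ \<delta>]) simp
  qed (rule bounded_linear_mult_right)
qed

section \<open>Rules of calculus on the orthant\<close>

lemma C1_const: "C1 (\<lambda>_. c) (\<lambda>_ _. 0)"
  by (auto simp: C1_def)

lemma C1_coord: "C1 (\<lambda>x. x $ j) (\<lambda>i x. if i = j then 1 else 0)"
  unfolding C1_def
  by (auto intro!: continuous_intros derivative_eq_intros simp: axis_def)

lemma C1_add: "C1 f G \<Longrightarrow> C1 f' G' \<Longrightarrow> C1 (\<lambda>x. f x + f' x) (\<lambda>i x. G i x + G' i x)"
  unfolding C1_def by (auto intro!: continuous_intros DERIV_add)

lemma C1_mult: "C1 f G \<Longrightarrow> C1 f' G' \<Longrightarrow> C1 (\<lambda>x. f x * f' x) (\<lambda>i x. G i x * f' x + f x * G' i x)"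
  unfolding C1_def
proof (intro conjI ballI allI, goal_cases)
  case (3 x i)
  then have "((\<lambda>t. f (x + t *\<^sub>R axis i 1)) has_real_derivative G i x) (at 0)"
    "((\<lambda>t. f' (x + t *\<^sub>R axis i 1)) has_real_derivative G' i x) (at 0)" by auto
  from DERIV_mult[OF this] show ?case by (simp add: algebra_simps)
qed (auto intro!: continuous_intros)

lemma C1_compose:
  fixes f :: "real^'n::finite \<Rightarrow> real"
  assumes f: "C1 f G" and \<phi>: "\<And>t. (\<phi> has_real_derivative \<phi>' t) (at t)" "continuous_on UNIV \<phi>'"
  shows "C1 (\<lambda>x. \<phi> (f x)) (\<lambda>i x. \<phi>' (f x) * G i x)"
proof -
  have c: "continuous_on UNIV \<phi>"
    by (rule DERIV_continuous_on) (rule has_field_derivative_at_within[OF \<phi>(1)])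
  have *: "continuous_on orthant (\<lambda>x. \<psi> (f x))" if "continuous_on UNIV \<psi>" for \<psi> :: "real \<Rightarrow> real"
    by (rule continuous_on_compose2[OF that C1D(1)[OF f]]) auto
  show ?thesis
    unfolding C1_def
  proof (intro conjI ballI allI)
    show "continuous_on orthant (\<lambda>x. \<phi> (f x))" by (rule *[OF c])
    show "continuous_on orthant (\<lambda>x. \<phi>' (f x) * G i x)" for i
      by (intro continuous_on_mult * \<phi> C1D(2)[OF f])
    fix x :: "real^'n" and i assume x: "x \<in> open_orthant"
    show "((\<lambda>t. \<phi> (f (x + t *\<^sub>R axis i 1))) has_real_derivative \<phi>' (f x) * G i x) (at 0)"
      using DERIV_chain2[OF \<phi>(1) C1D(3)[OF f x, of i]] by simp
  qed
qed

text \<open>The smoothness part of \<open>Cck 2\<close> in iterated form, for which sums, products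
  and compositions are immediate; \<open>Cck2_iff\<close> relates the two.\<close>

definition C2 :: "(real^'n::finite \<Rightarrow> real) \<Rightarrow> bool" where
  "C2 f \<longleftrightarrow> (\<exists>G. C1 f G \<and> (\<forall>i. \<exists>H. C1 (G i) H))"

lemma C2_C1: "C2 f \<Longrightarrow> C1 f (\<lambda>i. pd i f)"
proof -
  assume "C2 f"
  then obtain G where G: "C1 f G" by (auto simp: C2_def)
  show ?thesis by (rule C1_cong[OF G]) (simp add: pd_eq[OF G])
qed

lemma C1_cong_fun:
  fixes f :: "real^'n::finite \<Rightarrow> real"
  assumes "C1 f G" "\<And>x. x \<in> orthant \<Longrightarrow> f x = g x"
  shows "C1 g G"
  unfolding C1_def
proof (intro conjI ballI allI)
  show "continuous_on orthant g" using C1D(1)[OF assms(1)] assms(2) by (simp cong: continuous_on_cong)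
  show "continuous_on orthant (G i)" for i by (rule C1D(2)[OF assms(1)])
  fix x :: "real^'n" and i assume x: "x \<in> open_orthant"
    have "\<forall>\<^sub>F t in nhds (0::real). x + t *\<^sub>R axis i 1 \<in> open_orthant"
      by (rule eventually_line) (auto intro: open_open_orthant simp: x)
  then have "\<forall>\<^sub>F t in nhds (0::real). f (x + t *\<^sub>R axis i 1) = g (x + t *\<^sub>R axis i 1)"
    by eventually_elim (use assms(2) open_orthant_subset in auto)
  then show "((\<lambda>t. g (x + t *\<^sub>R axis i 1)) has_real_derivative G i x) (at 0)"
    by (rule deriv_transform_nhds[OF C1D(3)[OF assms(1) x, of i]])
qed

lemma C2_pd: "C2 f \<Longrightarrow> \<exists>H. C1 (pd i f) H"
proof -
  assume "C2 f"
  then obtain G H where G: "C1 f G" "C1 (G i) H" by (fastforce simp: C2_def)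
  have "C1 (pd i f) H" by (rule C1_cong_fun[OF G(2)]) (simp add: pd_eq[OF G(1)])
  then show ?thesis by blast
qed

lemma C2I: "C1 f G \<Longrightarrow> (\<And>i. \<exists>H. C1 (G i) H) \<Longrightarrow> C2 f"
  by (auto simp: C2_def)

lemma C2_const: "C2 (\<lambda>_. c)"
  by (rule C2I[OF C1_const]) (use C1_const in blast)

lemma C2_coord: "C2 (\<lambda>x. x $ j)"
  by (rule C2I[OF C1_coord]) (use C1_const in blast)

lemma C2_add: "C2 f \<Longrightarrow> C2 g \<Longrightarrow> C2 (\<lambda>x. f x + g x)"
proof -
  assume f: "C2 f" "C2 g"
  show ?thesis
  proof (rule C2I[OF C1_add[OF f[THEN C2_C1]]])
    fix i obtain H H' where "C1 (pd i f) H" "C1 (pd i g) H'" using f[THEN C2_pd] by blast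
    from C1_add[OF this] show "\<exists>H. C1 (\<lambda>x. pd i f x + pd i g x) H" by blast
  qed
qed

lemma C2_mult: "C2 f \<Longrightarrow> C2 g \<Longrightarrow> C2 (\<lambda>x. f x * g x)"
proof -
  assume f: "C2 f" "C2 g"
  show ?thesis
  proof (rule C2I[OF C1_mult[OF f[THEN C2_C1]]])
    fix i obtain H H' where "C1 (pd i f) H" "C1 (pd i g) H'" using f[THEN C2_pd] by blast
    from C1_add[OF C1_mult[OF this(1) C2_C1[OF f(2)]] C1_mult[OF C2_C1[OF f(1)] this(2)]]
    show "\<exists>H. C1 (\<lambda>x. pd i f x * g x + f x * pd i g x) H" by blast
  qed
qed

lemma C2_compose:
  assumes f: "C2 f" and \<phi>: "\<And>t. (\<phi> has_real_derivative \<phi>' t) (at t)" "\<And>t. (\<phi>' has_real_derivative \<phi>'' t) (at t)"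
    "continuous_on UNIV \<phi>''"
  shows "C2 (\<lambda>x. \<phi> (f x))"
proof -
  have c: "continuous_on UNIV \<phi>'"
    by (rule DERIV_continuous_on) (rule has_field_derivative_at_within[OF \<phi>(2)])
  show ?thesis
  proof (rule C2I[OF C1_compose[OF C2_C1[OF f] \<phi>(1) c]])
    fix i obtain H where "C1 (pd i f) H" using C2_pd[OF f] by blast
    from C1_mult[OF C1_compose[OF C2_C1[OF f] \<phi>(2,3)] this]
    show "\<exists>H. C1 (\<lambda>x. \<phi>' (f x) * pd i f x) H" by blast
  qed
qed

lemma C2_prod: "finite I \<Longrightarrow> (\<And>j. j \<in> I \<Longrightarrow> C2 (f j)) \<Longrightarrow> C2 (\<lambda>x. \<Prod>j\<in>I. f j x)"
  by (induction I rule: finite_induct) (auto intro: C2_const C2_mult)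

lemma C2_sum: "finite I \<Longrightarrow> (\<And>j. j \<in> I \<Longrightarrow> C2 (f j)) \<Longrightarrow> C2 (\<lambda>x. \<Sum>j\<in>I. f j x)"
  by (induction I rule: finite_induct) (auto intro: C2_const C2_add)

lemma C2_continuous: "C2 f \<Longrightarrow> continuous_on orthant f" "C2 f \<Longrightarrow> continuous_on orthant (pd i f)"
  using C1D[OF C2_C1] by auto

lemma pd_add: "C2 f \<Longrightarrow> C2 g \<Longrightarrow> x \<in> orthant \<Longrightarrow> pd i (\<lambda>x. f x + g x) x = pd i f x + pd i g x"
  by (rule pd_eq[OF C1_add[OF C2_C1 C2_C1]])

lemma pd_const: "x \<in> orthant \<Longrightarrow> pd i (\<lambda>_. c) x = 0"
  by (rule pd_eq[OF C1_const])

lemma pd_mult: "C2 f \<Longrightarrow> C2 g \<Longrightarrow> x \<in> orthant \<Longrightarrow> pd i (\<lambda>x. f x * g x) x = pd i f x * g x + f x * pd i g x"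
  by (rule pd_eq[OF C1_mult[OF C2_C1 C2_C1]])

lemma pd_compose:
  assumes "C2 f" "\<And>t. (\<phi> has_real_derivative \<phi>' t) (at t)" "continuous_on UNIV \<phi>'" "x \<in> orthant"
  shows "pd i (\<lambda>x. \<phi> (f x)) x = \<phi>' (f x) * pd i f x"
  by (rule pd_eq[OF C1_compose[OF C2_C1]]) (use assms in auto)

lemma pd_scale: "C2 f \<Longrightarrow> x \<in> orthant \<Longrightarrow> pd i (\<lambda>x. c * f x) x = c * pd i f x"
  using pd_mult[OF C2_const[of c], of f x i] by (simp add: pd_const)

subsection \<open>Compact supports\<close>

lemma compactly_supported_iff:
  "compactly_supported_on orthant (f :: real^'n::finite \<Rightarrow> real) \<longleftrightarrow> (\<exists>R. \<forall>x\<in>orthant. R < norm x \<longrightarrow> f x = 0)"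
proof
  assume "compactly_supported_on orthant f"
  then have "bounded (orthant \<inter> closure {x \<in> orthant. f x \<noteq> 0})"
    unfolding compactly_supported_on_def by (rule compact_imp_bounded)
  then obtain R where R: "\<And>x. x \<in> orthant \<inter> closure {x \<in> orthant. f x \<noteq> 0} \<Longrightarrow> norm x \<le> R"
    unfolding bounded_iff by blast
  show "\<exists>R. \<forall>x\<in>orthant. R < norm x \<longrightarrow> f x = 0"
  proof (intro exI[of _ R] ballI impI)
    fix x :: "real^'n" assume x: "x \<in> orthant" "R < norm x"
    show "f x = 0"
    proof (rule ccontr)
      assume "f x \<noteq> 0"
      then have "x \<in> closure {x \<in> orthant. f x \<noteq> 0}" using x closure_subset[of "{x \<in> orthant. f x \<noteq> 0}"] by auto
      then show False using R[of x] x by simp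
    qed
  qed
next
  assume "\<exists>R. \<forall>x\<in>orthant. R < norm x \<longrightarrow> f x = 0"
  then obtain R where R: "\<And>x. x \<in> orthant \<Longrightarrow> R < norm x \<Longrightarrow> f x = 0" by blast
  have "{x \<in> orthant. f x \<noteq> 0} \<subseteq> cball 0 R" using R by (force simp: not_le[symmetric])
  then have "bounded (closure {x \<in> orthant. f x \<noteq> 0})"
    by (meson bounded_cball bounded_closure bounded_subset)
  then have "compact (closure {x \<in> orthant. f x \<noteq> 0})" by (simp add: compact_eq_bounded_closed)
  then show "compactly_supported_on orthant f"
    unfolding compactly_supported_on_def using closed_orthant by (intro closed_Int_compact)
qed

text \<open>In \<open>[j, i]\<close> the derivative in direction \<open>i\<close> is taken first,
  hence \<open>H i j\<close>.\<close>

lemma iter_partial_eq: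
  assumes "C1 f G" "\<And>i. C1 (G i) (H i)" "x \<in> open_orthant"
  shows "iter_partial [i] f x = G i x" "iter_partial [j, i] f x = H i j x"
proof -
  show 1: "iter_partial [i] f x = G i x" using partial_deriv_eq[OF assms(1,3)] by simp
  have "partial_deriv j (partial_deriv i f) x = H i j x"
    unfolding partial_deriv_def[of j]
  proof (rule DERIV_imp_deriv)
    have "\<forall>\<^sub>F t in nhds (0::real). x + t *\<^sub>R axis j 1 \<in> open_orthant"
      by (rule eventually_line) (auto intro: open_open_orthant simp: assms)
    then have "\<forall>\<^sub>F t in nhds (0::real). G i (x + t *\<^sub>R axis j 1) = partial_deriv i f (x + t *\<^sub>R axis j 1)"
      by eventually_elim (simp add: partial_deriv_eq[OF assms(1)])
    then show "((\<lambda>t. partial_deriv i f (x + t *\<^sub>R axis j 1)) has_real_derivative H i j x) (at 0)"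
      by (rule deriv_transform_nhds[OF C1D(3)[OF assms(2,3), of i j]])
  qed
  then show "iter_partial [j, i] f x = H i j x" by simp
qed

lemma Cck2_imp_C2:
  fixes f :: "real^'n::finite \<Rightarrow> real"
  assumes "f \<in> Cck 2" shows "C2 f"
proof -
  have f: "continuous_on orthant f" "k_times_cont_diff_on 2 open_orthant f"
    "\<And>js. length js \<le> 2 \<Longrightarrow> \<exists>g. continuous_on orthant g \<and> (\<forall>x\<in>open_orthant. g x = iter_partial js f x)"
    using assms by (auto simp: Cck_def)
  have diff: "(\<lambda>t. iter_partial js f (x + t *\<^sub>R axis i 1)) differentiable (at 0)"
    if "length js < 2" "x \<in> open_orthant" for js x i
    using f(2) that by (auto simp: k_times_cont_diff_on_def)
  have "\<exists>G. \<forall>i. continuous_on orthant (G i) \<and> (\<forall>x\<in>open_orthant. G i x = iter_partial [i] f x)"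
    using f(3)[of "[_]"] by (intro choice) simp
  then obtain G where G: "\<And>i. continuous_on orthant (G i)" "\<And>i x. x \<in> open_orthant \<Longrightarrow> G i x = iter_partial [i] f x"
    by blast
  have "\<exists>H. \<forall>j. continuous_on orthant (H j) \<and> (\<forall>x\<in>open_orthant. H j x = iter_partial [j, i] f x)" for i
    using f(3)[of "[_, i]"] by (intro choice) simp
  then obtain H where H: "\<And>i j. continuous_on orthant (H i j)" "\<And>i j x. x \<in> open_orthant \<Longrightarrow> H i j x = iter_partial [j, i] f x"
    by metis
  have der: "((\<lambda>t. iter_partial js f (x + t *\<^sub>R axis i 1)) has_real_derivative iter_partial (i # js) f x) (at 0)"
    if "length js < 2" "x \<in> open_orthant" for js x i
    using diff[OF that, of i] by (simp add: partial_deriv_def DERIV_deriv_iff_real_differentiable)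
  have C1f: "C1 f G"
    unfolding C1_def using f(1) G der[of "[]"] by auto
  have "C1 (G i) (H i)" for i
    unfolding C1_def
  proof (intro conjI allI ballI G H)
    fix x :: "real^'n" and j assume x: "x \<in> open_orthant"
    have "\<forall>\<^sub>F t in nhds (0::real). x + t *\<^sub>R axis j 1 \<in> open_orthant"
      by (rule eventually_line) (auto intro: open_open_orthant simp: x)
    then have "\<forall>\<^sub>F t in nhds (0::real). iter_partial [i] f (x + t *\<^sub>R axis j 1) = G i (x + t *\<^sub>R axis j 1)"
      by eventually_elim (simp only: G(2))
    then show "((\<lambda>t. G i (x + t *\<^sub>R axis j 1)) has_real_derivative H i j x) (at 0)"
      using deriv_transform_nhds[OF der[of "[i]" x j]] x H(2)[OF x] by simp
  qed
  with C1f show ?thesis by (auto simp: C2_def)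
qed

lemma C2_imp_Cck2:
  fixes f :: "real^'n::finite \<Rightarrow> real"
  assumes "C2 f" "\<And>x. x \<in> orthant \<Longrightarrow> R < norm x \<Longrightarrow> f x = 0"
  shows "f \<in> Cck 2"
proof -
  obtain G where G: "C1 f G" "\<forall>i. \<exists>H. C1 (G i) H" using assms(1) by (auto simp: C2_def)
  then obtain H where H: "\<And>i. C1 (G i) (H i)" by metis
  have js: "js = [] \<or> (\<exists>i. js = [i]) \<or> (\<exists>i j. js = [j, i])" if "length js \<le> 2" for js :: "'n list"
    using that by (cases js rule: list.exhaust; cases "tl js" rule: list.exhaust) (auto simp: neq_Nil_conv)
  have ext: "\<exists>g. continuous_on orthant g \<and> (\<forall>x\<in>open_orthant. g x = iter_partial js f x)" if "length js \<le> 2" for js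
    using js[OF that]
  proof (elim disjE exE)
    assume "js = []" then show ?thesis using C1D(1)[OF G(1)] by auto
  next
    fix i assume "js = [i]"
    then show ?thesis using C1D(2)[OF G(1)] iter_partial_eq(1)[OF G(1) H] by (intro exI[of _ "G i"]) auto
  next
    fix i j assume "js = [j, i]"
    then show ?thesis using C1D(2)[OF H] iter_partial_eq(2)[OF G(1) H] by (intro exI[of _ "H i j"]) auto
  qed
  have cont: "continuous_on open_orthant (iter_partial js f)" if jl: "length js \<le> 2" for js
  proof -
    obtain g where "continuous_on orthant g" "\<forall>x\<in>open_orthant. g x = iter_partial js f x" using ext[OF jl] by blast
    then show ?thesis using continuous_on_subset[OF _ open_orthant_subset, of g] by (simp cong: continuous_on_cong)
  qed
  have diff: "(\<lambda>t. iter_partial js f (x + t *\<^sub>R axis i 1)) differentiable (at 0)"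
    if jl: "length js < 2" and x: "x \<in> open_orthant" for js x i
  proof (cases js)
    case Nil
    then show ?thesis using C1D(3)[OF G(1) x, of i] by (auto simp: real_differentiable_def)
  next
    case (Cons j js')
    then have js: "js = [j]" using jl by auto
    have "\<forall>\<^sub>F t in nhds (0::real). x + t *\<^sub>R axis i 1 \<in> open_orthant"
      by (rule eventually_line) (auto intro: open_open_orthant simp: x)
    then have "\<forall>\<^sub>F t in nhds (0::real). G j (x + t *\<^sub>R axis i 1) = partial_deriv j f (x + t *\<^sub>R axis i 1)"
      by eventually_elim (simp add: partial_deriv_eq[OF G(1)])
    then have "((\<lambda>t. partial_deriv j f (x + t *\<^sub>R axis i 1)) has_real_derivative H j i x) (at 0)"
      by (rule deriv_transform_nhds[OF C1D(3)[OF H x, of j i]])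
    then show ?thesis unfolding js by (auto simp: real_differentiable_def)
  qed
  show ?thesis
    unfolding Cck_def k_times_cont_diff_on_def compactly_supported_iff
    using C1D(1)[OF G(1)] ext cont diff assms(2) by blast
qed

lemma Cck2_iff: "f \<in> Cck 2 \<longleftrightarrow> C2 f \<and> (\<exists>R. \<forall>x\<in>orthant. R < norm x \<longrightarrow> f x = 0)"
proof
  assume f: "f \<in> Cck 2"
  then have "compactly_supported_on orthant f" by (simp add: Cck_def)
  with Cck2_imp_C2[OF f] show "C2 f \<and> (\<exists>R. \<forall>x\<in>orthant. R < norm x \<longrightarrow> f x = 0)"
    by (simp add: compactly_supported_iff)
qed (use C2_imp_Cck2 in blast)

text \<open>In the interior the function is locally zero along coordinate lines; boundary points of
  \<open>U\<close> are limits of interior points of \<open>U\<close>, where the derivative already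
  vanishes.\<close>

lemma pd_eq_0:
  fixes x :: "real^'n::finite"
  assumes f: "C2 f" and U: "open U" "\<And>y. y \<in> orthant \<Longrightarrow> y \<in> U \<Longrightarrow> f y = 0" and x: "x \<in> orthant" "x \<in> U"
  shows "pd i f x = 0"
proof -
  have int: "pd i f y = 0" if y: "y \<in> open_orthant" "y \<in> U" for y
  proof -
    have "\<forall>\<^sub>F t in nhds (0::real). y + t *\<^sub>R axis i 1 \<in> open_orthant \<inter> U"
      by (rule eventually_line) (auto intro: open_open_orthant U(1) simp: y)
    then have "\<forall>\<^sub>F t in nhds (0::real). f (y + t *\<^sub>R axis i 1) = 0"
      by eventually_elim (use U(2) open_orthant_subset in auto)
    then have "((\<lambda>t. 0) has_real_derivative pd i f y) (at 0)"
      by (rule deriv_transform_nhds[OF C1D(3)[OF C2_C1[OF f] y(1), of i]])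
    then show ?thesis using DERIV_const DERIV_unique by blast
  qed
  define y where "y k = x + inverse (real (Suc k)) *\<^sub>R 1" for k
  have y: "y \<longlonglongrightarrow> x" "\<And>k. y k \<in> open_orthant" using orthant_approx[OF x(1)] by (auto simp: y_def[abs_def])
  have "\<forall>\<^sub>F k in sequentially. y k \<in> U" by (rule topological_tendstoD[OF y(1) U(1) x(2)])
  then have "\<forall>\<^sub>F k in sequentially. pd i f (y k) = 0" by eventually_elim (use int y in blast)
  then have "(\<lambda>k. pd i f (y k)) \<longlonglongrightarrow> 0" by (rule tendsto_eventually)
  moreover have "(\<lambda>k. pd i f (y k)) \<longlonglongrightarrow> pd i f x"
    using continuous_on_tendsto_compose[OF C2_continuous(2)[OF f] y(1) x(1)] y(2) open_orthant_subset
    by (auto intro: always_eventually)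
  ultimately show ?thesis using LIMSEQ_unique by blast
qed

lemma Cck2_bounded:
  fixes f :: "real^'n::finite \<Rightarrow> real"
  assumes "f \<in> Cck 2"
  obtains R B where "\<And>x. x \<in> orthant \<Longrightarrow> R < norm x \<Longrightarrow> f x = 0" "\<And>x i. x \<in> orthant \<Longrightarrow> R < norm x \<Longrightarrow> pd i f x = 0"
    "\<And>x. x \<in> orthant \<Longrightarrow> \<bar>f x\<bar> \<le> B" "\<And>x i. x \<in> orthant \<Longrightarrow> \<bar>pd i f x\<bar> \<le> B"
proof -
  have f: "C2 f" using assms by (simp add: Cck2_iff)
  obtain R where R: "\<And>x. x \<in> orthant \<Longrightarrow> R < norm x \<Longrightarrow> f x = 0" using assms by (auto simp: Cck2_iff)
  have "open {x::real^'n. R < norm x}" by (intro open_Collect_less continuous_intros)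
  then have R': "pd i f x = 0" if "x \<in> orthant" "R < norm x" for x i
    using that R by (intro pd_eq_0[OF f, of "{x. R < norm x}"]) auto
  have K: "compact (orthant \<inter> cball (0::real^'n) R)"
    using closed_orthant by (intro closed_Int_compact compact_cball)
  have b: "\<exists>B. \<forall>x\<in>orthant. \<bar>g x\<bar> \<le> B" if "continuous_on orthant g" "\<And>x. x \<in> orthant \<Longrightarrow> R < norm x \<Longrightarrow> g x = 0"
    for g :: "real^'n \<Rightarrow> real"
  proof -
    have "bounded (g ` (orthant \<inter> cball 0 R))"
      by (intro compact_imp_bounded compact_continuous_image K continuous_on_subset[OF that(1)]) auto
    then obtain B where "\<forall>y\<in>g ` (orthant \<inter> cball 0 R). norm y \<le> B" unfolding bounded_iff by blast
    then have "\<And>x. x \<in> orthant \<inter> cball 0 R \<Longrightarrow> \<bar>g x\<bar> \<le> B" by simp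
    then have "\<bar>g x\<bar> \<le> max B 0" if "x \<in> orthant" for x
      using \<open>\<And>x. x \<in> orthant \<Longrightarrow> R < norm x \<Longrightarrow> g x = 0\<close>[OF that] that by (cases "norm x \<le> R") (auto simp: le_max_iff_disj)
    then show ?thesis by blast
  qed
  obtain B where B: "\<forall>x\<in>orthant. \<bar>f x\<bar> \<le> B" using b[OF C2_continuous(1)[OF f] R] by blast
  have "\<exists>B. \<forall>x\<in>orthant. \<bar>pd i f x\<bar> \<le> B" for i using b[OF C2_continuous(2)[OF f] R'] by blast
  then obtain B' where B': "\<And>i. \<forall>x\<in>orthant. \<bar>pd i f x\<bar> \<le> B' i" by metis
  define C where "C = max B (Max (range B'))"
  have C: "B \<le> C" "B' i \<le> C" for i unfolding C_def by (auto simp: le_max_iff_disj intro!: disjI2 Max_ge)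
  show ?thesis
  proof (rule that[OF R R'])
    show "\<bar>f x\<bar> \<le> C" if "x \<in> orthant" for x using B C(1) that by force
    show "\<bar>pd i f x\<bar> \<le> C" if "x \<in> orthant" for x i using B'[of i] C(2)[of i] that by force
  qed auto
qed

lemma Cck2_add: "f \<in> Cck 2 \<Longrightarrow> g \<in> Cck 2 \<Longrightarrow> (\<lambda>x. f x + g x) \<in> Cck 2"
proof -
  assume "f \<in> Cck 2" "g \<in> Cck 2"
  then obtain R R' where "C2 f" "C2 g" "\<And>x. x \<in> orthant \<Longrightarrow> R < norm x \<Longrightarrow> f x = 0"
    "\<And>x. x \<in> orthant \<Longrightarrow> R' < norm x \<Longrightarrow> g x = 0" unfolding Cck2_iff by blast
  then show ?thesis by (intro C2_imp_Cck2[of _ "max R R'"] C2_add) auto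
qed

lemma Cck2_mult: "f \<in> Cck 2 \<Longrightarrow> C2 g \<Longrightarrow> (\<lambda>x. f x * g x) \<in> Cck 2"
proof -
  assume "f \<in> Cck 2" "C2 g"
  then obtain R where "C2 f" "\<And>x. x \<in> orthant \<Longrightarrow> R < norm x \<Longrightarrow> f x = 0" unfolding Cck2_iff by blast
  then show ?thesis using \<open>C2 g\<close> by (intro C2_imp_Cck2[of _ R] C2_mult) auto
qed

lemma Cck2_scale: "f \<in> Cck 2 \<Longrightarrow> (\<lambda>x. c * f x) \<in> Cck 2"
  using Cck2_mult[OF _ C2_const[of c]] by (simp add: mult.commute)

lemma Cck2_compose:
  assumes "f \<in> Cck 2" and \<phi>: "\<And>t. (\<phi> has_real_derivative \<phi>' t) (at t)" "\<And>t. (\<phi>' has_real_derivative \<phi>'' t) (at t)"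
    "continuous_on UNIV \<phi>''" "\<phi> 0 = 0"
  shows "(\<lambda>x. \<phi> (f x)) \<in> Cck 2"
proof -
  obtain R where "C2 f" "\<And>x. x \<in> orthant \<Longrightarrow> R < norm x \<Longrightarrow> f x = 0" using assms(1) unfolding Cck2_iff by blast
  then show ?thesis using \<phi> by (intro C2_imp_Cck2[of _ R] C2_compose[OF _ \<phi>(1-3)]) auto
qed

subsection \<open>Bump functions, cutoffs and smooth contractions\<close>

lemma DERIV_max_power:
  "((\<lambda>t::real. max 0 t ^ Suc (Suc n)) has_real_derivative real (Suc (Suc n)) * max 0 t ^ Suc n) (at t)"
proof (cases t "0::real" rule: linorder_cases)
  case less
  have "((\<lambda>t::real. 0) has_real_derivative 0) (at t)" by simp
  then have "((\<lambda>t::real. max 0 t ^ Suc (Suc n)) has_real_derivative 0) (at t)"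
    by (rule has_field_derivative_transform_within_open[where S="{..<0}"]) (use less in auto)
  then show ?thesis using less by simp
next
  case greater
  have "((\<lambda>t::real. t ^ Suc (Suc n)) has_real_derivative real (Suc (Suc n)) * t ^ Suc n) (at t)"
    using DERIV_pow[of "Suc (Suc n)" t UNIV] by simp
  then have "((\<lambda>t::real. max 0 t ^ Suc (Suc n)) has_real_derivative real (Suc (Suc n)) * t ^ Suc n) (at t)"
    by (rule has_field_derivative_transform_within_open[where S="{0<..}"]) (use greater in auto)
  then show ?thesis using greater by simp
next
  case equal
  have "((\<lambda>h::real. max 0 h ^ Suc (Suc n) / h) \<longlongrightarrow> 0) (at 0)"
  proof (rule Lim_null_comparison)
    show "\<forall>\<^sub>F h in at (0::real). norm (max 0 h ^ Suc (Suc n) / h) \<le> \<bar>h\<bar> ^ Suc n"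
    proof (rule always_eventually, rule allI)
      fix h :: real
      show "norm (max 0 h ^ Suc (Suc n) / h) \<le> \<bar>h\<bar> ^ Suc n"
      proof (cases "h > 0")
        case False
        then have "max 0 h ^ Suc (Suc n) / h = 0" by simp
        then show ?thesis by (simp only: norm_zero zero_le_power abs_ge_zero)
      qed simp
    qed
    have "((\<lambda>h::real. \<bar>h\<bar> ^ Suc n) \<longlongrightarrow> \<bar>0\<bar> ^ Suc n) (at 0)" by (intro tendsto_intros)
    then show "((\<lambda>h::real. \<bar>h\<bar> ^ Suc n) \<longlongrightarrow> 0) (at 0)" by simp
  qed
  then show ?thesis unfolding equal DERIV_def by simp
qed

text \<open>The cube is the lowest integer power of the positive part that is twice continuously
  differentiable.\<close>

lemma C2_max_power3: "C2 f \<Longrightarrow> C2 (\<lambda>x. max 0 (f x) ^ 3)"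
proof (rule C2_compose[where \<phi>="\<lambda>t. max 0 t ^ 3" and \<phi>'="\<lambda>t. 3 * max 0 t ^ 2" and \<phi>''="\<lambda>t. 3 * (2 * max 0 t)"])
  show "((\<lambda>t. max 0 t ^ 3) has_real_derivative 3 * max 0 t ^ 2) (at t)" for t :: real
    using DERIV_max_power[of 1 t] by (simp add: numeral_eq_Suc)
  show "((\<lambda>t. 3 * max 0 t ^ 2) has_real_derivative 3 * (2 * max 0 t)) (at t)" for t :: real
    using DERIV_cmult[OF DERIV_max_power[of 0 t], of 3] by (simp add: numeral_eq_Suc)
  show "continuous_on UNIV (\<lambda>t::real. 3 * (2 * max 0 t))" by (intro continuous_intros)
qed

definition box_fun :: "real^'n::finite \<Rightarrow> real^'n \<Rightarrow> real^'n \<Rightarrow> real" where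
  "box_fun a b x = (\<Prod>j\<in>UNIV. max 0 (x $ j - a $ j) ^ 3 * max 0 (b $ j - x $ j) ^ 3)"

text \<open>The function s -> m s^2 / (1 + m s^2) is smooth with values in [0, 1), vanishes at 0
  together with its derivative, and tends to 1 for s distinct from 0. So the bumps for growing m
  approximate the indicator of the open box.\<close>

definition bump :: "real^'n::finite \<Rightarrow> real^'n \<Rightarrow> nat \<Rightarrow> real^'n \<Rightarrow> real" where
  "bump a b m x = real m * (box_fun a b x)\<^sup>2 / (1 + real m * (box_fun a b x)\<^sup>2)"

lemma C2_box_fun: "C2 (box_fun a b)"
proof -
  have "C2 (\<lambda>x. x $ j - a $ j)" "C2 (\<lambda>x. b $ j - x $ j)" for j
    using C2_add[OF C2_coord[of j] C2_const[of "- a $ j"]]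
      C2_add[OF C2_const[of "b $ j"] C2_mult[OF C2_const[of "-1"] C2_coord[of j]]] by auto
  then show ?thesis unfolding box_fun_def[abs_def] by (intro C2_prod C2_mult C2_max_power3) auto
qed

lemma box_fun_nonzero_iff: "box_fun a b x \<noteq> 0 \<longleftrightarrow> x \<in> box a b"
proof -
  have "max 0 u ^ 3 * max 0 v ^ 3 \<noteq> 0 \<longleftrightarrow> 0 < u \<and> 0 < v" for u v :: real by (auto simp: max_def)
  then have "box_fun a b x \<noteq> 0 \<longleftrightarrow> (\<forall>j. 0 < x $ j - a $ j \<and> 0 < b $ j - x $ j)"
    unfolding box_fun_def by (subst prod_zero_iff) auto
  then show ?thesis by (simp add: mem_box_cart)
qed

lemma psi_pos: "1 + real m * s\<^sup>2 > 0"
  by (meson add_pos_nonneg mult_nonneg_nonneg of_nat_0_le_iff zero_le_power2 zero_less_one)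

lemma psi_deriv:
  "((\<lambda>s. real m * s\<^sup>2 / (1 + real m * s\<^sup>2)) has_real_derivative 2 * real m * s / (1 + real m * s\<^sup>2)\<^sup>2) (at s)"
  using psi_pos[of m s]
  by (auto intro!: derivative_eq_intros simp: power2_eq_square field_simps)

lemma psi_deriv2:
  "((\<lambda>s. 2 * real m * s / (1 + real m * s\<^sup>2)\<^sup>2) has_real_derivative
     2 * real m / (1 + real m * s\<^sup>2)\<^sup>2 - 2 * real m * s * (4 * real m * s / (1 + real m * s\<^sup>2) ^ 3)) (at s)"
proof -
  have "((\<lambda>s. 1 / (1 + real m * s\<^sup>2)\<^sup>2) has_real_derivative - (4 * real m * s / (1 + real m * s\<^sup>2) ^ 3)) (at s)"
  proof -
    have "((\<lambda>w. 1 / w\<^sup>2) has_real_derivative - (2 / w ^ 3)) (at w)" if "w \<noteq> 0" for w :: real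
      using that by (auto intro!: derivative_eq_intros simp: divide_simps power2_eq_square power3_eq_cube)
    moreover have "((\<lambda>s. 1 + real m * s\<^sup>2) has_real_derivative 2 * real m * s) (at s)"
      by (auto intro!: derivative_eq_intros)
    ultimately have "((\<lambda>s. 1 / (1 + real m * s\<^sup>2)\<^sup>2) has_real_derivative - (2 / (1 + real m * s\<^sup>2) ^ 3) * (2 * real m * s)) (at s)"
      using psi_pos[of m s] by (intro DERIV_chain2[where f="\<lambda>w. 1 / w\<^sup>2"]) auto
    then show ?thesis by (simp add: mult.assoc)
  qed
  from DERIV_mult[OF DERIV_cmult[OF DERIV_ident, of "2 * real m"] this]
  show ?thesis by (simp add: algebra_simps)
qed

lemma C2_bump: "C2 (bump a b m)"
  unfolding bump_def[abs_def]
proof (rule C2_compose[OF C2_box_fun psi_deriv psi_deriv2])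
  have "1 + real m * s\<^sup>2 \<noteq> 0" for s using psi_pos[of m s] by simp
  then show "continuous_on UNIV (\<lambda>s. 2 * real m / (1 + real m * s\<^sup>2)\<^sup>2 - 2 * real m * s * (4 * real m * s / (1 + real m * s\<^sup>2) ^ 3))"
    by (intro continuous_intros) auto
qed

text \<open>The chain rule produces the derivative of the outer function at 0, which is 0; this
  includes the boundary of the box.\<close>

lemma pd_bump_outside:
  assumes "x \<in> orthant" "x \<notin> box a b" shows "pd i (bump a b m) x = 0"
proof -
  have "1 + real m * s\<^sup>2 \<noteq> 0" for s using psi_pos[of m s] by simp
  then have "continuous_on UNIV (\<lambda>s. 2 * real m * s / (1 + real m * s\<^sup>2)\<^sup>2)" by (intro continuous_intros) auto
  from pd_compose[OF C2_box_fun psi_deriv this assms(1)] show ?thesis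
    using assms(2) box_fun_nonzero_iff[of a b x] by (auto simp: bump_def[abs_def])
qed

lemma bump_range: "0 \<le> bump a b m x" "bump a b m x \<le> 1"
  using psi_pos[of m "box_fun a b x"] by (auto simp: bump_def)

lemma bump_outside: "x \<notin> box a b \<Longrightarrow> bump a b m x = 0"
  using box_fun_nonzero_iff[of a b x] by (simp add: bump_def)

lemma bump_tendsto: "(\<lambda>m. bump a b m x) \<longlonglongrightarrow> indicator (box a b) x"
proof (cases "x \<in> box a b")
  case True
  define s where "s = (box_fun a b x)\<^sup>2"
  have s: "s > 0" using True box_fun_nonzero_iff[of a b x] by (simp add: s_def)
  have "filterlim (\<lambda>m. 1 + s * real m) at_top sequentially"
    by (intro filterlim_tendsto_add_at_top[OF tendsto_const] filterlim_tendsto_pos_mult_at_top[OF tendsto_const s]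
        filterlim_real_sequentially)
  then have "(\<lambda>m. 1 - inverse (1 + s * real m)) \<longlonglongrightarrow> 1 - 0"
    by (intro tendsto_intros tendsto_inverse_0_at_top)
  moreover have "1 - inverse (1 + s * real m) = bump a b m x" for m
  proof -
    have "1 + s * real m > 0" using s by (simp add: add_pos_nonneg)
    then show ?thesis by (simp add: bump_def s_def[symmetric] field_simps)
  qed
  ultimately show ?thesis using True by simp
qed (simp add: bump_outside)

lemma bump_Cck2: "bump a b m \<in> Cck 2"
proof -
  obtain R where R: "\<And>x. x \<in> box a b \<Longrightarrow> norm x \<le> R" using bounded_box[of a b] unfolding bounded_iff by blast
  show ?thesis
    by (rule C2_imp_Cck2[of _ R]) (use R in \<open>auto intro!: C2_bump bump_outside simp: not_le[symmetric]\<close>)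
qed

text \<open>Equal to 1 for |x|^2 <= R and to 0 for |x|^2 >= 2 R. Dividing by R makes the gradient at
  most of order |x| / R on the support, that is, of order R^(-1/2).\<close>

definition cutoff :: "real \<Rightarrow> real^'n::finite \<Rightarrow> real" where
  "cutoff R x = max 0 (1 - max 0 ((norm x)\<^sup>2 / R - 1) ^ 3) ^ 3"

lemma norm_vec_square: "(norm (x::real^'n::finite))\<^sup>2 = (\<Sum>j\<in>UNIV. x $ j * x $ j)"
  by (simp add: power2_norm_eq_inner inner_vec_def)

lemma C1_norm_square: "C1 (\<lambda>x::real^'n::finite. (norm x)\<^sup>2 / R - 1) (\<lambda>i x. 2 * x $ i / R)"
proof -
  have sum: "C1 (\<lambda>x::real^'n. \<Sum>j\<in>I. x $ j * x $ j) (\<lambda>i x. \<Sum>j\<in>I. (if i = j then 1 else 0) * x $ j + x $ j * (if i = j then 1 else 0))"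
    if "finite I" for I
    using that
  proof (induction I rule: finite_induct)
    case empty show ?case by (simp only: sum.empty C1_const)
  next
    case (insert k I)
    from C1_add[OF C1_mult[OF C1_coord[of k] C1_coord[of k]] insert(3)]
    show ?case unfolding sum.insert[OF insert(1,2)] .
  qed
  have eq: "(\<Sum>j\<in>UNIV. (if i = j then 1 else 0) * x $ j + x $ j * (if i = j then 1 else 0)) = 2 * x $ i" for i and x :: "real^'n"
    by (simp add: sum.distrib if_distrib[where f="\<lambda>c. c * _"] if_distrib[where f="\<lambda>c. _ * c"] sum.delta cong: if_cong)
  have "C1 (\<lambda>x::real^'n. (norm x)\<^sup>2) (\<lambda>i x. 2 * x $ i)"
    using sum[of UNIV] unfolding norm_vec_square eq by simp
  moreover have "((\<lambda>t. t / R - 1) has_real_derivative 1 / R) (at t)" for t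
    using DERIV_diff[OF DERIV_cdivide[OF DERIV_ident] DERIV_const[of 1], of R t UNIV] by simp
  ultimately have "C1 (\<lambda>x::real^'n. (norm x)\<^sup>2 / R - 1) (\<lambda>i x. 1 / R * (2 * x $ i))"
    by (rule C1_compose) (rule continuous_on_const)
  then show ?thesis by simp
qed

lemma C2_cutoff: "C2 (cutoff R :: real^'n::finite \<Rightarrow> real)"
proof -
  have "C2 (\<lambda>x::real^'n. (norm x)\<^sup>2)" unfolding norm_vec_square by (intro C2_sum C2_mult C2_coord) auto
  then have "C2 (\<lambda>x::real^'n. (1 / R) * (norm x)\<^sup>2 + (- 1))" by (intro C2_add C2_mult C2_const)
  then have q: "C2 (\<lambda>x::real^'n. (norm x)\<^sup>2 / R - 1)" by simp
  have "C2 (\<lambda>x::real^'n. 1 + (- 1) * max 0 ((norm x)\<^sup>2 / R - 1) ^ 3)" by (intro C2_add C2_mult C2_const C2_max_power3 q)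
  then show ?thesis unfolding cutoff_def[abs_def] by (intro C2_max_power3) simp
qed

lemma cutoff_range: "0 \<le> cutoff R x" "cutoff R x \<le> 1"
  by (auto simp: cutoff_def intro!: power_le_one)

lemma cutoff_eq_1: "R > 0 \<Longrightarrow> (norm x)\<^sup>2 \<le> R \<Longrightarrow> cutoff R x = 1"
proof -
  assume "R > 0" "(norm x)\<^sup>2 \<le> R"
  then have "(norm x)\<^sup>2 / R - 1 \<le> 0" by simp
  then show ?thesis by (simp add: cutoff_def max_def)
qed

lemma cutoff_eq_0: assumes "R > 0" "2 * R \<le> (norm x)\<^sup>2" shows "cutoff R x = 0"
proof -
  have "1 \<le> (norm x)\<^sup>2 / R - 1" using assms by (simp add: le_divide_eq)
  then have "1 \<le> max 0 ((norm x)\<^sup>2 / R - 1) ^ 3" by (intro one_le_power) simp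
  then show ?thesis by (simp add: cutoff_def)
qed

lemma cutoff_Cck2: "R > 0 \<Longrightarrow> cutoff R \<in> Cck 2"
proof (rule C2_imp_Cck2[OF C2_cutoff])
  fix x :: "real^'n" assume R: "R > 0" and "sqrt (2 * R) < norm x"
  then have "(sqrt (2 * R))\<^sup>2 \<le> (norm x)\<^sup>2" by (intro power_mono) auto
  then show "cutoff R x = 0" using R by (intro cutoff_eq_0) auto
qed

text \<open>The factor 18 is 3 * 3 * 2, from the two cubes and the square; where the derivative does
  not vanish, |x_i| is at most sqrt (2 R).\<close>

lemma pd_cutoff_bound:
  fixes x :: "real^'n::finite"
  assumes R: "R > 0" and x: "x \<in> orthant"
  shows "\<bar>pd i (cutoff R) x\<bar> \<le> 18 * sqrt (2 * R) / R"
proof -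
  have d3: "((\<lambda>t. max 0 t ^ 3) has_real_derivative 3 * max 0 t ^ 2) (at t)" for t :: real
    using DERIV_max_power[of 1 t] by (simp add: numeral_eq_Suc)
  have c3: "continuous_on UNIV (\<lambda>t::real. 3 * max 0 t ^ 2)" by (intro continuous_intros)
  define q where "q = (norm x)\<^sup>2 / R - 1"
  have "C1 (\<lambda>x::real^'n. 1 + (-1) * max 0 ((norm x)\<^sup>2 / R - 1) ^ 3)
      (\<lambda>i x. 0 + (0 * max 0 ((norm x)\<^sup>2 / R - 1) ^ 3 + (- 1) * (3 * (max 0 ((norm x)\<^sup>2 / R - 1))\<^sup>2 * (2 * x $ i / R))))"
    by (intro C1_add C1_mult C1_const C1_compose[OF C1_norm_square d3 c3])
  from pd_eq[OF C1_compose[OF this d3 c3] x, of i]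
  have eq: "pd i (cutoff R) x = 3 * (max 0 (1 - max 0 q ^ 3))\<^sup>2 * (- (3 * (max 0 q)\<^sup>2 * (2 * x $ i / R)))"
    by (simp add: cutoff_def[abs_def] q_def)
  show ?thesis
  proof (cases "q \<le> 1")
    case False
    then have "1 \<le> max 0 q ^ 3" by (intro one_le_power) simp
    then show ?thesis using R by (simp add: eq)
  next
    case True
    have "(norm x)\<^sup>2 \<le> 2 * R" using True R by (simp add: q_def divide_le_eq)
    then have "norm x \<le> sqrt (2 * R)" using real_le_rsqrt by blast
    then have xi: "\<bar>x $ i\<bar> \<le> sqrt (2 * R)" using component_le_norm_cart[of x i] by linarith
    have 1: "0 \<le> max 0 q ^ 3" by simp
    have "\<bar>pd i (cutoff R) x\<bar> = 9 * (max 0 (1 - max 0 q ^ 3))\<^sup>2 * (max 0 q)\<^sup>2 * (2 * \<bar>x $ i\<bar> / R)"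
      using R by (simp add: eq abs_mult)
    also have "\<dots> \<le> 9 * 1 * 1 * (2 * sqrt (2 * R) / R)"
      using True R xi 1 by (intro mult_mono divide_right_mono power_le_one mult_nonneg_nonneg) auto
    finally show ?thesis by simp
  qed
qed

text \<open>In max 0 t = (|t| + t) / 2 the modulus is replaced by sqrt (t^2 + e^2) - e. Subtracting
  e gives the value 0 at 0, so that composition preserves compact supports; the derivative stays in
  [0, 1].\<close>

definition soft_plus :: "real \<Rightarrow> real \<Rightarrow> real" where
  "soft_plus e t = (sqrt (t\<^sup>2 + e\<^sup>2) - e + t) / 2"

lemma soft_plus_0: "e > 0 \<Longrightarrow> soft_plus e 0 = 0"
  by (simp add: soft_plus_def)

lemma soft_plus_pos: "e > 0 \<Longrightarrow> t\<^sup>2 + e\<^sup>2 > (0::real)"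
  by (simp add: add_nonneg_pos)

lemma soft_plus_deriv:
  assumes "e > 0"
  shows "(soft_plus e has_real_derivative (t / sqrt (t\<^sup>2 + e\<^sup>2) + 1) / 2) (at t)"
  unfolding soft_plus_def[abs_def] using soft_plus_pos[OF assms, of t]
  by (auto intro!: derivative_eq_intros simp: divide_simps)

lemma soft_plus_deriv2:
  assumes "e > 0"
  shows "((\<lambda>t. (t / sqrt (t\<^sup>2 + e\<^sup>2) + 1) / 2) has_real_derivative
    (1 / sqrt (t\<^sup>2 + e\<^sup>2) - t * (t / sqrt (t\<^sup>2 + e\<^sup>2) ^ 3)) / 2) (at t)"
proof -
  have "((\<lambda>t. 1 / sqrt (t\<^sup>2 + e\<^sup>2)) has_real_derivative - (t / sqrt (t\<^sup>2 + e\<^sup>2) ^ 3)) (at t)"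
    using soft_plus_pos[OF assms, of t]
    by (auto intro!: derivative_eq_intros simp: divide_simps power3_eq_cube)
  from DERIV_cdivide[OF DERIV_add[OF DERIV_mult[OF DERIV_ident this] DERIV_const[of 1]], of 2]
  show ?thesis by (simp add: algebra_simps)
qed

lemma soft_plus_continuous_deriv2:
  assumes "e > 0"
  shows "continuous_on UNIV (\<lambda>t. (1 / sqrt (t\<^sup>2 + e\<^sup>2) - t * (t / sqrt (t\<^sup>2 + e\<^sup>2) ^ 3)) / 2)"
proof -
  show ?thesis using assms by (intro continuous_intros) (auto simp: sum_power2_eq_zero_iff)
qed

lemma soft_plus_deriv_range:
  assumes "e > 0"
  shows "0 \<le> (t / sqrt (t\<^sup>2 + e\<^sup>2) + 1) / 2" "(t / sqrt (t\<^sup>2 + e\<^sup>2) + 1) / 2 \<le> 1"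
proof -
  have "\<bar>t\<bar> \<le> sqrt (t\<^sup>2 + e\<^sup>2)" using real_sqrt_le_mono[of "t\<^sup>2" "t\<^sup>2 + e\<^sup>2"] by simp
  moreover have "sqrt (t\<^sup>2 + e\<^sup>2) > 0" using soft_plus_pos[OF assms, of t] by simp
  ultimately have "\<bar>t / sqrt (t\<^sup>2 + e\<^sup>2)\<bar> \<le> 1" by (simp add: abs_divide divide_le_eq)
  moreover have "0 \<le> (q + 1) / 2 \<and> (q + 1) / 2 \<le> 1" if "\<bar>q\<bar> \<le> 1" for q :: real
    using that by (auto simp: abs_le_iff)
  ultimately show "0 \<le> (t / sqrt (t\<^sup>2 + e\<^sup>2) + 1) / 2" "(t / sqrt (t\<^sup>2 + e\<^sup>2) + 1) / 2 \<le> 1" by blast+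
qed

lemma soft_plus_approx:
  assumes "e > 0" shows "\<bar>soft_plus e t - max 0 t\<bar> \<le> e"
proof -
  have "sqrt (t\<^sup>2 + e\<^sup>2) \<le> \<bar>t\<bar> + e"
    using assms by (intro real_le_lsqrt) (auto simp: power2_sum)
  moreover have "\<bar>t\<bar> \<le> sqrt (t\<^sup>2 + e\<^sup>2)" using real_sqrt_le_mono[of "t\<^sup>2" "t\<^sup>2 + e\<^sup>2"] by simp
  moreover have "\<bar>(r - e + t) / 2 - max 0 t\<bar> \<le> e" if "r \<le> \<bar>t\<bar> + e" "\<bar>t\<bar> \<le> r" for r
    using that assms by (cases "0 \<le> t") (auto simp: abs_if max_def field_simps)
  ultimately show ?thesis unfolding soft_plus_def by blast
qed

section \<open>The reference measures\<close>

abbreviation (input) half_line :: "'n set \<Rightarrow> 'n \<Rightarrow> real measure" where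
  "half_line B i \<equiv> (if i \<in> B then restrict_space lborel {0..} else return (restrict_space borel {0..}) 0)"

abbreviation (input) orthant_borel :: "(real^'n::finite) measure" where
  "orthant_borel \<equiv> restrict_space borel orthant"

lemma sets_half_line: "sets (half_line B i) = sets (restrict_space borel {0..})"
  by (simp add: sets_restrict_space)

lemma space_half_line: "space (half_line B i) = {0..}"
  by (simp add: space_restrict_space)

lemma sigma_finite_half_line: "sigma_finite_measure (half_line B i)"
proof (cases "i \<in> B")
  case True
  have "sigma_finite_measure (restrict_space lborel {0::real..})"
    by (rule sigma_finite_measure_restrict_space[OF lborel.sigma_finite_measure_axioms]) simp
  with True show ?thesis by simp
next
  case False
  have "prob_space (return (restrict_space borel {0..}) (0::real))"
    by (rule prob_space_return) (simp add: space_restrict_space)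
  then show ?thesis using False by (simp add: prob_space_imp_sigma_finite)
qed

interpretation half_line: product_sigma_finite "half_line B" for B :: "'n set"
  by (rule product_sigma_finite.intro) (rule sigma_finite_half_line)

lemma space_orthant_borel: "space orthant_borel = orthant"
  by (simp add: space_restrict_space)

lemma sets_orthant_borel: "A \<in> sets orthant_borel \<longleftrightarrow> A \<subseteq> orthant \<and> A \<in> sets borel"
  by (rule sets_restrict_space_iff) (simp add: closed_orthant borel_closed)

lemma measurable_vec_lambda:
  "(\<lambda>f. \<chi> i. f i) \<in> measurable (PiM UNIV (half_line B)) (orthant_borel :: (real^'n::finite) measure)"
proof (rule measurable_restrict_space2)
  show "(\<lambda>f. \<chi> i. f i) \<in> space (PiM UNIV (half_line B)) \<rightarrow> orthant"
    by (auto simp: space_PiM orthant_def PiE_iff space_half_line simp del: if_split)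
  have "(\<lambda>f. f i) \<in> borel_measurable (PiM UNIV (half_line B))" for i
  proof -
    have "(\<lambda>f. f i) \<in> measurable (PiM UNIV (half_line B)) (half_line B i)"
      by (rule measurable_component_singleton) simp
    then have "(\<lambda>f. f i) \<in> measurable (PiM UNIV (half_line B)) (restrict_space borel {0..})"
      by (simp only: measurable_cong_sets[OF refl sets_half_line])
    then show ?thesis by (rule measurable_restrict_space2_iff[THEN iffD1, THEN conjunct1])
  qed
  then show "(\<lambda>f. (\<chi> i. f i) :: real^'n) \<in> borel_measurable (PiM UNIV (half_line B))"
    by (subst borel_measurable_euclidean_space) (auto simp: Basis_vec_def inner_axis)
qed

lemma sets_face_lebesgue: "sets (face_lebesgue B) = sets orthant_borel"
  by (simp add: face_lebesgue_def)

lemma space_face_lebesgue: "space (face_lebesgue B) = orthant"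
  by (simp add: face_lebesgue_def space_orthant_borel)

lemma emeasure_face_lebesgue_product:
  fixes B :: "'n::finite set"
  assumes A: "\<And>i. A i \<in> sets borel" "\<And>i. A i \<subseteq> {0..}"
  shows "emeasure (face_lebesgue B) {x. \<forall>i. x $ i \<in> A i} = (\<Prod>i\<in>UNIV. emeasure (half_line B i) (A i))"
    "{x::real^'n. \<forall>i. x $ i \<in> A i} \<in> sets orthant_borel"
proof -
  let ?S = "{x::real^'n. \<forall>i. x $ i \<in> A i}"
  have "?S = (\<Inter>i. (\<lambda>x. x $ i) -` A i)" by auto
  moreover have "(\<lambda>x::real^'n. x $ i) -` A i \<in> sets borel" for i
    using measurable_sets[of "\<lambda>x::real^'n. x $ i" borel borel "A i"] A(1)
    by (auto intro!: borel_measurable_continuous_onI continuous_intros)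
  ultimately have "?S \<in> sets borel" by (simp add: sets.countable_INT'')
  moreover have "?S \<subseteq> orthant" unfolding orthant_def using A(2) by fastforce
  ultimately show S: "?S \<in> sets orthant_borel" by (simp add: sets_orthant_borel)
  have "(\<lambda>f. \<chi> i. f i) -` ?S \<inter> space (PiM UNIV (half_line B)) = PiE UNIV A"
    using A(2) by (auto simp: space_PiM PiE_iff space_half_line simp del: if_split)
  then have "emeasure (face_lebesgue B) ?S = emeasure (PiM UNIV (half_line B)) (PiE UNIV A)"
    unfolding face_lebesgue_def using S measurable_vec_lambda[of B]
    by (subst emeasure_distr) auto
  also have "\<dots> = (\<Prod>i\<in>UNIV. emeasure (half_line B i) (A i))"
  proof (rule half_line.emeasure_PiM)
    show "A i \<in> sets (half_line B i)" for i
      using A unfolding sets_half_line by (subst sets_restrict_space_iff) auto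
  qed simp
  finally show "emeasure (face_lebesgue B) ?S = (\<Prod>i\<in>UNIV. emeasure (half_line B i) (A i))" .
qed

lemma emeasure_half_line:
  assumes "A \<in> sets borel" "A \<subseteq> {0..}"
  shows "emeasure (half_line B i) A = (if i \<in> B then emeasure lborel A else indicator A 0)"
proof (cases "i \<in> B")
  case True
  then show ?thesis using assms by (simp add: emeasure_restrict_space)
next
  case False
  have "A \<in> sets (restrict_space borel {0..})" using assms by (subst sets_restrict_space_iff) auto
  then show ?thesis using False by simp
qed

section \<open>The measures carried by the faces\<close>

lemma face_disjoint_cover:
  "x \<in> orthant \<Longrightarrow> x \<in> face {i. 0 < x $ i}" "x \<in> face B \<Longrightarrow> B = {i. 0 < x $ i}" "face B \<subseteq> orthant"
proof -
  show "x \<in> orthant \<Longrightarrow> x \<in> face {i. 0 < x $ i}" by (auto simp: orthant_def face_def not_less intro: antisym)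
  show "x \<in> face B \<Longrightarrow> B = {i. 0 < x $ i}" by (force simp: face_def)
  show "face B \<subseteq> orthant" unfolding face_def orthant_def by (force intro: less_imp_le)
qed

lemma AE_face: "AE x in face_lebesgue (B :: 'n::finite set). x \<in> face B"
proof -
  have "AE x in face_lebesgue B. x $ i \<in> (if i \<in> B then {0<..} else {0})" for i
  proof (rule AE_I)
    \<comment> \<open>Only the i-th factor is restricted, to a null set. The other factors may have
      infinite measure, and 0 * infinity = 0 in \<open>ennreal\<close>.\<close>
    define A :: "'n \<Rightarrow> real set" where "A j = (if j = i then (if i \<in> B then {0} else {0<..}) else {0..})" for j :: 'n
    have A: "A j \<in> sets borel" "A j \<subseteq> {0..}" for j by (auto simp: A_def)
    show "{x \<in> space (face_lebesgue B). x $ i \<notin> (if i \<in> B then {0<..} else {0})} \<subseteq> {x. \<forall>j. x $ j \<in> A j}"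
      by (auto simp: space_face_lebesgue orthant_def A_def not_less order.antisym less_le)
    have "emeasure (half_line B i) (A i) = 0"
      unfolding emeasure_half_line[OF A] by (auto simp: A_def)
    then show "emeasure (face_lebesgue B) {x. \<forall>j. x $ j \<in> A j} = 0"
      unfolding emeasure_face_lebesgue_product[OF A] by (intro prod_zero[OF finite] bexI[OF _ UNIV_I])
    show "{x. \<forall>j. x $ j \<in> A j} \<in> sets (face_lebesgue B)"
      unfolding sets_face_lebesgue by (rule emeasure_face_lebesgue_product[OF A])
  qed
  then have "AE x in face_lebesgue B. \<forall>i. x $ i \<in> (if i \<in> B then {0<..} else {0})"
    by (subst AE_all_countable) auto
  then show ?thesis by eventually_elim (auto simp: face_def split: if_splits)
qed

lemma emeasure_face_lebesgue_bounded:
  "emeasure (face_lebesgue (B::'n::finite set)) (orthant \<inter> cball 0 R) < \<infinity>"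
proof -
  have A: "{0..R} \<in> sets borel" "{0..R} \<subseteq> {0..}" by auto
  have "emeasure (face_lebesgue B) (orthant \<inter> cball 0 R) \<le> emeasure (face_lebesgue B) {x. \<forall>i. x $ i \<in> {0..R}}"
  proof (rule emeasure_mono)
    show "orthant \<inter> cball 0 R \<subseteq> {x::real^'n. \<forall>i. x $ i \<in> {0..R}}"
    proof
      fix x :: "real^'n" assume x: "x \<in> orthant \<inter> cball 0 R"
      have "\<bar>x $ i\<bar> \<le> R" for i using component_le_norm_cart[of x i] x by auto
      then show "x \<in> {x. \<forall>i. x $ i \<in> {0..R}}" using x by (auto simp: orthant_def abs_le_iff)
    qed
    show "{x. \<forall>i. x $ i \<in> {0..R}} \<in> sets (face_lebesgue B)"
      unfolding sets_face_lebesgue by (rule emeasure_face_lebesgue_product) auto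
  qed
  also have "\<dots> = (\<Prod>i\<in>UNIV. emeasure (half_line B i) {0..R})"
    by (rule emeasure_face_lebesgue_product) auto
  also have "\<dots> < \<infinity>"
    unfolding emeasure_half_line[OF A] by (auto simp: less_top[symmetric] ennreal_prod_eq_top indicator_def)
  finally show ?thesis .
qed

text \<open>A relatively open set meets the interior and so contains a small box there; the face of
  full dimension alone gives that box positive measure.\<close>

lemma emeasure_face_lebesgue_open:
  fixes U :: "(real^'n::finite) set"
  assumes U: "open U" "U \<inter> orthant \<noteq> {}"
  shows "emeasure (face_lebesgue UNIV) (U \<inter> orthant) > 0"
proof -
  obtain x where x: "x \<in> U" "x \<in> orthant" using U by blast
  have "\<forall>\<^sub>F k in sequentially. x + inverse (real (Suc k)) *\<^sub>R 1 \<in> U"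
    by (rule topological_tendstoD[OF orthant_approx(1)[OF x(2)] U(1) x(1)])
  then obtain k where "x + inverse (real (Suc k)) *\<^sub>R 1 \<in> U" by (auto simp: eventually_sequentially)
  then have "x + inverse (real (Suc k)) *\<^sub>R 1 \<in> U \<inter> open_orthant" using orthant_approx(2)[OF x(2)] by blast
  then obtain a b where ab: "x + inverse (real (Suc k)) *\<^sub>R 1 \<in> box a b" "box a b \<subseteq> U \<inter> open_orthant"
    using open_contains_box open_Int[OF U(1) open_open_orthant] by metis
  define A where "A i = {a $ i<..<b $ i} \<inter> {0<..}" for i
  have A: "A i \<in> sets borel" "A i \<subseteq> {0..}" for i by (auto simp: A_def)
  have eq: "{x. \<forall>i. x $ i \<in> A i} = box a b"
    using ab(2) by (fastforce simp: A_def mem_box_cart open_orthant_def)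
  have "emeasure (half_line UNIV i) (A i) \<noteq> 0" for i
  proof -
    define m where "m = max (a $ i) 0"
    have Ai: "A i = {m<..<b $ i}" by (auto simp: A_def m_def)
    have "m < b $ i"
    proof -
      define y where "y = x + inverse (real (Suc k)) *\<^sub>R 1"
      have "a $ i < y $ i" "y $ i < b $ i" using ab(1) unfolding y_def[symmetric] mem_box_cart by blast+
      moreover have "0 < y $ i" using orthant_approx(2)[OF x(2), of k] unfolding y_def[symmetric] open_orthant_def by blast
      ultimately show ?thesis by (simp add: m_def)
    qed
    then show ?thesis unfolding emeasure_half_line[OF A] by (simp add: Ai)
  qed
  then have "emeasure (face_lebesgue UNIV) (box a b) \<noteq> 0"
    using emeasure_face_lebesgue_product(1)[where A=A and B=UNIV, OF A] unfolding eq by simp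
  moreover have "emeasure (face_lebesgue UNIV) (box a b) \<le> emeasure (face_lebesgue UNIV) (U \<inter> orthant)"
  proof (rule emeasure_mono)
    show "box a b \<subseteq> U \<inter> orthant" using ab(2) open_orthant_subset by blast
    show "U \<inter> orthant \<in> sets (face_lebesgue UNIV)"
      unfolding sets_face_lebesgue sets_orthant_borel 
      using sets.Int[OF borel_open[OF U(1)] borel_closed[OF closed_orthant]] by simp
  qed
  ultimately show ?thesis by (metis le_zero_eq not_gr_zero)
qed

section \<open>Integration by parts on a face\<close>

lemma measurable_on_orthant:
  "continuous_on orthant f \<Longrightarrow> f \<in> borel_measurable orthant_borel"
  for f :: "real^'n::finite \<Rightarrow> real"
  by (rule borel_measurable_continuous_on_restrict)

text \<open>The interior version of the fundamental theorem: along a coordinate line the derivative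
  is available only where the coordinate is positive. Vanishing at both ends removes the boundary
  terms.\<close>

lemma integral_half_line_derivative:
  fixes F h :: "real \<Rightarrow> real"
  assumes R: "0 \<le> R" and F: "continuous_on {0..R} F" "\<And>y. 0 < y \<Longrightarrow> y < R \<Longrightarrow> (F has_real_derivative h y) (at y)"
    "F 0 = 0" "F R = 0" and h: "continuous_on {0..R} h" "\<And>y. R < y \<Longrightarrow> h y = 0"
  shows "integral\<^sup>L (restrict_space lborel {0..}) h = 0"
proof -
  have "integral\<^sup>L (restrict_space lborel {0..}) h = (\<integral>y. indicator {0..} y * h y \<partial>lborel)"
    by (subst integral_restrict_space) auto
  also have "\<dots> = set_lebesgue_integral lborel {0..R} h"
    unfolding set_integral_indicator using h(2) by (intro Bochner_Integration.integral_cong) (auto simp: indicator_def)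
  also have "\<dots> = integral {0..R} h"
    by (rule set_borel_integral_eq_integral(2)[OF borel_integrable_atLeastAtMost'[OF h(1)]])
  also have "\<dots> = F R - F 0"
    using F by (intro integral_unique fundamental_theorem_of_calculus_interior R)
      (auto simp: has_real_derivative_iff_has_vector_derivative)
  finally show ?thesis using F by simp
qed

lemma integrable_face_lebesgue:
  fixes g :: "real^'n::finite \<Rightarrow> real"
  assumes "continuous_on orthant g" "\<And>x. x \<in> orthant \<Longrightarrow> R < norm x \<Longrightarrow> g x = 0" "\<And>x. x \<in> orthant \<Longrightarrow> \<bar>g x\<bar> \<le> K"
  shows "integrable (face_lebesgue B) g"
proof (rule Bochner_Integration.integrable_bound)
  have "emeasure (face_lebesgue B) (orthant \<inter> cball 0 R) < \<infinity>" by (rule emeasure_face_lebesgue_bounded)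
  moreover have "orthant \<inter> cball 0 R \<in> sets (face_lebesgue B)"
    unfolding sets_face_lebesgue sets_orthant_borel by (auto intro!: borel_closed closed_Int closed_orthant)
  ultimately show "integrable (face_lebesgue B) (\<lambda>x. K * indicator (orthant \<inter> cball 0 R) x)"
    by (intro integrable_mult_right integrable_real_indicator)
  show "g \<in> borel_measurable (face_lebesgue B)"
    using measurable_on_orthant[OF assms(1)] by (simp cong: measurable_cong_sets add: sets_face_lebesgue)
  show "AE x in face_lebesgue B. norm (g x) \<le> norm (K * indicator (orthant \<inter> cball 0 R) x)"
  proof (rule AE_I2)
    fix x :: "real^'n" assume "x \<in> space (face_lebesgue B)"
    then have x: "x \<in> orthant" by (simp add: space_face_lebesgue)
    show "norm (g x) \<le> norm (K * indicator (orthant \<inter> cball 0 R) x)"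
      using assms(2)[OF x] assms(3)[OF x] x by (cases "R < norm x") (auto simp: indicator_def)
  qed
qed

text \<open>Fubini reduces this to the fundamental theorem of calculus in the \<open>i\<close>-th coordinate.\<close>

lemma integral_pd_eq_0:
  fixes f :: "real^'n::finite \<Rightarrow> real"
  assumes f: "f \<in> Cck 2" and i: "i \<in> B" and zero: "\<And>x. x \<in> orthant \<Longrightarrow> x $ i = 0 \<Longrightarrow> f x = 0"
  shows "integral\<^sup>L (face_lebesgue B) (pd i f) = 0"
proof -
  obtain R K where bd: "\<And>x. x \<in> orthant \<Longrightarrow> R < norm x \<Longrightarrow> f x = 0" "\<And>x i. x \<in> orthant \<Longrightarrow> R < norm x \<Longrightarrow> pd i f x = 0"
    "\<And>x. x \<in> orthant \<Longrightarrow> \<bar>f x\<bar> \<le> K" "\<And>x i. x \<in> orthant \<Longrightarrow> \<bar>pd i f x\<bar> \<le> K"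
    using Cck2_bounded[OF f] by metis
  have C2f: "C2 f" using f by (simp add: Cck2_iff)
  note C1f = C2_C1[OF C2f]
  let ?M = "half_line B" and ?e = "axis i 1 :: real^'n"
  define h where "h w = pd i f (\<chi> j. w j)" for w :: "'n \<Rightarrow> real"
  have meas: "pd i f \<in> borel_measurable orthant_borel" by (intro measurable_on_orthant C2_continuous(2) C2f)
  have int: "integrable (face_lebesgue B) (pd i f)"
    using bd by (intro integrable_face_lebesgue[of _ R K] C2_continuous(2) C2f) auto
  have "integral\<^sup>L (face_lebesgue B) (pd i f) = integral\<^sup>L (PiM UNIV ?M) h"
    unfolding face_lebesgue_def h_def by (rule integral_distr[OF measurable_vec_lambda meas])
  also have "\<dots> = integral\<^sup>L (PiM (insert i (UNIV - {i})) ?M) h" by (simp add: insert_absorb)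
  also have "\<dots> = (\<integral>x. (\<integral>y. h (x(i:=y)) \<partial>?M i) \<partial>PiM (UNIV - {i}) ?M)"
  proof (rule half_line.product_integral_insert)
    have "integrable (PiM UNIV ?M) h"
      using int unfolding face_lebesgue_def h_def by (rule integrable_distr[OF measurable_vec_lambda])
    then show "integrable (PiM (insert i (UNIV - {i})) ?M) h" by (simp add: insert_absorb)
  qed auto
  also have "\<dots> = (\<integral>x. 0 \<partial>PiM (UNIV - {i}) ?M)"
  proof (rule Bochner_Integration.integral_cong[OF refl])
    fix x assume x: "x \<in> space (PiM (UNIV - {i}) ?M)"
    \<comment> \<open>The base point of the coordinate line, with i-th coordinate 0; setting this
      coordinate to y means adding y times the unit vector.\<close>
    define z where "z = (\<chi> j. (x(i := 0)) j)"
    have x0: "0 \<le> x j" if "j \<noteq> i" for j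
      using x that by (auto simp: space_PiM PiE_iff space_half_line simp del: if_split)
    have eq: "(\<chi> j. (x(i := y)) j) = z + y *\<^sub>R ?e" for y
      by (simp add: z_def vec_eq_iff axis_def)
    have orth: "z + y *\<^sub>R ?e \<in> orthant" if "0 \<le> y" for y
      using x0 that by (auto simp: orthant_def z_def axis_def)
    have zi: "(z + y *\<^sub>R ?e) $ i = y" for y by (simp add: z_def)
    have norm: "\<bar>y\<bar> \<le> norm (z + y *\<^sub>R ?e)" for y
      using component_le_norm_cart[of "z + y *\<^sub>R ?e" i] by (simp only: zi)
    \<comment> \<open>Strictly beyond \<open>R\<close> and positive, so that the function already
      vanishes at the upper end.\<close>
    define S where "S = max R 0 + 1"
    have cont: "continuous_on {0..S} (\<lambda>y. g (z + y *\<^sub>R ?e))" if "continuous_on orthant g" for g :: "real^'n \<Rightarrow> real"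
      by (rule continuous_on_compose2[OF that]) (auto intro!: continuous_intros orth)
    have "integral\<^sup>L (restrict_space lborel {0..}) (\<lambda>y. pd i f (z + y *\<^sub>R ?e)) = 0"
    proof (rule integral_half_line_derivative[where F="\<lambda>y. f (z + y *\<^sub>R ?e)" and R=S])
      show "continuous_on {0..S} (\<lambda>y. f (z + y *\<^sub>R ?e))" by (intro cont C2_continuous C2f)
      show "continuous_on {0..S} (\<lambda>y. pd i f (z + y *\<^sub>R ?e))" by (intro cont C2_continuous C2f)
      show "f (z + 0 *\<^sub>R ?e) = 0" using orth[of 0] zi[of 0] by (intro zero) auto
      show "f (z + S *\<^sub>R ?e) = 0" using norm[of S] by (intro bd(1) orth) (auto simp: S_def)
      show "pd i f (z + y *\<^sub>R ?e) = 0" if "S < y" for y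
        using norm[of y] that by (intro bd(2) orth) (auto simp: S_def)
      fix y :: real assume y: "0 < y"
      \<comment> \<open>On a lower-dimensional face the other coordinates may be 0;
        \<open>C1_deriv\<close> covers such points because the i-th coordinate is positive.\<close>
      have "((\<lambda>t. f ((z + y *\<^sub>R ?e) + t *\<^sub>R ?e)) has_real_derivative pd i f (z + y *\<^sub>R ?e)) (at 0)"
        by (rule C1_deriv[OF C1f]) (use y orth[of y] zi[of y] in auto)
      then show "((\<lambda>y. f (z + y *\<^sub>R ?e)) has_real_derivative pd i f (z + y *\<^sub>R ?e)) (at y)"
        using DERIV_shift[of "\<lambda>s. f (z + s *\<^sub>R ?e)" "pd i f (z + y *\<^sub>R ?e)" 0 y]
        by (simp add: scaleR_add_left add_ac)
    qed (simp add: S_def)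
    then show "(\<integral>y. h (x(i:=y)) \<partial>?M i) = 0" unfolding h_def eq using i by simp
  qed
  finally show ?thesis by simp
qed

subsection \<open>The weighted measure\<close>

lemma sets_face_measure: "sets (face_measure \<beta> B) = sets orthant_borel"
  by (simp add: face_measure_def sets_face_lebesgue)

lemma space_face_measure: "space (face_measure \<beta> B) = orthant"
  using sets_eq_imp_space_eq[OF sets_face_measure] by (simp only: space_orthant_borel)

lemma space_ref_measure: "space (ref_measure \<beta>) = orthant"
  unfolding ref_measure_def using sets.space_closed[of orthant_borel]
  by (simp add: space_measure_of_conv space_orthant_borel)

lemma sets_ref_measure: "sets (ref_measure \<beta>) = sets orthant_borel"
proof -
  have "sets orthant_borel \<subseteq> Pow orthant"
    using sets.space_closed[of orthant_borel] by (simp only: space_orthant_borel)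
  then show ?thesis
    unfolding ref_measure_def using sets.sigma_sets_eq[of orthant_borel]
    by (subst sets_measure_of) (simp_all only: space_orthant_borel)
qed

lemma emeasure_ref_measure:
  fixes \<beta> :: real
  assumes A: "A \<in> sets (orthant_borel :: (real^'n::finite) measure)"
  shows "emeasure (ref_measure \<beta>) A = (\<Sum>B\<in>UNIV. emeasure (face_measure \<beta> B) A)"
proof (rule emeasure_measure_of[OF ref_measure_def])
  show "sets orthant_borel \<subseteq> Pow orthant" using sets.space_closed[of orthant_borel] by (simp add: space_orthant_borel)
  show "A \<in> sets (ref_measure \<beta>)" using A by (simp add: sets_ref_measure)
  show "positive (sets (ref_measure \<beta>)) (\<lambda>A. \<Sum>B\<in>UNIV. emeasure (face_measure \<beta> B) A)"
    by (simp add: positive_def)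
  show "countably_additive (sets (ref_measure \<beta>)) (\<lambda>A. \<Sum>B\<in>UNIV. emeasure (face_measure \<beta> B) A)"
  proof (rule countably_additiveI, goal_cases)
    case *: (1 A)
    have "(\<Sum>k. \<Sum>B\<in>UNIV. emeasure (face_measure \<beta> B) (A k)) = (\<Sum>B\<in>UNIV. \<Sum>k. emeasure (face_measure \<beta> B) (A k))"
      by (rule suminf_sum) simp
    also have "\<dots> = (\<Sum>B\<in>UNIV. emeasure (face_measure \<beta> B) (\<Union> (range A)))"
      using * by (intro sum.cong suminf_emeasure refl) (simp_all add: sets_ref_measure sets_face_measure)
    finally show ?case .
  qed
qed

lemma face_in_sets: "face B \<in> sets (orthant_borel :: (real^'n::finite) measure)"
proof -
  have "face B = {x::real^'n. \<forall>i. x $ i \<in> (if i \<in> B then {0<..} else {0})}"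
    by (auto simp: face_def split: if_splits)
  also have "\<dots> \<in> sets orthant_borel" by (rule emeasure_face_lebesgue_product(2)) auto
  finally show ?thesis .
qed

lemma AE_face_measure: "AE x in face_measure \<beta> B. x \<in> face B"
proof -
  have "emeasure (face_lebesgue B) (orthant - face B) = 0"
    using AE_face[of B] sets.Diff[OF sets.top face_in_sets, of B]
    by (subst (asm) AE_iff_measurable[where N="orthant - face B"])
      (auto simp: space_face_lebesgue sets_face_lebesgue space_orthant_borel)
  then have "emeasure (face_measure \<beta> B) (orthant - face B) = 0" by (simp add: face_measure_def)
  then show ?thesis using sets.Diff[OF sets.top face_in_sets, of B]
    by (subst AE_iff_measurable[where N="orthant - face B"])
      (auto simp: space_face_measure sets_face_measure space_orthant_borel)
qed

text \<open>Measures carried by disjoint faces are mutually singular.\<close>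

lemma emeasure_face_measure_Int:
  assumes A: "A \<in> sets orthant_borel"
  shows "emeasure (face_measure \<beta> B) (A \<inter> face B') = (if B = B' then emeasure (face_measure \<beta> B) A else 0)"
proof -
  have "emeasure (face_measure \<beta> B) (A \<inter> face B') = emeasure (face_measure \<beta> B) (if B = B' then A else {})"
    using AE_face_measure[where \<beta>=\<beta> and B=B]
    by (intro emeasure_eq_AE) (auto simp: sets_face_measure A face_in_sets elim!: eventually_mono dest: face_disjoint_cover(2))
  then show ?thesis by simp
qed

text \<open>On \<open>face B\<close> only one summand of the reference measure survives. Integrals
  over a face thereby become integrals over the orthant with an indicator.\<close>

lemma face_measure_eq_density: "face_measure \<beta> B = density (ref_measure \<beta>) (indicator (face B))"
proof (rule measure_eqI)
  fix A assume "A \<in> sets (face_measure \<beta> B)"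
  then have A: "A \<in> sets orthant_borel" by (simp add: sets_face_measure)
  have S: "A \<in> sets (ref_measure \<beta>)" "face B \<in> sets (ref_measure \<beta>)"
    using A face_in_sets[of B] by (simp_all add: sets_ref_measure)
  have "emeasure (density (ref_measure \<beta>) (indicator (face B))) A = (\<integral>\<^sup>+x. indicator (face B) x * indicator A x \<partial>ref_measure \<beta>)"
    using S by (intro emeasure_density) auto
  also have "\<dots> = (\<integral>\<^sup>+x. indicator (A \<inter> face B) x \<partial>ref_measure \<beta>)"
    by (intro nn_integral_cong) (auto simp: indicator_def)
  also have "\<dots> = emeasure (ref_measure \<beta>) (A \<inter> face B)" using S by (intro nn_integral_indicator) auto
  also have "\<dots> = (\<Sum>B'\<in>UNIV. if B' = B then emeasure (face_measure \<beta> B') A else 0)"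
    using A face_in_sets[of B] by (subst emeasure_ref_measure) (auto simp: emeasure_face_measure_Int)
  finally show "emeasure (face_measure \<beta> B) A = emeasure (density (ref_measure \<beta>) (indicator (face B))) A"
    by simp
qed (simp add: sets_face_measure sets_ref_measure)

text \<open>On \<open>face B\<close> the number of vanishing coordinates is n - #B, so the constant
  weights of the faces combine to one function of the point. This reduces every
  \<open>\<beta>\<close> to the measure on which the Hilbert space type is built.\<close>

lemma ref_measure_eq_density:
  fixes \<beta> :: real
  assumes "\<beta> > 0"
  shows "(ref_measure \<beta> :: (real^'n::finite) measure) = density (ref_measure 1) (\<lambda>x. ennreal (\<beta> ^ card {i. x $ i = 0}))"
    "(\<lambda>x. \<beta> ^ card {i. x $ i = 0}) \<in> borel_measurable (orthant_borel :: (real^'n) measure)"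
proof -
  let ?w = "\<lambda>x::real^'n. \<beta> ^ card {i. x $ i = 0}"
  have w_eq: "?w x = (\<Sum>B\<in>UNIV. \<beta> ^ (CARD('n) - card B) * indicator (face B) x)" if "x \<in> orthant" for x
  proof -
    have "{i. x $ i = 0} = UNIV - {i. 0 < x $ i}" using that by (auto simp: orthant_def less_le)
    then have "card {i. x $ i = 0} = CARD('n) - card {i. 0 < x $ i}" by (simp add: card_Diff_subset)
    moreover have "indicator (face B) x = (if B = {i. 0 < x $ i} then 1 else (0::real))" for B
    proof (cases "B = {i. 0 < x $ i}")
      case True
      then have "x \<in> face B" using face_disjoint_cover(1)[OF that] by simp
      then show ?thesis by (simp add: True[symmetric])
    next
      case False
      then have "x \<notin> face B" using face_disjoint_cover(2) by blast
      with False show ?thesis by simp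
    qed
    ultimately show ?thesis by (simp add: if_distrib[where f="\<lambda>c. _ * c"] cong: if_cong)
  qed
  have "(\<lambda>x. \<Sum>B\<in>UNIV. \<beta> ^ (CARD('n) - card B) * indicator (face B) x) \<in> borel_measurable (orthant_borel :: (real^'n) measure)"
    using face_in_sets by measurable
  then show meas: "?w \<in> borel_measurable orthant_borel"
    by (rule measurable_cong[THEN iffD2, rotated]) (simp add: w_eq space_orthant_borel)
  show "ref_measure \<beta> = density (ref_measure 1) (\<lambda>x. ennreal (?w x))"
  proof (rule measure_eqI)
    fix A assume "A \<in> sets (ref_measure \<beta> :: (real^'n) measure)"
    then have A: "A \<in> sets orthant_borel" by (simp add: sets_ref_measure)
    have meas': "?w \<in> borel_measurable (ref_measure 1)"
      using meas by (simp cong: measurable_cong_sets add: sets_ref_measure)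
    have "(\<lambda>x. ennreal (?w x)) \<in> borel_measurable (ref_measure 1)" "A \<in> sets (ref_measure 1)"
      using meas' A by (auto simp: sets_ref_measure)
    then have "emeasure (density (ref_measure 1) (\<lambda>x. ennreal (?w x))) A = (\<integral>\<^sup>+x. ennreal (?w x) * indicator A x \<partial>ref_measure 1)"
      by (rule emeasure_density)
    also have "\<dots> = (\<integral>\<^sup>+x. (\<Sum>B\<in>UNIV. ennreal (\<beta> ^ (CARD('n) - card B)) * indicator (A \<inter> face B) x) \<partial>ref_measure 1)"
    proof (rule nn_integral_cong)
      fix x :: "real^'n" assume "x \<in> space (ref_measure 1)"
      then have x: "x \<in> orthant" by (simp add: space_ref_measure)
      have "ennreal (?w x) * indicator A x = (\<Sum>B\<in>UNIV. ennreal (\<beta> ^ (CARD('n) - card B) * indicator (face B) x)) * indicator A x"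
        unfolding w_eq[OF x] using assms by (subst sum_ennreal) auto
      also have "\<dots> = (\<Sum>B\<in>UNIV. ennreal (\<beta> ^ (CARD('n) - card B) * indicator (face B) x) * indicator A x)"
        by (rule sum_distrib_right)
      also have "\<dots> = (\<Sum>B\<in>UNIV. ennreal (\<beta> ^ (CARD('n) - card B)) * indicator (A \<inter> face B) x)"
        by (intro sum.cong) (auto simp: indicator_def)
      finally show "ennreal (?w x) * indicator A x = (\<Sum>B\<in>UNIV. ennreal (\<beta> ^ (CARD('n) - card B)) * indicator (A \<inter> face B) x)" .
    qed
    also have "\<dots> = (\<Sum>B\<in>UNIV. ennreal (\<beta> ^ (CARD('n) - card B)) * emeasure (ref_measure 1) (A \<inter> face B))"
    proof -
      have "A \<inter> face B \<in> sets (ref_measure 1)" for B using A face_in_sets[of B] by (simp add: sets_ref_measure)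
      then show ?thesis by (subst nn_integral_sum) (auto simp: nn_integral_cmult_indicator simp del: sum_mult_indicator)
    qed
    also have "\<dots> = (\<Sum>B\<in>UNIV. emeasure (face_measure \<beta> B) A)"
    proof (rule sum.cong[OF refl])
      fix B :: "'n set"
      have "emeasure (ref_measure 1) (A \<inter> face B) = (\<Sum>B'\<in>UNIV. if B' = B then emeasure (face_measure 1 B') A else 0)"
        using A face_in_sets[of B] by (subst emeasure_ref_measure) (auto simp: emeasure_face_measure_Int)
      then show "ennreal (\<beta> ^ (CARD('n) - card B)) * emeasure (ref_measure 1) (A \<inter> face B) = emeasure (face_measure \<beta> B) A"
        by (simp add: face_measure_def)
    qed
    also have "\<dots> = emeasure (ref_measure \<beta>) A" by (rule emeasure_ref_measure[OF A, symmetric])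
    finally show "emeasure (ref_measure \<beta>) A = emeasure (density (ref_measure 1) (\<lambda>x. ennreal (?w x))) A" ..
  qed (simp add: sets_ref_measure)
qed

lemma emeasure_ref_measure_open:
  fixes U :: "(real^'n::finite) set"
  assumes "open U" "U \<inter> orthant \<noteq> {}"
  shows "emeasure (ref_measure \<beta>) (U \<inter> orthant) > 0"
proof -
  have S: "U \<inter> orthant \<in> sets orthant_borel" using sets.Int[OF borel_open[OF assms(1)] borel_closed[OF closed_orthant]]
    by (simp add: sets_orthant_borel)
  have "0 < emeasure (face_measure \<beta> UNIV) (U \<inter> orthant)"
    using emeasure_face_lebesgue_open[OF assms] by (simp add: face_measure_def)
  also have "\<dots> \<le> emeasure (ref_measure \<beta>) (U \<inter> orthant)"
    unfolding emeasure_ref_measure[OF S] by (rule member_le_sum) auto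
  finally show ?thesis .
qed

section \<open>The Hilbert space of square integrable functions\<close>

text \<open>The theorem of Riesz and Fischer for representatives: a fast subsequence converges
  almost everywhere, and Fatou's lemma turns its limit into a limit in L2.\<close>

lemma L2_complete:
  assumes s: "\<And>k. s k \<in> L2 M"
    and Cauchy: "\<And>e. e > 0 \<Longrightarrow> \<exists>N. \<forall>j\<ge>N. \<forall>k\<ge>N. (\<integral>x. (s j x - s k x)\<^sup>2 \<partial>M) < e"
  shows "\<exists>u\<in>L2 M. (\<lambda>k. \<integral>x. (s k x - u x)\<^sup>2 \<partial>M) \<longlonglongrightarrow> 0"
proof -
  have [measurable]: "s k \<in> borel_measurable M" for k using s L2D(1) by blast
  have int: "integrable M (\<lambda>x. (s j x - s k x)\<^sup>2)" for j k using L2D(2)[OF L2_diff[OF s s]] .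
  have nn: "(\<integral>\<^sup>+x. ennreal ((s j x - s k x)\<^sup>2) \<partial>M) = ennreal (\<integral>x. (s j x - s k x)\<^sup>2 \<partial>M)" for j k
    by (rule nn_integral_eq_integral[OF int]) simp
  have "\<exists>N. \<forall>j\<ge>N. \<forall>k\<ge>N. (\<integral>x. (s j x - s k x)\<^sup>2 \<partial>M) < (1/8)^i" for i by (rule Cauchy) simp
  then obtain N where N: "\<And>i j k. j \<ge> N i \<Longrightarrow> k \<ge> N i \<Longrightarrow> (\<integral>x. (s j x - s k x)\<^sup>2 \<partial>M) < (1/8)^i" by metis
  have le_suminf: "f k \<le> suminf f" for f :: "nat \<Rightarrow> ennreal" and k
    using sum_le_suminf[of f "{k}"] by simp
  \<comment> \<open>The partial sums put both \<open>r k\<close> and \<open>r (Suc k)\<close> beyond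
    \<open>N k\<close>.\<close>
  define r where "r k = (\<Sum>i\<le>k. N i) + k" for k
  have r: "N k \<le> r k" "N k \<le> r (Suc k)" "k \<le> r k" for k
  proof -
    have "N k \<le> sum N {..k}" by (rule member_le_sum) auto
    then show "N k \<le> r k" "N k \<le> r (Suc k)" "k \<le> r k" by (auto simp: r_def)
  qed
  define \<Delta> where "\<Delta> k x = s (r (Suc k)) x - s (r k) x" for k x
  have [measurable]: "\<Delta> k \<in> borel_measurable M" for k unfolding \<Delta>_def[abs_def] by measurable
  \<comment> \<open>The increments have squared norm below 8^(-k), so even with weights 2^k the sum
    is integrable. Where it is finite, the increments decay at least like 2^(-k/2), which is
    summable.\<close>
  have "(\<integral>\<^sup>+x. (\<Sum>k. ennreal (2^k * (\<Delta> k x)\<^sup>2)) \<partial>M) = (\<Sum>k. \<integral>\<^sup>+x. ennreal (2^k * (\<Delta> k x)\<^sup>2) \<partial>M)"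
    by (rule nn_integral_suminf) measurable
  also have "\<dots> \<le> (\<Sum>k. ennreal ((1/4)^k))"
  proof (rule suminf_le)
    fix k
    have "(\<integral>\<^sup>+x. ennreal (2^k * (\<Delta> k x)\<^sup>2) \<partial>M) = ennreal (2^k) * (\<integral>\<^sup>+x. ennreal ((\<Delta> k x)\<^sup>2) \<partial>M)"
      by (subst nn_integral_cmult[symmetric]) (auto simp: ennreal_mult)
    also have "\<dots> \<le> ennreal (2^k) * ennreal ((1/8)^k)"
      unfolding \<Delta>_def nn by (intro mult_left_mono ennreal_leI less_imp_le N r) simp
    also have "\<dots> = ennreal ((1/4)^k)" by (simp add: ennreal_mult[symmetric] power_mult_distrib[symmetric])
    finally show "(\<integral>\<^sup>+x. ennreal (2^k * (\<Delta> k x)\<^sup>2) \<partial>M) \<le> ennreal ((1/4)^k)" .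
  qed auto
  also have "\<dots> < \<infinity>" by (subst suminf_ennreal2) (auto intro: summable_geometric)
  finally have "AE x in M. (\<Sum>k. ennreal (2^k * (\<Delta> k x)\<^sup>2)) \<noteq> \<infinity>"
    by (intro nn_integral_noteq_infinite) auto
  then have conv: "AE x in M. convergent (\<lambda>k. s (r k) x)"
  proof eventually_elim
    case (elim x)
    have "\<exists>C\<ge>0. S = ennreal C" if "S \<noteq> \<infinity>" for S using that by (cases S) auto
    from this[OF elim] obtain C where C: "C \<ge> 0" "(\<Sum>k. ennreal (2^k * (\<Delta> k x)\<^sup>2)) = ennreal C" by blast
    have b: "\<bar>\<Delta> k x\<bar> \<le> sqrt C * (1 / sqrt 2)^k" for k
    proof -
      have "ennreal (2^k * (\<Delta> k x)\<^sup>2) \<le> ennreal C"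
        unfolding C(2)[symmetric] by (rule le_suminf)
      then have "2^k * (\<Delta> k x)\<^sup>2 \<le> C" using C(1) by simp
      then have "(\<Delta> k x)\<^sup>2 \<le> C * (1/2)^k" by (simp add: field_simps power_divide)
      then have "sqrt ((\<Delta> k x)\<^sup>2) \<le> sqrt (C * (1/2)^k)" by (rule real_sqrt_le_mono)
      moreover have "sqrt (C * (1/2)^k) = sqrt C * (1 / sqrt 2)^k"
        by (simp only: real_sqrt_mult real_sqrt_power real_sqrt_divide real_sqrt_one)
      ultimately show ?thesis by (simp only: real_sqrt_abs)
    qed
    have "summable (\<lambda>k. sqrt C * (1 / sqrt 2)^k)" by (intro summable_mult summable_geometric) simp
    then have "summable (\<lambda>k. \<Delta> k x)" by (rule summable_comparison_test'[where N=0]) (use b in simp)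
    then have "convergent (\<lambda>n. \<Sum>k<n. \<Delta> k x)" by (simp add: summable_iff_convergent)
    moreover have "(\<Sum>k<n. \<Delta> k x) = s (r n) x - s (r 0) x" for n
      unfolding \<Delta>_def by (rule sum_lessThan_telescope)
    ultimately have "convergent (\<lambda>n. s (r n) x - s (r 0) x)" by simp
    from convergent_add[OF this convergent_const[of "s (r 0) x"]] show ?case by simp
  qed
  define u where "u x = lim (\<lambda>k. s (r k) x)" for x
  have [measurable]: "u \<in> borel_measurable M" unfolding u_def[abs_def] by measurable
  have lim: "AE x in M. (\<lambda>k. s (r k) x) \<longlonglongrightarrow> u x"
    using conv by eventually_elim (simp add: u_def convergent_LIMSEQ_iff)
  \<comment> \<open>Fatou's lemma along the subsequence, with the index j fixed.\<close>
  have main: "(\<integral>\<^sup>+x. ennreal ((s j x - u x)\<^sup>2) \<partial>M) \<le> ennreal e"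
    if e: "e > 0" and Ne: "\<forall>j\<ge>Ne. \<forall>k\<ge>Ne. (\<integral>x. (s j x - s k x)\<^sup>2 \<partial>M) < e" and j: "j \<ge> Ne" for e Ne j
  proof -
    have "(\<integral>\<^sup>+x. ennreal ((s j x - u x)\<^sup>2) \<partial>M) = (\<integral>\<^sup>+x. liminf (\<lambda>k. ennreal ((s j x - s (r k) x)\<^sup>2)) \<partial>M)"
    proof (rule nn_integral_cong_AE)
      show "AE x in M. ennreal ((s j x - u x)\<^sup>2) = liminf (\<lambda>k. ennreal ((s j x - s (r k) x)\<^sup>2))"
        using lim
      proof eventually_elim
        case (elim x)
        have "(\<lambda>k. ennreal ((s j x - s (r k) x)\<^sup>2)) \<longlonglongrightarrow> ennreal ((s j x - u x)\<^sup>2)"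
          by (intro tendsto_ennrealI tendsto_intros elim)
        then show ?case by (rule lim_imp_Liminf[symmetric, rotated]) simp
      qed
    qed
    also have "\<dots> \<le> liminf (\<lambda>k. \<integral>\<^sup>+x. ennreal ((s j x - s (r k) x)\<^sup>2) \<partial>M)" by (rule nn_integral_liminf) measurable
    also have "\<dots> \<le> limsup (\<lambda>k. \<integral>\<^sup>+x. ennreal ((s j x - s (r k) x)\<^sup>2) \<partial>M)" by (rule Liminf_le_Limsup) simp
    also have "\<dots> \<le> ennreal e"
    proof (rule Limsup_bounded)
      show "\<forall>\<^sub>F k in sequentially. (\<integral>\<^sup>+x. ennreal ((s j x - s (r k) x)\<^sup>2) \<partial>M) \<le> ennreal e"
        using eventually_ge_at_top[of Ne]
      proof eventually_elim
        case (elim k)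
        then have "r k \<ge> Ne" using r(3)[of k] by linarith
        then show ?case unfolding nn using Ne j by (intro ennreal_leI less_imp_le) blast
      qed
    qed
    finally show ?thesis .
  qed
  have u_L2: "u \<in> L2 M"
  proof -
    obtain Ne where Ne: "\<forall>j\<ge>Ne. \<forall>k\<ge>Ne. (\<integral>x. (s j x - s k x)\<^sup>2 \<partial>M) < 1" using Cauchy[of 1] by auto
    have "(\<integral>\<^sup>+x. ennreal ((s Ne x - u x)\<^sup>2) \<partial>M) \<le> ennreal 1" by (rule main[OF _ Ne]) auto
    also have "\<dots> < \<infinity>" by simp
    finally have "(\<lambda>x. s Ne x - u x) \<in> L2 M" unfolding L2_def by (auto intro!: integrableI_nonneg)
    from L2_diff[OF s[of Ne] this] show ?thesis by simp
  qed
  show ?thesis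
  proof (rule bexI[OF _ u_L2], rule LIMSEQ_I)
    fix e :: real assume e: "e > 0"
    obtain Ne where Ne: "\<forall>j\<ge>Ne. \<forall>k\<ge>Ne. (\<integral>x. (s j x - s k x)\<^sup>2 \<partial>M) < e/2" using Cauchy[of "e/2"] e by auto
    have "(\<integral>x. (s j x - u x)\<^sup>2 \<partial>M) < e" if "j \<ge> Ne" for j
    proof -
      have "ennreal (\<integral>x. (s j x - u x)\<^sup>2 \<partial>M) = (\<integral>\<^sup>+x. ennreal ((s j x - u x)\<^sup>2) \<partial>M)"
        using L2D(2)[OF L2_diff[OF s u_L2]] by (intro nn_integral_eq_integral[symmetric]) auto
      also have "\<dots> \<le> ennreal (e/2)" using e by (intro main[OF _ Ne that]) simp
      finally have "(\<integral>x. (s j x - u x)\<^sup>2 \<partial>M) \<le> e/2" using e by (subst (asm) ennreal_le_iff) auto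
      then show ?thesis using e by simp
    qed
    then show "\<exists>no. \<forall>n\<ge>no. norm ((\<integral>x. (s n x - u x)\<^sup>2 \<partial>M) - 0) < e" by auto
  qed
qed

text \<open>A Hilbert space type cannot depend on \<open>\<mu>\<close>; hence \<open>L\<^sup>2(\<mu>)\<close> will be embedded isometrically into
  the space for the fixed measure \<open>ref_measure 1\<close> by multiplication with the root of the density.\<close>

definition l2_rel :: "(real^'n::finite \<Rightarrow> real) \<Rightarrow> (real^'n \<Rightarrow> real) \<Rightarrow> bool" where
  "l2_rel f g \<longleftrightarrow> f \<in> L2 (ref_measure 1) \<and> g \<in> L2 (ref_measure 1) \<and> (AE x in ref_measure 1. f x = g x)"

quotient_type (overloaded) 'n l2 = "real^'n::finite \<Rightarrow> real" / partial: l2_rel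
proof (rule part_equivpI)
  show "\<exists>f. l2_rel f f" by (rule exI[of _ "\<lambda>_. 0"]) (simp add: l2_rel_def L2_0)
  show "symp l2_rel" by (rule sympI) (auto simp: l2_rel_def elim: eventually_mono)
  show "transp l2_rel" by (rule transpI) (auto simp: l2_rel_def)
qed

lemma L2_inner_cong_AE:
  assumes "f \<in> L2 M" "f' \<in> L2 M" "g \<in> L2 M" "g' \<in> L2 M" "AE x in M. f x = f' x" "AE x in M. g x = g' x"
  shows "L2_inner M f g = L2_inner M f' g'"
  unfolding L2_inner_def
proof (rule integral_cong_AE)
  show "AE x in M. f x * g x = f' x * g' x" using assms(5,6) by eventually_elim simp
qed (use assms(1-4)[THEN L2D(1)] in measurable)

instantiation l2 :: (finite) real_inner
begin

lift_definition zero_l2 :: "'a l2" is "\<lambda>_. 0" by (simp add: l2_rel_def L2_0)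
lift_definition plus_l2 :: "'a l2 \<Rightarrow> 'a l2 \<Rightarrow> 'a l2" is "\<lambda>f g x. f x + g x"
  by (auto simp: l2_rel_def intro: L2_add)
lift_definition minus_l2 :: "'a l2 \<Rightarrow> 'a l2 \<Rightarrow> 'a l2" is "\<lambda>f g x. f x - g x"
  by (auto simp: l2_rel_def intro: L2_diff)
lift_definition uminus_l2 :: "'a l2 \<Rightarrow> 'a l2" is "\<lambda>f x. - f x"
  using L2_scale[where c="-1"] by (fastforce simp: l2_rel_def)
lift_definition scaleR_l2 :: "real \<Rightarrow> 'a l2 \<Rightarrow> 'a l2" is "\<lambda>c f x. c * f x"
  by (auto simp: l2_rel_def intro: L2_scale)
lift_definition inner_l2 :: "'a l2 \<Rightarrow> 'a l2 \<Rightarrow> real" is "L2_inner (ref_measure 1)"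
  by (rule L2_inner_cong_AE) (auto simp: l2_rel_def)
definition norm_l2 :: "'a l2 \<Rightarrow> real" where "norm_l2 x = sqrt (inner x x)"
definition sgn_l2 :: "'a l2 \<Rightarrow> 'a l2" where "sgn_l2 x = inverse (norm x) *\<^sub>R x"
definition dist_l2 :: "'a l2 \<Rightarrow> 'a l2 \<Rightarrow> real" where "dist_l2 x y = norm (x - y)"
definition uniformity_l2 :: "('a l2 \<times> 'a l2) filter"
  where "uniformity_l2 = (INF e\<in>{0 <..}. principal {(x, y). dist x y < e})"
definition open_l2 :: "'a l2 set \<Rightarrow> bool"
  where "open_l2 U \<longleftrightarrow> (\<forall>x\<in>U. \<forall>\<^sub>F (x', y) in uniformity. x' = x \<longrightarrow> y \<in> U)"

instance
proof
  fix x y z :: "'a l2" and a b :: real and U :: "'a l2 set"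
  show "x + y + z = x + (y + z)" by transfer (simp add: l2_rel_def L2_add add.assoc)
  show "x + y = y + x" by transfer (simp add: l2_rel_def L2_add add.commute)
  show "0 + x = x" by transfer (simp add: l2_rel_def)
  show "- x + x = 0" by transfer (simp add: l2_rel_def L2_0)
  show "x - y = x + - y"
  proof transfer
    fix f g :: "real^'a \<Rightarrow> real" assume "l2_rel f f" "l2_rel g g"
    then show "l2_rel (\<lambda>x. f x - g x) (\<lambda>x. f x + - g x)" using L2_diff by (fastforce simp: l2_rel_def)
  qed
  show "a *\<^sub>R (x + y) = a *\<^sub>R x + a *\<^sub>R y" by transfer (simp add: l2_rel_def L2_add L2_scale distrib_left)
  show "(a + b) *\<^sub>R x = a *\<^sub>R x + b *\<^sub>R x" by transfer (simp add: l2_rel_def L2_add L2_scale distrib_right)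
  show "a *\<^sub>R b *\<^sub>R x = (a * b) *\<^sub>R x" by transfer (simp add: l2_rel_def L2_scale mult.assoc)
  show "1 *\<^sub>R x = x" by transfer (simp add: l2_rel_def)
  show "inner x y = inner y x" by transfer (simp add: L2_inner_def mult.commute)
  show "inner (x + y) z = inner x z + inner y z"
    by transfer (simp add: L2_inner_def l2_rel_def distrib_right integrable_L2_mult)
  show "inner (a *\<^sub>R x) y = a * inner x y" by transfer (simp add: L2_inner_def mult.assoc)
  show "0 \<le> inner x x" by transfer (simp add: L2_inner_def)
  show "inner x x = 0 \<longleftrightarrow> x = 0"
  proof transfer
    fix f :: "real^'a \<Rightarrow> real" assume f: "l2_rel f f"
    then have "integrable (ref_measure 1) (\<lambda>x. f x * f x)" by (auto simp: l2_rel_def intro: integrable_L2_mult)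
    then have "L2_inner (ref_measure 1) f f = 0 \<longleftrightarrow> (AE x in ref_measure 1. f x * f x = 0)"
      unfolding L2_inner_def by (intro integral_nonneg_eq_0_iff_AE) auto
    then show "L2_inner (ref_measure 1) f f = 0 \<longleftrightarrow> l2_rel f (\<lambda>_. 0)" using f by (simp add: l2_rel_def L2_0)
  qed
  show "norm x = sqrt (inner x x)" by (fact norm_l2_def)
  show "dist x y = norm (x - y)" by (fact dist_l2_def)
  show "sgn x = inverse (norm x) *\<^sub>R x" by (fact sgn_l2_def)
  show "(uniformity :: ('a l2 \<times> 'a l2) filter) = (INF e\<in>{0 <..}. principal {(x, y). dist x y < e})"
    by (fact uniformity_l2_def)
  show "open U \<longleftrightarrow> (\<forall>x\<in>U. \<forall>\<^sub>F (x', y) in uniformity. x' = x \<longrightarrow> y \<in> U)" by (fact open_l2_def)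
qed

end

lemma l2_rel_rep: "l2_rel (rep_l2 h) (rep_l2 h)"
  by (rule Quotient3_rep_reflp[OF Quotient3_l2])

lemma rep_l2: "rep_l2 h \<in> L2 (ref_measure 1)"
  using l2_rel_rep by (auto simp: l2_rel_def)

lemma abs_rep_l2: "abs_l2 (rep_l2 h) = h"
  by (rule Quotient3_abs_rep[OF Quotient3_l2])

lemma abs_l2_add:
  "f \<in> L2 (ref_measure 1) \<Longrightarrow> g \<in> L2 (ref_measure 1) \<Longrightarrow> abs_l2 (\<lambda>x. f x + g x) = abs_l2 f + abs_l2 g"
  by (rule plus_l2.abs_eq[symmetric]) (auto simp: l2_rel_def)

lemma abs_l2_diff:
  "f \<in> L2 (ref_measure 1) \<Longrightarrow> g \<in> L2 (ref_measure 1) \<Longrightarrow> abs_l2 (\<lambda>x. f x - g x) = abs_l2 f - abs_l2 g"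
  by (rule minus_l2.abs_eq[symmetric]) (auto simp: l2_rel_def)

lemma abs_l2_scale: "f \<in> L2 (ref_measure 1) \<Longrightarrow> abs_l2 (\<lambda>x. c * f x) = c *\<^sub>R abs_l2 f"
  by (rule scaleR_l2.abs_eq[symmetric]) (auto simp: l2_rel_def)

lemma inner_abs_l2:
  "f \<in> L2 (ref_measure 1) \<Longrightarrow> g \<in> L2 (ref_measure 1) \<Longrightarrow> inner (abs_l2 f) (abs_l2 g) = L2_inner (ref_measure 1) f g"
  by (rule inner_l2.abs_eq) (auto simp: l2_rel_def)

instance l2 :: (finite) banach
proof
  fix X :: "nat \<Rightarrow> 'a l2" assume X: "Cauchy X"
  let ?s = "\<lambda>k. rep_l2 (X k)"
  have norm: "(norm (abs_l2 f - abs_l2 g))\<^sup>2 = (\<integral>x. (f x - g x)\<^sup>2 \<partial>ref_measure 1)"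
    if "f \<in> L2 (ref_measure 1)" "g \<in> L2 (ref_measure 1)" for f g :: "real^'a \<Rightarrow> real"
    using that inner_abs_l2[OF L2_diff[OF that] L2_diff[OF that]]
    unfolding power2_norm_eq_inner abs_l2_diff[OF that] L2_inner_def by (simp only: power2_eq_square)
  have dist: "(dist (X j) (X k))\<^sup>2 = (\<integral>x. (?s j x - ?s k x)\<^sup>2 \<partial>ref_measure 1)" for j k
    using norm[OF rep_l2 rep_l2, of "X j" "X k"] by (simp add: abs_rep_l2 dist_norm)
  have "\<exists>u\<in>L2 (ref_measure 1). (\<lambda>k. \<integral>x. (?s k x - u x)\<^sup>2 \<partial>ref_measure 1) \<longlonglongrightarrow> 0"
  proof (rule L2_complete[OF rep_l2])
    fix e :: real assume e: "e > 0"
    then obtain N where N: "\<forall>j\<ge>N. \<forall>k\<ge>N. dist (X j) (X k) < sqrt e"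
      using X unfolding Cauchy_def by (meson real_sqrt_gt_zero)
    have "(dist (X j) (X k))\<^sup>2 < e" if "j \<ge> N" "k \<ge> N" for j k
      using power_strict_mono[of "dist (X j) (X k)" "sqrt e" 2] N that e by simp
    then show "\<exists>N. \<forall>j\<ge>N. \<forall>k\<ge>N. (\<integral>x. (?s j x - ?s k x)\<^sup>2 \<partial>ref_measure 1) < e" unfolding dist by blast
  qed
  then obtain u where u: "u \<in> L2 (ref_measure 1)" "(\<lambda>k. \<integral>x. (?s k x - u x)\<^sup>2 \<partial>ref_measure 1) \<longlonglongrightarrow> 0" by blast
  have "(norm (X k - abs_l2 u))\<^sup>2 = (\<integral>x. (?s k x - u x)\<^sup>2 \<partial>ref_measure 1)" for k
    using norm[OF rep_l2 u(1), of "X k"] by (simp add: abs_rep_l2)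
  then have "(\<lambda>k. (norm (X k - abs_l2 u))\<^sup>2) \<longlonglongrightarrow> 0" using u(2) by simp
  then have "(\<lambda>k. norm (X k - abs_l2 u)) \<longlonglongrightarrow> 0" using tendsto_real_sqrt by fastforce
  then have "X \<longlonglongrightarrow> abs_l2 u" by (simp add: tendsto_norm_zero_iff LIM_zero_iff)
  then show "convergent X" by (auto simp: convergent_def)
qed

text \<open>A nonzero vector is what \<open>perfect_space\<close> amounts to for a normed space. The
  indicator of the unit ball serves: its measure is finite and positive.\<close>

lemma l2_nontrivial: "\<exists>v :: 'n::finite l2. v \<noteq> 0"
proof -
  define A where "A = ball 0 1 \<inter> (orthant :: (real^'n) set)"
  have A: "A \<in> sets orthant_borel"
    using sets.Int[OF borel_open[OF open_ball] borel_closed[OF closed_orthant]] by (simp add: sets_orthant_borel A_def)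
  then have A': "A \<in> sets (ref_measure 1)" by (simp add: sets_ref_measure)
  have pos: "emeasure (ref_measure 1) A > 0"
  proof -
    have "0 \<in> ball 0 1 \<inter> (orthant :: (real^'n) set)" by (simp add: orthant_def)
    then show ?thesis unfolding A_def by (intro emeasure_ref_measure_open open_ball) blast
  qed
  have S: "orthant \<inter> cball 0 1 \<in> sets (orthant_borel :: (real^'n) measure)"
    using sets.Int[OF borel_closed[OF closed_orthant] borel_closed[OF closed_cball]] by (simp add: sets_orthant_borel)
  have "emeasure (ref_measure 1) A \<le> emeasure (ref_measure 1) (orthant \<inter> cball 0 1 :: (real^'n) set)"
    using S by (intro emeasure_mono) (auto simp: A_def sets_ref_measure)
  also have "\<dots> = (\<Sum>B\<in>UNIV. emeasure (face_measure 1 B) (orthant \<inter> cball 0 1 :: (real^'n) set))" by (rule emeasure_ref_measure[OF S])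
  also have "\<dots> < \<infinity>" using emeasure_face_lebesgue_bounded[where 'n='n] by (simp add: face_measure_def ennreal_sum_less_top less_top)
  finally have fin: "emeasure (ref_measure 1) A < \<infinity>" .
  have ind: "indicator A \<in> L2 (ref_measure 1)"
  proof -
    have "(\<lambda>x. (indicator A x)\<^sup>2) = (indicator A :: real^'n \<Rightarrow> real)" by (auto simp: indicator_def)
    then show ?thesis unfolding L2_def using A' fin by (auto intro: integrable_real_indicator)
  qed
  have "inner (abs_l2 (indicator A)) (abs_l2 (indicator A)) = measure (ref_measure 1) A"
    using A' by (simp add: inner_abs_l2[OF ind ind] L2_inner_def indicator_inter_arith[symmetric])
  also have "\<dots> > 0" using pos fin by (simp add: measure_def enn2real_positive_iff less_top)
  finally show ?thesis by (metis inner_zero_left less_irrefl)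
qed

instance l2 :: (finite) perfect_space
proof
  fix x :: "'a l2"
  obtain v :: "'a l2" where v: "v \<noteq> 0" using l2_nontrivial by blast
  show "\<not> open {x}"
  proof
    assume "open {x}"
    then obtain e where e: "e > 0" "ball x e \<subseteq> {x}" by (meson insertI1 open_contains_ball)
    have "x + (e / (2 * norm v)) *\<^sub>R v \<in> ball x e" using e v by (simp add: dist_norm)
    then have "(e / (2 * norm v)) *\<^sub>R v = 0" using e(2) by (metis add_cancel_right_right singletonD subsetD)
    then show False using e v by simp
  qed
qed

text \<open>Multiplication by \<open>sqrt (r x)\<close> preserves inner products, and positivity of
  \<open>r\<close> almost everywhere makes it onto, with division as its inverse.\<close>

lemma L2_space_density:
  fixes r :: "real^'n::finite \<Rightarrow> real"
  assumes r [measurable]: "r \<in> borel_measurable (ref_measure 1)" and pos: "AE x in ref_measure 1. 0 < r x"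
    and M: "M = density (ref_measure 1) (\<lambda>x. ennreal (r x))"
  shows "L2_space M (\<lambda>f. abs_l2 (\<lambda>x. f x * sqrt (r x))) (\<lambda>h x. rep_l2 h x / sqrt (r x))"
proof -
  have meas: "f \<in> borel_measurable M \<longleftrightarrow> f \<in> borel_measurable (ref_measure 1)" for f :: "real^'n \<Rightarrow> real"
    by (simp add: M)
  have nonneg: "AE x in ref_measure 1. 0 \<le> r x" using pos by eventually_elim simp
  have mult: "f \<in> L2 M \<longleftrightarrow> f \<in> borel_measurable (ref_measure 1) \<and> (\<lambda>x. f x * sqrt (r x)) \<in> L2 (ref_measure 1)" for f
  proof (cases "f \<in> borel_measurable (ref_measure 1)")
    case True
    note [measurable] = True
    have "integrable M (\<lambda>x. (f x)\<^sup>2) \<longleftrightarrow> integrable (ref_measure 1) (\<lambda>x. r x * (f x)\<^sup>2)"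
      unfolding M by (rule integrable_real_density) (use nonneg in measurable)
    also have "\<dots> \<longleftrightarrow> integrable (ref_measure 1) (\<lambda>x. (f x * sqrt (r x))\<^sup>2)"
    proof (rule integrable_cong_AE)
      show "AE x in ref_measure 1. r x * (f x)\<^sup>2 = (f x * sqrt (r x))\<^sup>2"
        using nonneg by eventually_elim (simp add: power_mult_distrib)
    qed measurable
    finally show ?thesis by (simp add: L2_def meas)
  qed (simp add: L2_def meas)
  show ?thesis
  proof
    fix f g and c :: real assume f: "f \<in> L2 M" 
    then have fr: "(\<lambda>x. f x * sqrt (r x)) \<in> L2 (ref_measure 1)" by (simp add: mult)
    show "abs_l2 (\<lambda>x. c * f x * sqrt (r x)) = c *\<^sub>R abs_l2 (\<lambda>x. f x * sqrt (r x))"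
      by (simp add: abs_l2_scale[OF fr, symmetric] mult.assoc)
    assume g: "g \<in> L2 M"
    then have gr: "(\<lambda>x. g x * sqrt (r x)) \<in> L2 (ref_measure 1)" by (simp add: mult)
    show "abs_l2 (\<lambda>x. (f x + g x) * sqrt (r x)) = abs_l2 (\<lambda>x. f x * sqrt (r x)) + abs_l2 (\<lambda>x. g x * sqrt (r x))"
      by (simp add: abs_l2_add[OF fr gr, symmetric] distrib_right)
    have [measurable]: "f \<in> borel_measurable (ref_measure 1)" "g \<in> borel_measurable (ref_measure 1)"
      using f g by (auto simp: mult)
    have "L2_inner M f g = (\<integral>x. r x * (f x * g x) \<partial>ref_measure 1)"
      unfolding L2_inner_def M by (rule integral_real_density) (use nonneg in measurable)
    also have "\<dots> = L2_inner (ref_measure 1) (\<lambda>x. f x * sqrt (r x)) (\<lambda>x. g x * sqrt (r x))"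
      unfolding L2_inner_def
    proof (rule integral_cong_AE)
      show "AE x in ref_measure 1. r x * (f x * g x) = f x * sqrt (r x) * (g x * sqrt (r x))"
        using nonneg
      proof eventually_elim
        case (elim x)
        have "f x * sqrt (r x) * (g x * sqrt (r x)) = (sqrt (r x) * sqrt (r x)) * (f x * g x)" by (simp only: mult_ac)
        then show ?case using elim by simp
      qed
    qed measurable
    finally show "inner (abs_l2 (\<lambda>x. f x * sqrt (r x))) (abs_l2 (\<lambda>x. g x * sqrt (r x))) = L2_inner M f g"
      by (simp add: inner_abs_l2 fr gr)
  next
    fix h :: "'n l2"
    have [measurable]: "rep_l2 h \<in> borel_measurable (ref_measure 1)" using L2D(1)[OF rep_l2] .
    have eq: "AE x in ref_measure 1. rep_l2 h x = rep_l2 h x / sqrt (r x) * sqrt (r x)"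
      using pos by eventually_elim simp
    have L2': "(\<lambda>x. rep_l2 h x / sqrt (r x) * sqrt (r x)) \<in> L2 (ref_measure 1)"
      by (rule L2_cong_AE[OF rep_l2 _ eq]) measurable
    then show "(\<lambda>x. rep_l2 h x / sqrt (r x)) \<in> L2 M" unfolding mult by simp
    have "l2_rel (rep_l2 h) (\<lambda>x. rep_l2 h x / sqrt (r x) * sqrt (r x))"
      using eq L2' rep_l2 by (simp add: l2_rel_def)
    then have "abs_l2 (rep_l2 h) = abs_l2 (\<lambda>x. rep_l2 h x / sqrt (r x) * sqrt (r x))"
      by (rule Quotient3_rel_abs[OF Quotient3_l2])
    then show "abs_l2 (\<lambda>x. rep_l2 h x / sqrt (r x) * sqrt (r x)) = h" by (simp add: abs_rep_l2)
  qed
qed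

section \<open>Closability and density\<close>

lemma box_Int_cart:
  fixes a b c d :: "real^'n"
  shows "box a b \<inter> box c d = box (\<chi> i. max (a $ i) (c $ i)) (\<chi> i. min (b $ i) (d $ i))"
  by (auto simp: mem_box_cart)

text \<open>Boxes are stable under intersection and generate the Borel sets, so Dynkin's theorem
  applies. The step for complements needs the total integral, which is 0 by exhaustion with growing
  cubes.\<close>

lemma AE_zero_if_box_integrals_zero:
  fixes w :: "real^'n::finite \<Rightarrow> real"
  assumes "finite_measure M" and sets_M: "sets M = sets orthant_borel" and w: "integrable M w"
    and box: "\<And>a b. (\<integral>x. w x * indicator (box a b) x \<partial>M) = 0"
  shows "AE x in M. w x = 0"
proof -
  interpret finite_measure M by fact
  have space_M: "space M = orthant" using sets_eq_imp_space_eq[OF sets_M] by (simp add: space_orthant_borel)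
  have inM: "A \<inter> orthant \<in> sets M" if "A \<in> sets borel" for A :: "(real^'n) set"
    using sets.Int[OF that borel_closed[OF closed_orthant]] by (simp add: sets_M sets_orthant_borel)
  have ind: "(\<integral>x. w x * indicator A x \<partial>M) = set_lebesgue_integral M (A \<inter> orthant) w" for A
    unfolding set_integral_indicator
    by (intro Bochner_Integration.integral_cong) (auto simp: space_M indicator_def)
  have int: "set_integrable M (A \<inter> orthant) w" if "A \<in> sets borel" for A
    using integrable_mult_indicator[OF inM[OF that] w] by (simp add: set_integrable_def)
  have total: "integral\<^sup>L M w = 0"
  proof -
    have "(\<lambda>k. \<integral>x. w x * indicator (box (- real k *\<^sub>R 1) (real k *\<^sub>R 1)) x \<partial>M) \<longlonglongrightarrow> integral\<^sup>L M w"
    proof (rule integral_dominated_convergence[where w="\<lambda>x. \<bar>w x\<bar>"])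
      show "(\<lambda>x. w x * indicator (box (- real k *\<^sub>R 1) (real k *\<^sub>R 1)) x) \<in> borel_measurable M" for k
      proof -
        have "integrable M (\<lambda>x. indicator (box (- real k *\<^sub>R 1) (real k *\<^sub>R 1) \<inter> orthant) x *\<^sub>R w x)"
          by (intro integrable_mult_indicator inM w) simp
        then have "(\<lambda>x. indicator (box (- real k *\<^sub>R 1) (real k *\<^sub>R 1) \<inter> orthant) x *\<^sub>R w x) \<in> borel_measurable M" by simp
        then show ?thesis
          by (rule measurable_cong[THEN iffD1, rotated]) (auto simp: space_M indicator_def)
      qed
      show "AE x in M. (\<lambda>k. w x * indicator (box (- real k *\<^sub>R 1) (real k *\<^sub>R 1)) x) \<longlonglongrightarrow> w x"
      proof (rule AE_I2)
        fix x :: "real^'n"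
        obtain K :: nat where K: "norm x < real K" using reals_Archimedean2 by blast
        have "x \<in> box (- real k *\<^sub>R 1) (real k *\<^sub>R 1)" if "k \<ge> K" for k
        proof -
          have "\<bar>x $ i\<bar> < real k" for i using component_le_norm_cart[of x i] K that by linarith
          then show ?thesis by (auto simp: mem_box_cart abs_less_iff) (metis minus_less_iff)
        qed
        then have "\<forall>\<^sub>F k in sequentially. w x * indicator (box (- real k *\<^sub>R 1) (real k *\<^sub>R 1)) x = w x"
          by (intro eventually_mono[OF eventually_ge_at_top[of K]]) simp
        then show "(\<lambda>k. w x * indicator (box (- real k *\<^sub>R 1) (real k *\<^sub>R 1)) x) \<longlonglongrightarrow> w x"
          by (rule tendsto_eventually)
      qed
    qed (use w in \<open>auto simp: indicator_def\<close>)
    then show ?thesis unfolding box by (simp add: LIMSEQ_const_iff)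
  qed
  have zero: "set_lebesgue_integral M (A \<inter> orthant) w = 0" if "A \<in> sets borel" for A
  proof -
    have gen: "sets (borel :: (real^'n) measure) = sigma_sets UNIV (range (\<lambda>(a, b). box a b))"
      by (subst borel_eq_box) (simp add: sets_measure_of)
    have stable: "Int_stable (range (\<lambda>(a, b). box a b :: (real^'n) set))"
    proof (rule Int_stableI, elim imageE, clarify)
      fix a b c d :: "real^'n"
      show "box a b \<inter> box c d \<in> range (\<lambda>(a, b). box a b)" unfolding box_Int_cart by (rule range_eqI[of _ _ "(_, _)"]) simp
    qed
    have "range (\<lambda>(a, b). box a b :: (real^'n) set) \<subseteq> Pow UNIV" by simp
    from stable this that[unfolded gen] show ?thesis
    proof (induction rule: sigma_sets_induct_disjoint)
      case (basic A)
      then obtain a b where "A = box a b" by auto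
      then show ?case using box[of a b] ind by simp
    next
      case (compl A)
      then have A: "A \<in> sets borel" by (simp add: gen)
      have "set_lebesgue_integral M ((UNIV - A) \<inter> orthant) w = (\<integral>x. w x - indicator (A \<inter> orthant) x * w x \<partial>M)"
        unfolding set_integral_indicator
        by (intro Bochner_Integration.integral_cong) (auto simp: space_M indicator_def)
      also have "\<dots> = 0"
        using int[OF A] w compl total by (simp add: set_integrable_def set_integral_indicator)
      finally show ?case .
    next
      case (union A)
      then have A: "A i \<in> sets borel" for i by (auto simp: gen)
      have eq: "(\<Union> (range A)) \<inter> orthant = (\<Union>i. A i \<inter> orthant)" by auto
      have "\<Union> (range A) \<in> sets borel" using A by auto
      then have "set_integrable M (\<Union>i. A i \<inter> orthant) w" using int unfolding eq[symmetric] by blast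
      then have "set_lebesgue_integral M (\<Union>i. A i \<inter> orthant) w = (\<Sum>i. set_lebesgue_integral M (A i \<inter> orthant) w)"
        using union(1) A by (intro lebesgue_integral_countable_add inM) (auto simp: disjoint_family_on_def)
      then show ?case unfolding eq using union by simp
    qed (simp add: set_lebesgue_integral_def)
  qed
  show ?thesis
  proof (rule density_zero[OF w])
    fix A assume "A \<in> sets M"
    then have A: "A \<subseteq> orthant" "A \<in> sets borel" by (auto simp: sets_M sets_orthant_borel)
    then show "set_lebesgue_integral M A w = 0" using zero[OF A(2)] by (simp add: Int_absorb2)
  qed
qed

text \<open>By the Lindelof property countably many of the local null sets suffice.\<close>

lemma AE_of_local_AE:
  fixes R :: "'a::second_countable_topology set"
  assumes "\<And>x. x \<in> R \<Longrightarrow> \<exists>U. open U \<and> x \<in> U \<and> (AE y in M. y \<in> U \<longrightarrow> P y)"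
  shows "AE y in M. y \<in> R \<longrightarrow> P y"
proof -
  define \<U> where "\<U> = {U. open U \<and> (AE y in M. y \<in> U \<longrightarrow> P y)}"
  have "\<And>S. S \<in> \<U> \<Longrightarrow> open S" by (simp add: \<U>_def)
  then obtain \<V> where \<V>: "\<V> \<subseteq> \<U>" "countable \<V>" "\<Union>\<V> = \<Union>\<U>" by (rule Lindelof)
  have "AE y in M. \<forall>U\<in>\<V>. y \<in> U \<longrightarrow> P y"
    using \<V>(1,2) by (subst AE_ball_countable) (auto simp: \<U>_def)
  moreover have "R \<subseteq> \<Union>\<V>" unfolding \<V>(3) using assms by (auto simp: \<U>_def)
  ultimately show ?thesis by (auto elim!: eventually_mono)
qed

locale setting =
  fixes \<beta> :: real and \<rho> :: "real^'n::finite \<Rightarrow> real"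
  assumes \<beta>: "0 < \<beta>"
    and \<rho>_meas: "\<rho> \<in> borel_measurable (restrict_space borel orthant)"
    and \<rho>_pos: "AE x in ref_measure \<beta>. 0 < \<rho> x"
    and \<rho>_int: "integrable (ref_measure \<beta>) \<rho>"
    and \<rho>_regular: "\<And>B::'n set. B \<noteq> {} \<Longrightarrow>
           AE x in face_measure \<beta> B. x \<in> closure (face B) - regular_points \<beta> \<rho> B \<longrightarrow> \<rho> x = 0"
begin

abbreviation \<mu> :: "(real^'n) measure" where "\<mu> \<equiv> weighted_measure \<beta> \<rho>"

lemma sets_\<mu>: "sets \<mu> = sets orthant_borel" by (simp add: weighted_measure_def sets_ref_measure)

lemma space_\<mu>: "space \<mu> = orthant" by (simp add: weighted_measure_def space_ref_measure)

lemma measurable_ref_iff: "f \<in> borel_measurable (ref_measure b) \<longleftrightarrow> f \<in> borel_measurable orthant_borel"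
  for f :: "real^'n \<Rightarrow> 'b::topological_space"
  by (rule measurable_cong_sets[THEN arg_cong2[where f="(\<in>)", OF refl]]) (auto simp: sets_ref_measure)

lemma measurable_\<mu>_iff: "f \<in> borel_measurable \<mu> \<longleftrightarrow> f \<in> borel_measurable orthant_borel"
  for f :: "real^'n \<Rightarrow> 'b::topological_space"
  by (rule measurable_cong_sets[THEN arg_cong2[where f="(\<in>)", OF refl]]) (auto simp: sets_\<mu>)

lemma \<rho>_meas' [measurable]: "\<rho> \<in> borel_measurable (ref_measure \<beta>)"
  using \<rho>_meas by (simp only: measurable_ref_iff)

lemma AE_\<mu>_iff: "(AE x in \<mu>. P x) \<longleftrightarrow> (AE x in ref_measure \<beta>. P x)"
proof -
  have "(AE x in \<mu>. P x) \<longleftrightarrow> (AE x in ref_measure \<beta>. 0 < ennreal (\<rho> x) \<longrightarrow> P x)"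
    unfolding weighted_measure_def by (rule AE_density) measurable
  also have "\<dots> \<longleftrightarrow> (AE x in ref_measure \<beta>. P x)"
    using \<rho>_pos by (auto elim: eventually_elim2)
  finally show ?thesis .
qed

lemma \<rho>_pos': "AE x in \<mu>. 0 < \<rho> x" using \<rho>_pos AE_\<mu>_iff by blast

lemma AE_face_measure_iff: "(AE x in face_measure \<beta> B. P x) \<longleftrightarrow> (AE x in \<mu>. x \<in> face B \<longrightarrow> P x)"
  unfolding AE_\<mu>_iff face_measure_eq_density
  using face_in_sets[of B] by (subst AE_density) (auto simp: sets_ref_measure indicator_def intro!: borel_measurable_indicator)

sublocale finite_measure \<mu>
proof (rule finite_measureI)
  have "emeasure \<mu> (space \<mu>) = (\<integral>\<^sup>+x. ennreal (\<rho> x) * indicator (space (ref_measure \<beta>)) x \<partial>ref_measure \<beta>)"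
    unfolding weighted_measure_def space_density by (rule emeasure_density) auto
  also have "\<dots> = (\<integral>\<^sup>+x. ennreal (\<rho> x) \<partial>ref_measure \<beta>)" by (intro nn_integral_cong) simp
  also have "\<dots> = ennreal (\<integral>x. \<rho> x \<partial>ref_measure \<beta>)"
    using \<rho>_pos by (intro nn_integral_eq_integral \<rho>_int) (auto elim: eventually_mono)
  finally show "emeasure \<mu> (space \<mu>) \<noteq> \<infinity>" by simp
qed

lemma emeasure_\<mu>_open:
  assumes "open U" "U \<inter> orthant \<noteq> {}" shows "emeasure \<mu> (U \<inter> orthant) > 0"
proof (rule ccontr)
  assume "\<not> emeasure \<mu> (U \<inter> orthant) > 0"
  then have z: "emeasure \<mu> (U \<inter> orthant) = 0" by (simp add: zero_less_iff_neq_zero)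
  have S: "U \<inter> orthant \<in> sets orthant_borel"
    using sets.Int[OF borel_open[OF assms(1)] borel_closed[OF closed_orthant]] by (simp add: sets_orthant_borel)
  have "AE x in \<mu>. x \<notin> U \<inter> orthant"
    using z S by (intro AE_not_in null_setsI) (auto simp: sets_\<mu>)
  then have "AE x in ref_measure \<beta>. x \<notin> U \<inter> orthant" by (simp only: AE_\<mu>_iff)
  then have "emeasure (ref_measure \<beta>) (U \<inter> orthant) = 0"
    using S by (subst (asm) AE_iff_measurable[of "U \<inter> orthant"])
      (auto simp: sets_ref_measure space_ref_measure)
  then show False using emeasure_ref_measure_open[OF assms, of \<beta>] by simp
qed

text \<open>The density of \<open>\<mu>\<close> with respect to \<open>ref_measure 1\<close>.\<close>

definition r :: "real^'n \<Rightarrow> real" where "r x = \<beta> ^ card {i. x $ i = 0} * \<rho> x"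

definition \<Phi> :: "(real^'n \<Rightarrow> real) \<Rightarrow> 'n l2" where "\<Phi> f = abs_l2 (\<lambda>x. f x * sqrt (r x))"

definition \<Psi> :: "'n l2 \<Rightarrow> real^'n \<Rightarrow> real" where "\<Psi> h x = rep_l2 h x / sqrt (r x)"

sublocale finite_L2_space \<mu> \<Phi> \<Psi>
proof -
  have w: "(\<lambda>x. \<beta> ^ card {i. x $ i = 0}) \<in> borel_measurable (ref_measure 1 :: (real^'n) measure)"
    unfolding measurable_ref_iff by (rule ref_measure_eq_density(2)[OF \<beta>])
  have \<rho>1: "\<rho> \<in> borel_measurable (ref_measure 1)" unfolding measurable_ref_iff by (rule \<rho>_meas)
  have "L2_space \<mu> (\<lambda>f. abs_l2 (\<lambda>x. f x * sqrt (r x))) (\<lambda>h x. rep_l2 h x / sqrt (r x))"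
  proof (rule L2_space_density)
    show "r \<in> borel_measurable (ref_measure 1)" unfolding r_def[abs_def] using w \<rho>1 by measurable
    have "AE x in density (ref_measure 1) (\<lambda>x. ennreal (\<beta> ^ card {i. x $ i = 0})). 0 < \<rho> x"
      using \<rho>_pos unfolding ref_measure_eq_density(1)[OF \<beta>] .
    then have "AE x in ref_measure 1. 0 < ennreal (\<beta> ^ card {i. x $ i = 0}) \<longrightarrow> 0 < \<rho> x"
      using w by (subst (asm) AE_density) auto
    then show "AE x in ref_measure 1. 0 < r x" using \<beta> by (auto simp: r_def)
    have "\<mu> = density (density (ref_measure 1) (\<lambda>x. ennreal (\<beta> ^ card {i. x $ i = 0}))) (\<lambda>x. ennreal (\<rho> x))"
      unfolding weighted_measure_def ref_measure_eq_density(1)[OF \<beta>] ..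
    also have "\<dots> = density (ref_measure 1) (\<lambda>x. ennreal (\<beta> ^ card {i. x $ i = 0}) * ennreal (\<rho> x))"
      using w \<rho>1 by (intro density_density_eq) auto
    also have "\<dots> = density (ref_measure 1) (\<lambda>x. ennreal (r x))"
      using \<beta> by (simp add: r_def ennreal_mult')
    finally show "\<mu> = density (ref_measure 1) (\<lambda>x. ennreal (r x))" .
  qed
  then have "L2_space \<mu> \<Phi> \<Psi>" unfolding \<Phi>_def[abs_def] \<Psi>_def[abs_def] .
  then show "finite_L2_space \<mu> \<Phi> \<Psi>" unfolding finite_L2_space_def using finite_measure_axioms by blast
qed

text \<open>As \<open>i \<in> B\<close> iff \<open>x $ i > 0\<close> for \<open>x\<close> in \<open>face B\<close>, the sum over the faces is a single
  integral of \<open>\<Sum>i. fd i f * fd i g\<close> with respect to \<open>\<mu>\<close>.\<close>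

definition fd :: "'n \<Rightarrow> (real^'n \<Rightarrow> real) \<Rightarrow> real^'n \<Rightarrow> real" where
  "fd i f x = (if 0 < x $ i then pd i f x else 0)"

definition grad :: "(real^'n \<Rightarrow> real) \<Rightarrow> 'n l2 ^ 'n" where "grad f = (\<chi> i. \<Phi> (fd i f))"

lemma component_measurable: "(\<lambda>x. x $ i) \<in> borel_measurable orthant_borel"
  by (intro measurable_on_orthant continuous_intros)

lemma continuous_measurable_\<mu>: "continuous_on orthant f \<Longrightarrow> f \<in> borel_measurable \<mu>" for f :: "real^'n \<Rightarrow> real"
  unfolding measurable_\<mu>_iff by (rule measurable_on_orthant)

lemma fd_measurable: "C2 f \<Longrightarrow> fd i f \<in> borel_measurable \<mu>"
proof -
  assume "C2 f"
  then have [measurable]: "pd i f \<in> borel_measurable \<mu>" "(\<lambda>x. x $ i) \<in> borel_measurable \<mu>"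
    using component_measurable by (auto intro: continuous_measurable_\<mu> C2_continuous simp: measurable_\<mu>_iff[of "\<lambda>x. x $ i"])
  show ?thesis unfolding fd_def[abs_def] by measurable
qed

lemma Cck2_L2: assumes "f \<in> Cck 2" shows "f \<in> L2 \<mu>" "fd i f \<in> L2 \<mu>"
proof -
  have C2: "C2 f" using assms by (simp add: Cck2_iff)
  obtain K where K: "\<And>x. x \<in> orthant \<Longrightarrow> \<bar>f x\<bar> \<le> K" "\<And>x i. x \<in> orthant \<Longrightarrow> \<bar>pd i f x\<bar> \<le> K"
    using Cck2_bounded[OF assms] by metis
  have K0: "0 \<le> K" using K(1)[of 0] by (auto simp: orthant_def)
  show "f \<in> L2 \<mu>" by (rule L2_bounded[of _ K]) (auto simp: space_\<mu> K intro: continuous_measurable_\<mu> C2_continuous C2)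
  show "fd i f \<in> L2 \<mu>" by (rule L2_bounded[of _ K]) (auto simp: space_\<mu> K K0 fd_def intro: fd_measurable[OF C2])
qed

lemma \<Phi>_cong: "f \<in> L2 \<mu> \<Longrightarrow> g \<in> L2 \<mu> \<Longrightarrow> (\<And>x. x \<in> orthant \<Longrightarrow> f x = g x) \<Longrightarrow> \<Phi> f = \<Phi> g"
  by (subst \<Phi>_eq_iff) (auto simp: space_\<mu>)

lemma inner_grad: "f \<in> Cck 2 \<Longrightarrow> g \<in> Cck 2 \<Longrightarrow> inner (grad f) (grad g) = (\<Sum>i\<in>UNIV. \<integral>x. fd i f x * fd i g x \<partial>\<mu>)"
  by (simp add: inner_vec_def grad_def \<Phi>_inner Cck2_L2 L2_inner_def)

section \<open>The form as an inner product of gradients\<close>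

lemma face_gradient_inner:
  assumes "x \<in> face B"
  shows "face_gradient B f x \<bullet> face_gradient B g x = (\<Sum>i\<in>UNIV. fd i f x * fd i g x)"
proof -
  have comp: "face_gradient B f x $ i = fd i f x" for i and f :: "real^'n \<Rightarrow> real"
  proof -
    have "face_gradient B f x $ i = (\<Sum>j\<in>B. if j = i then pd i f x else 0)"
      by (simp add: face_gradient_def axis_def if_distrib[where f="\<lambda>c. _ * c"] cong: if_cong sum.cong)
    also have "\<dots> = fd i f x" using assms by (auto simp: fd_def face_def)
    finally show ?thesis .
  qed
  show ?thesis by (simp add: inner_vec_def comp)
qed

lemma weighted_face_measure_eq: "weighted_face_measure \<beta> \<rho> B = density \<mu> (\<lambda>x. ennreal (indicator (face B) x))"
proof -
  have F: "face B \<in> sets (ref_measure \<beta>)" using face_in_sets by (simp add: sets_ref_measure)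
  have i: "(\<lambda>x. ennreal (indicator (face B) x)) = indicator (face B)" by (auto simp: indicator_def)
  show ?thesis
    unfolding weighted_face_measure_def weighted_measure_def face_measure_eq_density i
    using F by (subst (1 2) density_density_eq) (auto simp: mult.commute)
qed

lemma face_meas_\<mu> [measurable]: "face B \<in> sets \<mu>" using face_in_sets by (simp add: sets_\<mu>)

definition energy :: "(real^'n \<Rightarrow> real) \<Rightarrow> (real^'n \<Rightarrow> real) \<Rightarrow> real^'n \<Rightarrow> real" where
  "energy f g x = (\<Sum>i\<in>UNIV. fd i f x * fd i g x)"

lemma energy_integrable: "f \<in> Cck 2 \<Longrightarrow> g \<in> Cck 2 \<Longrightarrow> integrable \<mu> (energy f g)"
  unfolding energy_def[abs_def] by (intro Bochner_Integration.integrable_sum integrable_L2_mult Cck2_L2)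

lemma face_integral:
  assumes "f \<in> Cck 2" "g \<in> Cck 2"
  shows "set_integrable (weighted_face_measure \<beta> \<rho> B) (face B) (\<lambda>x. face_gradient B f x \<bullet> face_gradient B g x)"
    "set_lebesgue_integral (weighted_face_measure \<beta> \<rho> B) (face B) (\<lambda>x. face_gradient B f x \<bullet> face_gradient B g x)
      = (\<integral>x. indicator (face B) x * energy f g x \<partial>\<mu>)"
proof -
  have eq: "indicator (face B) x *\<^sub>R (face_gradient B f x \<bullet> face_gradient B g x) = indicator (face B) x * energy f g x" for x
    using face_gradient_inner[of x B f g] by (auto simp: indicator_def energy_def)
  have int: "integrable \<mu> (\<lambda>x. indicator (face B) x * energy f g x)"
    using integrable_mult_indicator[OF face_meas_\<mu> energy_integrable[OF assms]] by simp
  then have [measurable]: "(\<lambda>x. indicator (face B) x * energy f g x) \<in> borel_measurable \<mu>" by simp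
  have idem: "(\<lambda>x. indicator (face B) x * (indicator (face B) x * energy f g x)) = (\<lambda>x. indicator (face B) x * energy f g x)"
    by (auto simp: indicator_def)
  show "set_integrable (weighted_face_measure \<beta> \<rho> B) (face B) (\<lambda>x. face_gradient B f x \<bullet> face_gradient B g x)"
    unfolding set_integrable_def eq weighted_face_measure_eq
    by (subst integrable_real_density) (auto simp: idem int)
  show "set_lebesgue_integral (weighted_face_measure \<beta> \<rho> B) (face B) (\<lambda>x. face_gradient B f x \<bullet> face_gradient B g x)
      = (\<integral>x. indicator (face B) x * energy f g x \<partial>\<mu>)"
    unfolding set_lebesgue_integral_def eq weighted_face_measure_eq
    by (subst integral_real_density) (auto simp: idem)
qed

lemma gradient_form_eq:
  assumes fg: "f \<in> Cck 2" "g \<in> Cck 2"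
  shows "gradient_form \<beta> \<rho> f g = inner (grad f) (grad g)"
proof -
  have "gradient_form \<beta> \<rho> f g = (\<Sum>B\<in>{B. B \<noteq> {}}. \<integral>x. indicator (face B) x * energy f g x \<partial>\<mu>)"
    unfolding gradient_form_def using face_integral(2)[OF fg] by simp
  also have "\<dots> = (\<Sum>B\<in>UNIV. \<integral>x. indicator (face B) x * energy f g x \<partial>\<mu>)"
  proof (rule sum.mono_neutral_left)
    \<comment> \<open>The omitted face is the origin, where every \<open>fd i\<close> is 0 by
      definition; so the sum may run over all faces.\<close>
    have "indicator (face {}) x * energy f g x = 0" for x
      by (cases "x \<in> face {}") (simp_all add: face_def energy_def fd_def)
    then have "(\<integral>x. indicator (face {}) x * energy f g x \<partial>\<mu>) = 0" by (simp only: integral_zero)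
    then show "\<forall>B\<in>UNIV - {B. B \<noteq> {}}. (\<integral>x. indicator (face B) x * energy f g x \<partial>\<mu>) = 0" by simp
  qed auto
  also have "\<dots> = (\<integral>x. (\<Sum>B\<in>UNIV. indicator (face B) x * energy f g x) \<partial>\<mu>)"
    using integrable_mult_indicator[OF face_meas_\<mu> energy_integrable[OF fg]]
    by (subst Bochner_Integration.integral_sum) auto
  also have "\<dots> = integral\<^sup>L \<mu> (energy f g)"
  proof (rule Bochner_Integration.integral_cong[OF refl])
    fix x assume "x \<in> space \<mu>"
    then have x: "x \<in> orthant" by (simp add: space_\<mu>)
    have "(\<Sum>B\<in>UNIV. indicator (face B) x * energy f g x) = (\<Sum>B\<in>UNIV. if B = {i. 0 < x $ i} then energy f g x else 0)"
    proof (rule sum.cong[OF refl])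
      fix B show "indicator (face B) x * energy f g x = (if B = {i. 0 < x $ i} then energy f g x else 0)"
        using face_disjoint_cover(1)[OF x] face_disjoint_cover(2)[of x B]
        by (cases "x \<in> face B") (metis indicator_simps mult_1 mult_zero_left)+
    qed
    then show "(\<Sum>B\<in>UNIV. indicator (face B) x * energy f g x) = energy f g x" by simp
  qed
  also have "\<dots> = inner (grad f) (grad g)"
    unfolding inner_grad[OF fg] energy_def[abs_def]
    by (rule Bochner_Integration.integral_sum) (intro integrable_L2_mult Cck2_L2 fg)
  finally show ?thesis .
qed

lemma \<Phi>_bump_limit:
  assumes "w \<in> L2 \<mu>" "\<And>m. (\<integral>x. w x * bump a b m x \<partial>\<mu>) = 0"
  shows "(\<integral>x. w x * indicator (box a b) x \<partial>\<mu>) = 0"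
proof -
  have "(\<lambda>m. \<integral>x. w x * bump a b m x \<partial>\<mu>) \<longlonglongrightarrow> (\<integral>x. w x * indicator (box a b) x \<partial>\<mu>)"
  proof (rule integral_dominated_convergence[where w="\<lambda>x. \<bar>w x\<bar>"])
    have b: "bump a b m \<in> borel_measurable \<mu>" for m by (intro continuous_measurable_\<mu> C2_continuous C2_bump)
    have w: "w \<in> borel_measurable \<mu>" using assms(1) by (rule L2D)
    show "(\<lambda>x. w x * bump a b m x) \<in> borel_measurable \<mu>" for m using b w by measurable
    have "(\<lambda>x. lim (\<lambda>m. bump a b m x)) \<in> borel_measurable \<mu>" using b by measurable
    then have "(indicator (box a b) :: real^'n \<Rightarrow> real) \<in> borel_measurable \<mu>"
      by (simp add: limI[OF bump_tendsto])
    then show "(\<lambda>x. w x * indicator (box a b) x) \<in> borel_measurable \<mu>" using w by measurable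
    show "integrable \<mu> (\<lambda>x. \<bar>w x\<bar>)" by (intro integrable_abs integrable_L2 assms)
    show "AE x in \<mu>. (\<lambda>m. w x * bump a b m x) \<longlonglongrightarrow> w x * indicator (box a b) x"
      by (intro AE_I2 tendsto_intros bump_tendsto)
    show "AE x in \<mu>. norm (w x * bump a b m x) \<le> \<bar>w x\<bar>" for m
      using bump_range[of a b m] by (intro AE_I2) (simp add: abs_mult mult_left_le)
  qed
  then show ?thesis unfolding assms(2) by (simp add: LIMSEQ_const_iff)
qed

lemma AE_zero_\<mu>:
  fixes w :: "real^'n \<Rightarrow> real"
  assumes "integrable \<mu> w" "\<And>a b. (\<integral>x. w x * indicator (box a b) x \<partial>\<mu>) = 0"
  shows "AE x in \<mu>. w x = 0"
  using AE_zero_if_box_integrals_zero[OF finite_measure_axioms sets_\<mu> assms] .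

section \<open>Density of the core\<close>

lemma subspace_\<Phi>_Cck2: "subspace (\<Phi> ` Cck 2)"
proof (rule subspaceI)
  have "(\<lambda>_. 0) \<in> Cck 2" using Cck2_scale[OF bump_Cck2, of 0 0 0 0] by simp
  then show "0 \<in> \<Phi> ` Cck 2" using \<Phi>_0 by (metis image_eqI)
next
  fix x y assume "x \<in> \<Phi> ` Cck 2" "y \<in> \<Phi> ` Cck 2"
  then obtain f g where "f \<in> Cck 2" "g \<in> Cck 2" "x = \<Phi> f" "y = \<Phi> g" by auto
  then show "x + y \<in> \<Phi> ` Cck 2" by (intro image_eqI[of _ _ "\<lambda>x. f x + g x"]) (auto simp: \<Phi>_add Cck2_L2 Cck2_add)
next
  fix c x assume "x \<in> \<Phi> ` Cck 2"
  then obtain f where "f \<in> Cck 2" "x = \<Phi> f" by auto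
  then show "c *\<^sub>R x \<in> \<Phi> ` Cck 2" by (intro image_eqI[of _ _ "\<lambda>x. c * f x"]) (auto simp: \<Phi>_scale Cck2_L2 Cck2_scale)
qed

text \<open>A vector orthogonal to all bumps has, by dominated convergence, integral 0 over every
  box.\<close>

lemma dense_Cck2: "closure (\<Phi> ` Cck 2) = UNIV"
proof (rule dense_subspaceI[OF subspace_\<Phi>_Cck2])
  fix h assume h: "\<And>y. y \<in> \<Phi> ` Cck 2 \<Longrightarrow> inner h y = 0"
  have "AE x in \<mu>. \<Psi> h x = 0"
  proof (rule AE_zero_\<mu>[OF integrable_L2[OF \<Psi>_L2]])
    fix a b
    show "(\<integral>x. \<Psi> h x * indicator (box a b) x \<partial>\<mu>) = 0"
    proof (rule \<Phi>_bump_limit[OF \<Psi>_L2])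
      fix m
      have "inner (\<Phi> (\<Psi> h)) (\<Phi> (bump a b m)) = 0" using h[OF imageI[OF bump_Cck2]] by (simp add: \<Phi>_\<Psi>)
      then show "(\<integral>x. \<Psi> h x * bump a b m x \<partial>\<mu>) = 0"
        by (subst (asm) \<Phi>_inner) (auto simp: \<Psi>_L2 Cck2_L2 bump_Cck2 L2_inner_def)
    qed
  qed
  then show "h = 0" using \<Phi>_eq_0_iff[OF \<Psi>_L2, of h] by (simp add: \<Phi>_\<Psi>)
qed

end

context setting
begin

text \<open>The density \<open>1 / \<rho>\<close> turns the pairing in \<open>L\<^sup>2(\<mu>)\<close> with \<open>test B h\<close> into the integral
  against \<open>h\<close> with respect to the unweighted measure on the face \<open>B\<close>.\<close>

definition test :: "'n set \<Rightarrow> (real^'n \<Rightarrow> real) \<Rightarrow> real^'n \<Rightarrow> real" where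
  "test B h x = indicator (face B) x * h x / \<rho> x"

lemma test_measurable: "h \<in> borel_measurable \<mu> \<Longrightarrow> test B h \<in> borel_measurable \<mu>"
proof -
  assume [measurable]: "h \<in> borel_measurable \<mu>"
  have [measurable]: "\<rho> \<in> borel_measurable \<mu>" unfolding measurable_\<mu>_iff by (rule \<rho>_meas)
  show ?thesis unfolding test_def[abs_def] by measurable
qed

text \<open>On \<open>face B\<close> the weight times the square of h / \<open>\<rho>\<close> is h^2
  / \<open>\<rho>\<close>, bounded by K^2 / \<open>\<rho>\<close> on \<open>Q\<close> and zero
  elsewhere.\<close>

lemma test_L2:
  assumes h: "h \<in> borel_measurable \<mu>" "\<And>x. x \<in> orthant \<Longrightarrow> \<bar>h x\<bar> \<le> K * indicator Q x" and K: "0 \<le> K"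
    and Q: "Q \<in> sets borel" "(\<integral>\<^sup>+y\<in>Q. inverse (ennreal (\<rho> y)) \<partial>face_measure \<beta> B) < \<infinity>"
  shows "test B h \<in> L2 \<mu>"
proof -
  have [measurable]: "test B h \<in> borel_measurable (ref_measure \<beta>)"
    using test_measurable[OF h(1)] by (simp add: measurable_\<mu>_iff measurable_ref_iff)
  have F [measurable]: "face B \<in> sets (ref_measure \<beta>)" using face_in_sets by (simp add: sets_ref_measure)
  have Qm [measurable]: "(indicator Q :: real^'n \<Rightarrow> ennreal) \<in> borel_measurable (ref_measure \<beta>)"
    unfolding measurable_ref_iff by (rule measurable_restrict_space1) (use Q(1) in measurable)
  have "(\<integral>\<^sup>+x. ennreal ((test B h x)\<^sup>2) \<partial>\<mu>) = (\<integral>\<^sup>+x. ennreal (\<rho> x) * ennreal ((test B h x)\<^sup>2) \<partial>ref_measure \<beta>)"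
    unfolding weighted_measure_def by (rule nn_integral_density) measurable
  also have "\<dots> \<le> (\<integral>\<^sup>+x. ennreal (K\<^sup>2) * (indicator (face B) x * (inverse (ennreal (\<rho> x)) * indicator Q x)) \<partial>ref_measure \<beta>)"
  proof (rule nn_integral_mono_AE)
    show "AE x in ref_measure \<beta>. ennreal (\<rho> x) * ennreal ((test B h x)\<^sup>2) \<le> ennreal (K\<^sup>2) * (indicator (face B) x * (inverse (ennreal (\<rho> x)) * indicator Q x))"
      using \<rho>_pos AE_space
    proof eventually_elim
      case (elim x)
      then have x: "x \<in> orthant" by (simp add: space_ref_measure)
      show ?case
      proof (cases "x \<in> face B \<and> x \<in> Q")
        case True
        then have "\<bar>h x\<bar> \<le> K" using h(2)[OF x] by simp
        then have "(h x)\<^sup>2 \<le> K\<^sup>2" using power_mono[of "\<bar>h x\<bar>" K 2] by simp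
        then have "\<rho> x * (test B h x)\<^sup>2 \<le> K\<^sup>2 * inverse (\<rho> x)"
          using True elim(1) by (simp add: test_def power2_eq_square field_simps)
        then have "ennreal (\<rho> x * (test B h x)\<^sup>2) \<le> ennreal (K\<^sup>2 * inverse (\<rho> x))" by (rule ennreal_leI)
        then show ?thesis using True elim(1) by (simp add: ennreal_mult inverse_ennreal)
      next
        case False
        then have "test B h x = 0" using h(2)[OF x] by (auto simp: test_def)
        then show ?thesis by simp
      qed
    qed
  qed
  also have "\<dots> = ennreal (K\<^sup>2) * (\<integral>\<^sup>+x. indicator (face B) x * (inverse (ennreal (\<rho> x)) * indicator Q x) \<partial>ref_measure \<beta>)"
    by (rule nn_integral_cmult) measurable
  also have "(\<integral>\<^sup>+x. indicator (face B) x * (inverse (ennreal (\<rho> x)) * indicator Q x) \<partial>ref_measure \<beta>)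
      = (\<integral>\<^sup>+y\<in>Q. inverse (ennreal (\<rho> y)) \<partial>face_measure \<beta> B)"
    unfolding face_measure_eq_density by (rule nn_integral_density[symmetric]) measurable
  also have "ennreal (K\<^sup>2) * \<dots> < \<infinity>" using Q(2) by (simp add: ennreal_mult_less_top)
  finally show ?thesis unfolding L2_def
    using test_measurable[OF h(1)] by (auto intro!: integrableI_nonneg)
qed

lemma test_pairing:
  fixes u h :: "real^'n \<Rightarrow> real"
  assumes u: "u \<in> borel_measurable \<mu>" and h: "h \<in> borel_measurable \<mu>"
  shows "integrable \<mu> (\<lambda>x. u x * test B h x) \<longleftrightarrow> integrable (face_measure \<beta> B) (\<lambda>x. u x * h x)"
    "(\<integral>x. u x * test B h x \<partial>\<mu>) = (\<integral>x. u x * h x \<partial>face_measure \<beta> B)"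
proof -
  have [measurable]: "u \<in> borel_measurable (ref_measure \<beta>)" "h \<in> borel_measurable (ref_measure \<beta>)"
    "test B h \<in> borel_measurable (ref_measure \<beta>)"
    using u h test_measurable[OF h] by (auto simp: measurable_\<mu>_iff measurable_ref_iff)
  have F [measurable]: "face B \<in> sets (ref_measure \<beta>)" using face_in_sets by (simp add: sets_ref_measure)
  have nonneg: "AE x in ref_measure \<beta>. 0 \<le> \<rho> x" using \<rho>_pos by eventually_elim simp
  have AE: "AE x in ref_measure \<beta>. \<rho> x * (u x * test B h x) = indicator (face B) x * (u x * h x)"
    using \<rho>_pos by eventually_elim (simp add: test_def)
  have d: "face_measure \<beta> B = density (ref_measure \<beta>) (\<lambda>x. ennreal (indicator (face B) x))"
    unfolding face_measure_eq_density by (intro arg_cong2[where f=density]) (auto simp: indicator_def)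
  have "integrable \<mu> (\<lambda>x. u x * test B h x) \<longleftrightarrow> integrable (ref_measure \<beta>) (\<lambda>x. \<rho> x * (u x * test B h x))"
    unfolding weighted_measure_def by (rule integrable_real_density) (use nonneg in measurable)
  also have "\<dots> \<longleftrightarrow> integrable (ref_measure \<beta>) (\<lambda>x. indicator (face B) x * (u x * h x))"
    by (rule integrable_cong_AE[OF _ _ AE]) measurable
  also have "\<dots> \<longleftrightarrow> integrable (face_measure \<beta> B) (\<lambda>x. u x * h x)"
    unfolding d by (rule integrable_real_density[symmetric]) (auto simp: measurable)
  finally show "integrable \<mu> (\<lambda>x. u x * test B h x) \<longleftrightarrow> integrable (face_measure \<beta> B) (\<lambda>x. u x * h x)" .
  have "(\<integral>x. u x * test B h x \<partial>\<mu>) = (\<integral>x. \<rho> x * (u x * test B h x) \<partial>ref_measure \<beta>)"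
    unfolding weighted_measure_def by (rule integral_real_density) (use nonneg in measurable)
  also have "\<dots> = (\<integral>x. indicator (face B) x * (u x * h x) \<partial>ref_measure \<beta>)"
    by (rule integral_cong_AE[OF _ _ AE]) measurable
  also have "\<dots> = (\<integral>x. u x * h x \<partial>face_measure \<beta> B)"
    unfolding d by (rule integral_real_density[symmetric]) (auto simp: measurable)
  finally show "(\<integral>x. u x * test B h x \<partial>\<mu>) = (\<integral>x. u x * h x \<partial>face_measure \<beta> B)" .
qed

lemma integral_face_measure_pd:
  fixes P :: "real^'n \<Rightarrow> real"
  assumes "P \<in> Cck 2" "i \<in> B" "\<And>x. x \<in> orthant \<Longrightarrow> x $ i = 0 \<Longrightarrow> P x = 0"
  shows "(\<integral>x. pd i P x \<partial>face_measure \<beta> B) = 0"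
proof -
  let ?c = "\<beta> ^ (CARD('n) - card B)"
  have d: "face_measure \<beta> B = density (face_lebesgue B) (\<lambda>_. ennreal ?c)"
    by (rule measure_eqI) (auto simp: face_measure_def emeasure_density_const sets_face_lebesgue)
  have m: "pd i P \<in> borel_measurable (face_lebesgue B)"
    using assms(1) by (subst measurable_cong_sets[OF sets_face_lebesgue refl])
      (auto intro: measurable_on_orthant C2_continuous simp: Cck2_iff)
  show ?thesis unfolding d using \<beta> m integral_pd_eq_0[OF assms]
    by (subst integral_real_density) auto
qed

lemma indicator_measurable_\<mu>: "A \<in> sets borel \<Longrightarrow> (indicator A :: real^'n \<Rightarrow> real) \<in> borel_measurable \<mu>"
  unfolding measurable_\<mu>_iff by (rule measurable_restrict_space1) simp

text \<open>After integration by parts both sides are pairings in L2 with fixed vectors, so they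
  pass to the limit, where the side containing \<open>s k\<close> vanishes. Thus g /
  \<open>\<rho>\<close>, restricted to the face and weighted by \<open>\<mu>\<close>, has integral 0
  over the smaller boxes.\<close>

lemma gradient_limit_zero_local:
  assumes s: "\<And>k. s k \<in> Cck 2" "(\<lambda>k. \<Phi> (s k)) \<longlonglongrightarrow> 0" "(\<lambda>k. \<Phi> (fd i (s k))) \<longlonglongrightarrow> \<Phi> g" and g: "g \<in> L2 \<mu>"
    and i: "i \<in> B" and Q: "(\<integral>\<^sup>+y\<in>box p q. inverse (ennreal (\<rho> y)) \<partial>face_measure \<beta> B) < \<infinity>"
  shows "AE x in \<mu>. x \<in> box p q \<longrightarrow> x \<in> face B \<longrightarrow> g x = 0"
proof -
  have gm [measurable]: "g \<in> borel_measurable \<mu>" using g by (rule L2D)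
  have bump_int: "(\<integral>x. g x * test B (bump a b m) x \<partial>\<mu>) = 0"
    if ai: "0 \<le> a $ i" and sub: "box a b \<subseteq> box p q" for a b m
  proof -
    let ?f = "bump a b m"
    have f: "?f \<in> Cck 2" "C2 ?f" by (auto intro: bump_Cck2 C2_bump)
    obtain K where K: "\<And>x. x \<in> orthant \<Longrightarrow> \<bar>?f x\<bar> \<le> K" "\<And>x i. x \<in> orthant \<Longrightarrow> \<bar>pd i ?f x\<bar> \<le> K"
      using Cck2_bounded[OF f(1)] by metis
    have K0: "0 \<le> K" using K(1)[of 0] by (auto simp: orthant_def)
    have fm: "?f \<in> borel_measurable \<mu>" "pd i ?f \<in> borel_measurable \<mu>"
      by (auto intro!: continuous_measurable_\<mu> C2_continuous f)
    have "\<bar>?f x\<bar> \<le> K * indicator (box p q) x" "\<bar>pd i ?f x\<bar> \<le> K * indicator (box p q) x" if "x \<in> orthant" for x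
      using K[OF that] bump_outside[of x a b m] pd_bump_outside[OF that, of a b i m] sub
      by (cases "x \<in> box p q"; force)+
    then have t1: "test B ?f \<in> L2 \<mu>" and t2: "test B (pd i ?f) \<in> L2 \<mu>"
      by (auto intro!: test_L2[OF _ _ K0 _ Q] fm)
    \<comment> \<open>Once \<open>\<rho>\<close> has cancelled, the sum is the integral over the
      face of the i-th derivative of \<open>s k\<close> times the bump. This product is 0 where x_i
      = 0, because the open box has \<open>0 \<le> a $ i\<close>.\<close>
    have "inner (\<Phi> (fd i (s k))) (\<Phi> (test B ?f)) + inner (\<Phi> (s k)) (\<Phi> (test B (pd i ?f))) = 0" for k
    proof -
      have sk: "s k \<in> L2 \<mu>" "fd i (s k) \<in> L2 \<mu>" "C2 (s k)" using s(1) by (auto simp: Cck2_L2 Cck2_iff)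
      have skm: "s k \<in> borel_measurable \<mu>" "fd i (s k) \<in> borel_measurable \<mu>" using sk by (auto intro: L2D)
      have "inner (\<Phi> (fd i (s k))) (\<Phi> (test B ?f)) + inner (\<Phi> (s k)) (\<Phi> (test B (pd i ?f)))
          = (\<integral>x. fd i (s k) x * ?f x \<partial>face_measure \<beta> B) + (\<integral>x. s k x * pd i ?f x \<partial>face_measure \<beta> B)"
        using sk t1 t2 by (simp add: \<Phi>_inner L2_inner_def test_pairing(2) skm fm)
      also have "\<dots> = (\<integral>x. fd i (s k) x * ?f x + s k x * pd i ?f x \<partial>face_measure \<beta> B)"
      proof (rule Bochner_Integration.integral_add[symmetric])
        show "integrable (face_measure \<beta> B) (\<lambda>x. fd i (s k) x * ?f x)"
          using integrable_L2_mult[OF sk(2) t1] by (simp add: test_pairing(1) skm fm)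
        show "integrable (face_measure \<beta> B) (\<lambda>x. s k x * pd i ?f x)"
          using integrable_L2_mult[OF sk(1) t2] by (simp add: test_pairing(1) skm fm)
      qed
      also have "\<dots> = (\<integral>x. pd i (\<lambda>x. s k x * ?f x) x \<partial>face_measure \<beta> B)"
      proof (rule integral_cong_AE)
        have m: "h \<in> borel_measurable (face_measure \<beta> B)" if "h \<in> borel_measurable \<mu>" for h :: "real^'n \<Rightarrow> real"
          using that by (simp only: measurable_\<mu>_iff measurable_cong_sets[OF sets_face_measure refl])
        show "(\<lambda>x. fd i (s k) x * ?f x + s k x * pd i ?f x) \<in> borel_measurable (face_measure \<beta> B)"
          by (intro m borel_measurable_add borel_measurable_times skm fm)
        show "pd i (\<lambda>x. s k x * ?f x) \<in> borel_measurable (face_measure \<beta> B)"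
          by (intro m continuous_measurable_\<mu> C2_continuous C2_mult sk f)
        show "AE x in face_measure \<beta> B. fd i (s k) x * ?f x + s k x * pd i ?f x = pd i (\<lambda>x. s k x * ?f x) x"
          using AE_face_measure AE_space
        proof eventually_elim
          case (elim x)
          then have "x \<in> orthant" "0 < x $ i" using i by (auto simp: space_face_measure face_def)
          then show ?case by (simp add: fd_def pd_mult[OF sk(3) f(2)])
        qed
      qed
      also have "\<dots> = 0"
      proof (rule integral_face_measure_pd[OF _ i])
        show "(\<lambda>x. s k x * ?f x) \<in> Cck 2" by (rule Cck2_mult[OF s(1) f(2)])
        show "s k x * ?f x = 0" if "x $ i = 0" for x
        proof -
          have "x \<notin> box a b" using ai that by (auto simp: mem_box_cart intro!: exI[of _ i])
          then show ?thesis by (simp add: bump_outside)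
        qed
      qed
      finally show ?thesis .
    qed
    moreover have "(\<lambda>k. inner (\<Phi> (fd i (s k))) (\<Phi> (test B ?f)) + inner (\<Phi> (s k)) (\<Phi> (test B (pd i ?f))))
        \<longlonglongrightarrow> inner (\<Phi> g) (\<Phi> (test B ?f)) + inner 0 (\<Phi> (test B (pd i ?f)))"
      by (intro tendsto_intros s)
    ultimately have "inner (\<Phi> g) (\<Phi> (test B ?f)) = 0" by (simp add: LIMSEQ_const_iff)
    then show ?thesis by (simp add: \<Phi>_inner g t1 L2_inner_def)
  qed
  have tQ: "test B (indicator (box p q)) \<in> L2 \<mu>"
    by (rule test_L2[where K=1, OF _ _ _ _ Q]) (auto intro!: indicator_measurable_\<mu>)
  have wint: "integrable \<mu> (\<lambda>x. g x * test B (indicator (box p q)) x)" by (rule integrable_L2_mult[OF g tQ])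
  have box_int: "(\<integral>x. g x * test B (indicator (box a b)) x \<partial>\<mu>) = 0"
    if ai: "0 \<le> a $ i" and sub: "box a b \<subseteq> box p q" for a b
  proof -
    have "(\<lambda>m. \<integral>x. g x * test B (bump a b m) x \<partial>\<mu>) \<longlonglongrightarrow> (\<integral>x. g x * test B (indicator (box a b)) x \<partial>\<mu>)"
    proof (rule integral_dominated_convergence[where w="\<lambda>x. \<bar>g x * test B (indicator (box p q)) x\<bar>"])
      show "(\<lambda>x. g x * test B (bump a b m) x) \<in> borel_measurable \<mu>" for m
        using test_measurable[of "bump a b m" B] continuous_measurable_\<mu>[OF C2_continuous(1)[OF C2_bump[of a b m]]]
        by measurable
      show "(\<lambda>x. g x * test B (indicator (box a b)) x) \<in> borel_measurable \<mu>"
        using test_measurable[OF indicator_measurable_\<mu>, of "box a b" B] by measurable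
      show "AE x in \<mu>. (\<lambda>m. g x * test B (bump a b m) x) \<longlonglongrightarrow> g x * test B (indicator (box a b)) x"
        unfolding test_def using \<rho>_pos' by eventually_elim (intro tendsto_intros bump_tendsto, simp)
      show "AE x in \<mu>. norm (g x * test B (bump a b m) x) \<le> \<bar>g x * test B (indicator (box p q)) x\<bar>" for m
      proof (rule AE_I2)
        fix x
        have "\<bar>bump a b m x\<bar> \<le> indicator (box p q) x"
          using bump_range[of a b m x] bump_outside[of x a b m] sub by (auto simp: indicator_def subset_iff)
        then show "norm (g x * test B (bump a b m) x) \<le> \<bar>g x * test B (indicator (box p q)) x\<bar>"
          unfolding test_def real_norm_def abs_mult abs_divide
          by (intro mult_left_mono divide_right_mono) auto
      qed
    qed (use wint in auto)
    then show ?thesis unfolding bump_int[OF that] by (simp add: LIMSEQ_const_iff)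
  qed
  have "AE x in \<mu>. g x * test B (indicator (box p q)) x = 0"
  proof (rule AE_zero_\<mu>[OF wint])
    fix a b :: "real^'n"
    \<comment> \<open>An arbitrary box is cut down to \<open>box p q\<close> and to x_i > 0. On
      \<open>face B\<close> the latter holds anyway as \<open>i \<in> B\<close>, so the integral is
      unchanged while \<open>box_int\<close> becomes applicable.\<close>
    define a' where "a' = (\<chi> j. if j = i then max 0 (max (a $ j) (p $ j)) else max (a $ j) (p $ j))"
    define b' where "b' = (\<chi> j. min (b $ j) (q $ j))"
    have mem: "x \<in> box a' b' \<longleftrightarrow> x \<in> box a b \<and> x \<in> box p q \<and> 0 < x $ i" for x
      by (auto simp: mem_box_cart a'_def b'_def)
    have "(\<integral>x. g x * test B (indicator (box p q)) x * indicator (box a b) x \<partial>\<mu>) = (\<integral>x. g x * test B (indicator (box a' b')) x \<partial>\<mu>)"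
    proof (rule Bochner_Integration.integral_cong[OF refl])
      fix x
      show "g x * test B (indicator (box p q)) x * indicator (box a b) x = g x * test B (indicator (box a' b')) x"
        using i mem[of x] by (cases "x \<in> face B") (auto simp: test_def indicator_def face_def)
    qed
    also have "\<dots> = 0" by (rule box_int) (use mem in \<open>auto simp: a'_def\<close>)
    finally show "(\<integral>x. g x * test B (indicator (box p q)) x * indicator (box a b) x \<partial>\<mu>) = 0" .
  qed
  then show ?thesis using \<rho>_pos' by eventually_elim (auto simp: test_def)
qed

lemma gradient_limit_zero:
  assumes s: "\<And>k. s k \<in> Cck 2" "(\<lambda>k. \<Phi> (s k)) \<longlonglongrightarrow> 0" "(\<lambda>k. \<Phi> (fd i (s k))) \<longlonglongrightarrow> \<Phi> g" and g: "g \<in> L2 \<mu>"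
  shows "AE x in \<mu>. g x = 0"
proof -
  have face_zero: "AE x in \<mu>. x \<in> face B \<longrightarrow> g x = 0" if i: "i \<in> B" for B
  proof -
    have "AE x in \<mu>. x \<in> regular_points \<beta> \<rho> B \<longrightarrow> x \<in> face B \<longrightarrow> g x = 0"
    proof (rule AE_of_local_AE)
      fix x assume "x \<in> regular_points \<beta> \<rho> B"
      then obtain e where e: "e > 0" "(\<integral>\<^sup>+ y \<in> closure {y \<in> closure (face B). dist x y < e}.
        inverse (ennreal (\<rho> y)) \<partial>face_measure \<beta> B) < \<infinity>" unfolding regular_points_def by blast
      obtain p q where pq: "x \<in> box p q" "box p q \<subseteq> ball x e"
        using e(1) open_contains_box[of "ball x e" x] by (metis centre_in_ball open_ball)
      \<comment> \<open>The face measure is carried by \<open>face B\<close>, so a full box inside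
        the ball may replace the relative ball in the definition of regular points.\<close>
      have "(\<integral>\<^sup>+y\<in>box p q. inverse (ennreal (\<rho> y)) \<partial>face_measure \<beta> B) \<le>
          (\<integral>\<^sup>+ y \<in> closure {y \<in> closure (face B). dist x y < e}. inverse (ennreal (\<rho> y)) \<partial>face_measure \<beta> B)"
      proof (rule nn_integral_mono_AE)
        show "AE y in face_measure \<beta> B. inverse (ennreal (\<rho> y)) * indicator (box p q) y \<le>
            inverse (ennreal (\<rho> y)) * indicator (closure {y \<in> closure (face B). dist x y < e}) y"
          using AE_face_measure
        proof eventually_elim
          case (elim y)
          have "y \<in> closure {y \<in> closure (face B). dist x y < e}" if "y \<in> box p q"
            using elim pq(2) that closure_subset[of "face B"] closure_subset[of "{y \<in> closure (face B). dist x y < e}"]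
            by (auto simp: subset_iff)
          then show ?case by (auto simp: indicator_def)
        qed
      qed
      also note e(2)
      finally show "\<exists>U. open U \<and> x \<in> U \<and> (AE y in \<mu>. y \<in> U \<longrightarrow> y \<in> face B \<longrightarrow> g y = 0)"
        using gradient_limit_zero_local[OF s g i] pq(1) by (intro exI[of _ "box p q"]) auto
    qed
    \<comment> \<open>Off the regular points \<open>\<rho>\<close> is 0 by hypothesis, against its
      positivity almost everywhere.\<close>
    moreover have "AE x in \<mu>. x \<in> face B \<longrightarrow> x \<in> regular_points \<beta> \<rho> B"
    proof -
      have "B \<noteq> {}" using i by blast
      from \<rho>_regular[OF this] have "AE x in \<mu>. x \<in> face B \<longrightarrow> x \<in> closure (face B) - regular_points \<beta> \<rho> B \<longrightarrow> \<rho> x = 0"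
        unfolding AE_face_measure_iff .
      then show ?thesis using \<rho>_pos'
        by eventually_elim (use closure_subset[of "face B"] in auto)
    qed
    ultimately show ?thesis by eventually_elim blast
  qed
  have "AE x in \<mu>. \<forall>B. i \<in> B \<longrightarrow> x \<in> face B \<longrightarrow> g x = 0"
    using face_zero by (subst AE_all_countable) auto
  \<comment> \<open>Where x_i = 0 every \<open>fd i (s N)\<close> is 0 by definition, and
    convergence almost everywhere along a subsequence passes this on to \<open>g\<close>.\<close>
  moreover obtain k :: "nat \<Rightarrow> nat" where "AE x in \<mu>. (\<lambda>N. fd i (s (k N)) x) \<longlonglongrightarrow> g x"
    using \<Phi>_tendsto_subseq[OF Cck2_L2(2)[OF s(1)] g s(3)] by blast
  ultimately show ?thesis using AE_space
  proof eventually_elim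
    case (elim x)
    show ?case
    proof (cases "0 < x $ i")
      case True
      then show ?thesis using elim(1,3) face_disjoint_cover(1)[of x] by (auto simp: space_\<mu>)
    next
      case False
      then show ?thesis using elim(2) by (simp add: fd_def LIMSEQ_const_iff)
    qed
  qed
qed

lemma fd_add: "f \<in> Cck 2 \<Longrightarrow> g \<in> Cck 2 \<Longrightarrow> x \<in> orthant \<Longrightarrow> fd i (\<lambda>x. f x + g x) x = fd i f x + fd i g x"
  by (simp add: fd_def pd_add Cck2_iff)

lemma fd_scale: "f \<in> Cck 2 \<Longrightarrow> x \<in> orthant \<Longrightarrow> fd i (\<lambda>x. c * f x) x = c * fd i f x"
  by (simp add: fd_def pd_scale Cck2_iff)

sublocale grad_form \<mu> \<Phi> \<Psi> "Cck 2" "gradient_form \<beta> \<rho>" grad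
proof
  show "Cck 2 \<subseteq> L2 \<mu>" using Cck2_L2 by blast
  show "(\<lambda>_. 0) \<in> Cck 2" using Cck2_scale[OF bump_Cck2, of 0 0 0 0] by simp
  show "closure (\<Phi> ` Cck 2) = UNIV" by (rule dense_Cck2)
  fix f g :: "real^'n \<Rightarrow> real" and c assume f: "f \<in> Cck 2"
  show "(\<lambda>x. c * f x) \<in> Cck 2" by (rule Cck2_scale[OF f])
  have "\<Phi> (fd i (\<lambda>x. c * f x)) = \<Phi> (\<lambda>x. c * fd i f x)" for i
    by (rule \<Phi>_cong) (auto intro: Cck2_L2 Cck2_scale f L2_scale simp: fd_scale[OF f])
  then show "grad (\<lambda>x. c * f x) = c *\<^sub>R grad f" by (simp add: grad_def vec_eq_iff \<Phi>_scale Cck2_L2 f)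
  assume g: "g \<in> Cck 2"
  show "(\<lambda>x. f x + g x) \<in> Cck 2" by (rule Cck2_add[OF f g])
  have "\<Phi> (fd i (\<lambda>x. f x + g x)) = \<Phi> (\<lambda>x. fd i f x + fd i g x)" for i
    by (rule \<Phi>_cong) (auto intro: Cck2_L2 Cck2_add f g L2_add simp: fd_add[OF f g])
  then show "grad (\<lambda>x. f x + g x) = grad f + grad g" by (simp add: grad_def vec_eq_iff \<Phi>_add Cck2_L2 f g)
  show "gradient_form \<beta> \<rho> f g = inner (grad f) (grad g)" by (rule gradient_form_eq[OF f g])
next
  fix w assume "(0, w) \<in> closure ((\<lambda>f. (\<Phi> f, grad f)) ` Cck 2)"
  then obtain x where x: "\<And>k. x k \<in> (\<lambda>f. (\<Phi> f, grad f)) ` Cck 2" "x \<longlonglongrightarrow> (0, w)"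
    unfolding closure_sequential by blast
  then have "\<forall>k. \<exists>f\<in>Cck 2. x k = (\<Phi> f, grad f)" by blast
  then obtain s where s: "\<And>k. s k \<in> Cck 2" "\<And>k. x k = (\<Phi> (s k), grad (s k))" by metis
  have lim: "(\<lambda>k. \<Phi> (s k)) \<longlonglongrightarrow> 0" "(\<lambda>k. grad (s k)) \<longlonglongrightarrow> w"
    using tendsto_fst[OF x(2)] tendsto_snd[OF x(2)] by (simp_all add: s(2))
  have "w $ i = 0" for i
  proof -
    have "(\<lambda>k. grad (s k) $ i) \<longlonglongrightarrow> w $ i" by (rule tendsto_vec_nth[OF lim(2)])
    then have "(\<lambda>k. \<Phi> (fd i (s k))) \<longlonglongrightarrow> \<Phi> (\<Psi> (w $ i))" by (simp add: grad_def \<Phi>_\<Psi>)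
    then have "AE x in \<mu>. \<Psi> (w $ i) x = 0" by (rule gradient_limit_zero[OF s(1) lim(1) _ \<Psi>_L2])
    then show ?thesis using \<Phi>_eq_0_iff[OF \<Psi>_L2, of "w $ i"] by (simp add: \<Phi>_\<Psi>)
  qed
  then show "w = 0" by (simp add: vec_eq_iff)
qed

end

section \<open>Properties of the closure\<close>

context setting
begin

section \<open>Contractions operating on the closure\<close>

lemma norm_\<Phi>_mono:
  assumes "f \<in> L2 \<mu>" "g \<in> L2 \<mu>" "AE x in \<mu>. \<bar>f x\<bar> \<le> \<bar>g x\<bar>"
  shows "norm (\<Phi> f) \<le> norm (\<Phi> g)"
proof -
  have "(\<integral>x. f x * f x \<partial>\<mu>) \<le> (\<integral>x. g x * g x \<partial>\<mu>)"
    using assms(3) by (intro integral_mono_AE integrable_L2_mult assms)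
      (auto elim!: eventually_mono simp: power2_eq_square[symmetric] abs_le_square_iff)
  then show ?thesis by (simp add: norm_le \<Phi>_inner assms L2_inner_def)
qed

lemma norm_\<Phi>_const: "norm (\<Phi> (\<lambda>_. c)) = \<bar>c\<bar> * norm (\<Phi> (\<lambda>_. 1))"
  using \<Phi>_scale[OF L2_const[of 1], of c] by simp

lemma norm_grad_mono:
  assumes "f \<in> Cck 2" "g \<in> Cck 2" "\<And>i x. x \<in> orthant \<Longrightarrow> \<bar>fd i f x\<bar> \<le> \<bar>fd i g x\<bar>"
  shows "norm (grad f) \<le> norm (grad g)"
  unfolding norm_vec_def grad_def
  by (rule L2_set_mono) (auto intro!: norm_\<Phi>_mono Cck2_L2 assms AE_I2 simp: space_\<mu>)

lemma \<Phi>_mult_tendsto: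
  assumes a: "\<And>k. a k \<in> L2 \<mu>" "b \<in> L2 \<mu>" "(\<lambda>k. \<Phi> (a k)) \<longlonglongrightarrow> \<Phi> b"
    and h: "h \<in> borel_measurable \<mu>" "\<And>x. x \<in> orthant \<Longrightarrow> \<bar>h x\<bar> \<le> K"
  shows "(\<lambda>k. \<Phi> (\<lambda>x. h x * a k x)) \<longlonglongrightarrow> \<Phi> (\<lambda>x. h x * b x)" "\<And>k. (\<lambda>x. h x * a k x) \<in> L2 \<mu>" "(\<lambda>x. h x * b x) \<in> L2 \<mu>"
proof -
  have le: "\<bar>h x * f x\<bar> \<le> \<bar>K * f x\<bar>" if "x \<in> orthant" for f :: "real^'n \<Rightarrow> real" and x
    using h(2)[OF that] by (simp add: abs_mult mult_right_mono)
  have L: "(\<lambda>x. h x * f x) \<in> L2 \<mu>" if "f \<in> L2 \<mu>" for f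
    by (rule L2_bound[OF L2_scale[OF that, of K]]) (use h L2D(1)[OF that] le in \<open>auto simp: space_\<mu>\<close>)
  show 1: "\<And>k. (\<lambda>x. h x * a k x) \<in> L2 \<mu>" "(\<lambda>x. h x * b x) \<in> L2 \<mu>" using L a by auto
  have "(\<lambda>k. \<Phi> (\<lambda>x. h x * a k x) - \<Phi> (\<lambda>x. h x * b x)) \<longlonglongrightarrow> 0"
  proof (rule Lim_null_comparison)
    show "\<forall>\<^sub>F k in sequentially. norm (\<Phi> (\<lambda>x. h x * a k x) - \<Phi> (\<lambda>x. h x * b x)) \<le> \<bar>K\<bar> * norm (\<Phi> (a k) - \<Phi> b)"
    proof (rule always_eventually, rule allI)
      fix k
      have "norm (\<Phi> (\<lambda>x. h x * a k x - h x * b x)) \<le> norm (\<Phi> (\<lambda>x. K * (a k x - b x)))"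
        using le[of _ "\<lambda>x. a k x - b x"]
        by (intro norm_\<Phi>_mono L2_diff 1 L2_scale a) (auto simp: space_\<mu> right_diff_distrib)
      then show "norm (\<Phi> (\<lambda>x. h x * a k x) - \<Phi> (\<lambda>x. h x * b x)) \<le> \<bar>K\<bar> * norm (\<Phi> (a k) - \<Phi> b)"
        using a 1 by (simp add: \<Phi>_diff \<Phi>_scale[OF L2_diff])
    qed
    show "(\<lambda>k. \<bar>K\<bar> * norm (\<Phi> (a k) - \<Phi> b)) \<longlonglongrightarrow> 0"
      by (intro tendsto_mult_right_zero tendsto_norm_zero LIM_zero a)
  qed
  then show "(\<lambda>k. \<Phi> (\<lambda>x. h x * a k x)) \<longlonglongrightarrow> \<Phi> (\<lambda>x. h x * b x)" by (rule LIM_zero_cancel)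
qed

text \<open>The functions \<open>v k\<close> converge in L2, as the measure is finite and
  \<open>\<delta>\<close> is a uniform error, and by the chain rule their gradients are bounded by
  those of \<open>s k\<close>. Convergence of these gradients is not claimed;
  \<open>closed_convex_lsc\<close> supplies the limit point of \<open>\<Gamma>\<close>.\<close>

lemma contraction:
  fixes \<phi> :: "real \<Rightarrow> real" and \<phi>k \<phi>k' \<phi>k'' :: "nat \<Rightarrow> real \<Rightarrow> real" and u :: "real^'n \<Rightarrow> real"
  assumes k: "\<And>k t. (\<phi>k k has_real_derivative \<phi>k' k t) (at t)" "\<And>k t. (\<phi>k' k has_real_derivative \<phi>k'' k t) (at t)"
      "\<And>k. continuous_on UNIV (\<phi>k'' k)" "\<And>k. \<phi>k k 0 = 0" "\<And>k t. \<bar>\<phi>k' k t\<bar> \<le> 1"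
    and approx: "\<And>k t. \<bar>\<phi>k k t - \<phi> t\<bar> \<le> \<delta> k" "\<delta> \<longlonglongrightarrow> 0"
    and \<phi>: "\<And>s t. \<bar>\<phi> s - \<phi> t\<bar> \<le> \<bar>s - t\<bar>" "\<phi> 0 = 0"
    and u: "u \<in> L2 \<mu>" "(\<Phi> u, w) \<in> \<Gamma>"
  shows "\<exists>z. (\<Phi> (\<lambda>x. \<phi> (u x)), z) \<in> \<Gamma> \<and> norm z \<le> norm w"
proof -
  obtain s where s: "\<And>k. s k \<in> Cck 2" "(\<lambda>k. \<Phi> (s k)) \<longlonglongrightarrow> \<Phi> u" "(\<lambda>k. grad (s k)) \<longlonglongrightarrow> w"
    using \<Gamma>_sequence[OF u(2)] by metis
  have \<phi>m: "\<phi> \<in> borel_measurable borel"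
  proof (rule borel_measurable_continuous_onI, rule continuous_onI)
    fix x e :: real assume "e > 0"
    then show "\<exists>d>0. \<forall>x'\<in>UNIV. dist x' x < d \<longrightarrow> dist (\<phi> x') (\<phi> x) \<le> e"
      using \<phi>(1) by (intro exI[of _ e]) (fastforce simp: dist_real_def intro: order_trans less_imp_le)
  qed
  have \<phi>L2: "(\<lambda>x. \<phi> (f x)) \<in> L2 \<mu>" if f: "f \<in> L2 \<mu>" for f :: "real^'n \<Rightarrow> real"
  proof (rule L2_bound[OF f])
    show "(\<lambda>x. \<phi> (f x)) \<in> borel_measurable \<mu>" using \<phi>m L2D(1)[OF f] by measurable
    show "AE x in \<mu>. \<bar>\<phi> (f x)\<bar> \<le> \<bar>f x\<bar>" using \<phi>(1)[of _ 0] \<phi>(2) by simp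
  qed
  define v where "v k x = \<phi>k k (s k x)" for k and x :: "real^'n"
  have v: "v k \<in> Cck 2" for k
    unfolding v_def[abs_def] by (rule Cck2_compose[OF s(1) k(1-4)])
  have vL: "v k \<in> L2 \<mu>" for k by (rule Cck2_L2[OF v])
  have sL: "s k \<in> L2 \<mu>" for k by (rule Cck2_L2[OF s(1)])
  have norm_v: "norm (grad (v k)) \<le> norm (grad (s k))" for k
  proof (rule norm_grad_mono[OF v s(1)])
    fix i and x :: "real^'n" assume x: "x \<in> orthant"
    have "continuous_on UNIV (\<phi>k' k)"
      by (rule DERIV_continuous_on) (rule has_field_derivative_at_within[OF k(2)])
    then have "pd i (v k) x = \<phi>k' k (s k x) * pd i (s k) x"
      unfolding v_def[abs_def] using s(1) by (intro pd_compose[OF _ k(1) _ x]) (simp_all add: Cck2_iff)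
    then show "\<bar>fd i (v k) x\<bar> \<le> \<bar>fd i (s k) x\<bar>"
      using k(5)[of k "s k x"] by (simp add: fd_def abs_mult mult_left_le_one_le)
  qed
  have v_lim: "(\<lambda>k. \<Phi> (v k)) \<longlonglongrightarrow> \<Phi> (\<lambda>x. \<phi> (u x))"
  proof (rule LIM_zero_cancel, rule Lim_null_comparison)
    show "\<forall>\<^sub>F k in sequentially. norm (\<Phi> (v k) - \<Phi> (\<lambda>x. \<phi> (u x))) \<le> \<bar>\<delta> k\<bar> * norm (\<Phi> (\<lambda>_. 1)) + norm (\<Phi> (s k) - \<Phi> u)"
    proof (rule always_eventually, rule allI)
      fix k
      have "norm (\<Phi> (v k) - \<Phi> (\<lambda>x. \<phi> (s k x))) = norm (\<Phi> (\<lambda>x. v k x - \<phi> (s k x)))"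
        by (simp add: \<Phi>_diff vL \<phi>L2 sL)
      also have "\<dots> \<le> norm (\<Phi> (\<lambda>_. \<delta> k))"
        using approx(1) by (intro norm_\<Phi>_mono L2_diff vL \<phi>L2 sL L2_const AE_I2)
          (auto simp: v_def intro: order_trans[OF _ abs_ge_self])
      also have "\<dots> = \<bar>\<delta> k\<bar> * norm (\<Phi> (\<lambda>_. 1))" by (rule norm_\<Phi>_const)
      finally have 1: "norm (\<Phi> (v k) - \<Phi> (\<lambda>x. \<phi> (s k x))) \<le> \<bar>\<delta> k\<bar> * norm (\<Phi> (\<lambda>_. 1))" .
      have "norm (\<Phi> (\<lambda>x. \<phi> (s k x)) - \<Phi> (\<lambda>x. \<phi> (u x))) = norm (\<Phi> (\<lambda>x. \<phi> (s k x) - \<phi> (u x)))"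
        by (simp add: \<Phi>_diff \<phi>L2 sL u)
      also have "\<dots> \<le> norm (\<Phi> (\<lambda>x. s k x - u x))"
        using \<phi>(1) by (intro norm_\<Phi>_mono L2_diff \<phi>L2 sL u AE_I2) auto
      finally have 2: "norm (\<Phi> (\<lambda>x. \<phi> (s k x)) - \<Phi> (\<lambda>x. \<phi> (u x))) \<le> norm (\<Phi> (s k) - \<Phi> u)"
        by (simp add: \<Phi>_diff sL u)
      show "norm (\<Phi> (v k) - \<Phi> (\<lambda>x. \<phi> (u x))) \<le> \<bar>\<delta> k\<bar> * norm (\<Phi> (\<lambda>_. 1)) + norm (\<Phi> (s k) - \<Phi> u)"
        using norm_triangle_ineq[of "\<Phi> (v k) - \<Phi> (\<lambda>x. \<phi> (s k x))" "\<Phi> (\<lambda>x. \<phi> (s k x)) - \<Phi> (\<lambda>x. \<phi> (u x))"] 1 2 by simp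
    qed
    have "(\<lambda>k. \<bar>\<delta> k\<bar> * norm (\<Phi> (\<lambda>_. 1)) + norm (\<Phi> (s k) - \<Phi> u)) \<longlonglongrightarrow> 0 * norm (\<Phi> (\<lambda>_. 1)) + 0"
      by (intro tendsto_add tendsto_mult tendsto_const tendsto_rabs_zero approx tendsto_norm_zero LIM_zero s)
    then show "(\<lambda>k. \<bar>\<delta> k\<bar> * norm (\<Phi> (\<lambda>_. 1)) + norm (\<Phi> (s k) - \<Phi> u)) \<longlonglongrightarrow> 0" by simp
  qed
  \<comment> \<open>The gradients of \<open>s k\<close> have norms that converge to that of
    \<open>w\<close> but may exceed it. So a tail is taken with slack e; the second component is
    unique, which allows e to tend to 0 afterwards.\<close>
  have approx_bound: "\<exists>z. (\<Phi> (\<lambda>x. \<phi> (u x)), z) \<in> \<Gamma> \<and> norm z \<le> norm w + e" if e: "e > 0" for e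
  proof -
    have "\<forall>\<^sub>F k in sequentially. norm (grad (s k)) < norm w + e"
      using tendsto_norm[OF s(3)] e by (intro order_tendstoD(2)) auto
    then obtain N where N: "\<And>k. k \<ge> N \<Longrightarrow> norm (grad (s k)) < norm w + e" by (auto simp: eventually_sequentially)
    show ?thesis
    proof (rule closed_convex_lsc[OF closed_\<Gamma> subspace_imp_convex[OF subspace_\<Gamma>]])
      show "(\<Phi> (v (k + N)), grad (v (k + N))) \<in> \<Gamma>" for k by (rule in_\<Gamma>[OF v])
      show "(\<lambda>k. \<Phi> (v (k + N))) \<longlonglongrightarrow> \<Phi> (\<lambda>x. \<phi> (u x))" by (rule LIMSEQ_ignore_initial_segment[OF v_lim])
      show "norm (grad (v (k + N))) \<le> norm w + e" for k
        using norm_v[of "k + N"] N[of "k + N"] by simp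
    qed
  qed
  from approx_bound[of 1] obtain z where z: "(\<Phi> (\<lambda>x. \<phi> (u x)), z) \<in> \<Gamma>" by auto
  have "norm z \<le> norm w + e" if "e > 0" for e
    using approx_bound[OF that] \<Gamma>_unique[OF z] by blast
  then have "norm z \<le> norm w" by (rule field_le_epsilon)
  with z show ?thesis by blast
qed

lemma inverse_Suc_tendsto: "(\<lambda>k. c * inverse (real (Suc k))) \<longlonglongrightarrow> 0"
  using tendsto_mult_right_zero[OF LIMSEQ_inverse_real_of_nat] by simp

lemma positive_part:
  assumes u: "u \<in> L2 \<mu>" "(\<Phi> u, w) \<in> \<Gamma>"
  shows "\<exists>z. (\<Phi> (\<lambda>x. max 0 (u x)), z) \<in> \<Gamma> \<and> norm z \<le> norm w"
proof -
  have e: "inverse (real (Suc k)) > 0" for k by simp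
  show ?thesis
  proof (rule contraction[OF soft_plus_deriv[OF e] soft_plus_deriv2[OF e] soft_plus_continuous_deriv2[OF e]
        soft_plus_0[OF e] _ soft_plus_approx[OF e] _ _ _ u])
    show "\<bar>(t / sqrt (t\<^sup>2 + (inverse (real (Suc k)))\<^sup>2) + 1) / 2\<bar> \<le> 1" for k t
      using soft_plus_deriv_range[OF e, of t k] by linarith
    show "(\<lambda>k. inverse (real (Suc k))) \<longlonglongrightarrow> 0" by (rule LIMSEQ_inverse_real_of_nat)
  qed auto
qed

text \<open>The clamp is approximated via \<open>min (max t 0) 1 = max 0 t - max 0 (t - 1)\<close>.\<close>

lemma unit_contraction:
  assumes u: "u \<in> L2 \<mu>" "(\<Phi> u, w) \<in> \<Gamma>"
  shows "\<exists>z. (\<Phi> (\<lambda>x. min (max (u x) 0) 1), z) \<in> \<Gamma> \<and> norm z \<le> norm w"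
proof -
  define e where "e k = inverse (real (Suc k))" for k
  have e: "e k > 0" for k by (simp add: e_def)
  define d where "d k t = (t / sqrt (t\<^sup>2 + (e k)\<^sup>2) + 1) / 2" for k t
  define d2 where "d2 k t = (1 / sqrt (t\<^sup>2 + (e k)\<^sup>2) - t * (t / sqrt (t\<^sup>2 + (e k)\<^sup>2) ^ 3)) / 2" for k t
  have D: "(soft_plus (e k) has_real_derivative d k t) (at t)" for k t
    unfolding d_def by (rule soft_plus_deriv[OF e])
  have D2: "(d k has_real_derivative d2 k t) (at t)" for k t
    unfolding d_def[abs_def] d2_def by (rule soft_plus_deriv2[OF e])
  have D3: "continuous_on UNIV (d2 k)" for k
    unfolding d2_def[abs_def] by (rule soft_plus_continuous_deriv2[OF e])
  have range: "0 \<le> d k t" "d k t \<le> 1" for k t unfolding d_def by (rule soft_plus_deriv_range[OF e])+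
  have shift: "((\<lambda>t. g (t - 1)) has_real_derivative g' (t - 1)) (at t)"
    if "\<And>t. (g has_real_derivative g' t) (at t)" for g g' :: "real \<Rightarrow> real" and t
    using DERIV_chain2[OF that[of "t - 1"] DERIV_diff[OF DERIV_ident DERIV_const[of 1]]] by simp
  show ?thesis
  \<comment> \<open>Adding the constant \<open>soft_plus (e k) (- 1)\<close>, which approximates 0,
    makes the value at 0 vanish. Each of the three terms has error at most \<open>e k\<close>, hence
    the factor 3; the derivative is a difference of two numbers in [0, 1].\<close>
  proof (rule contraction[where \<phi>="\<lambda>t. min (max t 0) 1" and \<delta>="\<lambda>k. 3 * inverse (real (Suc k))" and
        \<phi>k="\<lambda>k t. soft_plus (e k) t - soft_plus (e k) (t - 1) + soft_plus (e k) (- 1)" and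
        \<phi>k'="\<lambda>k t. d k t - d k (t - 1)" and \<phi>k''="\<lambda>k t. d2 k t - d2 k (t - 1)", OF _ _ _ _ _ _ _ _ _ u])
    fix k t
    show "((\<lambda>t. soft_plus (e k) t - soft_plus (e k) (t - 1) + soft_plus (e k) (- 1)) has_real_derivative d k t - d k (t - 1)) (at t)"
      using DERIV_add[OF DERIV_diff[OF D shift[OF D]] DERIV_const] by simp
    show "((\<lambda>t. d k t - d k (t - 1)) has_real_derivative d2 k t - d2 k (t - 1)) (at t)"
      by (rule DERIV_diff[OF D2 shift[OF D2]])
    show "continuous_on UNIV (\<lambda>t. d2 k t - d2 k (t - 1))"
      by (intro continuous_on_diff D3 continuous_on_compose2[OF D3] continuous_intros) auto
    show "soft_plus (e k) 0 - soft_plus (e k) (0 - 1) + soft_plus (e k) (- 1) = 0"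
      using soft_plus_0[OF e] by simp
    show "\<bar>d k t - d k (t - 1)\<bar> \<le> 1" using range[of k t] range[of k "t - 1"] by linarith
    have "\<bar>soft_plus (e k) t - max 0 t\<bar> \<le> e k" "\<bar>soft_plus (e k) (t - 1) - max 0 (t - 1)\<bar> \<le> e k"
      "\<bar>soft_plus (e k) (- 1) - max 0 (- 1)\<bar> \<le> e k" using soft_plus_approx[OF e] by blast+
    moreover have "min (max t 0) 1 = max 0 t - max 0 (t - 1)" by (auto simp: min_def max_def)
    ultimately have "\<bar>soft_plus (e k) t - soft_plus (e k) (t - 1) + soft_plus (e k) (- 1) - min (max t 0) 1\<bar> \<le> 3 * e k"
      by (simp add: abs_le_iff)
    then show "\<bar>soft_plus (e k) t - soft_plus (e k) (t - 1) + soft_plus (e k) (- 1) - min (max t 0) 1\<bar> \<le> 3 * inverse (real (Suc k))"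
      by (simp add: e_def)
  qed (auto simp: min_def max_def intro: inverse_Suc_tendsto[of 3, simplified])
qed

lemma dirichlet: "symmetric_Dirichlet_form \<mu> (closure_domain \<mu> (Cck 2) (gradient_form \<beta> \<rho>)) (closure_form \<mu> (Cck 2) (gradient_form \<beta> \<rho>))"
  by (rule symmetric_Dirichlet_formI) (rule unit_contraction)

text \<open>The derivatives of the cutoffs tend to 0 uniformly, and for a finite measure this gives
  convergence in L2.\<close>

lemma one_in_\<Gamma>: "(\<Phi> (\<lambda>_. 1), 0) \<in> \<Gamma>"
proof (rule in_\<Gamma>_limit[where s="\<lambda>k. cutoff (real (Suc k))"])
  show C: "cutoff (real (Suc k)) \<in> Cck 2" for k by (rule cutoff_Cck2) simp
  show "(\<lambda>k. \<Phi> (cutoff (real (Suc k)))) \<longlonglongrightarrow> \<Phi> (\<lambda>_. 1)"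
  proof (rule \<Phi>_tendsto(1)[where c="\<lambda>_. 1"])
    show "cutoff (real (Suc k)) \<in> borel_measurable \<mu>" for k by (intro L2D(1) Cck2_L2 C)
    show "AE x in \<mu>. (\<lambda>k. cutoff (real (Suc k)) x) \<longlonglongrightarrow> 1"
    proof (rule AE_I2)
      fix x :: "real^'n"
      obtain K :: nat where K: "(norm x)\<^sup>2 \<le> real K" using real_arch_simple by blast
      have "\<forall>\<^sub>F k in sequentially. cutoff (real (Suc k)) x = 1"
        using eventually_ge_at_top[of K] by eventually_elim (use K in \<open>auto intro!: cutoff_eq_1\<close>)
      then show "(\<lambda>k. cutoff (real (Suc k)) x) \<longlonglongrightarrow> 1" by (rule tendsto_eventually)
    qed
    show "AE x in \<mu>. \<bar>cutoff (real (Suc k)) x\<bar> \<le> 1" for k by (intro AE_I2) (simp only: abs_of_nonneg cutoff_range)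
  qed (auto intro: L2_const)
  have "(\<lambda>k. grad (cutoff (real (Suc k))) $ i) \<longlonglongrightarrow> 0 $ i" for i
  proof (rule Lim_null_comparison[THEN tendsto_eq_rhs])
    show "\<forall>\<^sub>F k in sequentially. norm (grad (cutoff (real (Suc k))) $ i) \<le> 18 * sqrt 2 * sqrt (inverse (real (Suc k))) * norm (\<Phi> (\<lambda>_. 1))"
    proof (rule always_eventually, rule allI)
      fix k
      define R where "R = real (Suc k)"
      have R: "R > 0" by (simp add: R_def)
      have eq: "18 * sqrt (2 * R) / R = 18 * sqrt 2 * sqrt (inverse R)"
      proof -
        have "sqrt R / R = inverse (sqrt R)" using R real_div_sqrt[of R] by (simp add: field_simps)
        then show ?thesis by (simp add: real_sqrt_mult real_sqrt_inverse mult.assoc flip: times_divide_eq_right)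
      qed
      have "norm (\<Phi> (fd i (cutoff R))) \<le> norm (\<Phi> (\<lambda>_. 18 * sqrt 2 * sqrt (inverse R)))"
      proof (intro norm_\<Phi>_mono Cck2_L2(2) cutoff_Cck2 R L2_const AE_I2)
        fix x :: "real^'n" assume "x \<in> space \<mu>"
        then have "\<bar>fd i (cutoff R) x\<bar> \<le> 18 * sqrt 2 * sqrt (inverse R)"
          using pd_cutoff_bound[OF R, of x i] eq R by (simp add: space_\<mu> fd_def)
        then show "\<bar>fd i (cutoff R) x\<bar> \<le> \<bar>18 * sqrt 2 * sqrt (inverse R)\<bar>" by linarith
      qed
      moreover have "\<bar>18 * sqrt 2 * sqrt (inverse R)\<bar> = 18 * sqrt 2 * sqrt (inverse R)" using R by simp
      ultimately show "norm (grad (cutoff (real (Suc k))) $ i) \<le> 18 * sqrt 2 * sqrt (inverse (real (Suc k))) * norm (\<Phi> (\<lambda>_. 1))"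
        unfolding norm_\<Phi>_const[of "18 * sqrt 2 * sqrt (inverse R)"] grad_def R_def[symmetric] vec_lambda_beta by simp
    qed
    have "(\<lambda>k. 18 * sqrt 2 * sqrt (inverse (real (Suc k))) * norm (\<Phi> (\<lambda>_. 1))) \<longlonglongrightarrow> 18 * sqrt 2 * sqrt 0 * norm (\<Phi> (\<lambda>_. 1))"
      by (intro tendsto_intros LIMSEQ_inverse_real_of_nat)
    then show "(\<lambda>k. 18 * sqrt 2 * sqrt (inverse (real (Suc k))) * norm (\<Phi> (\<lambda>_. 1))) \<longlonglongrightarrow> 0" by simp
  qed simp
  then show "(\<lambda>k. grad (cutoff (real (Suc k)))) \<longlonglongrightarrow> 0" by (rule vec_tendstoI)
qed

section \<open>Invariance of constants and positivity\<close>

lemma T_one: assumes "0 \<le> t" shows "T t (\<Phi> (\<lambda>_. 1)) = \<Phi> (\<lambda>_. 1)"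
proof -
  have "gen (\<Phi> (\<lambda>_. 1)) 0" unfolding gen_def using one_in_\<Gamma> by (intro exI[of _ 0]) simp
  from T_gen_le[OF assms this] show ?thesis by simp
qed

text \<open>The resolvent \<open>J l f\<close> minimizes \<open>F(v, v) + l \<parallel>v - f\<parallel>\<^sup>2\<close>, which for \<open>f \<ge> 0\<close> does not increase when
  \<open>v\<close> is replaced by its positive part.\<close>

lemma J_nonneg:
  assumes l: "l > 0" and f: "f \<in> L2 \<mu>" "AE x in \<mu>. 0 \<le> f x"
  shows "AE x in \<mu>. 0 \<le> \<Psi> (J l (\<Phi> f)) x"
proof -
  define u where "u = \<Psi> (J l (\<Phi> f))"
  define v where "v x = max 0 (u x)" for x
  have u: "u \<in> L2 \<mu>" "\<Phi> u = J l (\<Phi> f)" by (auto simp: u_def \<Psi>_L2 \<Phi>_\<Psi>)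
  obtain w where w: "(\<Phi> u, w) \<in> \<Gamma>" "\<And>a z. (a, z) \<in> \<Gamma> \<Longrightarrow> inner w z = - inner (l *\<^sub>R (\<Phi> u - \<Phi> f)) a"
    using gen_J[OF l, of "\<Phi> f"] unfolding u(2)[symmetric] gen_def by blast
  obtain z where z: "(\<Phi> v, z) \<in> \<Gamma>" "norm z \<le> norm w"
    using positive_part[OF u(1) w(1)] by (auto simp: v_def[abs_def])
  have v: "v \<in> L2 \<mu>"
    using L2D(1)[OF u(1)] unfolding v_def[abs_def] by (intro L2_bound[OF u(1)]) auto
  have "(\<Phi> v - \<Phi> u, z - w) \<in> \<Gamma>" using subspace_diff[OF subspace_\<Gamma> z(1) w(1)] by simp
  from w(2)[OF this] have orth: "inner w (z - w) = - (l * inner (\<Phi> u - \<Phi> f) (\<Phi> v - \<Phi> u))" by simp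
  have "norm (\<Phi> (\<lambda>x. v x - f x)) \<le> norm (\<Phi> (\<lambda>x. u x - f x))"
    using f(2) by (intro norm_\<Phi>_mono L2_diff u v f) (auto elim!: eventually_mono simp: v_def max_def)
  then have "norm (\<Phi> v - \<Phi> f) \<le> norm (\<Phi> u - \<Phi> f)" by (simp add: \<Phi>_diff u(1) v f)
  then have 1: "inner (\<Phi> v - \<Phi> f) (\<Phi> v - \<Phi> f) \<le> inner (\<Phi> u - \<Phi> f) (\<Phi> u - \<Phi> f)" by (simp add: norm_le)
  have 2: "inner z z \<le> inner w w" using z(2) by (simp add: norm_le)
  \<comment> \<open>Both squares are expanded around the minimizer. The first-order terms cancel by
    \<open>orth\<close>, and what remains is l |v - u|^2 + |z - w|^2 <= 0.\<close>
  have e1: "inner z z = inner w w + 2 * inner w (z - w) + inner (z - w) (z - w)"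
    by (simp add: inner_diff_left inner_diff_right inner_commute)
  have e2: "inner (\<Phi> v - \<Phi> f) (\<Phi> v - \<Phi> f) = inner (\<Phi> u - \<Phi> f) (\<Phi> u - \<Phi> f)
      + 2 * inner (\<Phi> u - \<Phi> f) (\<Phi> v - \<Phi> u) + inner (\<Phi> v - \<Phi> u) (\<Phi> v - \<Phi> u)"
    by (simp add: inner_diff_left inner_diff_right inner_commute)
  define p where "p = inner (\<Phi> u - \<Phi> f) (\<Phi> v - \<Phi> u)"
  define q where "q = inner (\<Phi> v - \<Phi> u) (\<Phi> v - \<Phi> u)"
  have "2 * p + q \<le> 0" using 1 e2 by (simp add: p_def q_def)
  then have "l * (2 * p + q) \<le> 0" using l by (simp add: mult_le_0_iff)
  moreover have "inner (z - w) (z - w) \<le> 2 * (l * p)" using 2 e1 orth by (simp add: p_def)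
  moreover have "l * (2 * p + q) = 2 * (l * p) + l * q" by (simp add: algebra_simps)
  ultimately have "l * q \<le> 0" using inner_ge_zero[of "z - w"] by linarith
  then have "q \<le> 0" using l by (simp add: mult_le_0_iff)
  then have "\<Phi> v = \<Phi> u" unfolding q_def by (metis antisym inner_eq_zero_iff inner_ge_zero right_minus_eq)
  then have "AE x in \<mu>. v x = u x" using \<Phi>_eq_iff[OF v u(1)] by simp
  then show ?thesis unfolding u_def[symmetric] by eventually_elim (simp add: v_def max_def split: if_splits)
qed

lemma T_pos:
  assumes t: "0 \<le> t" and f: "f \<in> L2 \<mu>" "AE x in \<mu>. 0 \<le> f x"
  shows "AE x in \<mu>. 0 \<le> \<Psi> (T t (\<Phi> f)) x"
proof -
  \<comment> \<open>The nonnegative functions as an intersection of closed half spaces, the form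
    needed by \<open>T_in_cone\<close>.\<close>
  define C where "C = (\<Inter>A\<in>sets \<mu>. {h. 0 \<le> inner h (\<Phi> (indicator A))})"
  have mem: "h \<in> C \<longleftrightarrow> (AE x in \<mu>. 0 \<le> \<Psi> h x)" for h
    using AE_le_iff[OF L2_0 \<Psi>_L2, of h] by (simp add: C_def \<Phi>_0 \<Phi>_\<Psi>)
  have "T t (\<Phi> f) \<in> C"
  proof (rule T_in_cone[OF _ _ _ _ _ _ t])
    show "closed C" unfolding C_def by (intro closed_INT ballI closed_Collect_le continuous_intros)
    show "J l h \<in> C" if "l > 0" "h \<in> C" for l h
      using J_nonneg[OF that(1) \<Psi>_L2, of h] that(2) by (simp add: mem \<Phi>_\<Psi>)
    show "\<Phi> f \<in> C" unfolding mem using \<Psi>_\<Phi>[OF f(1)] f(2) by eventually_elim simp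
  qed (auto simp: C_def inner_add_left)
  then show ?thesis by (simp add: mem)
qed

sublocale markov: markov_semigroup \<mu> \<Phi> \<Psi> T
  by (rule markov_semigroup.intro[OF finite_L2_space_axioms], rule markov_semigroup_axioms.intro)
    (rule T_linear T_norm_le T_add T_zero T_tendsto_0 T_sym T_pos T_one; assumption?)+

section \<open>Recurrence, conservativeness, locality and regularity\<close>

lemma recurrent_closure: "recurrent_form \<mu> (closure_domain \<mu> (Cck 2) (gradient_form \<beta> \<rho>)) (closure_form \<mu> (Cck 2) (gradient_form \<beta> \<rho>))"
  unfolding recurrent_form_def
proof (intro exI[of _ SG] conjI form_semigroup_closure allI impI)
  have SG: "SG = (\<lambda>t f. \<Psi> (T t (\<Phi> f)))" by (intro ext) (simp add: SG_def)
  fix f :: "real^'n \<Rightarrow> real" assume "integrable \<mu> f \<and> (AE x in \<mu>. 0 \<le> f x)"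
  then show "AE x in \<mu>. potential \<mu> SG f x = 0 \<or> potential \<mu> SG f x = \<infinity>"
    unfolding SG using markov.recurrent by blast
qed

lemma conservative_closure: "conservative_form \<mu> (closure_domain \<mu> (Cck 2) (gradient_form \<beta> \<rho>)) (closure_form \<mu> (Cck 2) (gradient_form \<beta> \<rho>))"
  unfolding conservative_form_def
proof (intro exI[of _ SG] conjI form_semigroup_closure allI impI)
  show "finite_measure \<mu>" by (rule finite_measure_axioms)
  fix t :: real assume "0 < t"
  then show "AE x in \<mu>. SG t (\<lambda>_. 1) x = 1"
    using \<Psi>_\<Phi>[OF L2_const[of 1]] by (simp add: SG_def T_one)
qed

text \<open>Let b be a bump supported in \<open>U\<close>. Then b (u - c) is 0, and by the product
  rule its approximations have gradients tending to b w, since the other term contains (u - c) times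
  a derivative of b. Closability forces b w = 0.\<close>

lemma gradient_local:
  assumes u: "u \<in> L2 \<mu>" "(\<Phi> u, w) \<in> \<Gamma>" and U: "open U" "AE x in \<mu>. x \<in> U \<longrightarrow> u x = c"
  shows "AE x in \<mu>. x \<in> U \<longrightarrow> \<Psi> (w $ i) x = 0"
proof (rule AE_of_local_AE)
  fix y assume "y \<in> U"
  then obtain a b where ab: "y \<in> box a b" "box a b \<subseteq> U" using open_contains_box[OF U(1)] by metis
  let ?f = "bump a b 1"
  have f: "?f \<in> Cck 2" "C2 ?f" by (auto intro: bump_Cck2 C2_bump)
  obtain K where K: "\<And>x. x \<in> orthant \<Longrightarrow> \<bar>?f x\<bar> \<le> K" "\<And>x i. x \<in> orthant \<Longrightarrow> \<bar>pd i ?f x\<bar> \<le> K"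
    using Cck2_bounded[OF f(1)] by metis
  have K0: "0 \<le> K" using K(1)[of 0] by (auto simp: orthant_def)
  have fK: "\<bar>fd i ?f x\<bar> \<le> K" if "x \<in> orthant" for x i using K(2)[OF that] K0 by (simp add: fd_def)
  have fm: "?f \<in> borel_measurable \<mu>" "fd i ?f \<in> borel_measurable \<mu>" for i
    by (rule L2D(1)[OF Cck2_L2(1)[OF f(1)]], rule L2D(1)[OF Cck2_L2(2)[OF f(1)]])
  obtain s where s: "\<And>k. s k \<in> Cck 2" "(\<lambda>k. \<Phi> (s k)) \<longlonglongrightarrow> \<Phi> u" "(\<lambda>k. grad (s k)) \<longlonglongrightarrow> w"
    using \<Gamma>_sequence[OF u(2)] by metis
  have sL: "s k \<in> L2 \<mu>" "fd i (s k) \<in> L2 \<mu>" for k i by (auto intro: Cck2_L2 s)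
  have scL: "(\<lambda>x. s k x - c) \<in> L2 \<mu>" for k by (intro L2_diff sL L2_const)
  have ucL: "(\<lambda>x. u x - c) \<in> L2 \<mu>" by (intro L2_diff u L2_const)
  have sc_lim: "(\<lambda>k. \<Phi> (\<lambda>x. s k x - c)) \<longlonglongrightarrow> \<Phi> (\<lambda>x. u x - c)"
    by (simp add: \<Phi>_diff sL L2_const u) (intro tendsto_intros s)
  \<comment> \<open>Subtracting \<open>c\<close> from \<open>s k\<close> may destroy its compact
    support, which the bump restores, so \<open>t k\<close> is again in the core.\<close>
  define t where "t k x = ?f x * (s k x - c)" for k x
  have sc2: "C2 (\<lambda>x. s k x - c)" for k
    using C2_add[OF _ C2_const[of "- c"], of "s k"] s(1)[of k] by (simp add: Cck2_iff)
  have t: "t k \<in> Cck 2" for k unfolding t_def[abs_def] by (rule Cck2_mult[OF f(1) sc2])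
  have uc0: "AE x in \<mu>. ?f x * (u x - c) = 0"
    using U(2)
  proof eventually_elim
    fix x assume "x \<in> U \<longrightarrow> u x = c"
    then show "?f x * (u x - c) = 0" using ab(2) bump_outside[of x a b 1] by (cases "x \<in> U") auto
  qed
  have uc0': "AE x in \<mu>. fd i ?f x * (u x - c) = 0" for i
    using U(2) AE_space
  proof eventually_elim
    fix x assume "x \<in> U \<longrightarrow> u x = c" "x \<in> space \<mu>"
    then show "fd i ?f x * (u x - c) = 0"
      using ab(2) pd_bump_outside[of x a b i 1] by (cases "x \<in> U") (auto simp: space_\<mu> fd_def)
  qed
  have t_lim: "(\<lambda>k. \<Phi> (t k)) \<longlonglongrightarrow> 0"
  proof -
    note m = \<Phi>_mult_tendsto[OF scL ucL sc_lim fm(1) K(1)]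
    have "\<Phi> (\<lambda>x. ?f x * (u x - c)) = 0" using \<Phi>_eq_0_iff[OF m(3)] uc0 by blast
    then show ?thesis using m(1) unfolding t_def[abs_def] by simp
  qed
  define z where "z = (\<chi> i. \<Phi> (\<lambda>x. ?f x * \<Psi> (w $ i) x))"
  have g_lim: "(\<lambda>k. grad (t k)) \<longlonglongrightarrow> z"
  proof (rule vec_tendstoI)
    fix i
    have w_lim: "(\<lambda>k. \<Phi> (fd i (s k))) \<longlonglongrightarrow> \<Phi> (\<Psi> (w $ i))"
      using tendsto_vec_nth[OF s(3), of i] by (simp add: grad_def \<Phi>_\<Psi>)
    note m1 = \<Phi>_mult_tendsto[OF sL(2) \<Psi>_L2 w_lim fm(1) K(1)]
    note m2 = \<Phi>_mult_tendsto[OF scL ucL sc_lim fm(2)[of i] fK]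
    have eq: "grad (t k) $ i = \<Phi> (\<lambda>x. ?f x * fd i (s k) x) + \<Phi> (\<lambda>x. fd i ?f x * (s k x - c))" for k
    proof -
      have "\<Phi> (fd i (t k)) = \<Phi> (\<lambda>x. ?f x * fd i (s k) x + fd i ?f x * (s k x - c))"
      proof (rule \<Phi>_cong[OF Cck2_L2(2)[OF t] L2_add[OF m1(2) m2(2)]])
        fix x :: "real^'n" assume x: "x \<in> orthant"
        have "pd i (\<lambda>x. s k x - c) x = pd i (s k) x"
          using pd_add[OF _ C2_const[of "- c"] x, of "s k" i] s(1)[of k] x by (simp add: Cck2_iff pd_const)
        then show "fd i (t k) x = ?f x * fd i (s k) x + fd i ?f x * (s k x - c)"
          using pd_mult[OF f(2) sc2[of k] x, of i] by (simp add: fd_def t_def[abs_def])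
      qed
      then show ?thesis by (simp only: grad_def vec_lambda_beta \<Phi>_add[OF m1(2) m2(2)])
    qed
    have "\<Phi> (\<lambda>x. fd i ?f x * (u x - c)) = 0" using uc0' m2(3) by (simp add: \<Phi>_eq_0_iff)
    then show "(\<lambda>k. grad (t k) $ i) \<longlonglongrightarrow> z $ i"
      using tendsto_add[OF m1(1) m2(1)] by (simp add: eq z_def)
  qed
  \<comment> \<open>The pairs of \<open>t k\<close> and its gradient converge to (0, z), and
    \<open>\<Gamma>\<close> is a graph.\<close>
  have "z = 0" using in_\<Gamma>_limit[OF t t_lim g_lim] by (rule single_\<Gamma>)
  then have "\<Phi> (\<lambda>x. ?f x * \<Psi> (w $ i) x) = 0" by (simp add: z_def vec_eq_iff)
  moreover have "(\<lambda>x. ?f x * \<Psi> (w $ i) x) \<in> L2 \<mu>"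
    by (rule \<Phi>_mult_tendsto(3)[OF \<Psi>_L2 \<Psi>_L2 tendsto_const fm(1) K(1)])
  ultimately have AE: "AE x in \<mu>. ?f x * \<Psi> (w $ i) x = 0" by (simp add: \<Phi>_eq_0_iff)
  have pos: "?f x \<noteq> 0" if "x \<in> box a b" for x
    using box_fun_nonzero_iff[of a b x] psi_pos[of 1 "box_fun a b x"] that by (simp add: bump_def)
  have "AE x in \<mu>. x \<in> box a b \<longrightarrow> \<Psi> (w $ i) x = 0"
    using AE by eventually_elim (use pos in auto)
  then show "\<exists>V. open V \<and> y \<in> V \<and> (AE x in \<mu>. x \<in> V \<longrightarrow> \<Psi> (w $ i) x = 0)"
    using ab(1) by (intro exI[of _ "box a b"]) auto
qed

text \<open>The gradient of \<open>u\<close> vanishes off its support, where \<open>u\<close> is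
  locally 0, and that of \<open>v\<close> vanishes on the neighbourhood \<open>U\<close> of this
  support, where \<open>v\<close> is constant. So the product of the gradients is 0 almost
  everywhere.\<close>

lemma strongly_local_closure: "strongly_local_form \<mu> (closure_domain \<mu> (Cck 2) (gradient_form \<beta> \<rho>)) (closure_form \<mu> (Cck 2) (gradient_form \<beta> \<rho>))"
  unfolding strongly_local_form_def
proof (intro ballI impI, elim conjE exE)
  fix u v U c
  assume "u \<in> closure_domain \<mu> (Cck 2) (gradient_form \<beta> \<rho>)" "v \<in> closure_domain \<mu> (Cck 2) (gradient_form \<beta> \<rho>)"
    and U: "open U" "ess_support \<mu> u \<subseteq> U" "AE x in \<mu>. x \<in> U \<longrightarrow> v x = c"
  then obtain w z where u: "u \<in> L2 \<mu>" "(\<Phi> u, w) \<in> \<Gamma>" and v: "v \<in> L2 \<mu>" "(\<Phi> v, z) \<in> \<Gamma>"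
    by (elim closure_domainE) blast
  have "AE x in \<mu>. x \<in> orthant - ess_support \<mu> u \<longrightarrow> \<Psi> (w $ i) x = 0" for i
  proof (rule AE_of_local_AE)
    fix x assume "x \<in> orthant - ess_support \<mu> u"
    then obtain V where "open V" "x \<in> V" "AE y in \<mu>. y \<in> V \<longrightarrow> u y = 0"
      by (auto simp: ess_support_def space_\<mu>)
    then show "\<exists>V. open V \<and> x \<in> V \<and> (AE y in \<mu>. y \<in> V \<longrightarrow> \<Psi> (w $ i) y = 0)"
      using gradient_local[OF u] by blast
  qed
  moreover have "AE x in \<mu>. x \<in> U \<longrightarrow> \<Psi> (z $ i) x = 0" for i by (rule gradient_local[OF v U(1,3)])
  ultimately have AE: "AE x in \<mu>. \<Psi> (w $ i) x * \<Psi> (z $ i) x = 0" for i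
  proof -
    show ?thesis
      using \<open>\<And>i. AE x in \<mu>. x \<in> orthant - ess_support \<mu> u \<longrightarrow> \<Psi> (w $ i) x = 0\<close>[of i]
        \<open>\<And>i. AE x in \<mu>. x \<in> U \<longrightarrow> \<Psi> (z $ i) x = 0\<close>[of i] AE_space
      by eventually_elim (use U(2) in \<open>auto simp: space_\<mu>\<close>)
  qed
  have "inner (w $ i) (z $ i) = 0" for i
  proof -
    have "inner (w $ i) (z $ i) = (\<integral>x. \<Psi> (w $ i) x * \<Psi> (z $ i) x \<partial>\<mu>)"
      using \<Phi>_inner[OF \<Psi>_L2 \<Psi>_L2, of "w $ i" "z $ i"] by (simp add: \<Phi>_\<Psi> L2_inner_def)
    also have "\<dots> = 0" using AE by (intro integral_eq_zero_AE)
    finally show ?thesis .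
  qed
  then show "closure_form \<mu> (Cck 2) (gradient_form \<beta> \<rho>) u v = 0"
    by (simp add: closure_form_eq[OF u v] inner_vec_def)
qed

text \<open>The theorem of Stone and Weierstrass for the algebra of C2 functions, which contains the
  coordinates, gives an approximation on a compact set; multiplication by a cutoff makes its support
  compact.\<close>

lemma uniform_approximation:
  fixes g :: "real^'n \<Rightarrow> real"
  assumes g: "g \<in> Cc orthant" and e: "e > 0"
  shows "\<exists>f\<in>Cck 2. \<forall>x\<in>orthant. \<bar>g x - f x\<bar> < e"
proof -
  have cont: "continuous_on orthant g" using g by (simp add: Cc_def)
  obtain R where R: "\<And>x. x \<in> orthant \<Longrightarrow> R < norm x \<Longrightarrow> g x = 0"
    using g by (auto simp: Cc_def compactly_supported_iff)
  \<comment> \<open>Chosen positive and so large that \<open>cutoff C\<close> is 1 wherever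
    \<open>g\<close> is nonzero. The cutoff vanishes beyond radius sqrt (2 C), which is the radius
    of \<open>K\<close>.\<close>
  define C where "C = R\<^sup>2 + 1"
  have C: "C > 0" by (simp add: C_def add_nonneg_pos)
  define K where "K = orthant \<inter> cball (0::real^'n) (sqrt (2 * C))"
  have gz: "g x = 0" if "x \<in> orthant" "C < (norm x)\<^sup>2" for x
  proof (rule R[OF that(1)])
    have "\<bar>R\<bar>\<^sup>2 < (norm x)\<^sup>2" using that(2) by (simp add: C_def)
    then have "\<bar>R\<bar> < norm x" by (rule power2_less_imp_less) simp
    then show "R < norm x" by simp
  qed
  have "\<exists>p. C2 p \<and> (\<forall>x\<in>K. \<bar>g x - p x\<bar> < e)"
  proof -
    interpret function_ring_on "Collect C2" K
    proof
      show "compact K" unfolding K_def using closed_orthant by (intro closed_Int_compact compact_cball)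
      show "continuous_on K f" if "f \<in> Collect C2" for f
        using that by (intro continuous_on_subset[OF C2_continuous(1)]) (auto simp: K_def)
      show "\<exists>f\<in>Collect C2. f x \<noteq> f y" if "x \<noteq> y" for x y :: "real^'n"
      proof -
        have "\<exists>j. x $ j \<noteq> y $ j" using that by (simp add: vec_eq_iff)
        then obtain j where "x $ j \<noteq> y $ j" ..
        then show ?thesis using C2_coord[of j] by (intro bexI[of _ "\<lambda>x. x $ j"]) auto
      qed
    qed (auto intro: C2_add C2_mult C2_const)
    have "continuous_on K g" by (rule continuous_on_subset[OF cont]) (auto simp: K_def)
    from Stone_Weierstrass_basic[OF this e] show ?thesis by auto
  qed
  then obtain p where p: "C2 p" "\<And>x. x \<in> K \<Longrightarrow> \<bar>g x - p x\<bar> < e" by blast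
  have "\<bar>g x - cutoff C x * p x\<bar> < e" if x: "x \<in> orthant" for x
  proof (cases "2 * C \<le> (norm x)\<^sup>2")
    case True
    then show ?thesis using cutoff_eq_0[OF C True] gz[OF x] C e by simp
  next
    case False
    then have "norm x \<le> sqrt (2 * C)" by (simp add: real_le_rsqrt)
    then have xK: "x \<in> K" using x by (simp add: K_def)
    have "g x = cutoff C x * g x"
      using cutoff_eq_1[OF C, of x] gz[OF x] by (cases "(norm x)\<^sup>2 \<le> C") auto
    then have "g x - cutoff C x * p x = cutoff C x * (g x - p x)" by (simp add: right_diff_distrib)
    then have "\<bar>g x - cutoff C x * p x\<bar> \<le> \<bar>g x - p x\<bar>"
      using cutoff_range[of C x] by (simp add: abs_mult mult_left_le_one_le)
    also have "\<dots> < e" by (rule p(2)[OF xK])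
    finally show ?thesis .
  qed
  then show ?thesis by (intro bexI[OF _ Cck2_mult[OF cutoff_Cck2[OF C] p(1)]] ballI)
qed

lemma Cck2_subset_Cc: "Cck 2 \<subseteq> Cc (orthant :: (real^'n) set)"
  by (auto simp: Cc_def Cck_def)

lemma regular_closure: "regular_form \<mu> (closure_domain \<mu> (Cck 2) (gradient_form \<beta> \<rho>)) (closure_form \<mu> (Cck 2) (gradient_form \<beta> \<rho>))"
  unfolding regular_form_def space_\<mu>
proof (intro conjI allI impI ballI)
  show "emeasure \<mu> K < \<infinity>" for K using emeasure_finite[of K] by (simp add: less_top[symmetric])
  show "0 < emeasure \<mu> (U \<inter> orthant)" if "open U \<and> U \<inter> orthant \<noteq> {}" for U using emeasure_\<mu>_open that by blast
next
  fix g :: "real^'n \<Rightarrow> real" and e :: real assume "g \<in> Cc orthant" "e > 0"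
  then obtain f where "f \<in> Cck 2" "\<forall>x\<in>orthant. \<bar>g x - f x\<bar> < e" using uniform_approximation by metis
  then show "\<exists>f\<in>closure_domain \<mu> (Cck 2) (gradient_form \<beta> \<rho>) \<inter> Cc orthant. \<forall>x\<in>orthant. \<bar>g x - f x\<bar> < e"
    using D_subset_closure Cck2_subset_Cc by (intro bexI[of _ f]) auto
next
  fix u and e :: real assume "u \<in> closure_domain \<mu> (Cck 2) (gradient_form \<beta> \<rho>)" and e: "e > 0"
  then obtain w where u: "u \<in> L2 \<mu>" "(\<Phi> u, w) \<in> \<Gamma>" by (elim closure_domainE) blast
  then obtain s where s: "\<And>k. s k \<in> Cck 2" "(\<lambda>k. \<Phi> (s k)) \<longlonglongrightarrow> \<Phi> u" "(\<lambda>k. grad (s k)) \<longlonglongrightarrow> w"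
    using \<Gamma>_sequence by metis
  \<comment> \<open>The squared graph norm of the difference is its value under
    \<open>form_one\<close>, so the sequence defining the point of \<open>\<Gamma>\<close> already
    approximates \<open>u\<close> from the core.\<close>
  have "(\<lambda>k. (norm ((\<Phi> u, w) - (\<Phi> (s k), grad (s k))))\<^sup>2) \<longlonglongrightarrow> (norm ((\<Phi> u, w) - (\<Phi> u, w)))\<^sup>2"
    by (intro tendsto_intros s)
  then have "\<forall>\<^sub>F k in sequentially. (norm ((\<Phi> u, w) - (\<Phi> (s k), grad (s k))))\<^sup>2 < e"
    using e by (intro order_tendstoD(2)) auto
  then obtain k where k: "(norm ((\<Phi> u, w) - (\<Phi> (s k), grad (s k))))\<^sup>2 < e" by (auto simp: eventually_sequentially)
  show "\<exists>f\<in>closure_domain \<mu> (Cck 2) (gradient_form \<beta> \<rho>) \<inter> Cc orthant.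
    form_one \<mu> (closure_form \<mu> (Cck 2) (gradient_form \<beta> \<rho>)) (\<lambda>x. u x - f x) (\<lambda>x. u x - f x) < e"
  proof (rule bexI[of _ "s k"])
    show "form_one \<mu> (closure_form \<mu> (Cck 2) (gradient_form \<beta> \<rho>)) (\<lambda>x. u x - s k x) (\<lambda>x. u x - s k x) < e"
      using form_one_closure[OF u D_L2'[OF s(1)] in_\<Gamma>[OF s(1)], of k] k by simp
    show "s k \<in> closure_domain \<mu> (Cck 2) (gradient_form \<beta> \<rho>) \<inter> Cc orthant"
      using s(1) D_subset_closure Cck2_subset_Cc by blast
  qed
qed

end

theorem theorem2p12:
  fixes \<beta> :: real and \<rho> :: "real^'n::finite \<Rightarrow> real"
  assumes "0 < \<beta>"
    and "\<rho> \<in> borel_measurable (restrict_space borel orthant)"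
    and "AE x in ref_measure \<beta>. 0 < \<rho> x"
    and "integrable (ref_measure \<beta>) \<rho>"
    and "\<And>B::'n set. B \<noteq> {} \<Longrightarrow>
           AE x in face_measure \<beta> B. x \<in> closure (face B) - regular_points \<beta> \<rho> B \<longrightarrow> \<rho> x = 0"
  defines "\<mu> \<equiv> weighted_measure \<beta> \<rho>"
    and "D \<equiv> (Cck 2 :: (real^'n \<Rightarrow> real) set)"
    and "F \<equiv> gradient_form \<beta> \<rho>"
  shows "(\<forall>f\<in>D. \<forall>g\<in>D. \<forall>B. B \<noteq> {} \<longrightarrow>
            set_integrable (weighted_face_measure \<beta> \<rho> B) (face B)
              (\<lambda>x. face_gradient B f x \<bullet> face_gradient B g x)) \<and>
         symmetric_form_on \<mu> D F \<and> positive_definite_on D F \<and> L2_dense \<mu> D \<and>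
         closable_on \<mu> D F \<and>
         symmetric_Dirichlet_form \<mu> (closure_domain \<mu> D F) (closure_form \<mu> D F) \<and>
         regular_form \<mu> (closure_domain \<mu> D F) (closure_form \<mu> D F) \<and>
         strongly_local_form \<mu> (closure_domain \<mu> D F) (closure_form \<mu> D F) \<and>
         recurrent_form \<mu> (closure_domain \<mu> D F) (closure_form \<mu> D F) \<and>
         conservative_form \<mu> (closure_domain \<mu> D F) (closure_form \<mu> D F)"
proof -
  interpret setting \<beta> \<rho> using assms(1-5) by unfold_locales
  show ?thesis
    unfolding D_def F_def assms(6)
    by (intro conjI ballI allI impI face_integral(1) symmetric_form_F positive_definite_F L2_dense_F
        closable_F dirichlet regular_closure strongly_local_closure recurrent_closure conservative_closure)
qed

end
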